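(* Let $R$ be a commutative local ring with principal nonzero maximal ideal $\mathfrak{m}=(p)$ satisfying $\mathfrak{m}^2=0$, and let $\mathscr{C}$ be the category of finitely generated free $R$-modules. Let $n\geq 3$ be an integer and let $\Sigma\colon\mathscr{C}\to\mathscr{C}$ be the identity functor. For each unit $u\in R$, let $\mathscr{N}_u$ be the collection of all $n$-$\Sigma$-sequences in $\mathscr{C}$ isomorphic to a direct sum $C_\bullet\oplus F_u(p)_\bullet$, where $C_\bullet$ is a contractible candidate $n$-angle in $\mathscr{C}$, $F$ is a free module in $\mathscr{C}$, and $F_u(p)_\bullet$ is the $n$-$\Sigma$-sequence $$F\xrightarrow{up}F\xrightarrow{p}\cdots\xrightarrow{p}F\xrightarrow{p}\Sigma F$$ (first map multiplication by $up$, all other maps multiplication by $p$). Then the following hold: (1) $(\mathscr{C},\Sigma,\mathscr{N}_u)$ is an $n$-angulated category whenever $n$ is even, or when $n$ is odd and $2p=0$ in $R$. (2) If $\mathscr{N}$ is any $n$-angulation of $(\mathscr{C},\Sigma)$, then $\mathscr{N}=\mathscr{N}_u$ for some unit $u$ in $R$. (3) For units $u,v\in R$, $\mathscr{N}_u=\mathscr{N}_v$ if and only if $up=vp$ in $R$.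
   Context: Let $\mathscr{C}$ be an additive category with an automorphism $\Sigma\colon\mathscr{C}\to\mathscr{C}$, and let $n\geq 3$ be an integer. An $n$-$\Sigma$-sequence is a sequence $A_\bullet\colon A_1\xrightarrow{\alpha_1}A_2\xrightarrow{\alpha_2}\cdots\xrightarrow{\alpha_{n-1}}A_n\xrightarrow{\alpha_n}\Sigma A_1$ of objects and morphisms in $\mathscr{C}$. Its left rotation is $A_2\xrightarrow{\alpha_2}A_3\to\cdots\xrightarrow{\alpha_n}\Sigma A_1\xrightarrow{(-1)^n\Sigma\alpha_1}\Sigma A_2$. A morphism $\varphi\colon A_\bullet\to B_\bullet$ is a sequence $(\varphi_1,\dots,\varphi_n)$ of morphisms $\varphi_i\colon A_i\to B_i$ with $\varphi_{i+1}\alpha_i=\beta_i\varphi_i$ for $1\le i\le n$, where $\varphi_{n+1}:=\Sigma\varphi_1$; it is an isomorphism if all $\varphi_i$ are. A candidate $n$-angle is an $n$-$\Sigma$-sequence with $\alpha_2\alpha_1=0,\dots,\alpha_n\alpha_{n-1}=0$ and $(\Sigma\alpha_1)\alpha_n=0$. An $n$-$\Sigma$-sequence is contractible if its identity morphism is nullhomotopic, i.e. there are morphisms $\Theta_i\colon A_{i+1}\to A_i$ ($1\le i\le n$, $A_{n+1}:=\Sigma A_1$) with $1_{A_i}=\Theta_i\alpha_i+\alpha_{i-1}\Theta_{i-1}$ for $2\le i\le n$ and $1_{\Sigma A_1}=(\Sigma\Theta_1)(\Sigma\alpha_1)+\alpha_n\Theta_n$. A collection $\mathscr{N}$ of $n$-$\Sigma$-sequences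 is an $n$-angulation of $(\mathscr{C},\Sigma)$, and $(\mathscr{C},\Sigma,\mathscr{N})$ is an $n$-angulated category, if: (N1) (a) $\mathscr{N}$ is closed under direct sums, direct summands and isomorphisms of $n$-$\Sigma$-sequences; (b) for all $A\in\mathscr{C}$, the sequence $A\xrightarrow{1}A\to0\to\cdots\to0\to\Sigma A$ belongs to $\mathscr{N}$; (c) every morphism in $\mathscr{C}$ is the first morphism of some $n$-$\Sigma$-sequence in $\mathscr{N}$. (N2) An $n$-$\Sigma$-sequence belongs to $\mathscr{N}$ if and only if its left rotation does. (N3) Given $A_\bullet,B_\bullet\in\mathscr{N}$ and morphisms $\varphi_1\colon A_1\to B_1$, $\varphi_2\colon A_2\to B_2$ with $\varphi_2\alpha_1=\beta_1\varphi_1$, there exist $\varphi_3,\dots,\varphi_n$ such that $(\varphi_1,\dots,\varphi_n)$ is a morphism $A_\bullet\to B_\bullet$. (N4) In the situation of (N3), $\varphi_3,\dots,\varphi_n$ can be chosen such that the mapping cone $$A_2\oplus B_1\xrightarrow{\left[\begin{smallmatrix}-\alpha_2&0\\ \varphi_2&\beta_1\end{smallmatrix}\right]}A_3\oplus B_2\xrightarrow{\left[\begin{smallmatrix}-\alpha_3&0\\ \varphi_3&\beta_2\end{smallmatrix}\right]}\cdots\xrightarrow{\left[\begin{smallmatrix}-\alpha_n&0\\ \varphi_n&\beta_{n-1}\end{smallmatrix}\right]}\Sigma A_1\oplus B_n\xrightarrow{\left[\begin{smallmatrix}-\Sigma\alpha_1&0\\ \Sigma\varphi_1&\beta_n\end{smallmatrix}\right]}\Sigma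 A_2\oplus\Sigma B_1$$ belongs to $\mathscr{N}$. *)

theory Defs
  imports
    "HOL-Algebra.Algebra"
    "Jordan_Normal_Form.Missing_VectorSpace"
begin

section \<open>Additive categories\<close>

text \<open>
  Arrows carry their domain and codomain. Composition, addition and the zero arrows are total
  functions, constrained by the axioms only on composable, respectively parallel, arrows.
\<close>

record ('o, 'a) precategory =
  Ob :: "'o set"
  Ar :: "'a set"
  Dom :: "'a \<Rightarrow> 'o"
  Cod :: "'a \<Rightarrow> 'o"
  Ident :: "'o \<Rightarrow> 'a"
  Comp :: "'a \<Rightarrow> 'a \<Rightarrow> 'a" (infixl \<open>\<bullet>\<index>\<close> 70)
  Plus :: "'a \<Rightarrow> 'a \<Rightarrow> 'a" (infixl \<open>\<boxplus>\<index>\<close> 65)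
  Null :: "'o \<Rightarrow> 'o \<Rightarrow> 'a"

definition Hom :: "('o, 'a) precategory \<Rightarrow> 'o \<Rightarrow> 'o \<Rightarrow> 'a set" where
  "Hom C A B = {f \<in> Ar C. Dom C f = A \<and> Cod C f = B}"

definition hom_group :: "('o, 'a) precategory \<Rightarrow> 'o \<Rightarrow> 'o \<Rightarrow> 'a monoid" where
  "hom_group C A B = \<lparr>carrier = Hom C A B, monoid.mult = Plus C, one = Null C A B\<rparr>"

definition Neg :: "('o, 'a) precategory \<Rightarrow> 'a \<Rightarrow> 'a" where
  "Neg C f = inv\<^bsub>hom_group C (Dom C f) (Cod C f)\<^esub> f"

definition iso_arrow :: "('o, 'a) precategory \<Rightarrow> 'a \<Rightarrow> bool" where
  "iso_arrow C f \<longleftrightarrow> f \<in> Ar C \<and>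
     (\<exists>g \<in> Hom C (Cod C f) (Dom C f).
        g \<bullet>\<^bsub>C\<^esub> f = Ident C (Dom C f) \<and> f \<bullet>\<^bsub>C\<^esub> g = Ident C (Cod C f))"

definition zero_object :: "('o, 'a) precategory \<Rightarrow> 'o \<Rightarrow> bool" where
  "zero_object C Z \<longleftrightarrow> Z \<in> Ob C \<and>
     (\<forall>A \<in> Ob C. (\<exists>!f. f \<in> Hom C A Z) \<and> (\<exists>!f. f \<in> Hom C Z A))"

definition biproduct ::
    "('o, 'a) precategory \<Rightarrow> 'o \<Rightarrow> 'o \<Rightarrow> 'o \<Rightarrow> 'a \<Rightarrow> 'a \<Rightarrow> 'a \<Rightarrow> 'a \<Rightarrow> bool" where
  "biproduct C A B S j1 j2 q1 q2 \<longleftrightarrow>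
     j1 \<in> Hom C A S \<and> j2 \<in> Hom C B S \<and> q1 \<in> Hom C S A \<and> q2 \<in> Hom C S B \<and>
     q1 \<bullet>\<^bsub>C\<^esub> j1 = Ident C A \<and> q2 \<bullet>\<^bsub>C\<^esub> j2 = Ident C B \<and>
     q1 \<bullet>\<^bsub>C\<^esub> j2 = Null C B A \<and> q2 \<bullet>\<^bsub>C\<^esub> j1 = Null C A B \<and>
     j1 \<bullet>\<^bsub>C\<^esub> q1 \<boxplus>\<^bsub>C\<^esub> j2 \<bullet>\<^bsub>C\<^esub> q2 = Ident C S"

locale additive_category =
  fixes C :: "('o, 'a) precategory" (structure)
  assumes Dom_Ob: "f \<in> Ar C \<Longrightarrow> Dom C f \<in> Ob C"
    and Cod_Ob: "f \<in> Ar C \<Longrightarrow> Cod C f \<in> Ob C"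
    and Ident_Hom: "A \<in> Ob C \<Longrightarrow> Ident C A \<in> Hom C A A"
    and Comp_Hom: "\<lbrakk>f \<in> Hom C A B; g \<in> Hom C B D\<rbrakk> \<Longrightarrow> g \<bullet> f \<in> Hom C A D"
    and Comp_Ident: "f \<in> Hom C A B \<Longrightarrow> f \<bullet> Ident C A = f"
    and Ident_Comp: "f \<in> Hom C A B \<Longrightarrow> Ident C B \<bullet> f = f"
    and Comp_assoc:
      "\<lbrakk>f \<in> Hom C A B; g \<in> Hom C B D; h \<in> Hom C D E\<rbrakk> \<Longrightarrow> (h \<bullet> g) \<bullet> f = h \<bullet> (g \<bullet> f)"
    and hom_comm_group: "\<lbrakk>A \<in> Ob C; B \<in> Ob C\<rbrakk> \<Longrightarrow> comm_group (hom_group C A B)"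
    and Comp_Plus:
      "\<lbrakk>f \<in> Hom C A B; f' \<in> Hom C A B; g \<in> Hom C B D\<rbrakk> \<Longrightarrow> g \<bullet> (f \<boxplus> f') = g \<bullet> f \<boxplus> g \<bullet> f'"
    and Plus_Comp:
      "\<lbrakk>f \<in> Hom C A B; g \<in> Hom C B D; g' \<in> Hom C B D\<rbrakk> \<Longrightarrow> (g \<boxplus> g') \<bullet> f = g \<bullet> f \<boxplus> g' \<bullet> f"
    and ex_zero_object: "\<exists>Z. zero_object C Z"
    and ex_biproduct: "\<lbrakk>A \<in> Ob C; B \<in> Ob C\<rbrakk> \<Longrightarrow> \<exists>S j1 j2 q1 q2. biproduct C A B S j1 j2 q1 q2"

record ('o, 'a) endofunctor =
  OMap :: "'o \<Rightarrow> 'o"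
  AMap :: "'a \<Rightarrow> 'a"

definition identity_functor :: "('o, 'a) endofunctor" where
  "identity_functor = \<lparr>OMap = (\<lambda>A. A), AMap = (\<lambda>f. f)\<rparr>"

text \<open>
  Additivity of an automorphism is automatic: an isomorphism of categories preserves zero objects
  and biproducts, hence the addition of arrows.
\<close>

definition category_automorphism ::
    "('o, 'a) precategory \<Rightarrow> ('o, 'a) endofunctor \<Rightarrow> bool" where
  "category_automorphism C S \<longleftrightarrow>
     bij_betw (OMap S) (Ob C) (Ob C) \<and> bij_betw (AMap S) (Ar C) (Ar C) \<and>
     (\<forall>f \<in> Ar C. Dom C (AMap S f) = OMap S (Dom C f) \<and> Cod C (AMap S f) = OMap S (Cod C f)) \<and>
     (\<forall>A \<in> Ob C. AMap S (Ident C A) = Ident C (OMap S A)) \<and>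
     (\<forall>f \<in> Ar C. \<forall>g \<in> Ar C. Cod C f = Dom C g \<longrightarrow>
        AMap S (g \<bullet>\<^bsub>C\<^esub> f) = AMap S g \<bullet>\<^bsub>C\<^esub> AMap S f)"


section \<open>Sequences\<close>

text \<open>
  A sequence is the family of its arrows \<open>\<alpha> 1, \<dots>, \<alpha> n\<close>, extended by \<^const>\<open>undefined\<close> outside
  \<open>{1..n}\<close> so that equality of sequences, and of sets of sequences, is the intended one; its objects
  are the domains of the arrows. Families of arrows indexed by \<open>{1..n}\<close> are prolonged to the index
  \<open>n + 1\<close> by \<open>\<Sigma>\<close> of their first member.
\<close>

locale sigma_sequences =
  fixes C :: "('o, 'a) precategory" (structure)
    and \<Sigma> :: "('o, 'a) endofunctor"
    and n :: nat
begin

definition prolong :: "(nat \<Rightarrow> 'a) \<Rightarrow> nat \<Rightarrow> 'a" where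
  "prolong \<alpha> i = (if i = n + 1 then AMap \<Sigma> (\<alpha> 1) else \<alpha> i)"

definition vertex :: "(nat \<Rightarrow> 'a) \<Rightarrow> nat \<Rightarrow> 'o" where
  "vertex \<alpha> i = Dom C (prolong \<alpha> i)"

definition sequences :: "(nat \<Rightarrow> 'a) set" where
  "sequences = {\<alpha> \<in> {1..n} \<rightarrow>\<^sub>E Ar C. \<forall>i \<in> {1..n}. Cod C (\<alpha> i) = vertex \<alpha> (i + 1)}"

definition left_rotation :: "(nat \<Rightarrow> 'a) \<Rightarrow> nat \<Rightarrow> 'a" where
  "left_rotation \<alpha> = (\<lambda>i \<in> {1..n}.
     if i < n then \<alpha> (i + 1)
     else if even n then AMap \<Sigma> (\<alpha> 1) else Neg C (AMap \<Sigma> (\<alpha> 1)))"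

definition seq_morphism :: "(nat \<Rightarrow> 'a) \<Rightarrow> (nat \<Rightarrow> 'a) \<Rightarrow> (nat \<Rightarrow> 'a) \<Rightarrow> bool" where
  "seq_morphism \<alpha> \<beta> \<phi> \<longleftrightarrow>
     (\<forall>i \<in> {1..n}. \<phi> i \<in> Hom C (vertex \<alpha> i) (vertex \<beta> i)) \<and>
     (\<forall>i \<in> {1..n}. prolong \<phi> (i + 1) \<bullet> \<alpha> i = \<beta> i \<bullet> \<phi> i)"

definition isomorphic_seqs :: "(nat \<Rightarrow> 'a) \<Rightarrow> (nat \<Rightarrow> 'a) \<Rightarrow> bool" where
  "isomorphic_seqs \<alpha> \<beta> \<longleftrightarrow> (\<exists>\<phi>. seq_morphism \<alpha> \<beta> \<phi> \<and> (\<forall>i \<in> {1..n}. iso_arrow C (\<phi> i)))"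

definition candidate_angle :: "(nat \<Rightarrow> 'a) \<Rightarrow> bool" where
  "candidate_angle \<alpha> \<longleftrightarrow> \<alpha> \<in> sequences \<and>
     (\<forall>i \<in> {1..n}. prolong \<alpha> (i + 1) \<bullet> \<alpha> i = Null C (Dom C (\<alpha> i)) (Cod C (prolong \<alpha> (i + 1))))"

definition contractible :: "(nat \<Rightarrow> 'a) \<Rightarrow> bool" where
  "contractible \<alpha> \<longleftrightarrow> \<alpha> \<in> sequences \<and>
     (\<exists>\<Theta>. (\<forall>i \<in> {1..n}. \<Theta> i \<in> Hom C (vertex \<alpha> (i + 1)) (vertex \<alpha> i)) \<and>
       (\<forall>i \<in> {2..n}. Ident C (vertex \<alpha> i) = \<Theta> i \<bullet> \<alpha> i \<boxplus> \<alpha> (i - 1) \<bullet> \<Theta> (i - 1)) \<and>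
       Ident C (OMap \<Sigma> (vertex \<alpha> 1)) = AMap \<Sigma> (\<Theta> 1) \<bullet> AMap \<Sigma> (\<alpha> 1) \<boxplus> \<alpha> n \<bullet> \<Theta> n)"

text \<open>
  Direct sums of objects are only determined up to isomorphism, so direct sums of sequences and
  mapping cones are predicates: \<open>\<gamma>\<close> has the required matrix form with respect to some
  choice of biproduct structures on its objects (\<open>\<Sigma>\<close> of the first one being used at \<open>n + 1\<close>).
\<close>

definition direct_sum_seq :: "(nat \<Rightarrow> 'a) \<Rightarrow> (nat \<Rightarrow> 'a) \<Rightarrow> (nat \<Rightarrow> 'a) \<Rightarrow> bool" where
  "direct_sum_seq \<alpha> \<beta> \<gamma> \<longleftrightarrow> \<alpha> \<in> sequences \<and> \<beta> \<in> sequences \<and> \<gamma> \<in> sequences \<and>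
     (\<exists>j1 j2 q1 q2. \<forall>i \<in> {1..n}.
        biproduct C (vertex \<alpha> i) (vertex \<beta> i) (vertex \<gamma> i) (j1 i) (j2 i) (q1 i) (q2 i) \<and>
        \<gamma> i = prolong j1 (i + 1) \<bullet> \<alpha> i \<bullet> q1 i \<boxplus> prolong j2 (i + 1) \<bullet> \<beta> i \<bullet> q2 i)"

definition mapping_cone ::
    "(nat \<Rightarrow> 'a) \<Rightarrow> (nat \<Rightarrow> 'a) \<Rightarrow> (nat \<Rightarrow> 'a) \<Rightarrow> (nat \<Rightarrow> 'a) \<Rightarrow> bool" where
  "mapping_cone \<alpha> \<beta> \<phi> \<gamma> \<longleftrightarrow> \<gamma> \<in> sequences \<and>
     (\<exists>j1 j2 q1 q2. \<forall>i \<in> {1..n}.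
        biproduct C (vertex \<alpha> (i + 1)) (vertex \<beta> i) (vertex \<gamma> i) (j1 i) (j2 i) (q1 i) (q2 i) \<and>
        \<gamma> i = prolong j1 (i + 1) \<bullet> Neg C (prolong \<alpha> (i + 1)) \<bullet> q1 i
            \<boxplus> prolong j2 (i + 1) \<bullet> prolong \<phi> (i + 1) \<bullet> q1 i
            \<boxplus> prolong j2 (i + 1) \<bullet> \<beta> i \<bullet> q2 i)"

text \<open>The sequence \<open>A \<rightarrow> A \<rightarrow> 0 \<rightarrow> \<dots> \<rightarrow> 0 \<rightarrow> \<Sigma> A\<close> built with a zero object \<open>Z\<close>.\<close>

definition trivial_seq :: "'o \<Rightarrow> 'o \<Rightarrow> nat \<Rightarrow> 'a" where
  "trivial_seq A Z = (\<lambda>i \<in> {1..n}.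
     if i = 1 then Ident C A
     else Null C (if i = 2 then A else Z) (if i = n then OMap \<Sigma> A else Z))"

end

locale n_angulation = sigma_sequences C \<Sigma> n
  for C :: "('o, 'a) precategory" (structure)
    and \<Sigma> :: "('o, 'a) endofunctor"
    and n :: nat +
  fixes N :: "(nat \<Rightarrow> 'a) set"
  assumes N_sequences: "N \<subseteq> sequences"
    and N1a_sum: "\<lbrakk>\<alpha> \<in> N; \<beta> \<in> N; direct_sum_seq \<alpha> \<beta> \<gamma>\<rbrakk> \<Longrightarrow> \<gamma> \<in> N"
    and N1a_summand: "\<lbrakk>\<gamma> \<in> N; direct_sum_seq \<alpha> \<beta> \<gamma>\<rbrakk> \<Longrightarrow> \<alpha> \<in> N"
    and N1a_iso: "\<lbrakk>\<alpha> \<in> N; \<beta> \<in> sequences; isomorphic_seqs \<alpha> \<beta>\<rbrakk> \<Longrightarrow> \<beta> \<in> N"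
    and N1b: "\<lbrakk>A \<in> Ob C; zero_object C Z\<rbrakk> \<Longrightarrow> trivial_seq A Z \<in> N"
    and N1c: "f \<in> Ar C \<Longrightarrow> \<exists>\<alpha> \<in> N. \<alpha> 1 = f"
    and N2: "\<alpha> \<in> sequences \<Longrightarrow> \<alpha> \<in> N \<longleftrightarrow> left_rotation \<alpha> \<in> N"
    and N3: "\<lbrakk>\<alpha> \<in> N; \<beta> \<in> N; f1 \<in> Hom C (vertex \<alpha> 1) (vertex \<beta> 1);
               f2 \<in> Hom C (vertex \<alpha> 2) (vertex \<beta> 2); f2 \<bullet> \<alpha> 1 = \<beta> 1 \<bullet> f1\<rbrakk>
             \<Longrightarrow> \<exists>\<phi>. \<phi> 1 = f1 \<and> \<phi> 2 = f2 \<and> seq_morphism \<alpha> \<beta> \<phi>"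
    and N4: "\<lbrakk>\<alpha> \<in> N; \<beta> \<in> N; f1 \<in> Hom C (vertex \<alpha> 1) (vertex \<beta> 1);
               f2 \<in> Hom C (vertex \<alpha> 2) (vertex \<beta> 2); f2 \<bullet> \<alpha> 1 = \<beta> 1 \<bullet> f1\<rbrakk>
             \<Longrightarrow> \<exists>\<phi>. \<phi> 1 = f1 \<and> \<phi> 2 = f2 \<and> seq_morphism \<alpha> \<beta> \<phi> \<and>
                   (\<exists>\<gamma> \<in> N. mapping_cone \<alpha> \<beta> \<phi> \<gamma>)"

definition n_angulated_category ::
    "('o, 'a) precategory \<Rightarrow> ('o, 'a) endofunctor \<Rightarrow> nat \<Rightarrow> (nat \<Rightarrow> 'a) set \<Rightarrow> bool" where
  "n_angulated_category C \<Sigma> n N \<longleftrightarrow>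
     n \<ge> 3 \<and> additive_category C \<and> category_automorphism C \<Sigma> \<and> n_angulation C \<Sigma> n N"


section \<open>Finitely generated free modules\<close>

definition local_ring :: "('r, 'x) ring_scheme \<Rightarrow> bool" where
  "local_ring R \<longleftrightarrow> cring R \<and> (\<exists>!\<mm>. maximalideal \<mm> R)"

definition fg_free_module :: "('r, 'x) ring_scheme \<Rightarrow> ('r, 'm) module \<Rightarrow> bool" where
  "fg_free_module R M \<longleftrightarrow> Module.module R M \<and>
     (\<exists>B. finite B \<and> B \<subseteq> carrier M \<and> \<not> module.lin_dep R M B \<and> module.span R M B = carrier M)"

text \<open>
  The arrows are triples consisting of domain, underlying map and codomain, where the map is
  \<^const>\<open>undefined\<close> outside the carrier of the domain. The type \<open>'m\<close> is the universe
  from which the carriers of the modules are taken. For the category to contain a copy of every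
  \<open>R\<^sup>k\<close>, as additivity requires, it must be large enough; it suffices that the finite lists over
  \<open>carrier R\<close> embed into \<open>'m\<close>.
\<close>

type_synonym ('r, 'm) linear_arrow = "('r, 'm) module \<times> ('m \<Rightarrow> 'm) \<times> ('r, 'm) module"

definition fg_free_modules ::
    "('r, 'x) ring_scheme \<Rightarrow> (('r, 'm) module, ('r, 'm) linear_arrow) precategory" where
  "fg_free_modules R = \<lparr>
     Ob = {M. fg_free_module R M},
     Ar = {(M, f, L). fg_free_module R M \<and> fg_free_module R L \<and>
             f \<in> LinearCombinations.module_hom R M L \<inter> extensional (carrier M)},
     Dom = (\<lambda>(M, f, L). M),
     Cod = (\<lambda>(M, f, L). L),
     Ident = (\<lambda>M. (M, \<lambda>x \<in> carrier M. x, M)),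
     Comp = (\<lambda>(_, g, L) (M, f, _). (M, compose (carrier M) g f, L)),
     Plus = (\<lambda>(M, f, L) (_, g, _). (M, \<lambda>x \<in> carrier M. f x \<oplus>\<^bsub>L\<^esub> g x, L)),
     Null = (\<lambda>M L. (M, \<lambda>x \<in> carrier M. \<zero>\<^bsub>L\<^esub>, L))\<rparr>"

definition homothety :: "('r, 'm) module \<Rightarrow> 'r \<Rightarrow> ('r, 'm) linear_arrow" where
  "homothety M r = (M, \<lambda>x \<in> carrier M. r \<odot>\<^bsub>M\<^esub> x, M)"

definition periodic_seq ::
    "('r, 'x) ring_scheme \<Rightarrow> nat \<Rightarrow> 'r \<Rightarrow> 'r \<Rightarrow> ('r, 'm) module \<Rightarrow> nat \<Rightarrow> ('r, 'm) linear_arrow" where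
  "periodic_seq R n p u F = (\<lambda>i \<in> {1..n}. homothety F (if i = 1 then u \<otimes>\<^bsub>R\<^esub> p else p))"

definition unit_angulation ::
    "('r, 'x) ring_scheme \<Rightarrow> nat \<Rightarrow> 'r \<Rightarrow> 'r \<Rightarrow> (nat \<Rightarrow> ('r, 'm) linear_arrow) set" where
  "unit_angulation R n p u =
     {\<alpha> \<in> sigma_sequences.sequences (fg_free_modules R) identity_functor n.
        \<exists>\<gamma> F \<delta>.
          sigma_sequences.candidate_angle (fg_free_modules R) identity_functor n \<gamma> \<and>
          sigma_sequences.contractible (fg_free_modules R) identity_functor n \<gamma> \<and>
          fg_free_module R F \<and>
          sigma_sequences.direct_sum_seq (fg_free_modules R) identity_functor n
            \<gamma> (periodic_seq R n p u F) \<delta> \<and>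
          sigma_sequences.isomorphic_seqs (fg_free_modules R) identity_functor n \<alpha> \<delta>}"

end

theory Submission
  imports Defs
begin

text \<open>
  Let \<open>k = R / \<mm>\<close>. On a free module the annihilator of \<open>p\<close> is the set of multiples of \<open>p\<close>, so a
  cyclic complex \<open>A\<close> of free modules lies in a short exact sequence \<open>0 \<rightarrow> A \<otimes> k \<rightarrow> A \<rightarrow> A \<otimes> k \<rightarrow> 0\<close>
  whose first map is induced by multiplication with \<open>p\<close>. If \<open>A\<close> is exact, the connecting maps are
  isomorphisms from the homology of \<open>A \<otimes> k\<close> at one position to the homology at the next one; they
  send the class of \<open>x\<close> to the class of \<open>x'\<close>, where \<open>\<alpha>\<^sub>i x = p x'\<close>. Following them once around the
  cycle gives an automorphism of the homology at position \<open>1\<close>, the monodromy of \<open>A\<close>. The key is that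
  \<open>\<N>\<^sub>u\<close> has a description that does not mention any decomposition: its members are the exact
  sequences whose monodromy is multiplication by \<open>u\<close> (\<open>angle_iff\<close>).

  Decompositions are obtained as follows. A unit in the matrix of an arrow \<open>\<alpha>\<^sub>i\<close> splits off a
  disc, a sequence whose only nonzero arrow is an identity. When no disc is left, all arrows have
  the form \<open>p a\<^sub>i\<close> (\<open>decomposition\<close>). Exactness forces the \<open>a\<^sub>i\<close> to be invertible, and up to
  isomorphism the sequence is \<open>(p t, p, \<dots>, p)\<close> for an automorphism \<open>t\<close> of a free module. Its
  monodromy is \<open>t\<close> modulo \<open>p\<close>.

  Part (1). Exactness and monodromy are inherited by direct sums, by retracts and along
  isomorphisms. Rotation conjugates the monodromy by a connecting map and multiplies it by
  \<open>(-1)\<^sup>n\<close>; this sign is trivial for even \<open>n\<close>, and invisible if \<open>2 p = 0\<close>. Every arrow is a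
  diagonal sum of copies of \<open>1\<close>, \<open>p\<close> and \<open>0\<close>, and each of these is a first arrow. The axiom on
  mapping cones is the main point. The cone of every morphism between exact sequences is exact, but
  its monodromy need only be block triangular. Each angle retracts onto its part \<open>F\<^sub>u(p)\<close> up to
  homotopy, and the monodromy of the cone depends on the morphism only up to homotopy. So one has to
  choose a morphism between two periodic sequences, with its first two components prescribed up to
  homotopy, and the freedom left in its last component suffices to remove the off-diagonal block
  (\<open>ex_periodic_cone\<close>, \<open>fill_cone\<close>).

  Part (2). Let \<open>\<N>\<close> be an angulation. Extending morphisms from and to discs shows that all members
  of \<open>\<N>\<close> are exact, and contractible candidates belong to \<open>\<N>\<close> because discs do. A member of \<open>\<N>\<close>
  whose first arrow is \<open>p\<close> on \<open>R\<close> has a summand \<open>(r p, p, \<dots>, p)\<close> on \<open>R\<close> with a unit \<open>r\<close>, and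
  sums of it give \<open>F\<^sub>r(p)\<close> for all \<open>F\<close>. For any other member with minimal part \<open>(p t, p, \<dots>, p)\<close> a
  morphism from \<open>(r p, p, \<dots>, p)\<close> with first component \<open>1\<close> shows \<open>p t = r p\<close>. Hence \<open>\<N> = \<N>\<^sub>r\<close>.

  Part (3). The monodromy of the sequence \<open>(u p, p, \<dots>, p)\<close> on \<open>R\<close> determines \<open>u p\<close>, and \<open>u\<close> enters
  the construction of \<open>\<N>\<^sub>u\<close> only through \<open>u p\<close>.

  All this takes place in an \<open>R\<close>-linear additive category in which every object is a finite direct sum of
  copies of an object \<open>U\<close> with endomorphism ring \<open>R\<close>. That finitely generated free modules form such
  a category is shown in the last sections.
\<close>

section \<open>Calculating with arrows of an additive category\<close>

context additive_category
begin

lemma in_Hom: "f \<in> Hom C A B \<longleftrightarrow> f \<in> Ar C \<and> Dom C f = A \<and> Cod C f = B"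
  by (simp add: Hom_def)

lemma Hom_Ob:
  assumes "f \<in> Hom C A B"
  shows "A \<in> Ob C" "B \<in> Ob C"
  using assms Dom_Ob Cod_Ob by (auto simp: in_Hom)

lemma hom_group_simps:
  "carrier (hom_group C A B) = Hom C A B" "monoid.mult (hom_group C A B) f g = f \<boxplus> g"
  "one (hom_group C A B) = Null C A B"
  by (simp_all add: hom_group_def)

lemma Plus_Hom: assumes f: "f \<in> Hom C A B" and g: "g \<in> Hom C A B" shows "f \<boxplus> g \<in> Hom C A B"
proof -
  interpret comm_group "hom_group C A B" using Hom_Ob[OF f] hom_comm_group by blast
  show ?thesis using f g m_closed[of f g] by (simp add: hom_group_simps)
qed

lemma Null_Hom: assumes "A \<in> Ob C" "B \<in> Ob C" shows "Null C A B \<in> Hom C A B"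
proof -
  interpret comm_group "hom_group C A B" using assms hom_comm_group by blast
  show ?thesis using one_closed by (simp add: hom_group_simps)
qed

lemma Neg_Hom: assumes f: "f \<in> Hom C A B" shows "Neg C f \<in> Hom C A B"
proof -
  interpret comm_group "hom_group C A B" using Hom_Ob[OF f] hom_comm_group by blast
  show ?thesis using f inv_closed[of f] by (simp add: Neg_def in_Hom hom_group_simps)
qed

lemma Plus_Neg_Hom:
  assumes f: "f \<in> Hom C A B"
  shows "f \<boxplus> Neg C f = Null C A B" "f \<boxplus> Null C A B = f" "Null C A B \<boxplus> f = f"
proof -
  interpret comm_group "hom_group C A B" using Hom_Ob[OF f] hom_comm_group by blast
  show "f \<boxplus> Neg C f = Null C A B" using f r_inv[of f] by (simp add: Neg_def in_Hom hom_group_simps)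
  show "f \<boxplus> Null C A B = f" "Null C A B \<boxplus> f = f" using f r_one[of f] l_one[of f] by (simp_all add: hom_group_simps)
qed

lemma Plus_AC_Hom:
  assumes "f \<in> Hom C A B" "g \<in> Hom C A B" "h \<in> Hom C A B"
  shows "(f \<boxplus> g) \<boxplus> h = f \<boxplus> (g \<boxplus> h)" "f \<boxplus> g = g \<boxplus> f" "f \<boxplus> (g \<boxplus> h) = g \<boxplus> (f \<boxplus> h)"
proof -
  interpret comm_group "hom_group C A B" using Hom_Ob[OF assms(1)] hom_comm_group by blast
  show "(f \<boxplus> g) \<boxplus> h = f \<boxplus> (g \<boxplus> h)" "f \<boxplus> g = g \<boxplus> f" "f \<boxplus> (g \<boxplus> h) = g \<boxplus> (f \<boxplus> h)"
    using assms m_assoc[of f g h] m_comm[of f g] m_lcomm[of f g h] by (simp_all add: hom_group_simps)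
qed

lemma arr_Comp [simp]:
  assumes "f \<in> Ar C" "g \<in> Ar C" "Dom C g = Cod C f"
  shows "g \<bullet> f \<in> Ar C" "Dom C (g \<bullet> f) = Dom C f" "Cod C (g \<bullet> f) = Cod C g"
  using Comp_Hom[of f "Dom C f" "Cod C f" g "Cod C g"] assms by (auto simp: in_Hom)

lemma arr_Plus [simp]:
  assumes "f \<in> Ar C" "g \<in> Ar C" "Dom C f = Dom C g" "Cod C f = Cod C g"
  shows "f \<boxplus> g \<in> Ar C" "Dom C (f \<boxplus> g) = Dom C g" "Cod C (f \<boxplus> g) = Cod C g"
  using Plus_Hom[of f "Dom C f" "Cod C f" g] assms by (auto simp: in_Hom)

lemma arr_Null [simp]:
  assumes "A \<in> Ob C" "B \<in> Ob C"
  shows "Null C A B \<in> Ar C" "Dom C (Null C A B) = A" "Cod C (Null C A B) = B"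
  using Null_Hom assms by (auto simp: in_Hom)

lemma arr_Ident [simp]:
  assumes "A \<in> Ob C"
  shows "Ident C A \<in> Ar C" "Dom C (Ident C A) = A" "Cod C (Ident C A) = A"
  using Ident_Hom assms by (auto simp: in_Hom)

lemma arr_Neg [simp]:
  assumes "f \<in> Ar C"
  shows "Neg C f \<in> Ar C" "Dom C (Neg C f) = Dom C f" "Cod C (Neg C f) = Cod C f"
  using Neg_Hom[of f] assms by (auto simp: in_Hom)

lemmas arr_Ob [simp] = Dom_Ob Cod_Ob

lemma comp_assoc:
  "\<lbrakk>f \<in> Ar C; g \<in> Ar C; h \<in> Ar C; Dom C g = Cod C f; Dom C h = Cod C g\<rbrakk> \<Longrightarrow> (h \<bullet> g) \<bullet> f = h \<bullet> (g \<bullet> f)"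
  using Comp_assoc[of f "Dom C f" "Cod C f" g "Cod C g" h "Cod C h"] by (simp add: in_Hom)

lemma comp_plus:
  "\<lbrakk>f \<in> Ar C; f' \<in> Ar C; g \<in> Ar C; Dom C f = Dom C f'; Dom C g = Cod C f'; Cod C f = Cod C f'\<rbrakk>
    \<Longrightarrow> g \<bullet> (f \<boxplus> f') = g \<bullet> f \<boxplus> g \<bullet> f'"
  using Comp_Plus[of f "Dom C f" "Cod C f" f' g "Cod C g"] by (simp add: in_Hom)

lemma plus_comp:
  "\<lbrakk>f \<in> Ar C; g' \<in> Ar C; g \<in> Ar C; Dom C g = Dom C g'; Dom C g' = Cod C f; Cod C g = Cod C g'\<rbrakk>
    \<Longrightarrow> (g \<boxplus> g') \<bullet> f = g \<bullet> f \<boxplus> g' \<bullet> f"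
  using Plus_Comp[of f "Dom C f" "Cod C f" g "Cod C g" g'] by (simp add: in_Hom)

lemma comp_ident [simp]: "f \<in> Ar C \<Longrightarrow> Dom C f = A \<Longrightarrow> f \<bullet> Ident C A = f"
  using Comp_Ident[of f A "Cod C f"] by (simp add: in_Hom)

lemma ident_comp [simp]: "f \<in> Ar C \<Longrightarrow> Cod C f = B \<Longrightarrow> Ident C B \<bullet> f = f"
  using Ident_Comp[of f "Dom C f" B] by (simp add: in_Hom)

lemma plus_null [simp]:
  assumes "f \<in> Ar C" "Dom C f = A" "Cod C f = B"
  shows "f \<boxplus> Null C A B = f" "Null C A B \<boxplus> f = f"
  using Plus_Neg_Hom[of f A B] assms by (auto simp: in_Hom)

lemma plus_neg [simp]:
  assumes "f \<in> Ar C"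
  shows "f \<boxplus> Neg C f = Null C (Dom C f) (Cod C f)"
  using Plus_Neg_Hom[of f] assms by (auto simp: in_Hom)

lemma plus_assoc:
  "\<lbrakk>f \<in> Ar C; g \<in> Ar C; h \<in> Ar C; Dom C f = Dom C g; Dom C g = Dom C h; Cod C f = Cod C g; Cod C g = Cod C h\<rbrakk>
    \<Longrightarrow> (f \<boxplus> g) \<boxplus> h = f \<boxplus> (g \<boxplus> h)"
  using Plus_AC_Hom(1)[of f "Dom C f" "Cod C f" g h] by (simp add: in_Hom)

lemma plus_comm:
  "\<lbrakk>f \<in> Ar C; g \<in> Ar C; Dom C f = Dom C g; Cod C f = Cod C g\<rbrakk> \<Longrightarrow> f \<boxplus> g = g \<boxplus> f"
  using Plus_AC_Hom(2)[of f "Dom C f" "Cod C f" g g] by (simp add: in_Hom)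

lemma plus_left_comm:
  "\<lbrakk>f \<in> Ar C; g \<in> Ar C; h \<in> Ar C; Dom C f = Dom C g; Dom C g = Dom C h; Cod C f = Cod C g; Cod C g = Cod C h\<rbrakk>
    \<Longrightarrow> f \<boxplus> (g \<boxplus> h) = g \<boxplus> (f \<boxplus> h)"
  using Plus_AC_Hom(3)[of f "Dom C f" "Cod C f" g h] by (simp add: in_Hom)

lemmas plus_ac = plus_assoc plus_comm plus_left_comm

lemma neg_plus [simp]: "f \<in> Ar C \<Longrightarrow> Neg C f \<boxplus> f = Null C (Dom C f) (Cod C f)"
  using plus_comm[of "Neg C f" f] by simp

lemma neg_plus_cancel [simp]:
  assumes "f \<in> Ar C" "g \<in> Ar C" "Dom C f = Dom C g" "Cod C f = Cod C g"
  shows "Neg C f \<boxplus> (f \<boxplus> g) = g" "f \<boxplus> (Neg C f \<boxplus> g) = g"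
  using assms plus_assoc[of "Neg C f" f g] plus_assoc[of f "Neg C f" g] by simp_all

lemma plus_cancel:
  assumes "f \<in> Ar C" "g \<in> Ar C" "h \<in> Ar C"
    "Dom C f = Dom C g" "Cod C f = Cod C g" "Dom C h = Dom C g" "Cod C h = Cod C g"
  shows "f \<boxplus> g = f \<boxplus> h \<longleftrightarrow> g = h"
proof
  assume *: "f \<boxplus> g = f \<boxplus> h"
  have "g = Neg C f \<boxplus> (f \<boxplus> g)" using assms by (intro neg_plus_cancel(1)[symmetric]) simp_all
  also have "\<dots> = Neg C f \<boxplus> (f \<boxplus> h)" by (simp only: *)
  also have "\<dots> = h" using assms by (intro neg_plus_cancel(1)) simp_all
  finally show "g = h" .
qed simp

lemma neg_unique:
  assumes "f \<in> Ar C" "g \<in> Ar C" "Dom C f = Dom C g" "Cod C f = Cod C g"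
    "f \<boxplus> g = Null C (Dom C g) (Cod C g)"
  shows "Neg C f = g"
proof -
  have "f \<boxplus> Neg C f = f \<boxplus> g" using assms by simp
  then show ?thesis by (rule iffD1[OF plus_cancel, rotated -1]) (use assms in simp_all)
qed

lemma comp_null [simp]:
  assumes "g \<in> Ar C" "Dom C g = B" "A \<in> Ob C" "D = B"
  shows "g \<bullet> Null C A D = Null C A (Cod C g)"
proof -
  have B: "B \<in> Ob C" using assms by auto
  have "g \<bullet> (Null C A B \<boxplus> Null C A B) = g \<bullet> Null C A B \<boxplus> g \<bullet> Null C A B"
    using assms B by (intro comp_plus) auto
  then have "g \<bullet> Null C A B \<boxplus> Null C A (Cod C g) = g \<bullet> Null C A B \<boxplus> g \<bullet> Null C A B"
    using assms B by simp
  then have "Null C A (Cod C g) = g \<bullet> Null C A B"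
    by (rule iffD1[OF plus_cancel, rotated -1]) (use assms B in simp_all)
  then show ?thesis using assms by simp
qed

lemma null_comp [simp]:
  assumes "f \<in> Ar C" "Cod C f = A" "B \<in> Ob C" "D = A"
  shows "Null C D B \<bullet> f = Null C (Dom C f) B"
proof -
  have A: "A \<in> Ob C" using assms by auto
  have "(Null C A B \<boxplus> Null C A B) \<bullet> f = Null C A B \<bullet> f \<boxplus> Null C A B \<bullet> f"
    using assms A by (intro plus_comp) auto
  then have "Null C A B \<bullet> f \<boxplus> Null C (Dom C f) B = Null C A B \<bullet> f \<boxplus> Null C A B \<bullet> f"
    using assms A by simp
  then have "Null C (Dom C f) B = Null C A B \<bullet> f"
    by (rule iffD1[OF plus_cancel, rotated -1]) (use assms A in simp_all)
  then show ?thesis using assms by simp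
qed

lemma neg_comp:
  assumes "f \<in> Ar C" "g \<in> Ar C" "Dom C g = Cod C f"
  shows "Neg C g \<bullet> f = Neg C (g \<bullet> f)" "g \<bullet> Neg C f = Neg C (g \<bullet> f)"
proof -
  have "g \<bullet> f \<boxplus> Neg C g \<bullet> f = (g \<boxplus> Neg C g) \<bullet> f" using assms by (simp add: plus_comp del: plus_neg)
  also have "\<dots> = Null C (Dom C f) (Cod C g)" using assms by simp
  finally show "Neg C g \<bullet> f = Neg C (g \<bullet> f)"
    using neg_unique[of "g \<bullet> f" "Neg C g \<bullet> f"] assms by simp
  have "g \<bullet> f \<boxplus> g \<bullet> Neg C f = g \<bullet> (f \<boxplus> Neg C f)" using assms by (simp add: comp_plus del: plus_neg)
  also have "\<dots> = Null C (Dom C f) (Cod C g)" using assms by simp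
  finally show "g \<bullet> Neg C f = Neg C (g \<bullet> f)"
    using neg_unique[of "g \<bullet> f" "g \<bullet> Neg C f"] assms by simp
qed

lemma neg_neg [simp]: "f \<in> Ar C \<Longrightarrow> Neg C (Neg C f) = f"
  using neg_unique[of "Neg C f" f] by simp

lemma neg_null [simp]: "A \<in> Ob C \<Longrightarrow> B \<in> Ob C \<Longrightarrow> Neg C (Null C A B) = Null C A B"
  using neg_unique[of "Null C A B" "Null C A B"] by simp

lemma neg_sum:
  assumes "f \<in> Ar C" "g \<in> Ar C" "Dom C f = Dom C g" "Cod C f = Cod C g"
  shows "Neg C (f \<boxplus> g) = Neg C f \<boxplus> Neg C g"
proof -
  have "(f \<boxplus> g) \<boxplus> (Neg C f \<boxplus> Neg C g) = Null C (Dom C g) (Cod C g)"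
    using assms by (simp add: plus_assoc plus_left_comm[of g "Neg C f" "Neg C g"])
  then show ?thesis using neg_unique[of "f \<boxplus> g" "Neg C f \<boxplus> Neg C g"] assms by simp
qed

lemma neg_eq_null:
  assumes "f \<in> Ar C" "Dom C f = A" "Cod C f = B" "Neg C f = Null C A B"
  shows "f = Null C A B"
proof -
  have "Neg C (Neg C f) = Null C A B" using assms(1-3) by (auto simp: assms(4))
  then show ?thesis using assms(1) by simp
qed

lemmas arrow_simps = comp_assoc comp_plus plus_comp neg_comp neg_sum

text \<open>Rewriting with \<open>g \<bullet> f = h\<close> inside a composition that is nested to the right.\<close>

lemma comp_rewrite:
  assumes "g \<bullet> f = h" "f \<in> Ar C" "g \<in> Ar C" "Dom C g = Cod C f" "x \<in> Ar C" "Dom C f = Cod C x"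
  shows "g \<bullet> (f \<bullet> x) = h \<bullet> x"
  using assms comp_assoc[of x f g] by simp

end

section \<open>Biproducts and free objects\<close>

context additive_category
begin

lemma zero_objectI:
  assumes "Z \<in> Ob C" "Ident C Z = Null C Z Z"
  shows "zero_object C Z"
proof -
  have "f = Null C A Z" if "f \<in> Hom C A Z" for f A
  proof -
    have "Ident C Z \<bullet> f = f" using that by (auto simp: in_Hom)
    then show ?thesis using that assms by (auto simp: in_Hom)
  qed
  moreover have "f = Null C Z A" if "f \<in> Hom C Z A" for f A
  proof -
    have "f \<bullet> Ident C Z = f" using that by (auto simp: in_Hom)
    then show ?thesis using that assms by (auto simp: in_Hom)
  qed
  ultimately show ?thesis using assms Null_Hom unfolding zero_object_def by metis
qed

lemma zero_objectD:
  assumes "zero_object C Z"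
  shows "Z \<in> Ob C"
    and "f \<in> Ar C \<Longrightarrow> Cod C f = Z \<Longrightarrow> f = Null C (Dom C f) Z"
    and "f \<in> Ar C \<Longrightarrow> Dom C f = Z \<Longrightarrow> f = Null C Z (Cod C f)"
proof -
  show Z: "Z \<in> Ob C" using assms by (simp add: zero_object_def)
  show "f = Null C (Dom C f) Z" if "f \<in> Ar C" "Cod C f = Z"
  proof -
    have "\<exists>!g. g \<in> Hom C (Dom C f) Z" using assms that unfolding zero_object_def by auto
    moreover have "f \<in> Hom C (Dom C f) Z" "Null C (Dom C f) Z \<in> Hom C (Dom C f) Z"
      using that Z by (auto simp: in_Hom)
    ultimately show ?thesis by blast
  qed
  show "f = Null C Z (Cod C f)" if "f \<in> Ar C" "Dom C f = Z"
  proof -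
    have "\<exists>!g. g \<in> Hom C Z (Cod C f)" using assms that unfolding zero_object_def by auto
    moreover have "f \<in> Hom C Z (Cod C f)" "Null C Z (Cod C f) \<in> Hom C Z (Cod C f)"
      using that Z by (auto simp: in_Hom)
    ultimately show ?thesis by blast
  qed
qed

lemma zero_object_Hom:
  assumes "zero_object C Z"
  shows "f \<in> Hom C A Z \<Longrightarrow> f = Null C A Z" "f \<in> Hom C Z A \<Longrightarrow> f = Null C Z A"
  using zero_objectD(2,3)[OF assms, of f] by (simp_all add: in_Hom)

lemma zero_object_ident: "zero_object C Z \<Longrightarrow> Ident C Z = Null C Z Z"
  using zero_objectD(1)[of Z] zero_objectD(2)[of Z "Ident C Z"] by simp

lemma biproductI:
  assumes "A \<in> Ob C" "B \<in> Ob C" "j1 \<in> Hom C A S" "j2 \<in> Hom C B S" "q1 \<in> Hom C S A" "q2 \<in> Hom C S B"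
    "q1 \<bullet> j1 = Ident C A" "q2 \<bullet> j2 = Ident C B" "j1 \<bullet> q1 \<boxplus> j2 \<bullet> q2 = Ident C S"
    "q2 \<bullet> j1 = Null C A B" "q1 \<bullet> j2 = Null C B A"
  shows "biproduct C A B S j1 j2 q1 q2"
  using assms by (simp add: biproduct_def)

lemma biproduct_Ob:
  assumes "biproduct C A B S j1 j2 q1 q2"
  shows "A \<in> Ob C" "B \<in> Ob C" "S \<in> Ob C"
  using assms Hom_Ob[of j1 A S] Hom_Ob[of j2 B S] by (auto simp: biproduct_def)

lemma biproduct_arr:
  assumes "biproduct C A B S j1 j2 q1 q2"
  shows "j1 \<in> Ar C" "j2 \<in> Ar C" "q1 \<in> Ar C" "q2 \<in> Ar C"
    "Dom C j1 = A" "Dom C j2 = B" "Dom C q1 = S" "Dom C q2 = S"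
    "Cod C j1 = S" "Cod C j2 = S" "Cod C q1 = A" "Cod C q2 = B"
    "q1 \<bullet> j1 = Ident C A" "q2 \<bullet> j2 = Ident C B"
    "q1 \<bullet> j2 = Null C B A" "q2 \<bullet> j1 = Null C A B"
  using assms by (auto simp: biproduct_def in_Hom)

lemma biproduct_comp:
  assumes b: "biproduct C A B S j1 j2 q1 q2" and x: "x \<in> Ar C"
  shows "Cod C x = A \<Longrightarrow> q1 \<bullet> (j1 \<bullet> x) = x"
    "Cod C x = B \<Longrightarrow> q2 \<bullet> (j2 \<bullet> x) = x"
    "Cod C x = B \<Longrightarrow> q1 \<bullet> (j2 \<bullet> x) = Null C (Dom C x) A"
    "Cod C x = A \<Longrightarrow> q2 \<bullet> (j1 \<bullet> x) = Null C (Dom C x) B"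
    "Cod C x = S \<Longrightarrow> j1 \<bullet> (q1 \<bullet> x) \<boxplus> j2 \<bullet> (q2 \<bullet> x) = x"
    "Dom C x = S \<Longrightarrow> x \<bullet> (j1 \<bullet> q1) \<boxplus> x \<bullet> (j2 \<bullet> q2) = x"
proof -
  note [simp] = biproduct_arr[OF b] biproduct_Ob[OF b] x
  show "q1 \<bullet> (j1 \<bullet> x) = x" if "Cod C x = A" using that comp_assoc[of x j1 q1] by simp
  show "q2 \<bullet> (j2 \<bullet> x) = x" if "Cod C x = B" using that comp_assoc[of x j2 q2] by simp
  show "q1 \<bullet> (j2 \<bullet> x) = Null C (Dom C x) A" if "Cod C x = B" using that comp_assoc[of x j2 q1] by simp
  show "q2 \<bullet> (j1 \<bullet> x) = Null C (Dom C x) B" if "Cod C x = A" using that comp_assoc[of x j1 q2] by simp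
  have s: "j1 \<bullet> q1 \<boxplus> j2 \<bullet> q2 = Ident C S" using b by (simp add: biproduct_def)
  show "j1 \<bullet> (q1 \<bullet> x) \<boxplus> j2 \<bullet> (q2 \<bullet> x) = x" if "Cod C x = S"
  proof -
    have "(j1 \<bullet> q1 \<boxplus> j2 \<bullet> q2) \<bullet> x = j1 \<bullet> (q1 \<bullet> x) \<boxplus> j2 \<bullet> (q2 \<bullet> x)"
      using that by (simp add: arrow_simps)
    then show ?thesis using that by (simp add: s)
  qed
  show "x \<bullet> (j1 \<bullet> q1) \<boxplus> x \<bullet> (j2 \<bullet> q2) = x" if "Dom C x = S"
  proof -
    have "x \<bullet> (j1 \<bullet> q1 \<boxplus> j2 \<bullet> q2) = x \<bullet> (j1 \<bullet> q1) \<boxplus> x \<bullet> (j2 \<bullet> q2)"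
      using that by (simp add: arrow_simps)
    then show ?thesis using that by (simp add: s)
  qed
qed

lemmas biproduct_simps = biproduct_arr biproduct_Ob biproduct_comp

lemma biproduct_eqI:
  assumes b: "biproduct C A B S j1 j2 q1 q2" and "x \<in> Hom C W S" "y \<in> Hom C W S"
    "q1 \<bullet> x = q1 \<bullet> y" "q2 \<bullet> x = q2 \<bullet> y"
  shows "x = y"
proof -
  note [simp] = assms(2,3)[unfolded in_Hom]
  have "x = j1 \<bullet> (q1 \<bullet> x) \<boxplus> j2 \<bullet> (q2 \<bullet> x)" by (simp add: biproduct_comp(5)[OF b])
  also have "\<dots> = j1 \<bullet> (q1 \<bullet> y) \<boxplus> j2 \<bullet> (q2 \<bullet> y)" by (simp only: assms(4,5))
  also have "\<dots> = y" by (simp add: biproduct_comp(5)[OF b])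
  finally show ?thesis .
qed

lemma biproduct_eqI':
  assumes b: "biproduct C A B S j1 j2 q1 q2" and "x \<in> Hom C S W" "y \<in> Hom C S W"
    "x \<bullet> j1 = y \<bullet> j1" "x \<bullet> j2 = y \<bullet> j2"
  shows "x = y"
proof -
  note [simp] = biproduct_arr[OF b] assms(2,3)[unfolded in_Hom]
  have "x = (x \<bullet> j1) \<bullet> q1 \<boxplus> (x \<bullet> j2) \<bullet> q2" by (simp add: comp_assoc biproduct_comp(6)[OF b])
  also have "\<dots> = (y \<bullet> j1) \<bullet> q1 \<boxplus> (y \<bullet> j2) \<bullet> q2" by (simp only: assms(4,5))
  also have "\<dots> = y" by (simp add: comp_assoc biproduct_comp(6)[OF b])
  finally show ?thesis .
qed

lemma biproduct_swap:
  assumes b: "biproduct C A B S j1 j2 q1 q2"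
  shows "biproduct C B A S j2 j1 q2 q1"
  using assms plus_comm[of "j1 \<bullet> q1" "j2 \<bullet> q2"] biproduct_arr[OF b]
  by (auto simp: biproduct_def)

text \<open>The four arrows are those of \<open>A \<oplus> (B \<oplus> D) = (A \<oplus> B) \<oplus> D\<close> for a chosen \<open>E = A \<oplus> B\<close>.\<close>

lemma biproduct_assoc:
  assumes b: "biproduct C A T S j1 j2 q1 q2" and d: "biproduct C B D T k1 k2 r1 r2"
    and e: "biproduct C A B E l1 l2 s1 s2"
  shows "biproduct C E D S (j1 \<bullet> s1 \<boxplus> j2 \<bullet> k1 \<bullet> s2) (j2 \<bullet> k2) (l1 \<bullet> q1 \<boxplus> l2 \<bullet> r1 \<bullet> q2) (r2 \<bullet> q2)"
proof -
  note [simp] = biproduct_simps[OF b] biproduct_simps[OF d] biproduct_simps[OF e]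
  have 1: "l1 \<bullet> s1 \<boxplus> l2 \<bullet> s2 = Ident C E" using e by (simp add: biproduct_def)
  have "j2 \<bullet> (k1 \<bullet> (r1 \<bullet> q2)) \<boxplus> j2 \<bullet> (k2 \<bullet> (r2 \<bullet> q2)) = j2 \<bullet> q2"
    using comp_plus[of "k1 \<bullet> (r1 \<bullet> q2)" "k2 \<bullet> (r2 \<bullet> q2)" j2] by simp
  moreover have "j1 \<bullet> q1 \<boxplus> j2 \<bullet> q2 = Ident C S" using b by (simp add: biproduct_def)
  ultimately have 2: "j1 \<bullet> q1 \<boxplus> (j2 \<bullet> (k1 \<bullet> (r1 \<bullet> q2)) \<boxplus> j2 \<bullet> (k2 \<bullet> (r2 \<bullet> q2))) = Ident C S" by simp
  show ?thesis
    by (rule biproductI) (simp_all add: in_Hom arrow_simps 1 2 plus_assoc)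
qed

end

text \<open>
  The rank is built up one copy of \<open>U\<close> at a time, because objects and arrows are treated by
  induction on it.
\<close>

inductive free_of_rank :: "('o, 'a) precategory \<Rightarrow> 'o \<Rightarrow> nat \<Rightarrow> 'o \<Rightarrow> bool"
  for C :: "('o, 'a) precategory" and U :: 'o where
  zero: "zero_object C Z \<Longrightarrow> free_of_rank C U 0 Z"
| add: "free_of_rank C U k A \<Longrightarrow> biproduct C U A S j1 j2 q1 q2 \<Longrightarrow> free_of_rank C U (Suc k) S"


section \<open>Linear categories over a local ring of length two\<close>

locale linear_category = additive_category C + cring R
  for C :: "('o, 'a) precategory" (structure) and R :: "('r, 'x) ring_scheme" +
  fixes sm :: "'r \<Rightarrow> 'a \<Rightarrow> 'a" (infixr \<open>\<star>\<close> 75)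
  assumes sm_Hom: "\<lbrakk>r \<in> carrier R; f \<in> Hom C A B\<rbrakk> \<Longrightarrow> r \<star> f \<in> Hom C A B"
    and sm_Comp: "\<lbrakk>r \<in> carrier R; f \<in> Hom C A B; g \<in> Hom C B D\<rbrakk> \<Longrightarrow> r \<star> g \<bullet> f = r \<star> (g \<bullet> f)"
    and Comp_sm: "\<lbrakk>r \<in> carrier R; f \<in> Hom C A B; g \<in> Hom C B D\<rbrakk> \<Longrightarrow> g \<bullet> r \<star> f = r \<star> (g \<bullet> f)"
    and sm_add: "\<lbrakk>r \<in> carrier R; s \<in> carrier R; f \<in> Hom C A B\<rbrakk> \<Longrightarrow> (r \<oplus>\<^bsub>R\<^esub> s) \<star> f = r \<star> f \<boxplus> s \<star> f"
    and sm_mult: "\<lbrakk>r \<in> carrier R; s \<in> carrier R; f \<in> Hom C A B\<rbrakk> \<Longrightarrow> (r \<otimes>\<^bsub>R\<^esub> s) \<star> f = r \<star> s \<star> f"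
    and sm_one: "f \<in> Hom C A B \<Longrightarrow> \<one>\<^bsub>R\<^esub> \<star> f = f"
begin

lemma arr_sm [simp]:
  assumes "r \<in> carrier R" "f \<in> Ar C"
  shows "r \<star> f \<in> Ar C" "Dom C (r \<star> f) = Dom C f" "Cod C (r \<star> f) = Cod C f"
  using sm_Hom[of r f "Dom C f" "Cod C f"] assms by (auto simp: in_Hom)

lemma sm_comp:
  assumes "r \<in> carrier R" "f \<in> Ar C" "g \<in> Ar C" "Dom C g = Cod C f"
  shows "r \<star> g \<bullet> f = r \<star> (g \<bullet> f)" "g \<bullet> r \<star> f = r \<star> (g \<bullet> f)"
  using sm_Comp[of r f "Dom C f" "Cod C f" g "Cod C g"] Comp_sm[of r f "Dom C f" "Cod C f" g "Cod C g"] assms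
  by (auto simp: in_Hom)

lemma sm_plus:
  assumes "r \<in> carrier R" "f \<in> Ar C" "g \<in> Ar C" "Dom C f = Dom C g" "Cod C f = Cod C g"
  shows "r \<star> (f \<boxplus> g) = r \<star> f \<boxplus> r \<star> g"
proof -
  have "r \<star> Ident C (Cod C g) \<bullet> (f \<boxplus> g) = r \<star> Ident C (Cod C g) \<bullet> f \<boxplus> r \<star> Ident C (Cod C g) \<bullet> g"
    using assms by (intro comp_plus) auto
  then show ?thesis using assms by (simp add: sm_comp)
qed

lemma sm_null [simp]:
  assumes "r \<in> carrier R" "A \<in> Ob C" "B \<in> Ob C"
  shows "r \<star> Null C A B = Null C A B"
  using assms sm_comp(2)[of r "Null C A B" "Null C B B"]
    sm_comp(1)[of r "Null C A B" "Null C B B"] by simp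

lemma sm_neg:
  assumes "r \<in> carrier R" "f \<in> Ar C"
  shows "r \<star> Neg C f = Neg C (r \<star> f)"
  using assms neg_unique[of "r \<star> f" "r \<star> Neg C f"] sm_plus[of r f "Neg C f"] by simp

lemma one_sm [simp]: "f \<in> Ar C \<Longrightarrow> \<one>\<^bsub>R\<^esub> \<star> f = f"
  using sm_one[of f "Dom C f" "Cod C f"] by (simp add: in_Hom)

lemma add_sm: "\<lbrakk>r \<in> carrier R; s \<in> carrier R; f \<in> Ar C\<rbrakk> \<Longrightarrow> (r \<oplus>\<^bsub>R\<^esub> s) \<star> f = r \<star> f \<boxplus> s \<star> f"
  using sm_add[of r s f "Dom C f" "Cod C f"] by (simp add: in_Hom)

lemma mult_sm: "\<lbrakk>r \<in> carrier R; s \<in> carrier R; f \<in> Ar C\<rbrakk> \<Longrightarrow> r \<star> s \<star> f = (r \<otimes>\<^bsub>R\<^esub> s) \<star> f"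
  using sm_mult[of r s f "Dom C f" "Cod C f"] by (simp add: in_Hom)

lemma sm_left_comm: "\<lbrakk>r \<in> carrier R; s \<in> carrier R; f \<in> Ar C\<rbrakk> \<Longrightarrow> r \<star> s \<star> f = s \<star> r \<star> f"
  using m_comm[of r s] by (simp add: mult_sm)

lemma zero_sm [simp]: "f \<in> Ar C \<Longrightarrow> \<zero>\<^bsub>R\<^esub> \<star> f = Null C (Dom C f) (Cod C f)"
  using add_sm[of "\<zero>\<^bsub>R\<^esub>" "\<zero>\<^bsub>R\<^esub>" f] plus_cancel[of "\<zero>\<^bsub>R\<^esub> \<star> f" "\<zero>\<^bsub>R\<^esub> \<star> f" "Null C (Dom C f) (Cod C f)"] by simp

lemma unit_sm_cancel:
  assumes "u \<in> Units R" "f \<in> Ar C"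
  shows "inv\<^bsub>R\<^esub> u \<star> u \<star> f = f" "u \<star> inv\<^bsub>R\<^esub> u \<star> f = f"
  using assms by (simp_all add: mult_sm Units_closed)

lemmas linear_simps = arrow_simps sm_comp sm_plus sm_neg

text \<open>For \<open>r = p\<close> these are the arrows that vanish over the residue field.\<close>

definition divisible :: "'r \<Rightarrow> 'a \<Rightarrow> bool" where
  "divisible r f \<longleftrightarrow> (\<exists>g \<in> Hom C (Dom C f) (Cod C f). f = r \<star> g)"

lemma divisibleI: "r \<in> carrier R \<Longrightarrow> g \<in> Ar C \<Longrightarrow> divisible r (r \<star> g)"
  unfolding divisible_def by (auto simp: in_Hom)

lemma divisibleE:
  assumes "divisible r f"
  obtains g where "g \<in> Ar C" "Dom C g = Dom C f" "Cod C g = Cod C f" "f = r \<star> g"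
  using assms unfolding divisible_def by (auto simp: in_Hom)

lemma divisible_null: "r \<in> carrier R \<Longrightarrow> A \<in> Ob C \<Longrightarrow> B \<in> Ob C \<Longrightarrow> divisible r (Null C A B)"
  using divisibleI[of r "Null C A B"] by simp

lemma divisible_comp:
  assumes "r \<in> carrier R" "divisible r f" "f \<in> Ar C" "g \<in> Ar C"
  shows "Cod C f = Dom C g \<Longrightarrow> divisible r (g \<bullet> f)" "Cod C g = Dom C f \<Longrightarrow> divisible r (f \<bullet> g)"
proof -
  obtain h where [simp]: "h \<in> Ar C" "Dom C h = Dom C f" "Cod C h = Cod C f" and h: "f = r \<star> h"
    using assms(2) by (rule divisibleE)
  show "divisible r (g \<bullet> f)" if "Cod C f = Dom C g"
  proof -
    have "g \<bullet> f = r \<star> (g \<bullet> h)" using that assms(1,3,4) by (subst h) (simp add: sm_comp)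
    then show ?thesis using divisibleI[of r "g \<bullet> h"] that assms(1,4) by simp
  qed
  show "divisible r (f \<bullet> g)" if "Cod C g = Dom C f"
  proof -
    have "f \<bullet> g = r \<star> (h \<bullet> g)" using that assms(1,3,4) by (subst h) (simp add: sm_comp)
    then show ?thesis using divisibleI[of r "h \<bullet> g"] that assms(1,4) by simp
  qed
qed

lemma divisible_plus:
  assumes "r \<in> carrier R" "divisible r f" "divisible r g" "Dom C f = Dom C g" "Cod C f = Cod C g"
  shows "divisible r (f \<boxplus> g)"
proof -
  obtain f' where f: "f' \<in> Ar C" "Dom C f' = Dom C f" "Cod C f' = Cod C f" "f = r \<star> f'" using assms by (auto elim: divisibleE)
  obtain g' where g: "g' \<in> Ar C" "Dom C g' = Dom C g" "Cod C g' = Cod C g" "g = r \<star> g'" using assms by (auto elim: divisibleE)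
  have "f \<boxplus> g = r \<star> (f' \<boxplus> g')" using f g assms by (simp add: sm_plus)
  then show ?thesis using f g assms by (simp add: divisibleI)
qed

lemma divisible_neg: "r \<in> carrier R \<Longrightarrow> divisible r f \<Longrightarrow> divisible r (Neg C f)"
  by (auto elim!: divisibleE simp: sm_neg[symmetric] intro!: divisibleI)

lemma divisible_dom:
  assumes b: "biproduct C A B S j1 j2 q1 q2" and "r \<in> carrier R" "f \<in> Ar C" "Dom C f = S"
    and "divisible r (f \<bullet> j1)" "divisible r (f \<bullet> j2)"
  shows "divisible r f"
proof -
  note [simp] = biproduct_arr[OF b]
  have "divisible r ((f \<bullet> j1) \<bullet> q1)" "divisible r ((f \<bullet> j2) \<bullet> q2)"
    using assms(2-6) by (auto intro!: divisible_comp(2))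
  then have "divisible r ((f \<bullet> j1) \<bullet> q1 \<boxplus> (f \<bullet> j2) \<bullet> q2)"
    using assms(2-4) by (intro divisible_plus) auto
  then show ?thesis using biproduct_comp(6)[OF b, of f] assms by (simp add: comp_assoc)
qed

lemma divisible_cod:
  assumes b: "biproduct C A B S j1 j2 q1 q2" and "r \<in> carrier R" "f \<in> Ar C" "Cod C f = S"
    and "divisible r (q1 \<bullet> f)" "divisible r (q2 \<bullet> f)"
  shows "divisible r f"
proof -
  note [simp] = biproduct_arr[OF b]
  have "divisible r (j1 \<bullet> (q1 \<bullet> f))" "divisible r (j2 \<bullet> (q2 \<bullet> f))"
    using assms(2-6) by (auto intro!: divisible_comp(1))
  then have "divisible r (j1 \<bullet> (q1 \<bullet> f) \<boxplus> j2 \<bullet> (q2 \<bullet> f))"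
    using assms(2-4) by (intro divisible_plus) auto
  then show ?thesis using biproduct_comp(5)[OF b, of f] assms by simp
qed

end

text \<open>
  The category of finitely generated free modules over a local ring \<open>R\<close> with maximal ideal
  \<open>(p) \<noteq> 0\<close> of square zero, as far as it matters; \<open>U\<close> stands for the module \<open>R\<close>.
\<close>

locale length_two_category = linear_category C R sm
  for C :: "('o, 'a) precategory" (structure) and R :: "('r, 'x) ring_scheme"
    and sm :: "'r \<Rightarrow> 'a \<Rightarrow> 'a" (infixr \<open>\<star>\<close> 75) +
  fixes U :: 'o and p :: 'r
  assumes U_Ob: "U \<in> Ob C"
    and End_U: "f \<in> Hom C U U \<Longrightarrow> \<exists>r \<in> carrier R. f = r \<star> Ident C U"
    and End_U_faithful: "\<lbrakk>r \<in> carrier R; r \<star> Ident C U = Null C U U\<rbrakk> \<Longrightarrow> r = \<zero>\<^bsub>R\<^esub>"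
    and free: "A \<in> Ob C \<Longrightarrow> \<exists>k. free_of_rank C U k A"
    and p_closed [simp]: "p \<in> carrier R"
    and p_square: "p \<otimes>\<^bsub>R\<^esub> p = \<zero>\<^bsub>R\<^esub>"
    and p_nonzero: "p \<noteq> \<zero>\<^bsub>R\<^esub>"
    and unit_or_p: "r \<in> carrier R \<Longrightarrow> r \<in> Units R \<or> (\<exists>s \<in> carrier R. r = p \<otimes>\<^bsub>R\<^esub> s)"
begin

lemma p_p [simp]: "f \<in> Ar C \<Longrightarrow> p \<star> p \<star> f = Null C (Dom C f) (Cod C f)"
  by (simp add: mult_sm p_square)

lemma p_r_p [simp]: "f \<in> Ar C \<Longrightarrow> r \<in> carrier R \<Longrightarrow> p \<star> r \<star> p \<star> f = Null C (Dom C f) (Cod C f)"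
  using sm_left_comm[of p r "p \<star> f"] by simp

lemma U_simps [simp]: "U \<in> Ob C" by (rule U_Ob)

lemma U_unit_or_divisible:
  assumes "f \<in> Hom C U U"
  shows "divisible p f \<or> (\<exists>r \<in> Units R. f = r \<star> Ident C U)"
proof -
  obtain r where r: "r \<in> carrier R" "f = r \<star> Ident C U" using End_U assms by blast
  show ?thesis using unit_or_p[OF r(1)]
  proof
    assume "\<exists>s \<in> carrier R. r = p \<otimes>\<^bsub>R\<^esub> s"
    then obtain s where "s \<in> carrier R" "f = p \<star> (s \<star> Ident C U)" using r by (auto simp: mult_sm)
    then show ?thesis by (auto intro!: divisibleI)
  qed (use r in blast)
qed

text \<open>
  The matrix entries of \<open>f\<close> are scalars. If none of them is a unit they are all multiples of \<open>p\<close>,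
  and a unit entry becomes the identity after rescaling.
\<close>

lemma divisible_or_entry:
  assumes "f \<in> Hom C A B"
  shows "divisible p f \<or> (\<exists>e \<in> Hom C U A. \<exists>g \<in> Hom C B U. g \<bullet> (f \<bullet> e) = Ident C U)"
proof -
  have UB: "divisible p f \<or> (\<exists>g \<in> Hom C B U. g \<bullet> f = Ident C U)"
    if fr: "free_of_rank C U k B" and "f \<in> Hom C U B" for f B k
    using that
  proof (induction arbitrary: f)
    case (zero Z)
    then have "f = Null C U Z" "Z \<in> Ob C" using zero_object_Hom(1) zero_objectD(1) by blast+
    then show ?case by (simp add: divisible_null)
  next
    case (add k A S j1 j2 q1 q2)
    note b = add.hyps(2)
    note [simp] = biproduct_arr[OF b]
    note f = add.prems[unfolded in_Hom]
    consider "divisible p (q1 \<bullet> f)" "divisible p (q2 \<bullet> f)"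
      | r where "r \<in> Units R" "q1 \<bullet> f = r \<star> Ident C U"
      | g where "g \<in> Hom C A U" "g \<bullet> (q2 \<bullet> f) = Ident C U"
      using U_unit_or_divisible[of "q1 \<bullet> f"] add.IH[of "q2 \<bullet> f"] f by (auto simp: in_Hom)
    then show ?case
    proof cases
      case 1
      then show ?thesis using divisible_cod[OF b, of p f] f by simp
    next
      case 2
      have "(inv\<^bsub>R\<^esub> r \<star> q1) \<bullet> f = Ident C U" using 2 f by (simp add: sm_comp unit_sm_cancel)
      moreover have "inv\<^bsub>R\<^esub> r \<star> q1 \<in> Hom C S U" using 2 by (simp add: in_Hom)
      ultimately show ?thesis by blast
    next
      case 3
      have "(g \<bullet> q2) \<bullet> f = Ident C U" using 3 f by (simp add: in_Hom comp_assoc)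
      moreover have "g \<bullet> q2 \<in> Hom C S U" using 3 by (simp add: in_Hom)
      ultimately show ?thesis by blast
    qed
  qed
  have AB: "divisible p f \<or> (\<exists>e \<in> Hom C U A. \<exists>g \<in> Hom C B U. g \<bullet> (f \<bullet> e) = Ident C U)"
    if fr: "free_of_rank C U k A" and "f \<in> Hom C A B" for f A B k
    using that
  proof (induction arbitrary: f)
    case (zero Z)
    then have "f = Null C Z B" "Z \<in> Ob C" "B \<in> Ob C"
      using zero_object_Hom(2) Hom_Ob by blast+
    then show ?case by (simp add: divisible_null)
  next
    case (add k A S j1 j2 q1 q2)
    note b = add.hyps(2)
    note [simp] = biproduct_arr[OF b]
    note f = add.prems[unfolded in_Hom]
    obtain l where "free_of_rank C U l B" using free f by (metis arr_Ob(2))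
    then consider "divisible p (f \<bullet> j1)" "divisible p (f \<bullet> j2)"
      | g where "g \<in> Hom C B U" "g \<bullet> (f \<bullet> j1) = Ident C U"
      | e g where "e \<in> Hom C U A" "g \<in> Hom C B U" "g \<bullet> (f \<bullet> j2 \<bullet> e) = Ident C U"
      using UB[of l B "f \<bullet> j1"] add.IH[of "f \<bullet> j2"] f by (auto simp: in_Hom)
    then show ?case
    proof cases
      case 1
      then show ?thesis using divisible_dom[OF b, of p f] f by simp
    next
      case 2
      then show ?thesis using f by (metis in_Hom biproduct_arr(1,5,9)[OF b])
    next
      case 3
      then have "g \<bullet> (f \<bullet> (j2 \<bullet> e)) = Ident C U" "j2 \<bullet> e \<in> Hom C U S"
        using f by (simp_all add: in_Hom comp_assoc)
      then show ?thesis using 3 by blast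
    qed
  qed
  show ?thesis using AB[OF _ assms] free Hom_Ob[OF assms] by blast
qed

text \<open>A unit entry of \<open>f\<close> would give \<open>p 1 = 0\<close> on \<open>U\<close>.\<close>

lemma p_annihilator:
  assumes f: "f \<in> Ar C" and 0: "p \<star> f = Null C (Dom C f) (Cod C f)"
  shows "divisible p f"
proof (rule ccontr)
  assume "\<not> divisible p f"
  then obtain e g where eg: "e \<in> Hom C U (Dom C f)" "g \<in> Hom C (Cod C f) U" "g \<bullet> (f \<bullet> e) = Ident C U"
    using divisible_or_entry[of f "Dom C f" "Cod C f"] f by (auto simp: in_Hom)
  have "p \<star> Ident C U = g \<bullet> (p \<star> f \<bullet> e)" using f eg by (simp add: in_Hom sm_comp)
  also have "\<dots> = Null C U U" using eg f by (simp add: 0 in_Hom)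
  finally show False using End_U_faithful[of p] p_nonzero by simp
qed

lemma p_annihilatorE:
  assumes "f \<in> Ar C" "p \<star> f = Null C (Dom C f) (Cod C f)"
  obtains g where "g \<in> Ar C" "Dom C g = Dom C f" "Cod C g = Cod C f" "f = p \<star> g"
  using p_annihilator[OF assms] by (rule divisibleE) (use that in blast)

lemma p_cancel:
  assumes "f \<in> Ar C" "g \<in> Ar C" "Dom C f = Dom C g" "Cod C f = Cod C g" "p \<star> f = p \<star> g"
  obtains h where "h \<in> Ar C" "Dom C h = Dom C f" "Cod C h = Cod C f" "f = g \<boxplus> p \<star> h"
proof -
  have a: "Neg C g \<boxplus> f \<in> Ar C" using assms(1-4) by simp
  have "p \<star> (Neg C g \<boxplus> f) = Neg C (p \<star> g) \<boxplus> p \<star> f" using assms(1-4) by (simp add: sm_plus sm_neg)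
  also have "\<dots> = Null C (Dom C (Neg C g \<boxplus> f)) (Cod C (Neg C g \<boxplus> f))"
    unfolding assms(5) using assms(1-4) by simp
  finally obtain h where h: "h \<in> Ar C" "Dom C h = Dom C (Neg C g \<boxplus> f)" "Cod C h = Cod C (Neg C g \<boxplus> f)"
    "Neg C g \<boxplus> f = p \<star> h"
    by (rule p_annihilatorE[OF a])
  have "f = g \<boxplus> (Neg C g \<boxplus> f)" using assms by (intro neg_plus_cancel(2)[symmetric]) simp_all
  then have "f = g \<boxplus> p \<star> h" by (simp only: h(4))
  then show ?thesis using that[OF h(1)] h(2,3) assms(1-4) by simp
qed

text \<open>
  If the component of \<open>g\<close> on a summand \<open>U\<close> of \<open>A\<close> is a unit, the kernel of \<open>g\<close> is a copy of the
  complement of that summand. Otherwise, \<open>R\<close> being local, the complement contributes a unit to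
  \<open>g e = 1\<close>, and the copy of \<open>U\<close> can be split off inside it.
\<close>

lemma split_U:
  assumes "free_of_rank C U k A" "e \<in> Hom C U A" "g \<in> Hom C A U" "g \<bullet> e = Ident C U"
  shows "\<exists>l A' j q. l < k \<and> free_of_rank C U l A' \<and> biproduct C U A' A e j g q"
  using assms
proof (induction arbitrary: e g)
  case (zero Z)
  have "e = Null C U Z" "Z \<in> Ob C" using zero zero_object_Hom(1) zero_objectD(1) by blast+
  then have "Null C U U = Ident C U" using zero(2-4) by (auto simp: in_Hom)
  then have "\<one>\<^bsub>R\<^esub> \<star> Ident C U = Null C U U" by simp
  then have "\<one>\<^bsub>R\<^esub> = \<zero>\<^bsub>R\<^esub>" using End_U_faithful[of "\<one>\<^bsub>R\<^esub>"] by simp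
  then show ?case using p_nonzero p_closed by (metis l_one l_null)
next
  case (add k A S j1 j2 q1 q2)
  have A: "A \<in> Ob C" using biproduct_Ob[OF add.hyps(2)] by simp
  \<comment> \<open>If the component of \<open>g\<close> on the summand \<open>U\<close> is invertible, \<open>ker g\<close> is a copy of \<open>A\<close>.\<close>
  have exchange: "\<exists>j q. biproduct C U A' S e j g q"
    if b: "biproduct C U A' S i1 i2 r1 r2" and r: "r \<in> Units R" "g \<bullet> i1 = r \<star> Ident C U" for A' i1 i2 r1 r2 r
  proof -
    note [simp] = biproduct_simps[OF b] add.prems[unfolded in_Hom] r
    let ?s = "inv\<^bsub>R\<^esub> r"
    have s: "?s \<in> carrier R" "r \<in> carrier R" using r by (auto simp: Units_closed)
    note [simp] = s
    let ?j = "i2 \<boxplus> Neg C (?s \<star> (i1 \<bullet> (g \<bullet> i2)))"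
    define t where "t = Ident C S \<boxplus> Neg C (e \<bullet> g)"
    have [simp]: "S \<in> Ob C" using biproduct_Ob[OF b] by blast
    have t [simp]: "t \<in> Ar C" "Dom C t = S" "Cod C t = S" by (simp_all add: t_def)
    have g1: "g \<bullet> (i1 \<bullet> x) = r \<star> x" if "x \<in> Ar C" "Cod C x = U" for x
      using that comp_rewrite[of g i1 "r \<star> Ident C U" x] by (simp add: sm_comp)
    have ge: "g \<bullet> (e \<bullet> x) = x" if "x \<in> Ar C" "Cod C x = U" for x
      using that comp_rewrite[of g e "Ident C U" x] by simp
    have gt: "g \<bullet> t = Null C S U" and te: "t \<bullet> e = Null C U S"
      by (simp_all add: t_def arrow_simps ge)
    have gj: "g \<bullet> ?j = Null C A' U" by (simp add: linear_simps g1 unit_sm_cancel)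
    have tj: "t \<bullet> ?j = ?j"
    proof -
      have "t \<bullet> ?j = Ident C S \<bullet> ?j \<boxplus> Neg C (e \<bullet> (g \<bullet> ?j))"
        unfolding t_def by (subst plus_comp) (simp_all add: neg_comp comp_assoc del: ident_comp)
      also have "\<dots> = ?j" by (simp add: gj)
      finally show ?thesis .
    qed
    have r2j: "r2 \<bullet> ?j = Ident C A'" by (simp add: linear_simps)
    have jrt: "?j \<bullet> (r2 \<bullet> t) = t"
    proof -
      have 1: "i1 \<bullet> (r1 \<bullet> t) \<boxplus> i2 \<bullet> (r2 \<bullet> t) = t" by simp
      have "g \<bullet> (i1 \<bullet> (r1 \<bullet> t) \<boxplus> i2 \<bullet> (r2 \<bullet> t)) = Null C S U" unfolding 1 by (rule gt)
      then have "r \<star> (r1 \<bullet> t) \<boxplus> g \<bullet> (i2 \<bullet> (r2 \<bullet> t)) = Null C S U"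
        by (subst (asm) comp_plus) (simp_all add: g1)
      then have "Neg C (r \<star> (r1 \<bullet> t)) = g \<bullet> (i2 \<bullet> (r2 \<bullet> t))"
        by (intro neg_unique) simp_all
      then have "?s \<star> (g \<bullet> (i2 \<bullet> (r2 \<bullet> t))) = ?s \<star> Neg C (r \<star> (r1 \<bullet> t))" by (simp only:)
      also have "\<dots> = Neg C (r1 \<bullet> t)" by (simp add: sm_neg unit_sm_cancel)
      finally have 2: "?s \<star> (g \<bullet> (i2 \<bullet> (r2 \<bullet> t))) = Neg C (r1 \<bullet> t)" .
      have "?j \<bullet> (r2 \<bullet> t) = i2 \<bullet> (r2 \<bullet> t) \<boxplus> Neg C (i1 \<bullet> (?s \<star> (g \<bullet> (i2 \<bullet> (r2 \<bullet> t)))))"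
        by (simp add: linear_simps)
      also have "\<dots> = i1 \<bullet> (r1 \<bullet> t) \<boxplus> i2 \<bullet> (r2 \<bullet> t)"
        unfolding 2 by (simp add: neg_comp plus_comm[of "i2 \<bullet> (r2 \<bullet> t)"])
      finally show ?thesis unfolding 1 .
    qed
    have "biproduct C U A' S e ?j g (r2 \<bullet> t)"
    proof (rule biproductI)
      have "r2 \<bullet> (t \<bullet> ?j) = Ident C A'" unfolding tj by (rule r2j)
      then show "r2 \<bullet> t \<bullet> ?j = Ident C A'" by (subst comp_assoc) simp_all
      show "r2 \<bullet> t \<bullet> e = Null C U A'" by (simp add: comp_assoc te)
      show "e \<bullet> g \<boxplus> ?j \<bullet> (r2 \<bullet> t) = Ident C S" unfolding jrt by (simp add: t_def plus_left_comm[of "e \<bullet> g"])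
    qed (simp_all add: in_Hom gj)
    then show ?thesis by blast
  qed
  note b = add.hyps(2)
  note e = add.prems(1)[unfolded in_Hom] and g = add.prems(2)[unfolded in_Hom]
  note [simp] = biproduct_simps[OF b] e g
  have sum: "(g \<bullet> j1) \<bullet> (q1 \<bullet> e) \<boxplus> (g \<bullet> j2) \<bullet> (q2 \<bullet> e) = Ident C U"
  proof -
    have 1: "j1 \<bullet> (q1 \<bullet> e) \<boxplus> j2 \<bullet> (q2 \<bullet> e) = e" by simp
    have "g \<bullet> (j1 \<bullet> (q1 \<bullet> e) \<boxplus> j2 \<bullet> (q2 \<bullet> e)) = Ident C U" unfolding 1 by (rule add.prems(3))
    then show ?thesis by (subst (asm) comp_plus) (simp_all add: comp_assoc)
  qed
  have not_div: "\<not> divisible p (Ident C U)"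
  proof
    assume "divisible p (Ident C U)"
    then obtain h where h: "h \<in> Ar C" "Dom C h = Dom C (Ident C U)" "Cod C h = Cod C (Ident C U)" "Ident C U = p \<star> h"
      by (rule divisibleE)
    from h(4) have "p \<star> Ident C U = p \<star> p \<star> h" by (rule arg_cong)
    then have "p \<star> Ident C U = Null C U U" using h(1-3) by simp
    then show False using End_U_faithful[of p] p_nonzero by simp
  qed
  consider r where "r \<in> Units R" "g \<bullet> j1 = r \<star> Ident C U"
    | r where "r \<in> Units R" "(g \<bullet> j2) \<bullet> (q2 \<bullet> e) = r \<star> Ident C U"
  proof -
    have "divisible p (Ident C U)" if "divisible p (g \<bullet> j1)" "divisible p ((g \<bullet> j2) \<bullet> (q2 \<bullet> e))"
    proof -
      have "divisible p ((g \<bullet> j1) \<bullet> (q1 \<bullet> e))" by (rule divisible_comp(2)[OF _ that(1)]) simp_all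
      then have "divisible p ((g \<bullet> j1) \<bullet> (q1 \<bullet> e) \<boxplus> (g \<bullet> j2) \<bullet> (q2 \<bullet> e))"
        by (rule divisible_plus[OF p_closed _ that(2)]) simp_all
      then show ?thesis unfolding sum .
    qed
    moreover have "g \<bullet> j1 \<in> Hom C U U" "(g \<bullet> j2) \<bullet> (q2 \<bullet> e) \<in> Hom C U U" by (simp_all add: in_Hom)
    ultimately show ?thesis using that U_unit_or_divisible not_div by blast
  qed
  then show ?case
  proof cases
    case 1
    then show ?thesis using exchange[OF b] add.hyps(1) by blast
  next
    case (2 r)
    have [simp]: "r \<in> carrier R" "inv\<^bsub>R\<^esub> r \<in> carrier R" using 2 by (auto simp: Units_closed)
    have "(inv\<^bsub>R\<^esub> r \<star> (g \<bullet> j2)) \<bullet> (q2 \<bullet> e) = inv\<^bsub>R\<^esub> r \<star> ((g \<bullet> j2) \<bullet> (q2 \<bullet> e))" by (rule sm_comp(1)) simp_all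
    also have "\<dots> = Ident C U" unfolding 2(2) using 2(1) by (simp add: unit_sm_cancel)
    finally obtain l A' j q where IH: "l < k" "free_of_rank C U l A'"
      "biproduct C U A' A (q2 \<bullet> e) j (inv\<^bsub>R\<^esub> r \<star> (g \<bullet> j2)) q"
      using add.IH[of "q2 \<bullet> e" "inv\<^bsub>R\<^esub> r \<star> (g \<bullet> j2)"] by (auto simp: in_Hom)
    obtain E l1 l2 s1 s2 where E: "biproduct C U A' E l1 l2 s1 s2"
      using ex_biproduct[of U A'] biproduct_Ob[OF IH(3)] by auto
    note b' = biproduct_swap[OF biproduct_assoc[OF b biproduct_swap[OF IH(3)] E]]
    have "g \<bullet> (j2 \<bullet> (q2 \<bullet> e)) = r \<star> Ident C U" using 2(2) by (simp add: comp_assoc)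
    then obtain j q where "biproduct C U E S e j g q" using exchange[OF b' 2(1)] by blast
    moreover have "free_of_rank C U (Suc l) E" using free_of_rank.add[OF IH(2) E] .
    ultimately show ?thesis using IH(1) Suc_less_eq by blast
  qed
qed

lemma object_induct [consumes 1, case_names zero add]:
  assumes "A \<in> Ob C"
    and "\<And>Z. zero_object C Z \<Longrightarrow> P Z"
    and "\<And>A S j1 j2 q1 q2. P A \<Longrightarrow> biproduct C U A S j1 j2 q1 q2 \<Longrightarrow> P S"
  shows "P A"
proof -
  obtain k where "free_of_rank C U k A" using free assms(1) by blast
  then show ?thesis by induction (use assms in blast)+
qed

text \<open>
  Gaussian elimination: a unit entry of \<open>f\<close> splits off an identity of \<open>U\<close>, which lowers the ranks;
  without unit entries \<open>f\<close> is divisible by \<open>p\<close>.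
\<close>

lemma arrow_induct [consumes 1, case_names divisible sum]:
  assumes "f \<in> Ar C"
    and div: "\<And>g. g \<in> Ar C \<Longrightarrow> P (p \<star> g)"
    and sum: "\<And>f g A B S T j1 j2 q1 q2 i1 i2 r1 r2.
      \<lbrakk>f \<in> Hom C S T; g \<in> Hom C A B; P g; biproduct C U A S j1 j2 q1 q2; biproduct C U B T i1 i2 r1 r2;
       f = i1 \<bullet> q1 \<boxplus> i2 \<bullet> (g \<bullet> q2)\<rbrakk> \<Longrightarrow> P f"
  shows "P f"
proof -
  obtain k where "free_of_rank C U k (Dom C f)" using free[of "Dom C f"] assms(1) by auto
  then show ?thesis using \<open>f \<in> Ar C\<close>
  proof (induction k arbitrary: f rule: less_induct)
    case (less k)
    show ?case
    proof (cases "divisible p f")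
      case True
      then show ?thesis using div less.prems by (auto elim: divisibleE)
    next
      case False
      then obtain e g where eg: "e \<in> Hom C U (Dom C f)" "g \<in> Hom C (Cod C f) U" "g \<bullet> (f \<bullet> e) = Ident C U"
        using divisible_or_entry[of f "Dom C f" "Cod C f"] less.prems by (auto simp: in_Hom)
      note [simp] = eg(1,2)[unfolded in_Hom] less.prems(2)
      have fe: "f \<bullet> e \<in> Hom C U (Cod C f)" "g \<bullet> f \<in> Hom C (Dom C f) U" by (simp_all add: in_Hom)
      have gfe: "(g \<bullet> f) \<bullet> e = Ident C U" using eg by (simp add: comp_assoc)
      obtain l A j q where A: "l < k" "free_of_rank C U l A" "biproduct C U A (Dom C f) e j (g \<bullet> f) q"
        using split_U[OF less.prems(1) eg(1) fe(2) gfe] by blast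
      obtain k' where "free_of_rank C U k' (Cod C f)" using free[of "Cod C f"] by auto
      then obtain B i r where B: "biproduct C U B (Cod C f) (f \<bullet> e) i g r"
        using split_U[OF _ fe(1) eg(2) eg(3)] by blast
      note [simp] = biproduct_simps[OF A(3)] biproduct_simps[OF B]
      let ?h = "r \<bullet> (f \<bullet> j)"
      have "P ?h" using less.IH[OF A(1), of ?h] A(2) by simp
      moreover have "f = (f \<bullet> e) \<bullet> (g \<bullet> f) \<boxplus> i \<bullet> (?h \<bullet> q)"
      proof -
        \<comment> \<open>The complement of \<open>e\<close> is the kernel of \<open>g f\<close>, so \<open>f\<close> maps it into the complement of \<open>f e\<close>.\<close>
        have "g \<bullet> (f \<bullet> j) = Null C A U" by (subst comp_assoc[symmetric]) simp_all
        then have "f \<bullet> j = i \<bullet> ?h" using biproduct_comp(5)[OF B, of "f \<bullet> j"] by (simp add: comp_assoc)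
        then have "(f \<bullet> j) \<bullet> q = (i \<bullet> ?h) \<bullet> q" by (rule arg_cong)
        then have "f \<bullet> (j \<bullet> q) = i \<bullet> (?h \<bullet> q)" by (simp add: comp_assoc)
        then show ?thesis using biproduct_comp(6)[OF A(3), of f] by (simp add: comp_assoc)
      qed
      ultimately show ?thesis using sum[OF _ _ _ A(3) B, of f ?h] by (auto simp: in_Hom)
    qed
  qed
qed

text \<open>Modulo \<open>p\<close> this is the von Neumann quasi-inverse of a linear map between vector spaces.\<close>

lemma quasi_inverse:
  assumes "f \<in> Ar C"
  shows "\<exists>g \<in> Hom C (Cod C f) (Dom C f). \<exists>h \<in> Hom C (Dom C f) (Cod C f). f = f \<bullet> (g \<bullet> f) \<boxplus> p \<star> h"
  using assms
proof (induction rule: arrow_induct)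
  case (divisible g)
  have "p \<star> g = p \<star> g \<bullet> (Null C (Cod C g) (Dom C g) \<bullet> p \<star> g) \<boxplus> p \<star> g" using divisible by simp
  moreover have "Null C (Cod C g) (Dom C g) \<in> Hom C (Cod C g) (Dom C g)" "g \<in> Hom C (Dom C (p \<star> g)) (Cod C (p \<star> g))"
    using divisible by (simp_all add: in_Hom)
  ultimately show ?case using divisible by (intro bexI) simp_all
next
  case (sum f f' A B S T j1 j2 q1 q2 i1 i2 r1 r2)
  note [simp] = biproduct_simps[OF sum.hyps(3)] biproduct_simps[OF sum.hyps(4)] sum.hyps(1,2)[unfolded in_Hom]
  obtain g h where g: "g \<in> Hom C B A" "h \<in> Hom C A B" and eq: "f' = f' \<bullet> (g \<bullet> f') \<boxplus> p \<star> h"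
    using sum.IH by (auto simp: in_Hom)
  note [simp] = g[unfolded in_Hom]
  let ?g = "j1 \<bullet> r1 \<boxplus> j2 \<bullet> (g \<bullet> r2)" and ?h = "i2 \<bullet> (h \<bullet> q2)"
  have "f' \<bullet> q2 = (f' \<bullet> (g \<bullet> f') \<boxplus> p \<star> h) \<bullet> q2" using eq by (rule arg_cong)
  then have 1: "f' \<bullet> q2 = f' \<bullet> (g \<bullet> (f' \<bullet> q2)) \<boxplus> p \<star> (h \<bullet> q2)" by (simp add: linear_simps)
  have "i2 \<bullet> (f' \<bullet> q2) = i2 \<bullet> (f' \<bullet> (g \<bullet> (f' \<bullet> q2)) \<boxplus> p \<star> (h \<bullet> q2))" using 1 by (rule arg_cong)
  then have 2: "i2 \<bullet> (f' \<bullet> q2) = i2 \<bullet> (f' \<bullet> (g \<bullet> (f' \<bullet> q2))) \<boxplus> p \<star> ?h" by (simp add: linear_simps)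
  have "f \<bullet> (?g \<bullet> f) \<boxplus> p \<star> ?h = i1 \<bullet> q1 \<boxplus> (i2 \<bullet> (f' \<bullet> (g \<bullet> (f' \<bullet> q2))) \<boxplus> p \<star> ?h)"
    unfolding sum.hyps(5) by (simp add: linear_simps plus_assoc)
  also have "\<dots> = f" unfolding 2[symmetric] by (rule sum.hyps(5)[symmetric])
  finally have "f = f \<bullet> (?g \<bullet> f) \<boxplus> p \<star> ?h" by (rule sym)
  moreover have "?g \<in> Hom C T S" "?h \<in> Hom C S T" by (simp_all add: in_Hom)
  ultimately show ?case by auto
qed

text \<open>If \<open>f g = 1 - p z\<close> then \<open>g (1 + p z)\<close> is a right inverse of \<open>f\<close>, since \<open>p\<^sup>2 = 0\<close>.\<close>

lemma right_inverse_mod_p: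
  assumes "f \<in> Hom C A B" "g \<in> Hom C B A" "p \<star> (f \<bullet> g) = p \<star> Ident C B"
  shows "\<exists>h \<in> Hom C B A. f \<bullet> h = Ident C B"
proof -
  note [simp] = assms(1,2)[unfolded in_Hom]
  have B [simp]: "B \<in> Ob C" using Hom_Ob[OF assms(1)] by simp
  obtain z where z: "z \<in> Ar C" "Dom C z = Dom C (f \<bullet> g)" "Cod C z = Cod C (f \<bullet> g)" "f \<bullet> g = Ident C B \<boxplus> p \<star> z"
    by (rule p_cancel[OF _ _ _ _ assms(3)]) simp_all
  from z(1-3) have [simp]: "z \<in> Ar C" "Dom C z = B" "Cod C z = B" by simp_all
  let ?w = "Ident C B \<boxplus> Neg C (p \<star> z)"
  have "f \<bullet> (g \<bullet> ?w) = (f \<bullet> g) \<bullet> ?w" by (subst comp_assoc) simp_all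
  also have "\<dots> = Ident C B" unfolding z(4) by (simp add: linear_simps plus_assoc)
  finally show ?thesis by (intro bexI[of _ "g \<bullet> ?w"]) (simp_all add: in_Hom)
qed

lemma left_inverse_mod_p:
  assumes "f \<in> Hom C A B" "g \<in> Hom C B A" "p \<star> (g \<bullet> f) = p \<star> Ident C A"
  shows "\<exists>h \<in> Hom C B A. h \<bullet> f = Ident C A"
proof -
  note [simp] = assms(1,2)[unfolded in_Hom]
  have A [simp]: "A \<in> Ob C" using Hom_Ob[OF assms(1)] by simp
  obtain z where z: "z \<in> Ar C" "Dom C z = Dom C (g \<bullet> f)" "Cod C z = Cod C (g \<bullet> f)" "g \<bullet> f = Ident C A \<boxplus> p \<star> z"
    by (rule p_cancel[OF _ _ _ _ assms(3)]) simp_all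
  from z(1-3) have [simp]: "z \<in> Ar C" "Dom C z = A" "Cod C z = A" by simp_all
  let ?w = "Ident C A \<boxplus> Neg C (p \<star> z)"
  have "(?w \<bullet> g) \<bullet> f = ?w \<bullet> (g \<bullet> f)" by (subst comp_assoc) simp_all
  also have "\<dots> = Ident C A" unfolding z(4) by (simp add: linear_simps plus_assoc)
  finally show ?thesis by (intro bexI[of _ "?w \<bullet> g"]) (simp_all add: in_Hom)
qed

lemma iso_arrowI:
  assumes "f \<in> Hom C A B" "g \<in> Hom C B A" "h \<in> Hom C B A" "f \<bullet> g = Ident C B" "h \<bullet> f = Ident C A"
  shows "iso_arrow C f"
proof -
  note [simp] = assms(1-3)[unfolded in_Hom]
  have "h = h \<bullet> (f \<bullet> g)" using assms(4) by simp
  also have "\<dots> = g" using assms(5) comp_assoc[of g f h] by simp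
  finally have "g \<bullet> f = Ident C A" using assms(5) by simp
  then show ?thesis using assms(4) unfolding iso_arrow_def by (auto intro!: bexI[of _ g] simp: in_Hom)
qed

end

section \<open>Cyclic sequences of arrows\<close>

lemma identity_functor_simps [simp]: "OMap identity_functor A = A" "AMap identity_functor f = f"
  by (simp_all add: identity_functor_def)

locale cyclic_sequences = length_two_category C R sm U p
  for C :: "('o, 'a) precategory" (structure) and R :: "('r, 'x) ring_scheme"
    and sm :: "'r \<Rightarrow> 'a \<Rightarrow> 'a" (infixr \<open>\<star>\<close> 75) and U :: 'o and p :: 'r +
  fixes n :: nat
  assumes n_ge_3: "3 \<le> n"
begin

sublocale sigma_sequences C identity_functor n .

text \<open>For the identity functor a sequence is cyclic; \<open>nx\<close> is the successor in the cyclic order.\<close>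

definition I :: "nat set" where "I = {1..n}"

definition nx :: "nat \<Rightarrow> nat" where "nx i = (if i = n then 1 else Suc i)"

lemma nx_I [simp]: "i \<in> I \<Longrightarrow> nx i \<in> I"
  using n_ge_3 by (auto simp: I_def nx_def)

lemma I_simps [simp]: "Suc 0 \<in> I" "1 \<in> I" "n \<in> I" "2 \<in> I" "3 \<in> I" "nx n = 1" "n - Suc 0 \<in> I" "nx (n - Suc 0) = n" "Suc (Suc 0) \<in> I"
  using n_ge_3 by (auto simp: I_def nx_def)

lemma Suc_I [simp]: "i \<in> I \<Longrightarrow> i < n \<Longrightarrow> Suc i \<in> I"
  by (auto simp: I_def)

lemma nx_Suc [simp]: "i < n \<Longrightarrow> nx i = Suc i" "nx (Suc 0) = 2" "nx 2 = 3"
  using n_ge_3 by (auto simp: nx_def)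

lemma I_less: "i \<in> I \<Longrightarrow> i = n \<or> i < n" by (auto simp: I_def)

lemma nx_inj: "i \<in> I \<Longrightarrow> k \<in> I \<Longrightarrow> nx i = nx k \<longleftrightarrow> i = k"
  using n_ge_3 by (auto simp: I_def nx_def split: if_splits)

lemma nx_surj: "i \<in> I \<Longrightarrow> \<exists>k \<in> I. nx k = i"
proof -
  assume "i \<in> I"
  then show ?thesis using n_ge_3
    by (intro bexI[of _ "if i = 1 then n else i - 1"]) (auto simp: I_def nx_def)
qed

lemma nx_neq: "i \<in> I \<Longrightarrow> nx i \<noteq> i" "i \<in> I \<Longrightarrow> nx (nx i) \<noteq> i"
  using n_ge_3 by (auto simp: I_def nx_def split: if_splits)

lemma prolong_nx: "i \<in> I \<Longrightarrow> prolong \<alpha> (Suc i) = \<alpha> (nx i)"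
  by (auto simp: prolong_def nx_def I_def)

lemma prolong_I: "i \<in> I \<Longrightarrow> prolong \<alpha> i = \<alpha> i"
  by (auto simp: prolong_def I_def)

lemma vertex_nx: "i \<in> I \<Longrightarrow> vertex \<alpha> (Suc i) = Dom C (\<alpha> (nx i))"
  unfolding vertex_def by (simp only: prolong_nx)

lemma vertex_I: "i \<in> I \<Longrightarrow> vertex \<alpha> i = Dom C (\<alpha> i)"
  unfolding vertex_def by (simp only: prolong_I)

lemma sequences_iff:
  "\<alpha> \<in> sequences \<longleftrightarrow> \<alpha> \<in> extensional I \<and> (\<forall>i \<in> I. \<alpha> i \<in> Ar C \<and> Cod C (\<alpha> i) = Dom C (\<alpha> (nx i)))"
  unfolding sequences_def I_def[symmetric] by (auto simp: PiE_iff vertex_nx)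

lemma sequencesI:
  "\<lbrakk>\<And>i. i \<in> I \<Longrightarrow> \<alpha> i \<in> Ar C; \<And>i. i \<in> I \<Longrightarrow> Cod C (\<alpha> i) = Dom C (\<alpha> (nx i))\<rbrakk>
    \<Longrightarrow> restrict \<alpha> I \<in> sequences"
  by (simp add: sequences_iff)

lemma seq_arr:
  assumes "\<alpha> \<in> sequences" "i \<in> I"
  shows "\<alpha> i \<in> Ar C" "Cod C (\<alpha> i) = Dom C (\<alpha> (nx i))"
  using assms by (auto simp: sequences_iff)

lemma sequences_eqI:
  "\<lbrakk>\<alpha> \<in> sequences; \<beta> \<in> sequences; \<And>i. i \<in> I \<Longrightarrow> \<alpha> i = \<beta> i\<rbrakk> \<Longrightarrow> \<alpha> = \<beta>"
  unfolding sequences_iff by (rule extensionalityI) auto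

lemma seq_morphism_iff:
  "seq_morphism \<alpha> \<beta> \<phi> \<longleftrightarrow>
    (\<forall>i \<in> I. \<phi> i \<in> Hom C (Dom C (\<alpha> i)) (Dom C (\<beta> i)) \<and> \<phi> (nx i) \<bullet> \<alpha> i = \<beta> i \<bullet> \<phi> i)"
  unfolding seq_morphism_def I_def[symmetric] by (auto simp: prolong_nx vertex_I)

lemma candidate_iff:
  "candidate_angle \<alpha> \<longleftrightarrow> \<alpha> \<in> sequences \<and>
    (\<forall>i \<in> I. \<alpha> (nx i) \<bullet> \<alpha> i = Null C (Dom C (\<alpha> i)) (Dom C (\<alpha> (nx (nx i)))))"
  unfolding candidate_angle_def I_def[symmetric] by (auto simp: prolong_nx seq_arr)

definition contraction :: "(nat \<Rightarrow> 'a) \<Rightarrow> (nat \<Rightarrow> 'a) \<Rightarrow> bool" where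
  "contraction \<alpha> \<Theta> \<longleftrightarrow> (\<forall>i \<in> I. \<Theta> i \<in> Hom C (Dom C (\<alpha> (nx i))) (Dom C (\<alpha> i)) \<and>
     \<Theta> (nx i) \<bullet> \<alpha> (nx i) \<boxplus> \<alpha> i \<bullet> \<Theta> i = Ident C (Dom C (\<alpha> (nx i))))"

lemma contractible_iff: "contractible \<alpha> \<longleftrightarrow> \<alpha> \<in> sequences \<and> (\<exists>\<Theta>. contraction \<alpha> \<Theta>)"
proof -
  have "(\<forall>i \<in> {2..n}. Ident C (vertex \<alpha> i) = \<Theta> i \<bullet> \<alpha> i \<boxplus> \<alpha> (i - 1) \<bullet> \<Theta> (i - 1)) \<and>
       Ident C (OMap identity_functor (vertex \<alpha> 1)) = AMap identity_functor (\<Theta> 1) \<bullet> AMap identity_functor (\<alpha> 1) \<boxplus> \<alpha> n \<bullet> \<Theta> n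
    \<longleftrightarrow> (\<forall>i \<in> I. \<Theta> (nx i) \<bullet> \<alpha> (nx i) \<boxplus> \<alpha> i \<bullet> \<Theta> i = Ident C (Dom C (\<alpha> (nx i))))" (is "?L \<longleftrightarrow> ?R") for \<Theta>
  proof
    assume L: ?L
    show ?R
    proof
      fix i assume i: "i \<in> I"
      show "\<Theta> (nx i) \<bullet> \<alpha> (nx i) \<boxplus> \<alpha> i \<bullet> \<Theta> i = Ident C (Dom C (\<alpha> (nx i)))"
      proof (cases "i = n")
        case True
        then show ?thesis using L by (simp add: vertex_I)
      next
        case False
        then have "Suc i \<in> {2..n}" "Suc i \<in> I" "i < n" using i by (auto simp: I_def)
        then show ?thesis using L by (fastforce simp: vertex_I)
      qed
    qed
  next
    assume R: ?R
    have "\<Theta> i \<bullet> \<alpha> i \<boxplus> \<alpha> (i - 1) \<bullet> \<Theta> (i - 1) = Ident C (vertex \<alpha> i)" if "i \<in> {2..n}" for i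
    proof -
      have "i - 1 \<in> I" "nx (i - 1) = i" "i \<in> I" using that by (auto simp: I_def nx_def)
      then show ?thesis using R[rule_format, of "i - 1"] by (simp add: vertex_I)
    qed
    then show ?L using R[rule_format, of n] by (simp add: vertex_I)
  qed
  then show ?thesis
    unfolding contractible_def contraction_def I_def[symmetric]
    by (auto simp: vertex_I vertex_nx)
qed

text \<open>
  The matrix form of a direct sum of sequences, expressed by the equations that make the inclusions
  and projections morphisms; these are what calculations rewrite with.
\<close>

definition splitting ::
    "(nat \<Rightarrow> 'a) \<Rightarrow> (nat \<Rightarrow> 'a) \<Rightarrow> (nat \<Rightarrow> 'a) \<Rightarrow> (nat \<Rightarrow> 'a) \<Rightarrow> (nat \<Rightarrow> 'a) \<Rightarrow> (nat \<Rightarrow> 'a) \<Rightarrow> (nat \<Rightarrow> 'a) \<Rightarrow> bool" where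
  "splitting \<alpha> \<beta> \<gamma> j1 j2 q1 q2 \<longleftrightarrow> (\<forall>i \<in> I.
     biproduct C (Dom C (\<alpha> i)) (Dom C (\<beta> i)) (Dom C (\<gamma> i)) (j1 i) (j2 i) (q1 i) (q2 i) \<and>
     \<gamma> i \<bullet> j1 i = j1 (nx i) \<bullet> \<alpha> i \<and> \<gamma> i \<bullet> j2 i = j2 (nx i) \<bullet> \<beta> i \<and>
     q1 (nx i) \<bullet> \<gamma> i = \<alpha> i \<bullet> q1 i \<and> q2 (nx i) \<bullet> \<gamma> i = \<beta> i \<bullet> q2 i)"

lemma splittingD:
  assumes "splitting \<alpha> \<beta> \<gamma> j1 j2 q1 q2" "i \<in> I"
  shows "biproduct C (Dom C (\<alpha> i)) (Dom C (\<beta> i)) (Dom C (\<gamma> i)) (j1 i) (j2 i) (q1 i) (q2 i)"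
    "\<gamma> i \<bullet> j1 i = j1 (nx i) \<bullet> \<alpha> i" "\<gamma> i \<bullet> j2 i = j2 (nx i) \<bullet> \<beta> i"
    "q1 (nx i) \<bullet> \<gamma> i = \<alpha> i \<bullet> q1 i" "q2 (nx i) \<bullet> \<gamma> i = \<beta> i \<bullet> q2 i"
  using assms by (auto simp: splitting_def)

lemma direct_sum_iff:
  "direct_sum_seq \<alpha> \<beta> \<gamma> \<longleftrightarrow> \<alpha> \<in> sequences \<and> \<beta> \<in> sequences \<and> \<gamma> \<in> sequences \<and>
     (\<exists>j1 j2 q1 q2. splitting \<alpha> \<beta> \<gamma> j1 j2 q1 q2)"
proof -
  have "(\<forall>i \<in> I.
        biproduct C (vertex \<alpha> i) (vertex \<beta> i) (vertex \<gamma> i) (j1 i) (j2 i) (q1 i) (q2 i) \<and>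
        \<gamma> i = prolong j1 (i + 1) \<bullet> \<alpha> i \<bullet> q1 i \<boxplus> prolong j2 (i + 1) \<bullet> \<beta> i \<bullet> q2 i) \<longleftrightarrow>
      splitting \<alpha> \<beta> \<gamma> j1 j2 q1 q2" (is "?L \<longleftrightarrow> ?R")
    if s: "\<alpha> \<in> sequences" "\<beta> \<in> sequences" "\<gamma> \<in> sequences" for j1 j2 q1 q2
  proof
    note [simp] = seq_arr[OF s(1)] seq_arr[OF s(2)] seq_arr[OF s(3)]
    assume L: ?L
    have b: "biproduct C (Dom C (\<alpha> i)) (Dom C (\<beta> i)) (Dom C (\<gamma> i)) (j1 i) (j2 i) (q1 i) (q2 i)" if "i \<in> I" for i
      using conjunct1[OF bspec[OF L that]] by (simp only: vertex_I[OF that])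
    show ?R unfolding splitting_def
    proof
      fix i assume i [simp]: "i \<in> I"
      note [simp] = biproduct_simps[OF b[OF i]] biproduct_simps[OF b[OF nx_I[OF i]]]
      have eq: "\<gamma> i = j1 (nx i) \<bullet> (\<alpha> i \<bullet> q1 i) \<boxplus> j2 (nx i) \<bullet> (\<beta> i \<bullet> q2 i)"
        using bspec[OF L i] by (simp add: prolong_nx comp_assoc)
      have "\<gamma> i \<bullet> j1 i = j1 (nx i) \<bullet> \<alpha> i" "\<gamma> i \<bullet> j2 i = j2 (nx i) \<bullet> \<beta> i"
        "q1 (nx i) \<bullet> \<gamma> i = \<alpha> i \<bullet> q1 i" "q2 (nx i) \<bullet> \<gamma> i = \<beta> i \<bullet> q2 i"
        by (subst eq, simp add: arrow_simps)+
      then show "biproduct C (Dom C (\<alpha> i)) (Dom C (\<beta> i)) (Dom C (\<gamma> i)) (j1 i) (j2 i) (q1 i) (q2 i) \<and>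
          \<gamma> i \<bullet> j1 i = j1 (nx i) \<bullet> \<alpha> i \<and> \<gamma> i \<bullet> j2 i = j2 (nx i) \<bullet> \<beta> i \<and>
          q1 (nx i) \<bullet> \<gamma> i = \<alpha> i \<bullet> q1 i \<and> q2 (nx i) \<bullet> \<gamma> i = \<beta> i \<bullet> q2 i"
        using b[OF i] by simp
    qed
  next
    assume R: ?R
    note [simp] = seq_arr[OF s(1)] seq_arr[OF s(2)] seq_arr[OF s(3)]
    show ?L
    proof
      fix i assume i [simp]: "i \<in> I"
      note s = splittingD[OF R i]
      note [simp] = biproduct_arr[OF s(1)] biproduct_arr[OF splittingD(1)[OF R nx_I[OF i]]]
      have "\<gamma> i = (\<gamma> i \<bullet> j1 i) \<bullet> q1 i \<boxplus> (\<gamma> i \<bullet> j2 i) \<bullet> q2 i"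
        using biproduct_comp(6)[OF s(1), of "\<gamma> i"] by (simp add: comp_assoc)
      also have "\<dots> = prolong j1 (i + 1) \<bullet> \<alpha> i \<bullet> q1 i \<boxplus> prolong j2 (i + 1) \<bullet> \<beta> i \<bullet> q2 i"
        unfolding s(2,3) by (simp add: prolong_nx)
      finally show "biproduct C (vertex \<alpha> i) (vertex \<beta> i) (vertex \<gamma> i) (j1 i) (j2 i) (q1 i) (q2 i) \<and>
        \<gamma> i = prolong j1 (i + 1) \<bullet> \<alpha> i \<bullet> q1 i \<boxplus> prolong j2 (i + 1) \<bullet> \<beta> i \<bullet> q2 i"
        using s(1) by (simp only: vertex_I[OF i])
    qed
  qed
  then show ?thesis unfolding direct_sum_seq_def I_def[symmetric] by blast
qed

lemma direct_sumI:
  "\<lbrakk>\<alpha> \<in> sequences; \<beta> \<in> sequences; \<gamma> \<in> sequences; splitting \<alpha> \<beta> \<gamma> j1 j2 q1 q2\<rbrakk> \<Longrightarrow> direct_sum_seq \<alpha> \<beta> \<gamma>"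
  unfolding direct_sum_iff by blast

lemma direct_sumE:
  assumes "direct_sum_seq \<alpha> \<beta> \<gamma>"
  obtains j1 j2 q1 q2 where "\<alpha> \<in> sequences" "\<beta> \<in> sequences" "\<gamma> \<in> sequences" "splitting \<alpha> \<beta> \<gamma> j1 j2 q1 q2"
  using assms unfolding direct_sum_iff by blast

lemma splitting_swap: "splitting \<alpha> \<beta> \<gamma> j1 j2 q1 q2 \<Longrightarrow> splitting \<beta> \<alpha> \<gamma> j2 j1 q2 q1"
  by (auto simp: splitting_def intro: biproduct_swap)

lemma direct_sum_swap: "direct_sum_seq \<alpha> \<beta> \<gamma> \<Longrightarrow> direct_sum_seq \<beta> \<alpha> \<gamma>"
  by (auto elim!: direct_sumE intro: direct_sumI splitting_swap)

lemma direct_sum_over: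
  assumes s: "\<alpha> \<in> sequences" "\<beta> \<in> sequences"
    and b: "\<And>i. i \<in> I \<Longrightarrow> biproduct C (Dom C (\<alpha> i)) (Dom C (\<beta> i)) (S i) (j1 i) (j2 i) (q1 i) (q2 i)"
    and \<gamma>: "\<gamma> = restrict (\<lambda>i. j1 (nx i) \<bullet> (\<alpha> i \<bullet> q1 i) \<boxplus> j2 (nx i) \<bullet> (\<beta> i \<bullet> q2 i)) I"
  shows "\<gamma> \<in> sequences" "splitting \<alpha> \<beta> \<gamma> j1 j2 q1 q2" "i \<in> I \<Longrightarrow> Dom C (\<gamma> i) = S i"
proof -
  note [simp] = seq_arr[OF s(1)] seq_arr[OF s(2)]
  have eq: "\<gamma> i = j1 (nx i) \<bullet> (\<alpha> i \<bullet> q1 i) \<boxplus> j2 (nx i) \<bullet> (\<beta> i \<bullet> q2 i)" if "i \<in> I" for i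
    using that by (simp add: \<gamma>)
  have D: "\<gamma> i \<in> Ar C" "Dom C (\<gamma> i) = S i" "Cod C (\<gamma> i) = S (nx i)" if i [simp]: "i \<in> I" for i
  proof -
    note [simp] = biproduct_simps[OF b[OF i]] biproduct_simps[OF b[OF nx_I[OF i]]]
    show "\<gamma> i \<in> Ar C" "Dom C (\<gamma> i) = S i" "Cod C (\<gamma> i) = S (nx i)" by (simp_all add: eq)
  qed
  show "i \<in> I \<Longrightarrow> Dom C (\<gamma> i) = S i" by (rule D)
  show "\<gamma> \<in> sequences" using D by (simp add: sequences_iff) (simp add: \<gamma>)
  show "splitting \<alpha> \<beta> \<gamma> j1 j2 q1 q2" unfolding splitting_def
  proof
    fix i assume i [simp]: "i \<in> I"
    note [simp] = biproduct_simps[OF b[OF i]] biproduct_simps[OF b[OF nx_I[OF i]]]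
    show "biproduct C (Dom C (\<alpha> i)) (Dom C (\<beta> i)) (Dom C (\<gamma> i)) (j1 i) (j2 i) (q1 i) (q2 i) \<and>
          \<gamma> i \<bullet> j1 i = j1 (nx i) \<bullet> \<alpha> i \<and> \<gamma> i \<bullet> j2 i = j2 (nx i) \<bullet> \<beta> i \<and>
          q1 (nx i) \<bullet> \<gamma> i = \<alpha> i \<bullet> q1 i \<and> q2 (nx i) \<bullet> \<gamma> i = \<beta> i \<bullet> q2 i"
      using b[OF i] D[OF i] by (simp add: eq arrow_simps)
  qed
qed


section \<open>Exact sequences with a prescribed monodromy\<close>

text \<open>
  Each arrow is a weak kernel of its successor and a weak cokernel of its predecessor. Both
  conditions are what the extension of morphisms from and to discs provides.
\<close>

definition exact :: "(nat \<Rightarrow> 'a) \<Rightarrow> bool" where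
  "exact \<alpha> \<longleftrightarrow> candidate_angle \<alpha> \<and> (\<forall>i \<in> I.
     (\<forall>W. \<forall>x \<in> Hom C W (Dom C (\<alpha> (nx i))). \<alpha> (nx i) \<bullet> x = Null C W (Dom C (\<alpha> (nx (nx i)))) \<longrightarrow>
        (\<exists>y \<in> Hom C W (Dom C (\<alpha> i)). x = \<alpha> i \<bullet> y)) \<and>
     (\<forall>W. \<forall>x \<in> Hom C (Dom C (\<alpha> (nx i))) W. x \<bullet> \<alpha> i = Null C (Dom C (\<alpha> i)) W \<longrightarrow>
        (\<exists>y \<in> Hom C (Dom C (\<alpha> (nx (nx i)))) W. x = y \<bullet> \<alpha> (nx i))))"

text \<open>
  A family \<open>x\<close> as in the premise represents a (generalized) homology class of the sequence modulo
  \<open>p\<close> at position \<open>1\<close>, followed along the connecting maps up to position \<open>n\<close>. The conclusion says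
  that the next connecting map returns \<open>u\<close> times the class of \<open>x 1\<close>: the two differ by a boundary
  \<open>\<alpha> n \<bullet> y\<close> and a multiple of \<open>p\<close>, which is lost on multiplication with \<open>p\<close>.
\<close>

definition monodromy :: "'r \<Rightarrow> (nat \<Rightarrow> 'a) \<Rightarrow> bool" where
  "monodromy u \<alpha> \<longleftrightarrow> (\<forall>W x. (\<forall>i \<in> I. x i \<in> Hom C W (Dom C (\<alpha> i))) \<and>
       (\<forall>i \<in> I. i < n \<longrightarrow> \<alpha> i \<bullet> x i = p \<star> x (Suc i)) \<longrightarrow>
     (\<exists>y \<in> Hom C W (Dom C (\<alpha> n)). \<alpha> n \<bullet> x n = p \<star> (u \<star> x 1 \<boxplus> \<alpha> n \<bullet> y)))"

definition angle :: "'r \<Rightarrow> (nat \<Rightarrow> 'a) \<Rightarrow> bool" where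
  "angle u \<alpha> \<longleftrightarrow> exact \<alpha> \<and> monodromy u \<alpha>"

lemma exactD:
  assumes "exact \<alpha>" "i \<in> I"
  shows "\<alpha> \<in> sequences" "\<alpha> (nx i) \<bullet> \<alpha> i = Null C (Dom C (\<alpha> i)) (Dom C (\<alpha> (nx (nx i))))"
  using assms by (auto simp: exact_def candidate_iff)

lemma exact_kernelE:
  assumes "exact \<alpha>" "i \<in> I" "x \<in> Hom C W (Dom C (\<alpha> (nx i)))" "\<alpha> (nx i) \<bullet> x = Null C W (Dom C (\<alpha> (nx (nx i))))"
  obtains y where "y \<in> Hom C W (Dom C (\<alpha> i))" "x = \<alpha> i \<bullet> y"
  using assms unfolding exact_def by blast

lemma exact_cokernelE:
  assumes "exact \<alpha>" "i \<in> I" "x \<in> Hom C (Dom C (\<alpha> (nx i))) W" "x \<bullet> \<alpha> i = Null C (Dom C (\<alpha> i)) W"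
  obtains y where "y \<in> Hom C (Dom C (\<alpha> (nx (nx i)))) W" "x = y \<bullet> \<alpha> (nx i)"
  using assms unfolding exact_def by blast

lemma monodromyE:
  assumes "monodromy u \<alpha>" "\<And>i. i \<in> I \<Longrightarrow> x i \<in> Hom C W (Dom C (\<alpha> i))"
    "\<And>i. i \<in> I \<Longrightarrow> i < n \<Longrightarrow> \<alpha> i \<bullet> x i = p \<star> x (Suc i)"
  obtains y where "y \<in> Hom C W (Dom C (\<alpha> n))" "\<alpha> n \<bullet> x n = p \<star> (u \<star> x 1 \<boxplus> \<alpha> n \<bullet> y)"
  using assms unfolding monodromy_def by blast

text \<open>Generalized elements and coelements are moved to \<open>\<gamma>\<close> by \<open>s\<close> and \<open>r\<close> and back again.\<close>

lemma retract:
  assumes u: "u \<in> carrier R" and ex: "exact \<gamma>" and \<alpha>: "\<alpha> \<in> sequences"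
    and s: "seq_morphism \<alpha> \<gamma> s" and r: "seq_morphism \<gamma> \<alpha> r"
    and rs: "\<And>i. i \<in> I \<Longrightarrow> r i \<bullet> s i = Ident C (Dom C (\<alpha> i))"
  shows "exact \<alpha>" "monodromy u \<gamma> \<Longrightarrow> monodromy u \<alpha>"
proof -
  have \<gamma>': "\<gamma> \<in> sequences" using ex by (simp add: exact_def candidate_iff)
  note [simp] = \<alpha> u seq_arr[OF \<alpha>] seq_arr[OF \<gamma>']
  have [simp]: "s i \<in> Ar C" "Dom C (s i) = Dom C (\<alpha> i)" "Cod C (s i) = Dom C (\<gamma> i)"
    "r i \<in> Ar C" "Dom C (r i) = Dom C (\<gamma> i)" "Cod C (r i) = Dom C (\<alpha> i)" if "i \<in> I" for i
    using s r that by (auto simp: seq_morphism_iff in_Hom)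
  have s': "\<gamma> i \<bullet> s i = s (nx i) \<bullet> \<alpha> i" and r': "r (nx i) \<bullet> \<gamma> i = \<alpha> i \<bullet> r i" if "i \<in> I" for i
    using s r that by (auto simp: seq_morphism_iff)
  have rsx: "r i \<bullet> (s i \<bullet> x) = x" if "i \<in> I" "x \<in> Ar C" "Cod C x = Dom C (\<alpha> i)" for i x
    using that comp_rewrite[OF rs[OF that(1)], of x] by simp
  have xrs: "(x \<bullet> r i) \<bullet> s i = x" if "i \<in> I" "x \<in> Ar C" "Dom C x = Dom C (\<alpha> i)" for i x
    using that rs by (simp add: comp_assoc)
  have sx: "\<gamma> i \<bullet> (s i \<bullet> x) = s (nx i) \<bullet> (\<alpha> i \<bullet> x)" if "i \<in> I" "x \<in> Ar C" "Cod C x = Dom C (\<alpha> i)" for i x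
    using that comp_rewrite[OF s'[OF that(1)], of x] by (simp add: comp_assoc)
  have rx: "r (nx i) \<bullet> (\<gamma> i \<bullet> x) = \<alpha> i \<bullet> (r i \<bullet> x)" if "i \<in> I" "x \<in> Ar C" "Cod C x = Dom C (\<gamma> i)" for i x
    using that comp_rewrite[OF r'[OF that(1)], of x] by (simp add: comp_assoc)
  show "exact \<alpha>" unfolding exact_def
  proof (intro conjI ballI allI impI)
    have "\<alpha> (nx i) \<bullet> \<alpha> i = Null C (Dom C (\<alpha> i)) (Dom C (\<alpha> (nx (nx i))))" if [simp]: "i \<in> I" for i
    proof -
      have "\<alpha> (nx i) \<bullet> \<alpha> i = r (nx (nx i)) \<bullet> (s (nx (nx i)) \<bullet> (\<alpha> (nx i) \<bullet> \<alpha> i))" by (simp add: rsx)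
      also have "\<dots> = r (nx (nx i)) \<bullet> ((\<gamma> (nx i) \<bullet> \<gamma> i) \<bullet> s i)" by (simp add: sx[symmetric] comp_assoc s')
      also have "\<dots> = Null C (Dom C (\<alpha> i)) (Dom C (\<alpha> (nx (nx i))))" by (simp add: exactD(2)[OF ex])
      finally show ?thesis .
    qed
    then show "candidate_angle \<alpha>" by (simp add: candidate_iff)
  next
    fix i W x assume i [simp]: "i \<in> I" and x: "x \<in> Hom C W (Dom C (\<alpha> (nx i)))"
      and 0: "\<alpha> (nx i) \<bullet> x = Null C W (Dom C (\<alpha> (nx (nx i))))"
    note [simp] = x[unfolded in_Hom] Hom_Ob[OF x]
    have 0: "\<gamma> (nx i) \<bullet> (s (nx i) \<bullet> x) = Null C W (Dom C (\<gamma> (nx (nx i))))" by (simp add: sx 0)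
    have "s (nx i) \<bullet> x \<in> Hom C W (Dom C (\<gamma> (nx i)))" by (simp add: in_Hom)
    then obtain y where y: "y \<in> Hom C W (Dom C (\<gamma> i))" "s (nx i) \<bullet> x = \<gamma> i \<bullet> y"
      by (rule exact_kernelE[OF ex i _ 0])
    note [simp] = y(1)[unfolded in_Hom]
    have "x = r (nx i) \<bullet> (s (nx i) \<bullet> x)" by (simp add: rsx)
    also have "\<dots> = \<alpha> i \<bullet> (r i \<bullet> y)" unfolding y(2) by (simp add: rx)
    finally show "\<exists>y \<in> Hom C W (Dom C (\<alpha> i)). x = \<alpha> i \<bullet> y" by (intro bexI[of _ "r i \<bullet> y"]) (simp_all add: in_Hom)
  next
    fix i W x assume i [simp]: "i \<in> I" and x: "x \<in> Hom C (Dom C (\<alpha> (nx i))) W"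
      and 0: "x \<bullet> \<alpha> i = Null C (Dom C (\<alpha> i)) W"
    note [simp] = x[unfolded in_Hom] Hom_Ob[OF x]
    have "(x \<bullet> r (nx i)) \<bullet> \<gamma> i = (x \<bullet> \<alpha> i) \<bullet> r i" by (simp add: comp_assoc r')
    then have 0: "(x \<bullet> r (nx i)) \<bullet> \<gamma> i = Null C (Dom C (\<gamma> i)) W" by (simp add: 0)
    have "x \<bullet> r (nx i) \<in> Hom C (Dom C (\<gamma> (nx i))) W" by (simp add: in_Hom)
    then obtain y where y: "y \<in> Hom C (Dom C (\<gamma> (nx (nx i)))) W" "x \<bullet> r (nx i) = y \<bullet> \<gamma> (nx i)"
      by (rule exact_cokernelE[OF ex i _ 0])
    note [simp] = y(1)[unfolded in_Hom]
    have "x = (x \<bullet> r (nx i)) \<bullet> s (nx i)" by (simp add: xrs)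
    also have "\<dots> = (y \<bullet> s (nx (nx i))) \<bullet> \<alpha> (nx i)" unfolding y(2) by (simp add: comp_assoc s')
    finally show "\<exists>y \<in> Hom C (Dom C (\<alpha> (nx (nx i)))) W. x = y \<bullet> \<alpha> (nx i)"
      by (intro bexI[of _ "y \<bullet> s (nx (nx i))"]) (simp_all add: in_Hom)
  qed
  show "monodromy u \<alpha>" if mon: "monodromy u \<gamma>" unfolding monodromy_def
  proof (intro allI impI, elim conjE)
    fix W x assume x: "\<forall>i \<in> I. x i \<in> Hom C W (Dom C (\<alpha> i))" and px: "\<forall>i \<in> I. i < n \<longrightarrow> \<alpha> i \<bullet> x i = p \<star> x (Suc i)"
    have [simp]: "x i \<in> Ar C" "Dom C (x i) = W" "Cod C (x i) = Dom C (\<alpha> i)" if "i \<in> I" for i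
      using x that by (auto simp: in_Hom)
    have "\<exists>y \<in> Hom C W (Dom C (\<gamma> n)). \<gamma> n \<bullet> (s n \<bullet> x n) = p \<star> (u \<star> (s 1 \<bullet> x 1) \<boxplus> \<gamma> n \<bullet> y)"
    proof (rule monodromyE[OF mon, of "\<lambda>i. s i \<bullet> x i" W])
      show "\<gamma> i \<bullet> (s i \<bullet> x i) = p \<star> (s (Suc i) \<bullet> x (Suc i))" if [simp]: "i \<in> I" "i < n" for i
      proof -
        have [simp]: "Suc i \<in> I" using nx_I[of i] by simp
        have "\<gamma> i \<bullet> (s i \<bullet> x i) = s (Suc i) \<bullet> (\<alpha> i \<bullet> x i)" using sx[of i "x i"] by simp
        also have "\<dots> = s (Suc i) \<bullet> (p \<star> x (Suc i))" using px by simp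
        finally show ?thesis by (simp add: sm_comp)
      qed
    qed (auto simp: in_Hom)
    then obtain y where y: "y \<in> Hom C W (Dom C (\<gamma> n))"
      "\<gamma> n \<bullet> (s n \<bullet> x n) = p \<star> (u \<star> (s 1 \<bullet> x 1) \<boxplus> \<gamma> n \<bullet> y)" by blast
    note [simp] = y(1)[unfolded in_Hom]
    have "r 1 \<bullet> (\<gamma> n \<bullet> (s n \<bullet> x n)) = \<alpha> n \<bullet> x n" using rx[of n "s n \<bullet> x n"] by (simp add: rsx)
    moreover have "r 1 \<bullet> p \<star> (u \<star> (s 1 \<bullet> x 1) \<boxplus> \<gamma> n \<bullet> y) = p \<star> (u \<star> x 1 \<boxplus> \<alpha> n \<bullet> (r n \<bullet> y))"
      using rx[of n y] by (simp add: linear_simps rsx)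
    ultimately have "\<alpha> n \<bullet> x n = p \<star> (u \<star> x 1 \<boxplus> \<alpha> n \<bullet> (r n \<bullet> y))" unfolding y(2) by (simp only:)
    then show "\<exists>y \<in> Hom C W (Dom C (\<alpha> n)). \<alpha> n \<bullet> x n = p \<star> (u \<star> x 1 \<boxplus> \<alpha> n \<bullet> y)"
      by (intro bexI[of _ "r n \<bullet> y"]) (simp_all add: in_Hom)
  qed
qed

lemma angle_retract:
  "\<lbrakk>u \<in> carrier R; angle u \<gamma>; \<alpha> \<in> sequences; seq_morphism \<alpha> \<gamma> s; seq_morphism \<gamma> \<alpha> r;
    \<And>i. i \<in> I \<Longrightarrow> r i \<bullet> s i = Ident C (Dom C (\<alpha> i))\<rbrakk> \<Longrightarrow> angle u \<alpha>"
  unfolding angle_def using retract by blast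

definition exact_pair :: "'a \<Rightarrow> 'a \<Rightarrow> bool" where
  "exact_pair f g \<longleftrightarrow> g \<bullet> f = Null C (Dom C f) (Cod C g) \<and>
     (\<forall>W. \<forall>x \<in> Hom C W (Dom C g). g \<bullet> x = Null C W (Cod C g) \<longrightarrow> (\<exists>y \<in> Hom C W (Dom C f). x = f \<bullet> y)) \<and>
     (\<forall>W. \<forall>x \<in> Hom C (Dom C g) W. x \<bullet> f = Null C (Dom C f) W \<longrightarrow> (\<exists>y \<in> Hom C (Cod C g) W. x = y \<bullet> g))"

lemma exact_iff: "exact \<alpha> \<longleftrightarrow> \<alpha> \<in> sequences \<and> (\<forall>i \<in> I. exact_pair (\<alpha> i) (\<alpha> (nx i)))"
proof (cases "\<alpha> \<in> sequences")
  case True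
  note [simp] = seq_arr[OF True]
  show ?thesis unfolding exact_def candidate_iff exact_pair_def using True by auto
next
  case False
  then show ?thesis by (simp add: exact_def candidate_iff)
qed

lemma exact_pair_neg:
  assumes [simp]: "f \<in> Ar C" "g \<in> Ar C" "Dom C g = Cod C f"
  shows "exact_pair f g \<Longrightarrow> exact_pair (Neg C f) g" "exact_pair f g \<Longrightarrow> exact_pair f (Neg C g)"
proof -
  assume e: "exact_pair f g"
  show "exact_pair (Neg C f) g" unfolding exact_pair_def
  proof (intro conjI allI ballI impI)
    show "g \<bullet> Neg C f = Null C (Dom C (Neg C f)) (Cod C g)" using e by (simp add: exact_pair_def neg_comp)
  next
    fix W x assume x: "x \<in> Hom C W (Dom C g)" "g \<bullet> x = Null C W (Cod C g)"
    then obtain y where y: "y \<in> Hom C W (Dom C f)" "x = f \<bullet> y" using e unfolding exact_pair_def by blast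
    then show "\<exists>y \<in> Hom C W (Dom C (Neg C f)). x = Neg C f \<bullet> y"
      by (intro bexI[of _ "Neg C y"]) (auto simp: in_Hom neg_comp)
  next
    fix W x assume x: "x \<in> Hom C (Dom C g) W" "x \<bullet> Neg C f = Null C (Dom C (Neg C f)) W"
    then have "Neg C (x \<bullet> f) = Null C (Dom C f) W" by (simp add: in_Hom neg_comp)
    then have "x \<bullet> f = Null C (Dom C f) W" by (rule neg_eq_null[rotated -1]) (use x(1) in \<open>simp_all add: in_Hom\<close>)
    then show "\<exists>y \<in> Hom C (Cod C g) W. x = y \<bullet> g" using e x(1) unfolding exact_pair_def by blast
  qed
next
  assume e: "exact_pair f g"
  show "exact_pair f (Neg C g)" unfolding exact_pair_def
  proof (intro conjI allI ballI impI)
    show "Neg C g \<bullet> f = Null C (Dom C f) (Cod C (Neg C g))" using e by (simp add: exact_pair_def neg_comp)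
  next
    fix W x assume x: "x \<in> Hom C W (Dom C (Neg C g))" "Neg C g \<bullet> x = Null C W (Cod C (Neg C g))"
    then have "Neg C (g \<bullet> x) = Null C W (Cod C g)" by (simp add: in_Hom neg_comp)
    then have "g \<bullet> x = Null C W (Cod C g)" by (rule neg_eq_null[rotated -1]) (use x(1) in \<open>simp_all add: in_Hom\<close>)
    then show "\<exists>y \<in> Hom C W (Dom C f). x = f \<bullet> y" using e x(1) unfolding exact_pair_def by (simp add: in_Hom)
  next
    fix W x assume x: "x \<in> Hom C (Dom C (Neg C g)) W" "x \<bullet> f = Null C (Dom C f) W"
    then have "x \<in> Hom C (Dom C g) W" by (simp add: in_Hom)
    then obtain y where y: "y \<in> Hom C (Cod C g) W" "x = y \<bullet> g" using e x(2) unfolding exact_pair_def by blast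
    then show "\<exists>y \<in> Hom C (Cod C (Neg C g)) W. x = y \<bullet> Neg C g"
      by (intro bexI[of _ "Neg C y"]) (auto simp: in_Hom neg_comp)
  qed
qed

lemma contraction_arr:
  assumes "contraction \<alpha> \<Theta>" "i \<in> I"
  shows "\<Theta> i \<in> Ar C" "Dom C (\<Theta> i) = Dom C (\<alpha> (nx i))" "Cod C (\<Theta> i) = Dom C (\<alpha> i)"
    "\<Theta> (nx i) \<bullet> \<alpha> (nx i) \<boxplus> \<alpha> i \<bullet> \<Theta> i = Ident C (Dom C (\<alpha> (nx i)))"
  using assms by (auto simp: contraction_def in_Hom)

lemma contraction_comp:
  assumes s: "\<alpha> \<in> sequences" and c: "contraction \<alpha> \<Theta>" and i: "i \<in> I" and x: "x \<in> Ar C"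
  shows "Cod C x = Dom C (\<alpha> (nx i)) \<Longrightarrow> \<Theta> (nx i) \<bullet> (\<alpha> (nx i) \<bullet> x) \<boxplus> \<alpha> i \<bullet> (\<Theta> i \<bullet> x) = x"
    "Dom C x = Dom C (\<alpha> (nx i)) \<Longrightarrow> x \<bullet> (\<Theta> (nx i) \<bullet> \<alpha> (nx i)) \<boxplus> x \<bullet> (\<alpha> i \<bullet> \<Theta> i) = x"
proof -
  note [simp] = seq_arr[OF s] contraction_arr(1-3)[OF c] i x
  show "\<Theta> (nx i) \<bullet> (\<alpha> (nx i) \<bullet> x) \<boxplus> \<alpha> i \<bullet> (\<Theta> i \<bullet> x) = x" if "Cod C x = Dom C (\<alpha> (nx i))"
  proof -
    have "(\<Theta> (nx i) \<bullet> \<alpha> (nx i) \<boxplus> \<alpha> i \<bullet> \<Theta> i) \<bullet> x = \<Theta> (nx i) \<bullet> (\<alpha> (nx i) \<bullet> x) \<boxplus> \<alpha> i \<bullet> (\<Theta> i \<bullet> x)"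
      using that by (simp add: arrow_simps)
    then show ?thesis using that unfolding contraction_arr(4)[OF c i] by simp
  qed
  show "x \<bullet> (\<Theta> (nx i) \<bullet> \<alpha> (nx i)) \<boxplus> x \<bullet> (\<alpha> i \<bullet> \<Theta> i) = x" if "Dom C x = Dom C (\<alpha> (nx i))"
  proof -
    have "x \<bullet> (\<Theta> (nx i) \<bullet> \<alpha> (nx i) \<boxplus> \<alpha> i \<bullet> \<Theta> i) = x \<bullet> (\<Theta> (nx i) \<bullet> \<alpha> (nx i)) \<boxplus> x \<bullet> (\<alpha> i \<bullet> \<Theta> i)"
      using that by (simp add: arrow_simps)
    then show ?thesis using that unfolding contraction_arr(4)[OF c i] by simp
  qed
qed

text \<open>
  The last connecting map is defined on every exact sequence: \<open>p x\<^sub>n\<close> lies in the image of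
  \<open>\<alpha>\<^bsub>n-1\<^esub>\<close>, so \<open>\<alpha>\<^sub>n x\<^sub>n\<close> is annihilated by \<open>p\<close>.
\<close>

lemma monodromy_step:
  assumes "exact \<alpha>" "\<And>i. i \<in> I \<Longrightarrow> x i \<in> Hom C W (Dom C (\<alpha> i))"
    "\<And>i. i \<in> I \<Longrightarrow> i < n \<Longrightarrow> \<alpha> i \<bullet> x i = p \<star> x (Suc i)"
  obtains v where "v \<in> Hom C W (Dom C (\<alpha> 1))" "\<alpha> n \<bullet> x n = p \<star> v" "divisible p (\<alpha> 1 \<bullet> v)"
proof -
  note s = exactD(1)[OF assms(1) I_simps(1)]
  note [simp] = seq_arr[OF s]
  have [simp]: "x i \<in> Ar C" "Dom C (x i) = W" "Cod C (x i) = Dom C (\<alpha> i)" if "i \<in> I" for i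
    using assms(2) that by (auto simp: in_Hom)
  have W: "W \<in> Ob C" using Hom_Ob[OF assms(2)[of 1]] by simp
  note [simp] = W
  have pn: "p \<star> x n = \<alpha> (n - 1) \<bullet> x (n - 1)" using assms(3)[of "n - 1"] n_ge_3 by simp
  have "p \<star> (\<alpha> n \<bullet> x n) = \<alpha> n \<bullet> (\<alpha> (n - 1) \<bullet> x (n - 1))" unfolding pn[symmetric] by (simp add: sm_comp)
  also have "\<dots> = Null C W (Dom C (\<alpha> 1))"
    using comp_rewrite[OF exactD(2)[OF assms(1), of "n - 1"], of "x (n - 1)"] by simp
  finally have 0: "p \<star> (\<alpha> n \<bullet> x n) = Null C (Dom C (\<alpha> n \<bullet> x n)) (Cod C (\<alpha> n \<bullet> x n))" by simp
  have a: "\<alpha> n \<bullet> x n \<in> Ar C" by simp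
  obtain v where v: "v \<in> Ar C" "Dom C v = Dom C (\<alpha> n \<bullet> x n)" "Cod C v = Cod C (\<alpha> n \<bullet> x n)" "\<alpha> n \<bullet> x n = p \<star> v"
    by (rule p_annihilatorE[OF a 0])
  from v(1-3) have [simp]: "v \<in> Ar C" "Dom C v = W" "Cod C v = Dom C (\<alpha> 1)" by simp_all
  have "p \<star> (\<alpha> 1 \<bullet> v) = \<alpha> 1 \<bullet> (\<alpha> n \<bullet> x n)" unfolding v(4) by (simp add: sm_comp)
  also have "\<dots> = Null C W (Cod C (\<alpha> 1))"
    using comp_rewrite[OF exactD(2)[OF assms(1) I_simps(3)], of "x n"] by simp
  finally have "divisible p (\<alpha> 1 \<bullet> v)" by (intro p_annihilator) simp_all
  then show ?thesis by (intro that[OF _ v(4)]) (simp_all add: in_Hom)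
qed

text \<open>The homology of a contractible sequence modulo \<open>p\<close> vanishes, so any scalar serves as its monodromy.\<close>

lemma angle_contractible:
  assumes [simp]: "u \<in> carrier R" and cand: "candidate_angle \<alpha>" and c: "contractible \<alpha>"
  shows "angle u \<alpha>"
proof -
  obtain \<Theta> where s: "\<alpha> \<in> sequences" and \<Theta>: "contraction \<alpha> \<Theta>" using c by (auto simp: contractible_iff)
  note [simp] = seq_arr[OF s] contraction_arr(1-3)[OF \<Theta>]
  have cc: "\<alpha> (nx i) \<bullet> \<alpha> i = Null C (Dom C (\<alpha> i)) (Dom C (\<alpha> (nx (nx i))))" if "i \<in> I" for i
    using cand that by (simp add: candidate_iff)
  have ex: "exact \<alpha>" unfolding exact_iff
  proof (intro conjI ballI s)
    fix i assume i [simp]: "i \<in> I"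
    show "exact_pair (\<alpha> i) (\<alpha> (nx i))" unfolding exact_pair_def
    proof (intro conjI allI ballI impI)
      show "\<alpha> (nx i) \<bullet> \<alpha> i = Null C (Dom C (\<alpha> i)) (Cod C (\<alpha> (nx i)))" using cc by simp
    next
      fix W x assume x: "x \<in> Hom C W (Dom C (\<alpha> (nx i)))" and 0: "\<alpha> (nx i) \<bullet> x = Null C W (Cod C (\<alpha> (nx i)))"
      note [simp] = x[unfolded in_Hom] Hom_Ob[OF x]
      have "x = \<Theta> (nx i) \<bullet> (\<alpha> (nx i) \<bullet> x) \<boxplus> \<alpha> i \<bullet> (\<Theta> i \<bullet> x)" by (simp add: contraction_comp(1)[OF s \<Theta> i])
      also have "\<dots> = \<alpha> i \<bullet> (\<Theta> i \<bullet> x)" unfolding 0 by simp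
      finally show "\<exists>y \<in> Hom C W (Dom C (\<alpha> i)). x = \<alpha> i \<bullet> y"
        by (intro bexI[of _ "\<Theta> i \<bullet> x"]) (simp_all add: in_Hom)
    next
      fix W x assume x: "x \<in> Hom C (Dom C (\<alpha> (nx i))) W" and 0: "x \<bullet> \<alpha> i = Null C (Dom C (\<alpha> i)) W"
      note [simp] = x[unfolded in_Hom] Hom_Ob[OF x]
      have "x = x \<bullet> (\<Theta> (nx i) \<bullet> \<alpha> (nx i)) \<boxplus> x \<bullet> (\<alpha> i \<bullet> \<Theta> i)" by (simp add: contraction_comp(2)[OF s \<Theta> i])
      also have "x \<bullet> (\<alpha> i \<bullet> \<Theta> i) = (x \<bullet> \<alpha> i) \<bullet> \<Theta> i" by (simp add: comp_assoc)
      finally have "x = (x \<bullet> \<Theta> (nx i)) \<bullet> \<alpha> (nx i)" unfolding 0 by (simp add: comp_assoc)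
      then show "\<exists>y \<in> Hom C (Cod C (\<alpha> (nx i))) W. x = y \<bullet> \<alpha> (nx i)"
        by (intro bexI[of _ "x \<bullet> \<Theta> (nx i)"]) (simp_all add: in_Hom)
    qed
  qed
  moreover have "monodromy u \<alpha>" unfolding monodromy_def
  proof (intro allI impI, elim conjE)
    fix W x assume x: "\<forall>i \<in> I. x i \<in> Hom C W (Dom C (\<alpha> i))" and px: "\<forall>i \<in> I. i < n \<longrightarrow> \<alpha> i \<bullet> x i = p \<star> x (Suc i)"
    have [simp]: "x i \<in> Ar C" "Dom C (x i) = W" "Cod C (x i) = Dom C (\<alpha> i)" if "i \<in> I" for i
      using x that by (auto simp: in_Hom)
    have W [simp]: "W \<in> Ob C" using Hom_Ob[of "x 1" W "Dom C (\<alpha> 1)"] x by simp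
    \<comment> \<open>an element with divisible image is, up to a divisible element, a boundary\<close>
    have *: "\<exists>y \<in> Hom C W (Dom C (\<alpha> n)). p \<star> v = p \<star> (\<alpha> n \<bullet> y)"
      if v: "v \<in> Hom C W (Dom C (\<alpha> 1))" and d: "divisible p (\<alpha> 1 \<bullet> v)" for v
    proof -
      note [simp] = v[unfolded in_Hom]
      obtain w where w: "w \<in> Ar C" "Dom C w = Dom C (\<alpha> 1 \<bullet> v)" "Cod C w = Cod C (\<alpha> 1 \<bullet> v)" "\<alpha> 1 \<bullet> v = p \<star> w"
        using d by (rule divisibleE)
      from w(1-3) have [simp]: "w \<in> Ar C" "Dom C w = W" "Cod C w = Dom C (\<alpha> 2)" by simp_all
      have "v = \<Theta> 1 \<bullet> (\<alpha> 1 \<bullet> v) \<boxplus> \<alpha> n \<bullet> (\<Theta> n \<bullet> v)" using contraction_comp(1)[OF s \<Theta>, of n v] by simp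
      then have "p \<star> v = p \<star> (\<Theta> 1 \<bullet> (p \<star> w) \<boxplus> \<alpha> n \<bullet> (\<Theta> n \<bullet> v))" unfolding w(4) by (rule arg_cong)
      also have "\<dots> = p \<star> (\<alpha> n \<bullet> (\<Theta> n \<bullet> v))" by (simp add: linear_simps)
      finally show ?thesis by (intro bexI[of _ "\<Theta> n \<bullet> v"]) (simp_all add: in_Hom)
    qed
    obtain v where v: "v \<in> Hom C W (Dom C (\<alpha> 1))" "\<alpha> n \<bullet> x n = p \<star> v" "divisible p (\<alpha> 1 \<bullet> v)"
      by (rule monodromy_step[OF ex, of x W]) (use x px in auto)
    obtain y where y: "y \<in> Hom C W (Dom C (\<alpha> n))" "p \<star> v = p \<star> (\<alpha> n \<bullet> y)" using *[OF v(1,3)] by blast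
    have "\<alpha> 1 \<bullet> x 1 = p \<star> x (Suc 1)" using px n_ge_3 by (simp del: One_nat_def add: I_simps[unfolded One_nat_def[symmetric]])
    then have "divisible p (\<alpha> 1 \<bullet> x 1)" using divisibleI[of p "x (Suc 1)"] by simp
    then obtain z where z: "z \<in> Hom C W (Dom C (\<alpha> n))" "p \<star> x 1 = p \<star> (\<alpha> n \<bullet> z)" using *[of "x 1"] x by auto
    note [simp] = v(1)[unfolded in_Hom] y(1)[unfolded in_Hom] z(1)[unfolded in_Hom]
    have "u \<star> p \<star> x 1 = u \<star> p \<star> (\<alpha> n \<bullet> z)" using z(2) by (rule arg_cong)
    then have 1: "p \<star> u \<star> x 1 = p \<star> (u \<star> (\<alpha> n \<bullet> z))" by (simp add: sm_left_comm[of p u])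
    have "p \<star> (u \<star> x 1 \<boxplus> \<alpha> n \<bullet> (y \<boxplus> Neg C (u \<star> z))) = p \<star> u \<star> x 1 \<boxplus> (p \<star> (\<alpha> n \<bullet> y) \<boxplus> Neg C (p \<star> u \<star> (\<alpha> n \<bullet> z)))"
      by (simp add: linear_simps)
    also have "\<dots> = p \<star> (\<alpha> n \<bullet> y)" unfolding 1 by (simp add: plus_left_comm)
    also have "\<dots> = \<alpha> n \<bullet> x n" unfolding v(2) y(2) ..
    finally show "\<exists>y \<in> Hom C W (Dom C (\<alpha> n)). \<alpha> n \<bullet> x n = p \<star> (u \<star> x 1 \<boxplus> \<alpha> n \<bullet> y)"
      by (intro bexI[of _ "y \<boxplus> Neg C (u \<star> z)"]) (simp_all add: in_Hom)
  qed
  ultimately show ?thesis by (simp add: angle_def)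
qed

lemma splitting_comp:
  assumes "\<alpha> \<in> sequences" "\<beta> \<in> sequences" "\<gamma> \<in> sequences" and s: "splitting \<alpha> \<beta> \<gamma> j1 j2 q1 q2"
    and i: "i \<in> I" and x: "x \<in> Ar C"
  shows "Cod C x = Dom C (\<alpha> i) \<Longrightarrow> \<gamma> i \<bullet> (j1 i \<bullet> x) = j1 (nx i) \<bullet> (\<alpha> i \<bullet> x)"
    "Cod C x = Dom C (\<beta> i) \<Longrightarrow> \<gamma> i \<bullet> (j2 i \<bullet> x) = j2 (nx i) \<bullet> (\<beta> i \<bullet> x)"
    "Cod C x = Dom C (\<gamma> i) \<Longrightarrow> q1 (nx i) \<bullet> (\<gamma> i \<bullet> x) = \<alpha> i \<bullet> (q1 i \<bullet> x)"
    "Cod C x = Dom C (\<gamma> i) \<Longrightarrow> q2 (nx i) \<bullet> (\<gamma> i \<bullet> x) = \<beta> i \<bullet> (q2 i \<bullet> x)"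
proof -
  note [simp] = seq_arr[OF assms(1)] seq_arr[OF assms(2)] seq_arr[OF assms(3)] i x
    biproduct_arr[OF splittingD(1)[OF s i]] biproduct_arr[OF splittingD(1)[OF s nx_I[OF i]]]
  note d = splittingD[OF s i]
  show "\<gamma> i \<bullet> (j1 i \<bullet> x) = j1 (nx i) \<bullet> (\<alpha> i \<bullet> x)" if "Cod C x = Dom C (\<alpha> i)"
    using that comp_rewrite[OF d(2), of x] by (simp add: comp_assoc)
  show "\<gamma> i \<bullet> (j2 i \<bullet> x) = j2 (nx i) \<bullet> (\<beta> i \<bullet> x)" if "Cod C x = Dom C (\<beta> i)"
    using that comp_rewrite[OF d(3), of x] by (simp add: comp_assoc)
  show "q1 (nx i) \<bullet> (\<gamma> i \<bullet> x) = \<alpha> i \<bullet> (q1 i \<bullet> x)" if "Cod C x = Dom C (\<gamma> i)"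
    using that comp_rewrite[OF d(4), of x] by (simp add: comp_assoc)
  show "q2 (nx i) \<bullet> (\<gamma> i \<bullet> x) = \<beta> i \<bullet> (q2 i \<bullet> x)" if "Cod C x = Dom C (\<gamma> i)"
    using that comp_rewrite[OF d(5), of x] by (simp add: comp_assoc)
qed

lemma candidate_sum:
  assumes s: "direct_sum_seq \<alpha> \<beta> \<gamma>" and "candidate_angle \<alpha>" "candidate_angle \<beta>"
  shows "candidate_angle \<gamma>"
proof -
  obtain j1 j2 q1 q2 where sq: "\<alpha> \<in> sequences" "\<beta> \<in> sequences" "\<gamma> \<in> sequences" and sp: "splitting \<alpha> \<beta> \<gamma> j1 j2 q1 q2"
    using s by (rule direct_sumE)
  note [simp] = seq_arr[OF sq(1)] seq_arr[OF sq(2)] seq_arr[OF sq(3)]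
  have "\<gamma> (nx i) \<bullet> \<gamma> i = Null C (Dom C (\<gamma> i)) (Dom C (\<gamma> (nx (nx i))))" if i [simp]: "i \<in> I" for i
  proof (rule biproduct_eqI[OF splittingD(1)[OF sp, of "nx (nx i)"], of _ "Dom C (\<gamma> i)"])
    note [simp] = biproduct_simps[OF splittingD(1)[OF sp i]] biproduct_simps[OF splittingD(1)[OF sp nx_I[OF i]]]
       biproduct_simps[OF splittingD(1)[OF sp nx_I[OF nx_I[OF i]]]]
    have "\<alpha> (nx i) \<bullet> \<alpha> i = Null C (Dom C (\<alpha> i)) (Dom C (\<alpha> (nx (nx i))))"
      "\<beta> (nx i) \<bullet> \<beta> i = Null C (Dom C (\<beta> i)) (Dom C (\<beta> (nx (nx i))))" using assms(2,3) by (simp_all add: candidate_iff)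
    note r = comp_rewrite[OF this(1)] comp_rewrite[OF this(2)]
    show "q1 (nx (nx i)) \<bullet> (\<gamma> (nx i) \<bullet> \<gamma> i) = q1 (nx (nx i)) \<bullet> Null C (Dom C (\<gamma> i)) (Dom C (\<gamma> (nx (nx i))))"
      "q2 (nx (nx i)) \<bullet> (\<gamma> (nx i) \<bullet> \<gamma> i) = q2 (nx (nx i)) \<bullet> Null C (Dom C (\<gamma> i)) (Dom C (\<gamma> (nx (nx i))))"
      by (simp_all add: splitting_comp[OF sq sp] splittingD(4,5)[OF sp] r)
  qed (simp_all add: in_Hom)
  then show ?thesis using sq by (simp add: candidate_iff)
qed

lemma angle_sum:
  assumes [simp]: "u \<in> carrier R" and s: "direct_sum_seq \<alpha> \<beta> \<gamma>" and a: "angle u \<alpha>" and b: "angle u \<beta>"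
  shows "angle u \<gamma>"
proof -
  obtain j1 j2 q1 q2 where sq: "\<alpha> \<in> sequences" "\<beta> \<in> sequences" "\<gamma> \<in> sequences" and sp: "splitting \<alpha> \<beta> \<gamma> j1 j2 q1 q2"
    using s by (rule direct_sumE)
  note [simp] = seq_arr[OF sq(1)] seq_arr[OF sq(2)] seq_arr[OF sq(3)]
  note bp = splittingD(1)[OF sp]
  have bps [simp]: "j1 i \<in> Ar C" "j2 i \<in> Ar C" "q1 i \<in> Ar C" "q2 i \<in> Ar C"
    "Dom C (j1 i) = Dom C (\<alpha> i)" "Dom C (j2 i) = Dom C (\<beta> i)" "Dom C (q1 i) = Dom C (\<gamma> i)" "Dom C (q2 i) = Dom C (\<gamma> i)"
    "Cod C (j1 i) = Dom C (\<gamma> i)" "Cod C (j2 i) = Dom C (\<gamma> i)" "Cod C (q1 i) = Dom C (\<alpha> i)" "Cod C (q2 i) = Dom C (\<beta> i)"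
    if "i \<in> I" for i using biproduct_arr[OF bp[OF that]] by simp_all
  have ea: "exact \<alpha>" "monodromy u \<alpha>" and eb: "exact \<beta>" "monodromy u \<beta>" using a b by (auto simp: angle_def)
  have "candidate_angle \<gamma>" using candidate_sum[OF s] ea eb by (simp add: exact_def)
  moreover have "\<exists>y \<in> Hom C W (Dom C (\<gamma> i)). x = \<gamma> i \<bullet> y"
    if i [simp]: "i \<in> I" and x: "x \<in> Hom C W (Dom C (\<gamma> (nx i)))"
      and 0: "\<gamma> (nx i) \<bullet> x = Null C W (Dom C (\<gamma> (nx (nx i))))" for i W x
  proof -
    note [simp] = x[unfolded in_Hom] Hom_Ob[OF x]
    have 1: "\<alpha> (nx i) \<bullet> (q1 (nx i) \<bullet> x) = Null C W (Dom C (\<alpha> (nx (nx i))))"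
      using splitting_comp(3)[OF sq sp, of "nx i" x] by (simp add: 0)
    have 2: "\<beta> (nx i) \<bullet> (q2 (nx i) \<bullet> x) = Null C W (Dom C (\<beta> (nx (nx i))))"
      using splitting_comp(4)[OF sq sp, of "nx i" x] by (simp add: 0)
    have "q1 (nx i) \<bullet> x \<in> Hom C W (Dom C (\<alpha> (nx i)))" "q2 (nx i) \<bullet> x \<in> Hom C W (Dom C (\<beta> (nx i)))" by (simp_all add: in_Hom)
    then obtain y1 y2 where y1: "y1 \<in> Hom C W (Dom C (\<alpha> i))" "q1 (nx i) \<bullet> x = \<alpha> i \<bullet> y1"
      and y2: "y2 \<in> Hom C W (Dom C (\<beta> i))" "q2 (nx i) \<bullet> x = \<beta> i \<bullet> y2"
      using exact_kernelE[OF ea(1) i _ 1] exact_kernelE[OF eb(1) i _ 2] by metis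
    note [simp] = y1(1)[unfolded in_Hom] y2(1)[unfolded in_Hom]
    have "x = j1 (nx i) \<bullet> (q1 (nx i) \<bullet> x) \<boxplus> j2 (nx i) \<bullet> (q2 (nx i) \<bullet> x)"
      by (simp add: biproduct_comp(5)[OF bp[OF nx_I[OF i]]])
    also have "\<dots> = \<gamma> i \<bullet> (j1 i \<bullet> y1 \<boxplus> j2 i \<bullet> y2)" unfolding y1(2) y2(2)
      by (simp add: comp_plus splitting_comp[OF sq sp])
    finally show ?thesis by (intro bexI[of _ "j1 i \<bullet> y1 \<boxplus> j2 i \<bullet> y2"]) (simp_all add: in_Hom)
  qed
  moreover have "\<exists>y \<in> Hom C (Dom C (\<gamma> (nx (nx i)))) W. x = y \<bullet> \<gamma> (nx i)"
    if i [simp]: "i \<in> I" and x: "x \<in> Hom C (Dom C (\<gamma> (nx i))) W"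
      and 0: "x \<bullet> \<gamma> i = Null C (Dom C (\<gamma> i)) W" for i W x
  proof -
    note [simp] = x[unfolded in_Hom] Hom_Ob[OF x]
    have 1: "(x \<bullet> j1 (nx i)) \<bullet> \<alpha> i = Null C (Dom C (\<alpha> i)) W"
    proof -
      have "(x \<bullet> j1 (nx i)) \<bullet> \<alpha> i = (x \<bullet> \<gamma> i) \<bullet> j1 i" by (simp add: comp_assoc splittingD(2)[OF sp i])
      then show ?thesis by (simp add: 0)
    qed
    have 2: "(x \<bullet> j2 (nx i)) \<bullet> \<beta> i = Null C (Dom C (\<beta> i)) W"
    proof -
      have "(x \<bullet> j2 (nx i)) \<bullet> \<beta> i = (x \<bullet> \<gamma> i) \<bullet> j2 i" by (simp add: comp_assoc splittingD(3)[OF sp i])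
      then show ?thesis by (simp add: 0)
    qed
    have "x \<bullet> j1 (nx i) \<in> Hom C (Dom C (\<alpha> (nx i))) W" "x \<bullet> j2 (nx i) \<in> Hom C (Dom C (\<beta> (nx i))) W" by (simp_all add: in_Hom)
    then obtain y1 y2 where y1: "y1 \<in> Hom C (Dom C (\<alpha> (nx (nx i)))) W" "x \<bullet> j1 (nx i) = y1 \<bullet> \<alpha> (nx i)"
      and y2: "y2 \<in> Hom C (Dom C (\<beta> (nx (nx i)))) W" "x \<bullet> j2 (nx i) = y2 \<bullet> \<beta> (nx i)"
      using exact_cokernelE[OF ea(1) i _ 1] exact_cokernelE[OF eb(1) i _ 2] by metis
    note [simp] = y1(1)[unfolded in_Hom] y2(1)[unfolded in_Hom]
    let ?y = "y1 \<bullet> q1 (nx (nx i)) \<boxplus> y2 \<bullet> q2 (nx (nx i))"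
    have "x = (x \<bullet> j1 (nx i)) \<bullet> q1 (nx i) \<boxplus> (x \<bullet> j2 (nx i)) \<bullet> q2 (nx i)"
      by (simp add: comp_assoc biproduct_comp(6)[OF bp[OF nx_I[OF i]]])
    also have "\<dots> = ?y \<bullet> \<gamma> (nx i)" unfolding y1(2) y2(2)
      by (simp add: comp_assoc plus_comp splittingD(4,5)[OF sp])
    finally show ?thesis by (intro bexI[of _ ?y]) (simp_all add: in_Hom)
  qed
  ultimately have "exact \<gamma>" unfolding exact_def by blast
  moreover have "monodromy u \<gamma>" unfolding monodromy_def
  proof (intro allI impI, elim conjE)
    fix W x assume x: "\<forall>i \<in> I. x i \<in> Hom C W (Dom C (\<gamma> i))" and px: "\<forall>i \<in> I. i < n \<longrightarrow> \<gamma> i \<bullet> x i = p \<star> x (Suc i)"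
    have [simp]: "x i \<in> Ar C" "Dom C (x i) = W" "Cod C (x i) = Dom C (\<gamma> i)" if "i \<in> I" for i
      using x that by (auto simp: in_Hom)
    have step: "\<alpha> i \<bullet> (q1 i \<bullet> x i) = p \<star> (q1 (Suc i) \<bullet> x (Suc i))" "\<beta> i \<bullet> (q2 i \<bullet> x i) = p \<star> (q2 (Suc i) \<bullet> x (Suc i))"
      if [simp]: "i \<in> I" "i < n" for i
    proof -
      have [simp]: "Suc i \<in> I" using nx_I[of i] by simp
      have *: "\<gamma> i \<bullet> x i = p \<star> x (Suc i)" using px by simp
      have "\<alpha> i \<bullet> (q1 i \<bullet> x i) = q1 (Suc i) \<bullet> (\<gamma> i \<bullet> x i)" "\<beta> i \<bullet> (q2 i \<bullet> x i) = q2 (Suc i) \<bullet> (\<gamma> i \<bullet> x i)"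
        using splitting_comp(3,4)[OF sq sp, of i "x i"] by simp_all
      then show "\<alpha> i \<bullet> (q1 i \<bullet> x i) = p \<star> (q1 (Suc i) \<bullet> x (Suc i))" "\<beta> i \<bullet> (q2 i \<bullet> x i) = p \<star> (q2 (Suc i) \<bullet> x (Suc i))"
        unfolding * by (simp_all add: sm_comp)
    qed
    obtain y1 where y1: "y1 \<in> Hom C W (Dom C (\<alpha> n))" "\<alpha> n \<bullet> (q1 n \<bullet> x n) = p \<star> (u \<star> (q1 1 \<bullet> x 1) \<boxplus> \<alpha> n \<bullet> y1)"
      by (rule monodromyE[OF ea(2), of "\<lambda>i. q1 i \<bullet> x i" W]) (simp_all add: in_Hom step)
    obtain y2 where y2: "y2 \<in> Hom C W (Dom C (\<beta> n))" "\<beta> n \<bullet> (q2 n \<bullet> x n) = p \<star> (u \<star> (q2 1 \<bullet> x 1) \<boxplus> \<beta> n \<bullet> y2)"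
      by (rule monodromyE[OF eb(2), of "\<lambda>i. q2 i \<bullet> x i" W]) (simp_all add: in_Hom step)
    note [simp] = y1(1)[unfolded in_Hom] y2(1)[unfolded in_Hom]
    note b1 = bp[OF I_simps(2)] and bn = bp[OF I_simps(3)]
    note [simp] = biproduct_simps[OF b1] biproduct_simps[OF bn]
    let ?y = "j1 n \<bullet> y1 \<boxplus> j2 n \<bullet> y2"
    have c: "q1 1 \<bullet> (\<gamma> n \<bullet> z) = \<alpha> n \<bullet> (q1 n \<bullet> z)" "q2 1 \<bullet> (\<gamma> n \<bullet> z) = \<beta> n \<bullet> (q2 n \<bullet> z)"
      if "z \<in> Ar C" "Cod C z = Dom C (\<gamma> n)" for z
      using splitting_comp(3,4)[OF sq sp, of n z] that by simp_all
    have y: "?y \<in> Ar C" "Dom C ?y = W" "Cod C ?y = Dom C (\<gamma> n)" by simp_all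
    have l: "q1 1 \<bullet> p \<star> (u \<star> x 1 \<boxplus> z) = p \<star> (u \<star> (q1 1 \<bullet> x 1) \<boxplus> q1 1 \<bullet> z)"
      "q2 1 \<bullet> p \<star> (u \<star> x 1 \<boxplus> z) = p \<star> (u \<star> (q2 1 \<bullet> x 1) \<boxplus> q2 1 \<bullet> z)"
      if "z \<in> Ar C" "Dom C z = W" "Cod C z = Dom C (\<gamma> 1)" for z using that by (simp_all add: linear_simps)
    have cy: "q1 1 \<bullet> (\<gamma> n \<bullet> ?y) = \<alpha> n \<bullet> y1" "q2 1 \<bullet> (\<gamma> n \<bullet> ?y) = \<beta> n \<bullet> y2"
      unfolding c[OF y(1,3)] by (simp_all add: comp_plus)
    have "\<gamma> n \<bullet> x n = p \<star> (u \<star> x 1 \<boxplus> \<gamma> n \<bullet> ?y)"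
    proof (rule biproduct_eqI[OF b1, of _ W])
      have "q1 1 \<bullet> (\<gamma> n \<bullet> x n) = p \<star> (u \<star> (q1 1 \<bullet> x 1) \<boxplus> \<alpha> n \<bullet> y1)" by (subst c) (simp_all add: y1(2))
      also have "\<dots> = q1 1 \<bullet> p \<star> (u \<star> x 1 \<boxplus> \<gamma> n \<bullet> ?y)" by (subst l) (simp_all only: cy, simp_all)
      finally show "q1 1 \<bullet> (\<gamma> n \<bullet> x n) = q1 1 \<bullet> p \<star> (u \<star> x 1 \<boxplus> \<gamma> n \<bullet> ?y)" .
      have "q2 1 \<bullet> (\<gamma> n \<bullet> x n) = p \<star> (u \<star> (q2 1 \<bullet> x 1) \<boxplus> \<beta> n \<bullet> y2)" by (subst c) (simp_all add: y2(2))
      also have "\<dots> = q2 1 \<bullet> p \<star> (u \<star> x 1 \<boxplus> \<gamma> n \<bullet> ?y)" by (subst l) (simp_all only: cy, simp_all)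
      finally show "q2 1 \<bullet> (\<gamma> n \<bullet> x n) = q2 1 \<bullet> p \<star> (u \<star> x 1 \<boxplus> \<gamma> n \<bullet> ?y)" .
    qed (simp_all add: in_Hom)
    then show "\<exists>y \<in> Hom C W (Dom C (\<gamma> n)). \<gamma> n \<bullet> x n = p \<star> (u \<star> x 1 \<boxplus> \<gamma> n \<bullet> y)"
      by (intro bexI[of _ ?y]) (simp_all add: in_Hom)
  qed
  ultimately show ?thesis by (simp add: angle_def)
qed

lemma splitting_morphisms:
  assumes "splitting \<alpha> \<beta> \<gamma> j1 j2 q1 q2"
  shows "seq_morphism \<alpha> \<gamma> j1" "seq_morphism \<gamma> \<alpha> q1"
  using assms by (auto simp: splitting_def seq_morphism_iff biproduct_def)

lemma exact_summand:
  assumes "direct_sum_seq \<alpha> \<beta> \<gamma>" and g: "exact \<gamma>"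
  shows "exact \<beta>"
proof -
  have "direct_sum_seq \<beta> \<alpha> \<gamma>" using assms(1) by (rule direct_sum_swap)
  then obtain j1 j2 q1 q2 where sq: "\<beta> \<in> sequences" and sp: "splitting \<beta> \<alpha> \<gamma> j1 j2 q1 q2"
    by (rule direct_sumE)
  show ?thesis
    by (rule retract(1)[OF zero_closed g sq splitting_morphisms[OF sp]]) (use splittingD(1)[OF sp] in \<open>simp add: biproduct_def\<close>)
qed

lemma angle_summand:
  assumes u: "u \<in> carrier R" and s: "direct_sum_seq \<alpha> \<beta> \<gamma>" and g: "angle u \<gamma>"
  shows "angle u \<alpha>" "angle u \<beta>"
proof -
  have "angle u \<alpha>" if sm: "direct_sum_seq \<alpha> \<beta> \<gamma>" for \<alpha> \<beta>
  proof -
    obtain j1 j2 q1 q2 where sq: "\<alpha> \<in> sequences" "\<beta> \<in> sequences" "\<gamma> \<in> sequences" and sp: "splitting \<alpha> \<beta> \<gamma> j1 j2 q1 q2"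
      using sm by (rule direct_sumE)
    show ?thesis
      by (rule angle_retract[OF u g sq(1) splitting_morphisms[OF sp]]) (use splittingD(1)[OF sp] in \<open>simp add: biproduct_def\<close>)
  qed
  then show "angle u \<alpha>" "angle u \<beta>" using s direct_sum_swap by blast+
qed

lemma isomorphic_inverse:
  assumes "\<alpha> \<in> sequences" "\<beta> \<in> sequences" "isomorphic_seqs \<alpha> \<beta>"
  obtains \<phi> \<psi> where "seq_morphism \<alpha> \<beta> \<phi>" "seq_morphism \<beta> \<alpha> \<psi>"
    "\<And>i. i \<in> I \<Longrightarrow> \<psi> i \<bullet> \<phi> i = Ident C (Dom C (\<alpha> i))" "\<And>i. i \<in> I \<Longrightarrow> \<phi> i \<bullet> \<psi> i = Ident C (Dom C (\<beta> i))"
proof -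
  note [simp] = seq_arr[OF assms(1)] seq_arr[OF assms(2)]
  obtain \<phi> where \<phi>: "seq_morphism \<alpha> \<beta> \<phi>" and iso: "\<And>i. i \<in> I \<Longrightarrow> iso_arrow C (\<phi> i)"
    using assms(3) unfolding isomorphic_seqs_def I_def[symmetric] by blast
  have [simp]: "\<phi> i \<in> Ar C" "Dom C (\<phi> i) = Dom C (\<alpha> i)" "Cod C (\<phi> i) = Dom C (\<beta> i)" if "i \<in> I" for i
    using \<phi> that by (auto simp: seq_morphism_iff in_Hom)
  have "\<forall>i \<in> I. \<exists>g. g \<in> Hom C (Dom C (\<beta> i)) (Dom C (\<alpha> i)) \<and> g \<bullet> \<phi> i = Ident C (Dom C (\<alpha> i)) \<and> \<phi> i \<bullet> g = Ident C (Dom C (\<beta> i))"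
  proof
    fix i assume "i \<in> I"
    then show "\<exists>g. g \<in> Hom C (Dom C (\<beta> i)) (Dom C (\<alpha> i)) \<and> g \<bullet> \<phi> i = Ident C (Dom C (\<alpha> i)) \<and> \<phi> i \<bullet> g = Ident C (Dom C (\<beta> i))"
      using iso[of i] by (auto simp: iso_arrow_def)
  qed
  then obtain \<psi> where \<psi>: "\<forall>i \<in> I. \<psi> i \<in> Hom C (Dom C (\<beta> i)) (Dom C (\<alpha> i)) \<and> \<psi> i \<bullet> \<phi> i = Ident C (Dom C (\<alpha> i)) \<and> \<phi> i \<bullet> \<psi> i = Ident C (Dom C (\<beta> i))"
    by (rule bchoice[THEN exE])
  have [simp]: "\<psi> i \<in> Ar C" "Dom C (\<psi> i) = Dom C (\<beta> i)" "Cod C (\<psi> i) = Dom C (\<alpha> i)" if "i \<in> I" for i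
    using \<psi> that by (auto simp: in_Hom)
  have "seq_morphism \<beta> \<alpha> \<psi>" unfolding seq_morphism_iff
  proof (intro ballI conjI)
    fix i assume i [simp]: "i \<in> I"
    show "\<psi> i \<in> Hom C (Dom C (\<beta> i)) (Dom C (\<alpha> i))" using \<psi> by simp
    have 1: "\<phi> i \<bullet> \<psi> i = Ident C (Dom C (\<beta> i))" "\<psi> (nx i) \<bullet> \<phi> (nx i) = Ident C (Dom C (\<alpha> (nx i)))"
      and 2: "\<phi> (nx i) \<bullet> \<alpha> i = \<beta> i \<bullet> \<phi> i" using \<psi> \<phi> nx_I[OF i] i by (simp_all add: seq_morphism_iff)
    have "\<psi> (nx i) \<bullet> \<beta> i = \<psi> (nx i) \<bullet> (\<beta> i \<bullet> (\<phi> i \<bullet> \<psi> i))" by (simp add: 1)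
    also have "\<dots> = \<psi> (nx i) \<bullet> ((\<beta> i \<bullet> \<phi> i) \<bullet> \<psi> i)" by (simp add: comp_assoc)
    also have "\<dots> = (\<psi> (nx i) \<bullet> \<phi> (nx i)) \<bullet> (\<alpha> i \<bullet> \<psi> i)" unfolding 2[symmetric] by (simp add: comp_assoc)
    also have "\<dots> = \<alpha> i \<bullet> \<psi> i" unfolding 1 by simp
    finally show "\<psi> (nx i) \<bullet> \<beta> i = \<alpha> i \<bullet> \<psi> i" .
  qed
  then show ?thesis using that \<phi> \<psi> by blast
qed

lemma angle_iso:
  assumes "u \<in> carrier R" "angle u \<alpha>" "\<beta> \<in> sequences" "isomorphic_seqs \<alpha> \<beta>"
  shows "angle u \<beta>"
proof -
  have s: "\<alpha> \<in> sequences" using assms(2) by (simp add: angle_def exact_iff)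
  from isomorphic_inverse[OF s assms(3,4)] show ?thesis
    by (metis angle_retract[OF assms(1,2,3)])
qed

section \<open>Zero sequences, discs and periodic sequences\<close>

definition zero_seq :: "'o \<Rightarrow> nat \<Rightarrow> 'a" where
  "zero_seq Z = (\<lambda>i \<in> I. Null C Z Z)"

text \<open>
  The identity of \<open>A\<close> at position \<open>i\<close>, with a zero object \<open>Z\<close> at the positions other than \<open>i\<close> and
  its successor.
\<close>

definition disc :: "nat \<Rightarrow> 'o \<Rightarrow> 'o \<Rightarrow> nat \<Rightarrow> 'a" where
  "disc i A Z = (\<lambda>k \<in> I. if k = i then Ident C A
     else Null C (if k = nx i then A else Z) (if nx k = i then A else Z))"

text \<open>After removal of discs every exact sequence has this form, up to isomorphism.\<close>

definition twisted :: "'a \<Rightarrow> nat \<Rightarrow> 'a" where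
  "twisted t = (\<lambda>i \<in> I. p \<star> (if i = 1 then t else Ident C (Dom C t)))"

text \<open>The sequence \<open>F\<^sub>u(p)\<close>.\<close>

definition periodic :: "'r \<Rightarrow> 'o \<Rightarrow> nat \<Rightarrow> 'a" where
  "periodic u F = twisted (u \<star> Ident C F)"

lemma zero_seq:
  assumes Z: "zero_object C Z"
  shows "zero_seq Z \<in> sequences" "candidate_angle (zero_seq Z)" "contractible (zero_seq Z)"
    "i \<in> I \<Longrightarrow> Dom C (zero_seq Z i) = Z"
proof -
  have [simp]: "Z \<in> Ob C" using Z zero_objectD by blast
  show s: "zero_seq Z \<in> sequences" by (simp add: sequences_iff zero_seq_def)
  show "i \<in> I \<Longrightarrow> Dom C (zero_seq Z i) = Z" by (simp add: zero_seq_def)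
  show "candidate_angle (zero_seq Z)" using s by (simp add: candidate_iff) (simp add: zero_seq_def)
  have "contraction (zero_seq Z) (\<lambda>_. Null C Z Z)"
    using zero_object_ident[OF Z] by (simp add: contraction_def zero_seq_def in_Hom)
  then show "contractible (zero_seq Z)" using s by (auto simp: contractible_iff)
qed

lemma zero_sum:
  assumes Z: "zero_object C Z" and a: "\<alpha> \<in> sequences"
  shows "direct_sum_seq (zero_seq Z) \<alpha> \<alpha>"
proof -
  have [simp]: "Z \<in> Ob C" using Z zero_objectD by blast
  note [simp] = seq_arr[OF a]
  have "splitting (zero_seq Z) \<alpha> \<alpha> (\<lambda>i. Null C Z (Dom C (\<alpha> i))) (\<lambda>i. Ident C (Dom C (\<alpha> i)))
    (\<lambda>i. Null C (Dom C (\<alpha> i)) Z) (\<lambda>i. Ident C (Dom C (\<alpha> i)))"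
    using zero_object_ident[OF Z] by (simp add: splitting_def biproduct_def in_Hom zero_seq_def)
  then show ?thesis using zero_seq(1)[OF Z] a by (intro direct_sumI)
qed

lemma disc_Dom:
  assumes Z: "zero_object C Z" and A: "A \<in> Ob C" and k: "k \<in> I"
  shows "Dom C (disc i A Z k) = (if k = i \<or> k = nx i then A else Z)"
  using zero_objectD(1)[OF Z] A k by (auto simp: disc_def)

lemma disc:
  assumes Z: "zero_object C Z" and A: "A \<in> Ob C" and i [simp]: "i \<in> I"
  shows "disc i A Z \<in> sequences" "candidate_angle (disc i A Z)" "contractible (disc i A Z)"
proof -
  have [simp]: "Z \<in> Ob C" using Z zero_objectD by blast
  note [simp] = A
  have D: "disc i A Z k \<in> Ar C \<and> Cod C (disc i A Z k) = Dom C (disc i A Z (nx k))" if [simp]: "k \<in> I" for k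
    using nx_neq[of i] nx_inj[of k i] nx_neq[of k] by (auto simp: disc_def)
  show s: "disc i A Z \<in> sequences" using D by (simp add: sequences_iff) (simp add: disc_def)
  note [simp] = seq_arr[OF s]
  have n: "disc i A Z k = Null C (Dom C (disc i A Z k)) (Dom C (disc i A Z (nx k)))" if [simp]: "k \<in> I" and ne: "k \<noteq> i" for k
    using ne nx_inj[of k i] by (simp add: disc_Dom[OF Z A]) (simp add: disc_def)
  have "disc i A Z (nx k) \<bullet> disc i A Z k = Null C (Dom C (disc i A Z k)) (Dom C (disc i A Z (nx (nx k))))"
    if k [simp]: "k \<in> I" for k
  proof (cases "k = i")
    case True
    then have "disc i A Z (nx k) = Null C (Dom C (disc i A Z (nx k))) (Dom C (disc i A Z (nx (nx k))))"
      using n[of "nx k"] nx_neq[of i] by simp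
    then show ?thesis by (rule ssubst) simp
  next
    case False
    show ?thesis by (subst n[OF k False]) simp
  qed
  then show "candidate_angle (disc i A Z)" using s by (simp add: candidate_iff)
  define \<Theta> where "\<Theta> k = (if k = i then Ident C A else Null C (Dom C (disc i A Z (nx k))) (Dom C (disc i A Z k)))" for k
  have di: "disc i A Z i = Ident C A" by (simp add: disc_def)
  have "contraction (disc i A Z) \<Theta>" unfolding contraction_def
  proof (intro ballI conjI)
    fix k assume k [simp]: "k \<in> I"
    have T: "\<Theta> l \<in> Hom C (Dom C (disc i A Z (nx l))) (Dom C (disc i A Z l))" if [simp]: "l \<in> I" for l
      by (cases "l = i") (simp_all add: \<Theta>_def in_Hom disc_Dom[OF Z A])
    show "\<Theta> k \<in> Hom C (Dom C (disc i A Z (nx k))) (Dom C (disc i A Z k))" by (rule T) simp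
    note [simp] = T[OF k, unfolded in_Hom] T[OF nx_I[OF k], unfolded in_Hom]
    consider "k = i" | "nx k = i" "k \<noteq> i" | "k \<noteq> i" "nx k \<noteq> i" by blast
    then show "\<Theta> (nx k) \<bullet> disc i A Z (nx k) \<boxplus> disc i A Z k \<bullet> \<Theta> k = Ident C (Dom C (disc i A Z (nx k)))"
    proof cases
      case 1
      then have "disc i A Z (nx k) = Null C A (Dom C (disc i A Z (nx (nx k))))"
        using n[of "nx k"] nx_neq[of i] by (simp add: disc_Dom[OF Z A])
      then show ?thesis using 1 di T[OF nx_I[OF k], unfolded in_Hom] by (simp add: \<Theta>_def disc_Dom[OF Z A])
    next
      case 2
      then have "disc i A Z k = Null C (Dom C (disc i A Z k)) A" using n[OF k] by (simp add: disc_Dom[OF Z A])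
      then show ?thesis using 2 di by (simp add: \<Theta>_def disc_Dom[OF Z A])
    next
      case 3
      then have "Dom C (disc i A Z (nx k)) = Z" using nx_inj[of k i] by (simp add: disc_Dom[OF Z A])
      then have *: "f = Ident C (Dom C (disc i A Z (nx k)))" if "f \<in> Hom C Z Z" for f
        using zero_object_Hom(1)[OF Z that] zero_object_ident[OF Z] by simp
      show ?thesis by (rule *) (simp add: in_Hom \<open>Dom C (disc i A Z (nx k)) = Z\<close>)
    qed
  qed
  then show "contractible (disc i A Z)" using s by (auto simp: contractible_iff)
qed

lemma trivial_seq_disc: "trivial_seq A Z = disc 1 A Z"
  unfolding trivial_seq_def disc_def I_def[symmetric]
  by (rule restrict_ext) (use n_ge_3 in \<open>auto simp: nx_def I_def\<close>)

lemma contractible_sum: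
  assumes s: "direct_sum_seq \<alpha> \<beta> \<gamma>" and "contractible \<alpha>" "contractible \<beta>"
  shows "contractible \<gamma>"
proof -
  obtain j1 j2 q1 q2 where sq: "\<alpha> \<in> sequences" "\<beta> \<in> sequences" "\<gamma> \<in> sequences" and sp: "splitting \<alpha> \<beta> \<gamma> j1 j2 q1 q2"
    using s by (rule direct_sumE)
  obtain \<Theta> \<Xi> where \<Theta>: "contraction \<alpha> \<Theta>" and \<Xi>: "contraction \<beta> \<Xi>" using assms(2,3) by (auto simp: contractible_iff)
  note [simp] = seq_arr[OF sq(1)] seq_arr[OF sq(2)] seq_arr[OF sq(3)] contraction_arr(1-3)[OF \<Theta>] contraction_arr(1-3)[OF \<Xi>]
  note bp = splittingD(1)[OF sp]
  have bps [simp]: "j1 i \<in> Ar C" "j2 i \<in> Ar C" "q1 i \<in> Ar C" "q2 i \<in> Ar C"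
    "Dom C (j1 i) = Dom C (\<alpha> i)" "Dom C (j2 i) = Dom C (\<beta> i)" "Dom C (q1 i) = Dom C (\<gamma> i)" "Dom C (q2 i) = Dom C (\<gamma> i)"
    "Cod C (j1 i) = Dom C (\<gamma> i)" "Cod C (j2 i) = Dom C (\<gamma> i)" "Cod C (q1 i) = Dom C (\<alpha> i)" "Cod C (q2 i) = Dom C (\<beta> i)"
    if "i \<in> I" for i using biproduct_arr[OF bp[OF that]] by simp_all
  have "contraction \<gamma> (\<lambda>i. j1 i \<bullet> (\<Theta> i \<bullet> q1 (nx i)) \<boxplus> j2 i \<bullet> (\<Xi> i \<bullet> q2 (nx i)))" unfolding contraction_def
  proof (intro ballI conjI)
    fix i assume i [simp]: "i \<in> I"
    show "j1 i \<bullet> (\<Theta> i \<bullet> q1 (nx i)) \<boxplus> j2 i \<bullet> (\<Xi> i \<bullet> q2 (nx i)) \<in> Hom C (Dom C (\<gamma> (nx i))) (Dom C (\<gamma> i))"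
      by (simp add: in_Hom)
    have 1: "(j1 (nx i) \<bullet> (\<Theta> (nx i) \<bullet> q1 (nx (nx i))) \<boxplus> j2 (nx i) \<bullet> (\<Xi> (nx i) \<bullet> q2 (nx (nx i)))) \<bullet> \<gamma> (nx i)
      = j1 (nx i) \<bullet> (\<Theta> (nx i) \<bullet> (\<alpha> (nx i) \<bullet> q1 (nx i))) \<boxplus> j2 (nx i) \<bullet> (\<Xi> (nx i) \<bullet> (\<beta> (nx i) \<bullet> q2 (nx i)))"
      by (simp add: plus_comp comp_assoc splittingD(4,5)[OF sp])
    have 2: "\<gamma> i \<bullet> (j1 i \<bullet> (\<Theta> i \<bullet> q1 (nx i)) \<boxplus> j2 i \<bullet> (\<Xi> i \<bullet> q2 (nx i)))
      = j1 (nx i) \<bullet> (\<alpha> i \<bullet> (\<Theta> i \<bullet> q1 (nx i))) \<boxplus> j2 (nx i) \<bullet> (\<beta> i \<bullet> (\<Xi> i \<bullet> q2 (nx i)))"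
      by (simp add: comp_plus splitting_comp[OF sq sp])
    have 3: "j1 (nx i) \<bullet> (\<Theta> (nx i) \<bullet> (\<alpha> (nx i) \<bullet> q1 (nx i))) \<boxplus> j1 (nx i) \<bullet> (\<alpha> i \<bullet> (\<Theta> i \<bullet> q1 (nx i))) = j1 (nx i) \<bullet> q1 (nx i)"
      using contraction_comp(1)[OF sq(1) \<Theta> i, of "q1 (nx i)"]
        comp_plus[of "\<Theta> (nx i) \<bullet> (\<alpha> (nx i) \<bullet> q1 (nx i))" "\<alpha> i \<bullet> (\<Theta> i \<bullet> q1 (nx i))" "j1 (nx i)"] by simp
    have 4: "j2 (nx i) \<bullet> (\<Xi> (nx i) \<bullet> (\<beta> (nx i) \<bullet> q2 (nx i))) \<boxplus> j2 (nx i) \<bullet> (\<beta> i \<bullet> (\<Xi> i \<bullet> q2 (nx i))) = j2 (nx i) \<bullet> q2 (nx i)"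
      using contraction_comp(1)[OF sq(2) \<Xi> i, of "q2 (nx i)"]
        comp_plus[of "\<Xi> (nx i) \<bullet> (\<beta> (nx i) \<bullet> q2 (nx i))" "\<beta> i \<bullet> (\<Xi> i \<bullet> q2 (nx i))" "j2 (nx i)"] by simp
    have e: "(a \<boxplus> b) \<boxplus> (c \<boxplus> d) = (a \<boxplus> c) \<boxplus> (b \<boxplus> d)"
      if "a \<in> Hom C A B" "b \<in> Hom C A B" "c \<in> Hom C A B" "d \<in> Hom C A B" for a b c d A B
      using that by (simp add: in_Hom plus_ac)
    have 5: "j1 (nx i) \<bullet> q1 (nx i) \<boxplus> j2 (nx i) \<bullet> q2 (nx i) = Ident C (Dom C (\<gamma> (nx i)))"
      using bp[OF nx_I[OF i]] by (simp add: biproduct_def)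
    show "(j1 (nx i) \<bullet> (\<Theta> (nx i) \<bullet> q1 (nx (nx i))) \<boxplus> j2 (nx i) \<bullet> (\<Xi> (nx i) \<bullet> q2 (nx (nx i)))) \<bullet> \<gamma> (nx i) \<boxplus>
       \<gamma> i \<bullet> (j1 i \<bullet> (\<Theta> i \<bullet> q1 (nx i)) \<boxplus> j2 i \<bullet> (\<Xi> i \<bullet> q2 (nx i))) = Ident C (Dom C (\<gamma> (nx i)))"
      unfolding 1 2 by (subst e[of _ "Dom C (\<gamma> (nx i))" "Dom C (\<gamma> (nx i))"]) (simp_all add: in_Hom 3 4 5)
  qed
  then show ?thesis using sq(3) by (auto simp: contractible_iff)
qed

text \<open>If \<open>1 = p h\<close> then \<open>p 1 = p\<^sup>2 h = 0\<close>, and so \<open>1 = (p 1) h = 0\<close>.\<close>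

lemma divisible_ident_zero:
  assumes A: "A \<in> Ob C" and d: "divisible p (Ident C A)"
  shows "zero_object C A"
proof -
  note [simp] = A
  obtain h where h: "h \<in> Ar C" "Dom C h = Dom C (Ident C A)" "Cod C h = Cod C (Ident C A)" "Ident C A = p \<star> h"
    using d by (rule divisibleE)
  from h(1-3) have [simp]: "h \<in> Ar C" "Dom C h = A" "Cod C h = A" by simp_all
  have "p \<star> Ident C A = p \<star> p \<star> h" using h(4) by (rule arg_cong)
  then have 0: "p \<star> Ident C A = Null C A A" by simp
  have "p \<star> h = p \<star> Ident C A \<bullet> h" by (simp add: sm_comp)
  also have "\<dots> = Null C A A" unfolding 0 by simp
  finally have "Ident C A = Null C A A" unfolding h(4) .
  then show ?thesis by (rule zero_objectI[OF A])
qed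

text \<open>The contraction writes the identity of the summand as a sum of multiples of \<open>p\<close>.\<close>

lemma contractible_minimal_summand:
  assumes s: "direct_sum_seq \<beta> \<mu> \<alpha>" and c: "contractible \<alpha>" and d: "\<And>i. i \<in> I \<Longrightarrow> divisible p (\<mu> i)" and "i \<in> I"
  shows "zero_object C (Dom C (\<mu> i))"
proof -
  obtain k where k [simp]: "k \<in> I" and ik: "i = nx k" using nx_surj[OF assms(4)] by auto
  obtain j1 j2 q1 q2 where sq: "\<beta> \<in> sequences" "\<mu> \<in> sequences" "\<alpha> \<in> sequences" and sp: "splitting \<beta> \<mu> \<alpha> j1 j2 q1 q2"
    using s by (rule direct_sumE)
  obtain \<Theta> where \<Theta>: "contraction \<alpha> \<Theta>" using c by (auto simp: contractible_iff)
  note [simp] = seq_arr[OF sq(2)] seq_arr[OF sq(3)] contraction_arr(1-3)[OF \<Theta>]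
  note bp = splittingD(1)[OF sp]
  note [simp] = biproduct_arr[OF bp[OF k]] biproduct_arr[OF bp[OF nx_I[OF k]]] biproduct_arr[OF bp[OF nx_I[OF nx_I[OF k]]]]
  let ?j = "j2 (nx k)"
  have 1: "\<Theta> (nx k) \<bullet> (\<alpha> (nx k) \<bullet> ?j) \<boxplus> \<alpha> k \<bullet> (\<Theta> k \<bullet> ?j) = ?j" by (rule contraction_comp(1)[OF sq(3) \<Theta> k]) simp_all
  have "q2 (nx k) \<bullet> (\<Theta> (nx k) \<bullet> (\<alpha> (nx k) \<bullet> ?j) \<boxplus> \<alpha> k \<bullet> (\<Theta> k \<bullet> ?j)) = Ident C (Dom C (\<mu> (nx k)))"
    unfolding 1 by simp
  then have 2: "q2 (nx k) \<bullet> (\<Theta> (nx k) \<bullet> (\<alpha> (nx k) \<bullet> ?j)) \<boxplus> q2 (nx k) \<bullet> (\<alpha> k \<bullet> (\<Theta> k \<bullet> ?j)) = Ident C (Dom C (\<mu> (nx k)))"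
    by (subst (asm) comp_plus) simp_all
  have 3: "q2 (nx k) \<bullet> (\<Theta> (nx k) \<bullet> (\<alpha> (nx k) \<bullet> ?j)) = (q2 (nx k) \<bullet> (\<Theta> (nx k) \<bullet> j2 (nx (nx k)))) \<bullet> \<mu> (nx k)"
    unfolding splittingD(3)[OF sp nx_I[OF k]] by (simp add: comp_assoc)
  have 4: "q2 (nx k) \<bullet> (\<alpha> k \<bullet> (\<Theta> k \<bullet> ?j)) = \<mu> k \<bullet> (q2 k \<bullet> (\<Theta> k \<bullet> ?j))"
    by (rule splitting_comp(4)[OF sq sp k]) simp_all
  have "divisible p (Ident C (Dom C (\<mu> (nx k))))"
    unfolding 2[symmetric] 3 4
  proof (rule divisible_plus)
    show "divisible p ((q2 (nx k) \<bullet> (\<Theta> (nx k) \<bullet> j2 (nx (nx k)))) \<bullet> \<mu> (nx k))"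
      by (rule divisible_comp(1)[OF _ d]) simp_all
    show "divisible p (\<mu> k \<bullet> (q2 k \<bullet> (\<Theta> k \<bullet> ?j)))"
      by (rule divisible_comp(2)[OF _ d]) simp_all
  qed simp_all
  then show ?thesis unfolding ik by (intro divisible_ident_zero) simp_all
qed

lemma biproduct_family:
  assumes a: "\<alpha> \<in> sequences" and b: "\<beta> \<in> sequences"
  obtains S j1 j2 q1 q2 where "\<And>i. i \<in> I \<Longrightarrow> biproduct C (Dom C (\<alpha> i)) (Dom C (\<beta> i)) (S i) (j1 i) (j2 i) (q1 i) (q2 i)"
proof -
  note [simp] = seq_arr[OF a] seq_arr[OF b]
  have "\<forall>i \<in> I. \<exists>b. case b of (S, j1, j2, q1, q2) \<Rightarrow> biproduct C (Dom C (\<alpha> i)) (Dom C (\<beta> i)) S j1 j2 q1 q2"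
  proof
    fix i assume "i \<in> I"
    then obtain S j1 j2 q1 q2 where "biproduct C (Dom C (\<alpha> i)) (Dom C (\<beta> i)) S j1 j2 q1 q2"
      using ex_biproduct[of "Dom C (\<alpha> i)" "Dom C (\<beta> i)"] by auto
    then show "\<exists>b. case b of (S, j1, j2, q1, q2) \<Rightarrow> biproduct C (Dom C (\<alpha> i)) (Dom C (\<beta> i)) S j1 j2 q1 q2"
      by (intro exI[of _ "(S, j1, j2, q1, q2)"]) simp
  qed
  then obtain b where b: "\<forall>i \<in> I. case b i of (S, j1, j2, q1, q2) \<Rightarrow> biproduct C (Dom C (\<alpha> i)) (Dom C (\<beta> i)) S j1 j2 q1 q2"
    by (rule bchoice[THEN exE])
  show ?thesis
    by (rule that[of "\<lambda>i. fst (b i)" "\<lambda>i. fst (snd (b i))" "\<lambda>i. fst (snd (snd (b i)))" "\<lambda>i. fst (snd (snd (snd (b i))))" "\<lambda>i. snd (snd (snd (snd (b i))))"])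
      (use b in \<open>auto split: prod.splits\<close>)
qed

lemma direct_sum_assoc:
  assumes a: "direct_sum_seq \<delta> \<beta> \<alpha>" and b: "direct_sum_seq \<gamma> \<mu> \<beta>"
  shows "\<exists>\<epsilon>. direct_sum_seq \<delta> \<gamma> \<epsilon> \<and> direct_sum_seq \<epsilon> \<mu> \<alpha>"
proof -
  obtain j1 j2 q1 q2 where sa: "\<delta> \<in> sequences" "\<beta> \<in> sequences" "\<alpha> \<in> sequences" and pa: "splitting \<delta> \<beta> \<alpha> j1 j2 q1 q2"
    using a by (rule direct_sumE)
  obtain k1 k2 r1 r2 where sb: "\<gamma> \<in> sequences" "\<mu> \<in> sequences" "\<beta> \<in> sequences" and pb: "splitting \<gamma> \<mu> \<beta> k1 k2 r1 r2"
    using b by (rule direct_sumE)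
  note [simp] = seq_arr[OF sa(1)] seq_arr[OF sa(2)] seq_arr[OF sa(3)] seq_arr[OF sb(1)] seq_arr[OF sb(2)]
  obtain S l1 l2 s1 s2 where bp: "\<And>i. i \<in> I \<Longrightarrow> biproduct C (Dom C (\<delta> i)) (Dom C (\<gamma> i)) (S i) (l1 i) (l2 i) (s1 i) (s2 i)"
    by (rule biproduct_family[OF sa(1) sb(1)]) blast
  define \<epsilon> where "\<epsilon> = restrict (\<lambda>i. l1 (nx i) \<bullet> (\<delta> i \<bullet> s1 i) \<boxplus> l2 (nx i) \<bullet> (\<gamma> i \<bullet> s2 i)) I"
  note ov = direct_sum_over[OF sa(1) sb(1) bp \<epsilon>_def]
  have se: "\<epsilon> \<in> sequences" and pe: "splitting \<delta> \<gamma> \<epsilon> l1 l2 s1 s2" using ov by blast+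
  note [simp] = seq_arr[OF se]
  have bas [simp]: "j1 i \<in> Ar C" "j2 i \<in> Ar C" "q1 i \<in> Ar C" "q2 i \<in> Ar C"
    "Dom C (j1 i) = Dom C (\<delta> i)" "Dom C (j2 i) = Dom C (\<beta> i)" "Dom C (q1 i) = Dom C (\<alpha> i)" "Dom C (q2 i) = Dom C (\<alpha> i)"
    "Cod C (j1 i) = Dom C (\<alpha> i)" "Cod C (j2 i) = Dom C (\<alpha> i)" "Cod C (q1 i) = Dom C (\<delta> i)" "Cod C (q2 i) = Dom C (\<beta> i)"
    if "i \<in> I" for i using biproduct_arr[OF splittingD(1)[OF pa that]] by simp_all
  have bbs [simp]: "k1 i \<in> Ar C" "k2 i \<in> Ar C" "r1 i \<in> Ar C" "r2 i \<in> Ar C"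
    "Dom C (k1 i) = Dom C (\<gamma> i)" "Dom C (k2 i) = Dom C (\<mu> i)" "Dom C (r1 i) = Dom C (\<beta> i)" "Dom C (r2 i) = Dom C (\<beta> i)"
    "Cod C (k1 i) = Dom C (\<beta> i)" "Cod C (k2 i) = Dom C (\<beta> i)" "Cod C (r1 i) = Dom C (\<gamma> i)" "Cod C (r2 i) = Dom C (\<mu> i)"
    if "i \<in> I" for i using biproduct_arr[OF splittingD(1)[OF pb that]] by simp_all
  have bes [simp]: "l1 i \<in> Ar C" "l2 i \<in> Ar C" "s1 i \<in> Ar C" "s2 i \<in> Ar C"
    "Dom C (l1 i) = Dom C (\<delta> i)" "Dom C (l2 i) = Dom C (\<gamma> i)" "Dom C (s1 i) = Dom C (\<epsilon> i)" "Dom C (s2 i) = Dom C (\<epsilon> i)"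
    "Cod C (l1 i) = Dom C (\<epsilon> i)" "Cod C (l2 i) = Dom C (\<epsilon> i)" "Cod C (s1 i) = Dom C (\<delta> i)" "Cod C (s2 i) = Dom C (\<gamma> i)"
    if "i \<in> I" for i using biproduct_arr[OF splittingD(1)[OF pe that]] by simp_all
  have "splitting \<epsilon> \<mu> \<alpha> (\<lambda>i. j1 i \<bullet> s1 i \<boxplus> j2 i \<bullet> k1 i \<bullet> s2 i) (\<lambda>i. j2 i \<bullet> k2 i)
     (\<lambda>i. l1 i \<bullet> q1 i \<boxplus> l2 i \<bullet> r1 i \<bullet> q2 i) (\<lambda>i. r2 i \<bullet> q2 i)"
    unfolding splitting_def
  proof (intro ballI conjI)
    fix i assume i [simp]: "i \<in> I"
    show "biproduct C (Dom C (\<epsilon> i)) (Dom C (\<mu> i)) (Dom C (\<alpha> i)) (j1 i \<bullet> s1 i \<boxplus> j2 i \<bullet> k1 i \<bullet> s2 i) (j2 i \<bullet> k2 i)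
       (l1 i \<bullet> q1 i \<boxplus> l2 i \<bullet> r1 i \<bullet> q2 i) (r2 i \<bullet> q2 i)"
      by (rule biproduct_assoc[OF splittingD(1)[OF pa i] splittingD(1)[OF pb i] splittingD(1)[OF pe i]])
    show "\<alpha> i \<bullet> (j1 i \<bullet> s1 i \<boxplus> j2 i \<bullet> k1 i \<bullet> s2 i) = (j1 (nx i) \<bullet> s1 (nx i) \<boxplus> j2 (nx i) \<bullet> k1 (nx i) \<bullet> s2 (nx i)) \<bullet> \<epsilon> i"
      by (simp add: arrow_simps splitting_comp[OF sa pa] splitting_comp[OF sb pb] splittingD(4,5)[OF pe])
    show "\<alpha> i \<bullet> (j2 i \<bullet> k2 i) = j2 (nx i) \<bullet> k2 (nx i) \<bullet> \<mu> i"
      by (simp add: arrow_simps splitting_comp[OF sa pa] splittingD(3)[OF pb])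
    show "(l1 (nx i) \<bullet> q1 (nx i) \<boxplus> l2 (nx i) \<bullet> r1 (nx i) \<bullet> q2 (nx i)) \<bullet> \<alpha> i = \<epsilon> i \<bullet> (l1 i \<bullet> q1 i \<boxplus> l2 i \<bullet> r1 i \<bullet> q2 i)"
      by (simp add: arrow_simps splittingD(4,5)[OF pa] splitting_comp[OF sb pb] splitting_comp[OF sa(1) sb(1) se pe])
    show "r2 (nx i) \<bullet> q2 (nx i) \<bullet> \<alpha> i = \<mu> i \<bullet> (r2 i \<bullet> q2 i)"
      by (simp add: arrow_simps splittingD(5)[OF pa] splitting_comp[OF sb pb])
  qed
  then show ?thesis using direct_sumI[OF sa(1) sb(1) se pe] direct_sumI[OF se sb(2) sa(3)] by blast
qed

lemma direct_sum_iso_right: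
  assumes a: "direct_sum_seq \<gamma> \<mu> \<alpha>" and s: "\<mu>' \<in> sequences" and iso: "isomorphic_seqs \<mu> \<mu>'"
  shows "direct_sum_seq \<gamma> \<mu>' \<alpha>"
proof -
  obtain j1 j2 q1 q2 where sa: "\<gamma> \<in> sequences" "\<mu> \<in> sequences" "\<alpha> \<in> sequences" and pa: "splitting \<gamma> \<mu> \<alpha> j1 j2 q1 q2"
    using a by (rule direct_sumE)
  obtain \<phi> \<psi> where \<phi>: "seq_morphism \<mu> \<mu>' \<phi>" and \<psi>: "seq_morphism \<mu>' \<mu> \<psi>"
    and i1: "\<And>i. i \<in> I \<Longrightarrow> \<psi> i \<bullet> \<phi> i = Ident C (Dom C (\<mu> i))" and i2: "\<And>i. i \<in> I \<Longrightarrow> \<phi> i \<bullet> \<psi> i = Ident C (Dom C (\<mu>' i))"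
    by (rule isomorphic_inverse[OF sa(2) s iso]) blast
  note [simp] = seq_arr[OF sa(1)] seq_arr[OF sa(2)] seq_arr[OF sa(3)] seq_arr[OF s]
  have [simp]: "\<phi> i \<in> Ar C" "Dom C (\<phi> i) = Dom C (\<mu> i)" "Cod C (\<phi> i) = Dom C (\<mu>' i)"
    "\<psi> i \<in> Ar C" "Dom C (\<psi> i) = Dom C (\<mu>' i)" "Cod C (\<psi> i) = Dom C (\<mu> i)"
    and nat: "\<phi> (nx i) \<bullet> \<mu> i = \<mu>' i \<bullet> \<phi> i" "\<psi> (nx i) \<bullet> \<mu>' i = \<mu> i \<bullet> \<psi> i" if "i \<in> I" for i
    using \<phi> \<psi> that by (auto simp: seq_morphism_iff in_Hom)
  have "splitting \<gamma> \<mu>' \<alpha> j1 (\<lambda>i. j2 i \<bullet> \<psi> i) q1 (\<lambda>i. \<phi> i \<bullet> q2 i)"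
    unfolding splitting_def
  proof (intro ballI)
    fix i assume i [simp]: "i \<in> I"
    note bp = splittingD(1)[OF pa]
    note [simp] = biproduct_simps[OF bp[OF i]] biproduct_arr[OF bp[OF nx_I[OF i]]] i1 i2
    have id: "j1 i \<bullet> q1 i \<boxplus> j2 i \<bullet> q2 i = Ident C (Dom C (\<alpha> i))" using bp[OF i] by (simp add: biproduct_def)
    have "\<psi> i \<bullet> (\<phi> i \<bullet> q2 i) = q2 i" using comp_rewrite[OF i1[OF i], of "q2 i"] by simp
    then have "biproduct C (Dom C (\<gamma> i)) (Dom C (\<mu>' i)) (Dom C (\<alpha> i)) (j1 i) (j2 i \<bullet> \<psi> i) (q1 i) (\<phi> i \<bullet> q2 i)"
      by (intro biproductI) (simp_all add: in_Hom comp_assoc id)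
    moreover have "\<phi> (nx i) \<bullet> (\<mu> i \<bullet> q2 i) = \<mu>' i \<bullet> (\<phi> i \<bullet> q2 i)" using comp_rewrite[OF nat(1)[OF i], of "q2 i"] by (simp add: comp_assoc)
    ultimately show "biproduct C (Dom C (\<gamma> i)) (Dom C (\<mu>' i)) (Dom C (\<alpha> i)) (j1 i) (j2 i \<bullet> \<psi> i) (q1 i) (\<phi> i \<bullet> q2 i) \<and>
      \<alpha> i \<bullet> j1 i = j1 (nx i) \<bullet> \<gamma> i \<and> \<alpha> i \<bullet> (j2 i \<bullet> \<psi> i) = j2 (nx i) \<bullet> \<psi> (nx i) \<bullet> \<mu>' i \<and>
      q1 (nx i) \<bullet> \<alpha> i = \<gamma> i \<bullet> q1 i \<and> \<phi> (nx i) \<bullet> q2 (nx i) \<bullet> \<alpha> i = \<mu>' i \<bullet> (\<phi> i \<bullet> q2 i)"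
      using splittingD(2-5)[OF pa i] splitting_comp(2)[OF sa pa i, of "\<psi> i"] by (simp add: comp_assoc nat(2))
  qed
  then show ?thesis using sa s by (intro direct_sumI)
qed

section \<open>Decomposition into discs and a minimal part\<close>

text \<open>
  Since both the inclusion and the retraction of \<open>\<delta>\<close> are morphisms, the off-diagonal blocks of \<open>\<alpha>\<close>
  vanish, and its remaining block is the complement.
\<close>

lemma split_off:
  assumes d: "\<delta> \<in> sequences" and a: "\<alpha> \<in> sequences"
    and bp: "\<And>i. i \<in> I \<Longrightarrow> biproduct C (Dom C (\<delta> i)) (B i) (Dom C (\<alpha> i)) (j1 i) (j2 i) (q1 i) (q2 i)"
    and j: "\<And>i. i \<in> I \<Longrightarrow> \<alpha> i \<bullet> j1 i = j1 (nx i) \<bullet> \<delta> i"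
    and q: "\<And>i. i \<in> I \<Longrightarrow> q1 (nx i) \<bullet> \<alpha> i = \<delta> i \<bullet> q1 i"
  shows "\<exists>\<beta>. direct_sum_seq \<delta> \<beta> \<alpha> \<and> (\<forall>i \<in> I. Dom C (\<beta> i) = B i)"
proof -
  note [simp] = seq_arr[OF d] seq_arr[OF a]
  define \<beta> where "\<beta> = restrict (\<lambda>i. q2 (nx i) \<bullet> (\<alpha> i \<bullet> j2 i)) I"
  have bps [simp]: "j1 i \<in> Ar C" "j2 i \<in> Ar C" "q1 i \<in> Ar C" "q2 i \<in> Ar C"
    "Dom C (j1 i) = Dom C (\<delta> i)" "Dom C (j2 i) = B i" "Dom C (q1 i) = Dom C (\<alpha> i)" "Dom C (q2 i) = Dom C (\<alpha> i)"
    "Cod C (j1 i) = Dom C (\<alpha> i)" "Cod C (j2 i) = Dom C (\<alpha> i)" "Cod C (q1 i) = Dom C (\<delta> i)" "Cod C (q2 i) = B i"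
    "B i \<in> Ob C"
    if "i \<in> I" for i using biproduct_arr[OF bp[OF that]] biproduct_Ob[OF bp[OF that]] by simp_all
  have eq: "\<beta> i = q2 (nx i) \<bullet> (\<alpha> i \<bullet> j2 i)" if "i \<in> I" for i using that by (simp add: \<beta>_def)
  have D: "Dom C (\<beta> i) = B i" if "i \<in> I" for i using that by (simp add: eq)
  have s: "\<beta> \<in> sequences" unfolding \<beta>_def by (rule sequencesI) simp_all
  have "splitting \<delta> \<beta> \<alpha> j1 j2 q1 q2" unfolding splitting_def
  proof (intro ballI conjI)
    fix i assume i [simp]: "i \<in> I"
    note b = bp[OF i] and b' = bp[OF nx_I[OF i]]
    show "biproduct C (Dom C (\<delta> i)) (Dom C (\<beta> i)) (Dom C (\<alpha> i)) (j1 i) (j2 i) (q1 i) (q2 i)" using b by (simp add: D)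
    show "\<alpha> i \<bullet> j1 i = j1 (nx i) \<bullet> \<delta> i" "q1 (nx i) \<bullet> \<alpha> i = \<delta> i \<bullet> q1 i" using j q by simp_all
    have "\<alpha> i \<bullet> j2 i = j1 (nx i) \<bullet> (q1 (nx i) \<bullet> (\<alpha> i \<bullet> j2 i)) \<boxplus> j2 (nx i) \<bullet> (q2 (nx i) \<bullet> (\<alpha> i \<bullet> j2 i))"
      by (simp add: biproduct_comp(5)[OF b'])
    also have "q1 (nx i) \<bullet> (\<alpha> i \<bullet> j2 i) = Null C (B i) (Dom C (\<delta> (nx i)))"
      using comp_rewrite[OF q[OF i], of "j2 i"] biproduct_arr(15)[OF b] by (simp add: comp_assoc)
    finally show "\<alpha> i \<bullet> j2 i = j2 (nx i) \<bullet> \<beta> i" by (simp add: eq)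
    have "q2 (nx i) \<bullet> \<alpha> i = (q2 (nx i) \<bullet> (\<alpha> i \<bullet> j1 i)) \<bullet> q1 i \<boxplus> (q2 (nx i) \<bullet> (\<alpha> i \<bullet> j2 i)) \<bullet> q2 i"
      using biproduct_comp(6)[OF b, of "q2 (nx i) \<bullet> \<alpha> i"] by (simp add: comp_assoc)
    also have "q2 (nx i) \<bullet> (\<alpha> i \<bullet> j1 i) = Null C (Dom C (\<delta> i)) (B (nx i))"
      unfolding j[OF i] by (simp add: biproduct_comp(4)[OF b'])
    finally show "q2 (nx i) \<bullet> \<alpha> i = \<beta> i \<bullet> q2 i" by (simp add: eq)
  qed
  then show ?thesis using direct_sumI[OF d s a] D by blast
qed

lemma candidate_summand:
  assumes "direct_sum_seq \<delta> \<beta> \<alpha>" "candidate_angle \<alpha>"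
  shows "candidate_angle \<beta>"
proof -
  obtain j1 j2 q1 q2 where sq: "\<delta> \<in> sequences" "\<beta> \<in> sequences" "\<alpha> \<in> sequences" and sp: "splitting \<delta> \<beta> \<alpha> j1 j2 q1 q2"
    using assms(1) by (rule direct_sumE)
  note [simp] = seq_arr[OF sq(2)] seq_arr[OF sq(3)]
  have "\<beta> (nx i) \<bullet> \<beta> i = Null C (Dom C (\<beta> i)) (Dom C (\<beta> (nx (nx i))))" if i [simp]: "i \<in> I" for i
  proof -
    note bp = splittingD(1)[OF sp]
    note [simp] = biproduct_simps[OF bp[OF i]] biproduct_simps[OF bp[OF nx_I[OF i]]] biproduct_simps[OF bp[OF nx_I[OF nx_I[OF i]]]]
    have 0: "\<alpha> (nx i) \<bullet> \<alpha> i = Null C (Dom C (\<alpha> i)) (Dom C (\<alpha> (nx (nx i))))" using assms(2) by (simp add: candidate_iff)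
    have "\<beta> (nx i) \<bullet> \<beta> i = \<beta> (nx i) \<bullet> (\<beta> i \<bullet> (q2 i \<bullet> j2 i))" by simp
    also have "\<dots> = q2 (nx (nx i)) \<bullet> ((\<alpha> (nx i) \<bullet> \<alpha> i) \<bullet> j2 i)"
      by (simp add: comp_assoc splitting_comp(4)[OF sq sp] del: biproduct_arr(14)[OF bp[OF i]])
    also have "\<dots> = Null C (Dom C (\<beta> i)) (Dom C (\<beta> (nx (nx i))))" unfolding 0 by simp
    finally show ?thesis .
  qed
  then show ?thesis using sq by (simp add: candidate_iff)
qed

text \<open>
  A unit entry of \<open>\<alpha>\<^sub>i\<close> consists of arrows \<open>e\<close> and \<open>g\<close> with \<open>g \<alpha>\<^sub>i e = 1\<close>. Then \<open>e\<close> and \<open>\<alpha>\<^sub>i e\<close>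
  include a disc, and \<open>g \<alpha>\<^sub>i\<close> and \<open>g\<close> retract onto it; that these are morphisms follows from the
  vanishing of composites.
\<close>

lemma split_disc:
  assumes Z: "zero_object C Z" and cand: "candidate_angle \<alpha>" and i [simp]: "i \<in> I" and nd: "\<not> divisible p (\<alpha> i)"
    and k: "\<And>l. l \<in> I \<Longrightarrow> free_of_rank C U (k l) (Dom C (\<alpha> l))"
  shows "\<exists>\<beta> k'. direct_sum_seq (disc i U Z) \<beta> \<alpha> \<and> (\<forall>l \<in> I. free_of_rank C U (k' l) (Dom C (\<beta> l))) \<and> sum k' I < sum k I"
proof -
  have a: "\<alpha> \<in> sequences" using cand by (simp add: candidate_iff)
  note [simp] = seq_arr[OF a]
  have Zo [simp]: "Z \<in> Ob C" using zero_objectD(1)[OF Z] .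
  have cc: "\<alpha> (nx l) \<bullet> \<alpha> l = Null C (Dom C (\<alpha> l)) (Dom C (\<alpha> (nx (nx l))))" if "l \<in> I" for l
    using cand that by (simp add: candidate_iff)
  obtain e g where eg: "e \<in> Hom C U (Dom C (\<alpha> i))" "g \<in> Hom C (Dom C (\<alpha> (nx i))) U" "g \<bullet> (\<alpha> i \<bullet> e) = Ident C U"
    using divisible_or_entry[of "\<alpha> i" "Dom C (\<alpha> i)" "Dom C (\<alpha> (nx i))"] nd by (auto simp: in_Hom)
  note [simp] = eg(1,2)[unfolded in_Hom]
  have h: "\<alpha> i \<bullet> e \<in> Hom C U (Dom C (\<alpha> (nx i)))" "g \<bullet> \<alpha> i \<in> Hom C (Dom C (\<alpha> i)) U" "(g \<bullet> \<alpha> i) \<bullet> e = Ident C U"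
    using eg(3) by (simp_all add: in_Hom comp_assoc)
  obtain k1 A1 ja qa where A1: "k1 < k i" "free_of_rank C U k1 A1" "biproduct C U A1 (Dom C (\<alpha> i)) e ja (g \<bullet> \<alpha> i) qa"
    using split_U[OF k[OF i] eg(1) h(2,3)] by blast
  obtain k2 A2 jb qb where A2: "k2 < k (nx i)" "free_of_rank C U k2 A2" "biproduct C U A2 (Dom C (\<alpha> (nx i))) (\<alpha> i \<bullet> e) jb g qb"
    using split_U[OF k[OF nx_I[OF i]] h(1) eg(2,3)] by blast
  define B where "B l = (if l = i then A1 else if l = nx i then A2 else Dom C (\<alpha> l))" for l
  define k' where "k' l = (if l = i then k1 else if l = nx i then k2 else k l)" for l
  define j1 where "j1 l = (if l = i then e else if l = nx i then \<alpha> i \<bullet> e else Null C Z (Dom C (\<alpha> l)))" for l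
  define j2 where "j2 l = (if l = i then ja else if l = nx i then jb else Ident C (Dom C (\<alpha> l)))" for l
  define q1 where "q1 l = (if l = i then g \<bullet> \<alpha> i else if l = nx i then g else Null C (Dom C (\<alpha> l)) Z)" for l
  define q2 where "q2 l = (if l = i then qa else if l = nx i then qb else Ident C (Dom C (\<alpha> l)))" for l
  note dD = disc_Dom[OF Z U_Ob]
  have bp: "biproduct C (Dom C (disc i U Z l)) (B l) (Dom C (\<alpha> l)) (j1 l) (j2 l) (q1 l) (q2 l)" if [simp]: "l \<in> I" for l
    using A1(3) A2(3) nx_neq[of i] zero_object_ident[OF Z]
    by (auto simp: dD B_def j1_def j2_def q1_def q2_def biproduct_def in_Hom)
  have j: "\<alpha> l \<bullet> j1 l = j1 (nx l) \<bullet> disc i U Z l" if l [simp]: "l \<in> I" for l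
  proof -
    consider "l = i" | "l = nx i" "l \<noteq> i" | "l \<noteq> nx i" "l \<noteq> i" by blast
    then show ?thesis
    proof cases
      case 1
      then show ?thesis using nx_neq[of i] by (simp add: j1_def disc_def)
    next
      case 2
      have "\<alpha> (nx i) \<bullet> (\<alpha> i \<bullet> e) = Null C U (Dom C (\<alpha> (nx (nx i))))"
        using comp_rewrite[OF cc[OF i], of e] by simp
      then show ?thesis using 2 nx_neq[of i] nx_neq[of "nx i"] by (auto simp: j1_def disc_def nx_inj)
    next
      case 3
      then show ?thesis using nx_inj[of l i] by (auto simp: j1_def disc_def)
    qed
  qed
  have q: "q1 (nx l) \<bullet> \<alpha> l = disc i U Z l \<bullet> q1 l" if l [simp]: "l \<in> I" for l
  proof -
    consider "l = i" | "nx l = i" "l \<noteq> i" | "nx l \<noteq> i" "l \<noteq> i" by blast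
    then show ?thesis
    proof cases
      case 1
      then show ?thesis using nx_neq[of i] by (simp add: q1_def disc_def)
    next
      case 2
      have "(g \<bullet> \<alpha> i) \<bullet> \<alpha> l = g \<bullet> (\<alpha> (nx l) \<bullet> \<alpha> l)" using 2 by (simp add: comp_assoc)
      also have "\<dots> = Null C (Dom C (\<alpha> l)) U" unfolding cc[OF l] using 2 by simp
      finally have "(g \<bullet> \<alpha> i) \<bullet> \<alpha> l = Null C (Dom C (\<alpha> l)) U" .
      then show ?thesis using 2 nx_neq[of l] by (auto simp: q1_def disc_def)
    next
      case 3
      then show ?thesis using nx_inj[of l i] by (auto simp: q1_def disc_def)
    qed
  qed
  obtain \<beta> where \<beta>: "direct_sum_seq (disc i U Z) \<beta> \<alpha>" "\<And>l. l \<in> I \<Longrightarrow> Dom C (\<beta> l) = B l"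
    using split_off[OF disc(1)[OF Z U_Ob i] a bp j q] by blast
  have "\<forall>l \<in> I. free_of_rank C U (k' l) (Dom C (\<beta> l))"
    using k A1(2) A2(2) by (auto simp: \<beta>(2) B_def k'_def)
  moreover have "sum k' I < sum k I"
    using A1(1) A2(1) i by (intro sum_strict_mono_ex1) (auto simp: k'_def I_def intro: less_imp_le intro!: bexI[of _ i])
  ultimately show ?thesis using \<beta>(1) by blast
qed

text \<open>
  Discs are split off until no unit entry is left; the total rank bounds their number. The class
  \<open>K\<close> is a parameter because the first summand is needed once as a contractible candidate and
  once as a member of a given angulation.
\<close>

theorem decomposition:
  assumes cand: "candidate_angle \<alpha>"
    and zero: "\<And>Z. zero_object C Z \<Longrightarrow> K (zero_seq Z)"
    and disc: "\<And>Z i. zero_object C Z \<Longrightarrow> i \<in> I \<Longrightarrow> K (disc i U Z)"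
    and sum: "\<And>\<alpha> \<beta> \<gamma>. K \<alpha> \<Longrightarrow> K \<beta> \<Longrightarrow> direct_sum_seq \<alpha> \<beta> \<gamma> \<Longrightarrow> K \<gamma>"
  shows "\<exists>\<gamma> \<mu>. K \<gamma> \<and> direct_sum_seq \<gamma> \<mu> \<alpha> \<and> (\<forall>i \<in> I. divisible p (\<mu> i))"
proof -
  obtain Z where Z: "zero_object C Z" using ex_zero_object by blast
  have "\<exists>\<gamma> \<mu>. K \<gamma> \<and> direct_sum_seq \<gamma> \<mu> \<alpha> \<and> (\<forall>i \<in> I. divisible p (\<mu> i))"
    if "candidate_angle \<alpha>" "\<forall>i \<in> I. free_of_rank C U (k i) (Dom C (\<alpha> i))" "m = sum k I" for \<alpha> k m
    using that
  proof (induction m arbitrary: \<alpha> k rule: less_induct)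
    case (less m)
    show ?case
    proof (cases "\<forall>i \<in> I. divisible p (\<alpha> i)")
      case True
      have "\<alpha> \<in> sequences" using less.prems(1) by (simp add: candidate_iff)
      then show ?thesis using zero[OF Z] zero_sum[OF Z] True by blast
    next
      case False
      then obtain i where i: "i \<in> I" "\<not> divisible p (\<alpha> i)" by blast
      obtain \<beta> k' where b: "direct_sum_seq (disc i U Z) \<beta> \<alpha>" "\<forall>l \<in> I. free_of_rank C U (k' l) (Dom C (\<beta> l))" "sum k' I < sum k I"
        using split_disc[OF Z less.prems(1) i] less.prems(2) by blast
      have "sum k' I < m" using b(3) less.prems(3) by simp
      from less.IH[OF this candidate_summand[OF b(1) less.prems(1)] b(2) refl]
      obtain \<gamma> \<mu> where g: "K \<gamma>" "direct_sum_seq \<gamma> \<mu> \<beta>" "\<forall>i \<in> I. divisible p (\<mu> i)" by blast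
      then obtain \<epsilon> where "direct_sum_seq (disc i U Z) \<gamma> \<epsilon>" "direct_sum_seq \<epsilon> \<mu> \<alpha>"
        using direct_sum_assoc[OF b(1)] by blast
      then show ?thesis using sum[OF disc[OF Z i(1)] g(1)] g(3) by blast
    qed
  qed
  moreover have "\<forall>i \<in> I. \<exists>k. free_of_rank C U k (Dom C (\<alpha> i))"
    using cand free by (auto simp: candidate_iff seq_arr)
  then obtain k where "\<forall>i \<in> I. free_of_rank C U (k i) (Dom C (\<alpha> i))" by (rule bchoice[THEN exE])
  ultimately show ?thesis using cand by blast
qed

lemma divisible_family:
  assumes s: "\<mu> \<in> sequences" and d: "\<forall>i \<in> I. divisible p (\<mu> i)"
  obtains a where "\<And>i. i \<in> I \<Longrightarrow> a i \<in> Hom C (Dom C (\<mu> i)) (Dom C (\<mu> (nx i)))" "\<And>i. i \<in> I \<Longrightarrow> \<mu> i = p \<star> a i"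
proof -
  have "\<forall>i \<in> I. \<exists>g. g \<in> Hom C (Dom C (\<mu> i)) (Dom C (\<mu> (nx i))) \<and> \<mu> i = p \<star> g"
  proof
    fix i assume i: "i \<in> I"
    then have "divisible p (\<mu> i)" using d by blast
    then show "\<exists>g. g \<in> Hom C (Dom C (\<mu> i)) (Dom C (\<mu> (nx i))) \<and> \<mu> i = p \<star> g"
      unfolding divisible_def seq_arr(2)[OF s i] by blast
  qed
  then obtain a where a: "\<forall>i \<in> I. a i \<in> Hom C (Dom C (\<mu> i)) (Dom C (\<mu> (nx i))) \<and> \<mu> i = p \<star> a i"
    by (rule bchoice[THEN exE])
  show ?thesis by (rule that[of a]) (use a in blast)+
qed

text \<open>
  The arrow \<open>\<mu>\<^bsub>i+1\<^esub>\<close> annihilates \<open>p 1\<close>, so exactness gives \<open>p 1 = \<mu>\<^sub>i y = p a\<^sub>i y\<close>. Hence \<open>a\<^sub>i\<close> has a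
  right inverse modulo \<open>p\<close>, and therefore a right inverse. A left inverse is found dually.
\<close>

lemma minimal_exact_iso:
  assumes ex: "exact \<mu>" and a: "\<And>i. i \<in> I \<Longrightarrow> a i \<in> Hom C (Dom C (\<mu> i)) (Dom C (\<mu> (nx i)))"
    and \<mu>: "\<And>i. i \<in> I \<Longrightarrow> \<mu> i = p \<star> a i" and i [simp]: "i \<in> I"
  shows "iso_arrow C (a i)"
proof -
  note s = exactD(1)[OF ex i]
  note [simp] = seq_arr[OF s]
  have [simp]: "a i \<in> Ar C" "Dom C (a i) = Dom C (\<mu> i)" "Cod C (a i) = Dom C (\<mu> (nx i))" if "i \<in> I" for i
    using a[OF that] by (auto simp: in_Hom)
  have 1: "p \<star> Ident C (Dom C (\<mu> (nx i))) \<in> Hom C (Dom C (\<mu> (nx i))) (Dom C (\<mu> (nx i)))" by (simp add: in_Hom)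
  have "\<mu> (nx i) \<bullet> p \<star> Ident C (Dom C (\<mu> (nx i))) = p \<star> \<mu> (nx i)" by (simp add: sm_comp)
  also have "\<dots> = p \<star> p \<star> a (nx i)" by (simp only: \<mu>[OF nx_I[OF i]])
  also have "\<dots> = Null C (Dom C (\<mu> (nx i))) (Dom C (\<mu> (nx (nx i))))" by simp
  finally obtain y where y: "y \<in> Hom C (Dom C (\<mu> (nx i))) (Dom C (\<mu> i))" "p \<star> Ident C (Dom C (\<mu> (nx i))) = \<mu> i \<bullet> y"
    by (rule exact_kernelE[OF ex i 1])
  note [simp] = y(1)[unfolded in_Hom]
  have "p \<star> (a i \<bullet> y) = (p \<star> a i) \<bullet> y" by (simp add: sm_comp)
  also have "\<dots> = p \<star> Ident C (Dom C (\<mu> (nx i)))" unfolding y(2) by (simp only: \<mu>[OF i])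
  finally obtain r where r: "r \<in> Hom C (Dom C (\<mu> (nx i))) (Dom C (\<mu> i))" "a i \<bullet> r = Ident C (Dom C (\<mu> (nx i)))"
    using right_inverse_mod_p[OF a[OF i] y(1)] by blast
  obtain k where k [simp]: "k \<in> I" and ik: "i = nx k" using nx_surj[OF i] by auto
  have 1: "p \<star> Ident C (Dom C (\<mu> (nx k))) \<in> Hom C (Dom C (\<mu> (nx k))) (Dom C (\<mu> (nx k)))" by (simp add: in_Hom)
  have "p \<star> Ident C (Dom C (\<mu> (nx k))) \<bullet> \<mu> k = p \<star> \<mu> k" by (simp add: sm_comp)
  also have "\<dots> = p \<star> p \<star> a k" by (simp only: \<mu>[OF k])
  also have "\<dots> = Null C (Dom C (\<mu> k)) (Dom C (\<mu> (nx k)))" by simp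
  finally obtain z where z: "z \<in> Hom C (Dom C (\<mu> (nx (nx k)))) (Dom C (\<mu> (nx k)))" "p \<star> Ident C (Dom C (\<mu> (nx k))) = z \<bullet> \<mu> (nx k)"
    by (rule exact_cokernelE[OF ex k 1])
  note z = z[folded ik]
  note [simp] = z(1)[unfolded in_Hom]
  have "p \<star> (z \<bullet> a i) = z \<bullet> p \<star> a i" by (simp add: sm_comp)
  also have "\<dots> = p \<star> Ident C (Dom C (\<mu> i))" unfolding z(2) by (simp only: \<mu>[OF i])
  finally obtain l where l: "l \<in> Hom C (Dom C (\<mu> (nx i))) (Dom C (\<mu> i))" "l \<bullet> a i = Ident C (Dom C (\<mu> i))"
    using left_inverse_mod_p[OF a[OF i] z(1)] by blast
  show ?thesis by (rule iso_arrowI[OF a[OF i] r(1) l(1) r(2) l(2)])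
qed

lemma iso_arrow_comp:
  assumes f: "iso_arrow C f" and g: "iso_arrow C g" and fg: "Dom C g = Cod C f"
  shows "iso_arrow C (g \<bullet> f)"
proof -
  obtain f' where f': "f \<in> Ar C" "f' \<in> Hom C (Cod C f) (Dom C f)" "f' \<bullet> f = Ident C (Dom C f)" "f \<bullet> f' = Ident C (Cod C f)"
    using f by (auto simp: iso_arrow_def)
  obtain g' where g': "g \<in> Ar C" "g' \<in> Hom C (Cod C g) (Dom C g)" "g' \<bullet> g = Ident C (Dom C g)" "g \<bullet> g' = Ident C (Cod C g)"
    using g by (auto simp: iso_arrow_def)
  note [simp] = f'(1) g'(1) f'(2)[unfolded in_Hom] g'(2)[unfolded in_Hom] fg
  have "g' \<bullet> (g \<bullet> f) = f" using comp_rewrite[OF g'(3), of f] by simp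
  then have 1: "f' \<bullet> g' \<bullet> (g \<bullet> f) = Ident C (Dom C f)" using f'(3) by (simp add: comp_assoc)
  have "f \<bullet> (f' \<bullet> g') = g'" using comp_rewrite[OF f'(4), of g'] by simp
  then have 2: "g \<bullet> f \<bullet> (f' \<bullet> g') = Ident C (Cod C g)" using g'(4) by (simp add: comp_assoc)
  have "f' \<bullet> g' \<in> Hom C (Cod C (g \<bullet> f)) (Dom C (g \<bullet> f))" by (simp add: in_Hom)
  with 1 2 show ?thesis unfolding iso_arrow_def by auto
qed

lemma twisted:
  assumes t: "t \<in> Hom C M M"
  shows "twisted t \<in> sequences" "i \<in> I \<Longrightarrow> Dom C (twisted t i) = M" "twisted t 1 = p \<star> t"
    "i \<in> I \<Longrightarrow> i \<noteq> 1 \<Longrightarrow> twisted t i = p \<star> Ident C M"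
  using t Hom_Ob[OF t] by (simp_all add: sequences_iff) (auto simp: twisted_def in_Hom)

text \<open>
  Transporting all objects of \<open>(p a\<^sub>i)\<close> to the first one along the \<open>a\<^sub>i\<close> concentrates the
  composite \<open>a\<^sub>n \<cdots> a\<^sub>1\<close> in the first arrow.
\<close>

lemma minimal_twisted:
  assumes s: "\<mu> \<in> sequences" and a: "\<And>i. i \<in> I \<Longrightarrow> a i \<in> Hom C (Dom C (\<mu> i)) (Dom C (\<mu> (nx i)))"
    and \<mu>: "\<And>i. i \<in> I \<Longrightarrow> \<mu> i = p \<star> a i" and iso: "\<And>i. i \<in> I \<Longrightarrow> iso_arrow C (a i)"
  shows "\<exists>t \<in> Hom C (Dom C (\<mu> 1)) (Dom C (\<mu> 1)). iso_arrow C t \<and> isomorphic_seqs \<mu> (twisted t)"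
proof -
  note [simp] = seq_arr[OF s]
  let ?M = "Dom C (\<mu> (Suc 0))"
  have [simp]: "a i \<in> Ar C" "Dom C (a i) = Dom C (\<mu> i)" "Cod C (a i) = Dom C (\<mu> (nx i))" if "i \<in> I" for i
    using a[OF that] by (auto simp: in_Hom)
  define \<psi> where "\<psi> = rec_nat (a n) (\<lambda>k f. f \<bullet> a (n - Suc k))"
  have \<psi>0: "\<psi> 0 = a n" and \<psi>S: "\<psi> (Suc k) = \<psi> k \<bullet> a (n - Suc k)" for k by (simp_all add: \<psi>_def)
  have \<psi>: "\<psi> k \<in> Hom C (Dom C (\<mu> (n - k))) ?M \<and> iso_arrow C (\<psi> k)" if "k < n" for k
    using that
  proof (induction k)
    case 0
    then show ?case using iso[of n] by (simp add: \<psi>0 in_Hom)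
  next
    case (Suc k)
    then have IH: "\<psi> k \<in> Hom C (Dom C (\<mu> (n - k))) ?M" "iso_arrow C (\<psi> k)" by simp_all
    have [simp]: "n - Suc k \<in> I" "nx (n - Suc k) = n - k" using Suc.prems by (auto simp: I_def nx_def)
    show ?case using IH iso[of "n - Suc k"] unfolding \<psi>S by (auto simp: in_Hom intro: iso_arrow_comp)
  qed
  define \<phi>' where "\<phi>' i = \<psi> (n - i)" for i
  have \<phi>': "\<phi>' i \<in> Hom C (Dom C (\<mu> i)) ?M" "iso_arrow C (\<phi>' i)" if "i \<in> I" for i
    using \<psi>[of "n - i"] that by (auto simp: \<phi>'_def I_def)
  have step: "\<phi>' (Suc i) \<bullet> a i = \<phi>' i" if "i \<in> I" "i < n" for i
    using \<psi>S[of "n - Suc i"] that by (simp add: \<phi>'_def I_def Suc_diff_Suc)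
  note t = \<phi>'[OF I_simps(1)]
  note tw = twisted[OF t(1)]
  define \<phi> where "\<phi> i = (if i = 1 then Ident C ?M else \<phi>' i)" for i
  have [simp]: "\<phi>' i \<in> Ar C" "Dom C (\<phi>' i) = Dom C (\<mu> i)" "Cod C (\<phi>' i) = ?M" if "i \<in> I" for i
    using \<phi>'(1)[OF that] by (auto simp: in_Hom)
  have M: "?M \<in> Ob C" by simp
  have "seq_morphism \<mu> (twisted (\<phi>' 1)) \<phi>" unfolding seq_morphism_iff
  proof (intro ballI conjI)
    fix i assume i [simp]: "i \<in> I"
    show "\<phi> i \<in> Hom C (Dom C (\<mu> i)) (Dom C (twisted (\<phi>' 1) i))" using \<phi>'(1)[OF i] M by (simp add: tw(2) \<phi>_def in_Hom)
    consider "i = 1" | "i \<noteq> 1" "i < n" | "i = n" "i \<noteq> 1" using I_less[OF i] by blast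
    then show "\<phi> (nx i) \<bullet> \<mu> i = twisted (\<phi>' 1) i \<bullet> \<phi> i"
    proof cases
      case 1
      have "\<phi>' 2 \<bullet> \<mu> 1 = p \<star> (\<phi>' 2 \<bullet> a 1)" by (subst \<mu>) (simp_all add: sm_comp)
      also have "\<phi>' 2 \<bullet> a 1 = \<phi>' 1" using step[of 1] n_ge_3 by (simp add: numeral_2_eq_2)
      finally show ?thesis using 1 tw(3) by (simp add: \<phi>_def)
    next
      case 2
      have "\<phi>' (Suc i) \<bullet> \<mu> i = p \<star> (\<phi>' (Suc i) \<bullet> a i)" using 2 by (subst \<mu>) (simp_all add: sm_comp)
      then have "\<phi>' (Suc i) \<bullet> \<mu> i = p \<star> \<phi>' i" using 2 by (simp add: step)
      moreover have "Suc i \<noteq> 1" using i by (auto simp: I_def)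
      ultimately show ?thesis using 2 tw(4)[OF i] M by (simp add: \<phi>_def sm_comp)
    next
      case 3
      then show ?thesis using tw(4)[OF i] M \<mu>[OF i] by (simp add: \<phi>_def sm_comp \<phi>'_def \<psi>0)
    qed
  qed
  moreover have "iso_arrow C (Ident C ?M)" by (rule iso_arrowI[of _ ?M ?M "Ident C ?M" "Ident C ?M"]) (simp_all add: in_Hom)
  then have "\<forall>i \<in> I. iso_arrow C (\<phi> i)" using \<phi>'(2) by (simp add: \<phi>_def)
  ultimately have "isomorphic_seqs \<mu> (twisted (\<phi>' 1))" unfolding isomorphic_seqs_def I_def[symmetric] by blast
  then show ?thesis using t by auto
qed

lemma twisted_cong: "p \<star> t = p \<star> t' \<Longrightarrow> Dom C t = Dom C t' \<Longrightarrow> twisted t = twisted t'"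
  unfolding twisted_def by (rule restrict_ext) auto

text \<open>The monodromy is evaluated on the chain \<open>1, t, \<dots>, t\<close>.\<close>

lemma monodromy_twisted:
  assumes u: "u \<in> carrier R" and t: "t \<in> Hom C M M" and m: "monodromy u (twisted t)"
  shows "p \<star> t = p \<star> u \<star> Ident C M" "twisted t = periodic u M"
proof -
  note tw = twisted[OF t] and [simp] = t[unfolded in_Hom] Hom_Ob[OF t] u
  define x where "x i = (if i = (1::nat) then Ident C M else t)" for i
  obtain y where y: "y \<in> Hom C M (Dom C (twisted t n))" "twisted t n \<bullet> x n = p \<star> (u \<star> x 1 \<boxplus> twisted t n \<bullet> y)"
  proof (rule monodromyE[OF m])
    show "x i \<in> Hom C M (Dom C (twisted t i))" if "i \<in> I" for i using that by (simp add: x_def in_Hom tw(2))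
    show "twisted t i \<bullet> x i = p \<star> x (Suc i)" if i: "i \<in> I" "i < n" for i
    proof (cases "i = 1")
      case True
      then show ?thesis using tw(3) by (simp add: x_def)
    next
      case False
      moreover have "i \<noteq> 0" using i by (auto simp: I_def)
      ultimately show ?thesis using tw(4)[OF i(1)] by (simp add: x_def sm_comp)
    qed
  qed blast
  have [simp]: "y \<in> Ar C" "Dom C y = M" "Cod C y = M" using y(1) by (auto simp: in_Hom tw(2))
  have n: "twisted t n = p \<star> Ident C M" "x n = t" using tw(4)[of n] n_ge_3 by (simp_all add: x_def)
  have "p \<star> t = twisted t n \<bullet> x n" unfolding n by (simp add: sm_comp)
  also have "\<dots> = p \<star> u \<star> Ident C M" unfolding y(2) unfolding n by (simp add: linear_simps x_def)
  finally show *: "p \<star> t = p \<star> u \<star> Ident C M" .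
  show "twisted t = periodic u M" unfolding periodic_def by (rule twisted_cong[OF *]) simp
qed

text \<open>Kernel and image of \<open>p\<close>, on elements and on coelements, both consist of the multiples of \<open>p\<close>.\<close>

lemma exact_pair_p:
  assumes uv: "u \<in> Units R" "v \<in> Units R" and F: "F \<in> Ob C"
  shows "exact_pair (p \<star> u \<star> Ident C F) (p \<star> v \<star> Ident C F)"
proof -
  have [simp]: "u \<in> carrier R" "v \<in> carrier R" "inv\<^bsub>R\<^esub> u \<in> carrier R" "inv\<^bsub>R\<^esub> v \<in> carrier R" using uv by (auto simp: Units_closed)
  note [simp] = F
  have *: "divisible p x" if x: "x \<in> Ar C" "p \<star> w \<star> x = Null C (Dom C x) (Cod C x)" and w: "w \<in> Units R" for x w
  proof -
    have [simp]: "w \<in> carrier R" "inv\<^bsub>R\<^esub> w \<in> carrier R" using w by (auto simp: Units_closed)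
    note [simp] = x(1)
    have "p \<star> x = inv\<^bsub>R\<^esub> w \<star> p \<star> w \<star> x" using w by (simp add: sm_left_comm[of "inv\<^bsub>R\<^esub> w" p] unit_sm_cancel)
    also have "\<dots> = Null C (Dom C x) (Cod C x)" unfolding x(2) by simp
    finally show ?thesis by (intro p_annihilator) simp_all
  qed
  show ?thesis unfolding exact_pair_def
  proof (intro conjI allI ballI impI)
    show "p \<star> v \<star> Ident C F \<bullet> p \<star> u \<star> Ident C F = Null C (Dom C (p \<star> u \<star> Ident C F)) (Cod C (p \<star> v \<star> Ident C F))"
      by (simp add: sm_comp sm_left_comm[of v p])
  next
    fix W x assume x: "x \<in> Hom C W (Dom C (p \<star> v \<star> Ident C F))"
      and 0: "p \<star> v \<star> Ident C F \<bullet> x = Null C W (Cod C (p \<star> v \<star> Ident C F))"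
    have [simp]: "x \<in> Ar C" "Dom C x = W" "Cod C x = F" using x by (auto simp: in_Hom)
    have "p \<star> v \<star> x = Null C (Dom C x) (Cod C x)" using 0 by (simp add: sm_comp)
    then have "divisible p x" by (rule *[rotated]) (use uv in simp_all)
    then obtain y where y: "y \<in> Ar C" "Dom C y = Dom C x" "Cod C y = Cod C x" "x = p \<star> y" by (rule divisibleE)
    from y(1-3) have [simp]: "y \<in> Ar C" "Dom C y = W" "Cod C y = F" by simp_all
    have "x = p \<star> u \<star> Ident C F \<bullet> (inv\<^bsub>R\<^esub> u \<star> y)" unfolding y(4) using uv(1) by (simp add: sm_comp unit_sm_cancel sm_left_comm[of "inv\<^bsub>R\<^esub> u"])
    then show "\<exists>y \<in> Hom C W (Dom C (p \<star> u \<star> Ident C F)). x = p \<star> u \<star> Ident C F \<bullet> y"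
      by (intro bexI[of _ "inv\<^bsub>R\<^esub> u \<star> y"]) (simp_all add: in_Hom)
  next
    fix W x assume x: "x \<in> Hom C (Dom C (p \<star> v \<star> Ident C F)) W"
      and 0: "x \<bullet> p \<star> u \<star> Ident C F = Null C (Dom C (p \<star> u \<star> Ident C F)) W"
    have [simp]: "x \<in> Ar C" "Dom C x = F" "Cod C x = W" using x by (auto simp: in_Hom)
    have "p \<star> u \<star> x = Null C (Dom C x) (Cod C x)" using 0 by (simp add: sm_comp)
    then have "divisible p x" by (rule *[rotated]) (use uv in simp_all)
    then obtain y where y: "y \<in> Ar C" "Dom C y = Dom C x" "Cod C y = Cod C x" "x = p \<star> y" by (rule divisibleE)
    from y(1-3) have [simp]: "y \<in> Ar C" "Dom C y = F" "Cod C y = W" by simp_all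
    have "x = (inv\<^bsub>R\<^esub> v \<star> y) \<bullet> p \<star> v \<star> Ident C F" unfolding y(4) using uv(2) by (simp add: sm_comp unit_sm_cancel sm_left_comm[of "inv\<^bsub>R\<^esub> v"])
    then show "\<exists>y \<in> Hom C (Cod C (p \<star> v \<star> Ident C F)) W. x = y \<bullet> p \<star> v \<star> Ident C F"
      by (intro bexI[of _ "inv\<^bsub>R\<^esub> v \<star> y"]) (simp_all add: in_Hom)
  qed
qed

text \<open>A chain satisfies \<open>p u x\<^sub>1 = p x\<^sub>2 = \<dots> = p x\<^sub>n\<close>.\<close>

lemma angle_periodic:
  assumes u: "u \<in> Units R" and F: "F \<in> Ob C"
  shows "angle u (periodic u F)"
proof -
  have [simp]: "u \<in> carrier R" using u by (rule Units_closed)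
  note [simp] = F
  have t: "u \<star> Ident C F \<in> Hom C F F" by (simp add: in_Hom)
  note tw = twisted[OF t, folded periodic_def]
  have "exact_pair (periodic u F i) (periodic u F (nx i))" if i: "i \<in> I" for i
  proof -
    have "\<exists>v \<in> Units R. periodic u F k = p \<star> v \<star> Ident C F" if "k \<in> I" for k
    proof (cases "k = 1")
      case True
      then show ?thesis using u tw(3) by blast
    next
      case False
      then have "periodic u F k = p \<star> \<one>\<^bsub>R\<^esub> \<star> Ident C F" using tw(4)[OF that] by simp
      then show ?thesis using Units_one_closed by blast
    qed
    then show ?thesis using exact_pair_p[OF _ _ F] i nx_I by metis
  qed
  then have "exact (periodic u F)" using tw(1) by (simp add: exact_iff)
  moreover have "monodromy u (periodic u F)" unfolding monodromy_def
  proof (intro allI impI, elim conjE)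
    fix W x assume x: "\<forall>i \<in> I. x i \<in> Hom C W (Dom C (periodic u F i))" and px: "\<forall>i \<in> I. i < n \<longrightarrow> periodic u F i \<bullet> x i = p \<star> x (Suc i)"
    have [simp]: "x i \<in> Ar C" "Dom C (x i) = W" "Cod C (x i) = F" if "i \<in> I" for i
      using x that tw(2) by (auto simp: in_Hom)
    have W [simp]: "W \<in> Ob C" using Hom_Ob[of "x 1" W F] by (simp add: in_Hom)
    have "p \<star> x (Suc k) = p \<star> u \<star> x 1" if "1 \<le> k" "k < n" for k
      using that
    proof (induction k rule: dec_induct)
      case base
      have "p \<star> x (Suc 1) = periodic u F 1 \<bullet> x 1" using px n_ge_3 by simp
      then show ?case unfolding tw(3) by (simp add: sm_comp)
    next
      case (step k)
      then have k: "Suc k \<in> I" "Suc k \<noteq> 1" by (auto simp: I_def)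
      have "p \<star> x (Suc (Suc k)) = periodic u F (Suc k) \<bullet> x (Suc k)" using px k step by simp
      also have "\<dots> = p \<star> x (Suc k)" unfolding tw(4)[OF k] using k by (simp add: sm_comp)
      finally show ?case using step by simp
    qed
    from this[of "n - 1"] have 1: "p \<star> x n = p \<star> u \<star> x 1" using n_ge_3 by simp
    have n: "periodic u F n = p \<star> Ident C F" using tw(4)[of n] n_ge_3 by simp
    have "periodic u F n \<bullet> x n = p \<star> x n" unfolding n by (simp add: sm_comp)
    also have "\<dots> = p \<star> (u \<star> x 1 \<boxplus> periodic u F n \<bullet> Null C W F)" unfolding 1 n by simp
    finally show "\<exists>y \<in> Hom C W (Dom C (periodic u F n)). periodic u F n \<bullet> x n = p \<star> (u \<star> x 1 \<boxplus> periodic u F n \<bullet> y)"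
      by (intro bexI[of _ "Null C W F"]) (simp_all add: in_Hom tw(2))
  qed
  ultimately show ?thesis by (simp add: angle_def)
qed

text \<open>The part without unit entries inherits exactness, so that its arrows are \<open>p\<close> times isomorphisms.\<close>

theorem exact_decomposition:
  assumes ex: "exact \<alpha>"
  obtains \<gamma> M t where "candidate_angle \<gamma>" "contractible \<gamma>" "t \<in> Hom C M M" "iso_arrow C t"
    "direct_sum_seq \<gamma> (twisted t) \<alpha>"
proof -
  have cand: "candidate_angle \<alpha>" using ex by (simp add: exact_def)
  obtain \<gamma> \<mu> where g: "candidate_angle \<gamma>" "contractible \<gamma>" and s: "direct_sum_seq \<gamma> \<mu> \<alpha>" and d: "\<forall>i \<in> I. divisible p (\<mu> i)"
    using decomposition[OF cand, of "\<lambda>\<gamma>. candidate_angle \<gamma> \<and> contractible \<gamma>"]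
      zero_seq(2,3) disc(2,3)[OF _ U_Ob] candidate_sum contractible_sum by blast
  have am: "exact \<mu>" and sm: "\<mu> \<in> sequences"
    using exact_summand[OF s ex] by (auto simp: exact_iff)
  obtain a where a: "\<And>i. i \<in> I \<Longrightarrow> a i \<in> Hom C (Dom C (\<mu> i)) (Dom C (\<mu> (nx i)))" "\<And>i. i \<in> I \<Longrightarrow> \<mu> i = p \<star> a i"
    using divisible_family[OF sm d] by blast
  obtain t where t: "t \<in> Hom C (Dom C (\<mu> 1)) (Dom C (\<mu> 1))" "iso_arrow C t" "isomorphic_seqs \<mu> (twisted t)"
    using minimal_twisted[OF sm a minimal_exact_iso[OF am a]] by blast
  show ?thesis using that[OF g t(1,2) direct_sum_iso_right[OF s twisted(1)[OF t(1)] t(3)]] .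
qed

text \<open>
  The monodromy of an exact sequence is that of its summand \<open>(p t, p, \<dots>, p)\<close>, which is \<open>t\<close> modulo
  \<open>p\<close>. It is multiplication by \<open>u\<close> only if this summand equals \<open>F\<^sub>u(p)\<close>.
\<close>

theorem angle_iff:
  assumes u: "u \<in> Units R"
  shows "angle u \<alpha> \<longleftrightarrow> (\<exists>\<gamma> F. candidate_angle \<gamma> \<and> contractible \<gamma> \<and> F \<in> Ob C \<and> direct_sum_seq \<gamma> (periodic u F) \<alpha>)"
proof
  have u' [simp]: "u \<in> carrier R" using u by (rule Units_closed)
  show "angle u \<alpha>" if "\<exists>\<gamma> F. candidate_angle \<gamma> \<and> contractible \<gamma> \<and> F \<in> Ob C \<and> direct_sum_seq \<gamma> (periodic u F) \<alpha>"
    using that angle_sum[OF u'] angle_contractible[OF u'] angle_periodic[OF u] by blast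
  assume a: "angle u \<alpha>"
  then have ex: "exact \<alpha>" by (simp add: angle_def)
  obtain \<gamma> M t where g: "candidate_angle \<gamma>" "contractible \<gamma>" and t: "t \<in> Hom C M M"
    and s: "direct_sum_seq \<gamma> (twisted t) \<alpha>" by (rule exact_decomposition[OF ex])
  have "monodromy u (twisted t)" using angle_summand(2)[OF u' s a] by (simp add: angle_def)
  then have "twisted t = periodic u M" by (rule monodromy_twisted(2)[OF u' t])
  then show "\<exists>\<gamma> F. candidate_angle \<gamma> \<and> contractible \<gamma> \<and> F \<in> Ob C \<and> direct_sum_seq \<gamma> (periodic u F) \<alpha>"
    using g s Hom_Ob[OF t] by auto
qed

theorem angle_iff_isomorphic:
  assumes u: "u \<in> Units R"
  shows "angle u \<alpha> \<longleftrightarrow> \<alpha> \<in> sequences \<and>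
    (\<exists>\<gamma> F \<delta>. candidate_angle \<gamma> \<and> contractible \<gamma> \<and> F \<in> Ob C \<and>
      direct_sum_seq \<gamma> (periodic u F) \<delta> \<and> isomorphic_seqs \<alpha> \<delta>)" (is "_ \<longleftrightarrow> ?R")
proof
  assume a: "angle u \<alpha>"
  then have s: "\<alpha> \<in> sequences" by (simp add: angle_def exact_iff)
  note [simp] = seq_arr[OF s]
  have "iso_arrow C (Ident C (Dom C (\<alpha> i)))" if "i \<in> I" for i
    by (rule iso_arrowI[of _ "Dom C (\<alpha> i)" "Dom C (\<alpha> i)" "Ident C (Dom C (\<alpha> i))" "Ident C (Dom C (\<alpha> i))"]) (use that in \<open>simp_all add: in_Hom\<close>)
  moreover have "seq_morphism \<alpha> \<alpha> (\<lambda>i. Ident C (Dom C (\<alpha> i)))" by (simp add: seq_morphism_iff in_Hom)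
  ultimately have "isomorphic_seqs \<alpha> \<alpha>" unfolding isomorphic_seqs_def I_def[symmetric] by blast
  then show ?R using a s unfolding angle_iff[OF u] by blast
next
  assume ?R
  then obtain \<gamma> F \<delta> where s: "\<alpha> \<in> sequences" and d: "direct_sum_seq \<gamma> (periodic u F) \<delta>" "isomorphic_seqs \<alpha> \<delta>"
    and "candidate_angle \<gamma>" "contractible \<gamma>" "F \<in> Ob C" by blast
  then have \<delta>: "angle u \<delta>" unfolding angle_iff[OF u] by blast
  have "\<delta> \<in> sequences" using d(1) by (auto elim: direct_sumE)
  then obtain \<phi> \<psi> where "seq_morphism \<alpha> \<delta> \<phi>" "seq_morphism \<delta> \<alpha> \<psi>" "\<And>i. i \<in> I \<Longrightarrow> \<psi> i \<bullet> \<phi> i = Ident C (Dom C (\<alpha> i))"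
    using isomorphic_inverse[OF s _ d(2)] by metis
  then show "angle u \<alpha>" by (rule angle_retract[OF Units_closed[OF u] \<delta> s])
qed

section \<open>Rotations and first arrows\<close>

lemma neg_p:
  assumes "p \<oplus>\<^bsub>R\<^esub> p = \<zero>\<^bsub>R\<^esub>" "f \<in> Ar C"
  shows "Neg C (p \<star> f) = p \<star> f"
proof (rule neg_unique)
  show "p \<star> f \<boxplus> p \<star> f = Null C (Dom C (p \<star> f)) (Cod C (p \<star> f))"
    using assms(2) unfolding add_sm[OF p_closed p_closed assms(2), symmetric] by (simp add: assms(1))
qed (use assms(2) in simp_all)

lemma left_rotation_nx:
  "i \<in> I \<Longrightarrow> left_rotation \<alpha> i = (if i < n \<or> even n then \<alpha> (nx i) else Neg C (\<alpha> (nx i)))"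
  by (auto simp: left_rotation_def I_def nx_def)

lemma left_rotation_sequences:
  assumes s: "\<alpha> \<in> sequences"
  shows "left_rotation \<alpha> \<in> sequences" "i \<in> I \<Longrightarrow> Dom C (left_rotation \<alpha> i) = Dom C (\<alpha> (nx i))"
proof -
  note [simp] = seq_arr[OF s]
  show "i \<in> I \<Longrightarrow> Dom C (left_rotation \<alpha> i) = Dom C (\<alpha> (nx i))" by (simp add: left_rotation_nx)
  have "left_rotation \<alpha> \<in> extensional I" by (simp add: left_rotation_def I_def)
  then show "left_rotation \<alpha> \<in> sequences" by (simp add: sequences_iff left_rotation_nx)
qed

lemma exact_rotation:
  assumes s: "\<alpha> \<in> sequences"
  shows "exact (left_rotation \<alpha>) \<longleftrightarrow> exact \<alpha>"
proof -
  note [simp] = seq_arr[OF s]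
  have n: "exact_pair (Neg C f) g \<longleftrightarrow> exact_pair f g" "exact_pair f (Neg C g) \<longleftrightarrow> exact_pair f g"
    if "f \<in> Ar C" "g \<in> Ar C" "Dom C g = Cod C f" for f g
    by (metis that exact_pair_neg(1) neg_neg arr_Neg(1,3)) (metis that exact_pair_neg(2) neg_neg arr_Neg(1,2))
  have "exact_pair (left_rotation \<alpha> i) (left_rotation \<alpha> (nx i)) \<longleftrightarrow> exact_pair (\<alpha> (nx i)) (\<alpha> (nx (nx i)))"
    if "i \<in> I" for i using that by (simp add: left_rotation_nx n)
  then have "exact (left_rotation \<alpha>) \<longleftrightarrow> (\<forall>i \<in> I. exact_pair (\<alpha> (nx i)) (\<alpha> (nx (nx i))))"
    using left_rotation_sequences[OF s] by (simp add: exact_iff)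
  also have "\<dots> \<longleftrightarrow> (\<forall>i \<in> I. exact_pair (\<alpha> i) (\<alpha> (nx i)))" using nx_surj nx_I by metis
  finally show ?thesis using s by (simp add: exact_iff)
qed

lemma p_zero_divisible:
  assumes "divisible p f"
  shows "p \<star> f = Null C (Dom C f) (Cod C f)"
proof -
  obtain g where g: "g \<in> Ar C" "Dom C g = Dom C f" "Cod C g = Cod C f" "f = p \<star> g" using assms by (rule divisibleE)
  have "p \<star> f = p \<star> p \<star> g" using g(4) by (rule arg_cong)
  then show ?thesis using g(1-3) by simp
qed

text \<open>
  A chain for one of the two sequences is turned into one for the other by dropping its first
  member and appending a new last one, or conversely; exactness provides the new member. The sign of
  the last arrow of the rotation, present for odd \<open>n\<close>, is applied to multiples of \<open>p\<close> only,
  on which \<open>2 p = 0\<close> makes it trivial.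
\<close>

lemma angle_rotation:
  assumes u [simp]: "u \<in> carrier R" and par: "even n \<or> p \<oplus>\<^bsub>R\<^esub> p = \<zero>\<^bsub>R\<^esub>" and s: "\<alpha> \<in> sequences"
  shows "angle u (left_rotation \<alpha>) \<longleftrightarrow> angle u \<alpha>"
proof -
  note [simp] = seq_arr[OF s]
  note rs = left_rotation_sequences[OF s]
  note [simp] = seq_arr[OF rs(1)]
  define \<rho> where "\<rho> = left_rotation \<alpha>"
  have \<rho>: "\<rho> i = \<alpha> (Suc i)" if "i \<in> I" "i < n" for i using that by (simp add: \<rho>_def left_rotation_nx)
  have \<rho>D: "\<rho> i \<in> Ar C" "Dom C (\<rho> i) = Dom C (\<alpha> (nx i))" "Cod C (\<rho> i) = Dom C (\<alpha> (nx (nx i)))" if "i \<in> I" for i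
    using that rs by (simp_all add: \<rho>_def)
  \<comment> \<open>the sign of the last arrow is invisible on multiples of \<open>p\<close>\<close>
  have sgn: "\<rho> n \<bullet> f = \<alpha> 1 \<bullet> f" if f: "f \<in> Ar C" "Cod C f = Dom C (\<alpha> 1)" and d: "divisible p (\<alpha> 1 \<bullet> f)" for f
  proof (cases "even n")
    case True
    then show ?thesis by (simp add: \<rho>_def left_rotation_nx)
  next
    case False
    then have pp: "p \<oplus>\<^bsub>R\<^esub> p = \<zero>\<^bsub>R\<^esub>" using par by simp
    obtain g where g: "g \<in> Ar C" "\<alpha> 1 \<bullet> f = p \<star> g" using d by (rule divisibleE)
    have "\<rho> n \<bullet> f = Neg C (\<alpha> 1 \<bullet> f)" using False f by (simp add: \<rho>_def left_rotation_nx neg_comp)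
    also have "\<dots> = \<alpha> 1 \<bullet> f" unfolding g(2) by (rule neg_p[OF pp g(1)])
    finally show ?thesis .
  qed
  have psgn: "p \<star> (\<rho> n \<bullet> f) = p \<star> (\<alpha> 1 \<bullet> f)" if f: "f \<in> Ar C" "Cod C f = Dom C (\<alpha> 1)" for f
    using sgn[of "p \<star> f"] f divisibleI[of p "\<alpha> 1 \<bullet> f"] \<rho>D[of n] by (simp add: sm_comp)
  have "monodromy u \<rho> \<longleftrightarrow> monodromy u \<alpha>" if ex: "exact \<alpha>"
  proof
    assume m: "monodromy u \<alpha>"
    show "monodromy u \<rho>" unfolding monodromy_def
    proof (intro allI impI, elim conjE)
      fix W y assume y: "\<forall>i \<in> I. y i \<in> Hom C W (Dom C (\<rho> i))" and py: "\<forall>i \<in> I. i < n \<longrightarrow> \<rho> i \<bullet> y i = p \<star> y (Suc i)"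
      have [simp]: "y i \<in> Ar C" "Dom C (y i) = W" "Cod C (y i) = Dom C (\<alpha> (nx i))" if "i \<in> I" for i
        using y that by (auto simp: in_Hom \<rho>D)
      have [simp]: "W \<in> Ob C" using arr_Ob(1)[of "y 1"] by simp
      have "\<alpha> 2 \<bullet> y 1 = p \<star> y (Suc 1)" using py[rule_format, of 1] \<rho>[of 1] n_ge_3 by (simp add: numeral_2_eq_2)
      then have "p \<star> (\<alpha> 2 \<bullet> y 1) = Null C W (Cod C (\<alpha> 2))" by (simp add: numeral_2_eq_2)
      then have 0: "\<alpha> (nx 1) \<bullet> p \<star> y 1 = Null C W (Dom C (\<alpha> (nx (nx 1))))" by (simp add: sm_comp)
      have "p \<star> y 1 \<in> Hom C W (Dom C (\<alpha> (nx 1)))" by (simp add: in_Hom)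
      then obtain x1 where x1: "x1 \<in> Hom C W (Dom C (\<alpha> 1))" "p \<star> y 1 = \<alpha> 1 \<bullet> x1"
        by (rule exact_kernelE[OF ex I_simps(2) _ 0])
      note [simp] = x1(1)[unfolded in_Hom]
      define x where "x i = (if i = 1 then x1 else y (i - 1))" for i
      have pv: "i - 1 \<in> I" "nx (i - 1) = i" if "i \<in> I" "i \<noteq> 1" for i using that by (auto simp: I_def nx_def)
      obtain z where z: "z \<in> Hom C W (Dom C (\<alpha> n))" "\<alpha> n \<bullet> x n = p \<star> (u \<star> x 1 \<boxplus> \<alpha> n \<bullet> z)"
      proof (rule monodromyE[OF m])
        show "x i \<in> Hom C W (Dom C (\<alpha> i))" if "i \<in> I" for i using that pv[of i] by (simp add: x_def in_Hom)
        show "\<alpha> i \<bullet> x i = p \<star> x (Suc i)" if i: "i \<in> I" "i < n" for i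
        proof (cases "i = 1")
          case True
          then show ?thesis using x1(2) by (simp add: x_def)
        next
          case False
          then have "i - 1 < n" "Suc (i - 1) = i" using i by (auto simp: I_def)
          then have "\<alpha> i \<bullet> y (i - 1) = p \<star> y i" using py pv[OF i(1) False] \<rho>[of "i - 1"] by metis
          then show ?thesis using False i by (simp add: x_def I_def)
        qed
      qed blast
      note [simp] = z(1)[unfolded in_Hom]
      have n1: "Suc (n - Suc 0) = n" using n_ge_3 by simp
      have "\<alpha> n \<bullet> y (n - 1) = p \<star> y n" using py[rule_format, of "n - 1"] \<rho>[of "n - 1"] n_ge_3 n1 by simp
      then have "p \<star> y n = p \<star> (u \<star> x1 \<boxplus> \<alpha> n \<bullet> z)" using z(2) n_ge_3 by (simp add: x_def)
      then obtain w where w: "w \<in> Ar C" "Dom C w = Dom C (y n)" "Cod C w = Cod C (y n)" "y n = (u \<star> x1 \<boxplus> \<alpha> n \<bullet> z) \<boxplus> p \<star> w"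
        by (rule p_cancel[rotated 4]) simp_all
      from w(1-3) have [simp]: "w \<in> Ar C" "Dom C w = W" "Cod C w = Dom C (\<alpha> 1)" by simp_all
      have \<alpha>z: "\<alpha> 1 \<bullet> (\<alpha> n \<bullet> z) = Null C W (Dom C (\<alpha> 2))"
        using comp_rewrite[OF exactD(2)[OF ex I_simps(3)], of z] by simp
      have "\<alpha> 1 \<bullet> y n = u \<star> (\<alpha> 1 \<bullet> x1) \<boxplus> p \<star> (\<alpha> 1 \<bullet> w)"
        unfolding w(4) by (simp add: linear_simps \<alpha>z[unfolded One_nat_def])
      also have "\<dots> = u \<star> p \<star> y 1 \<boxplus> p \<star> (\<alpha> 1 \<bullet> w)" unfolding x1(2) ..
      also have "\<dots> = p \<star> (u \<star> y 1 \<boxplus> \<alpha> 1 \<bullet> w)" by (simp add: sm_plus sm_left_comm[of u p])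
      finally have 1: "\<alpha> 1 \<bullet> y n = p \<star> (u \<star> y 1 \<boxplus> \<alpha> 1 \<bullet> w)" .
      have "divisible p (\<alpha> 1 \<bullet> y n)" unfolding 1 by (rule divisibleI) simp_all
      then have "\<rho> n \<bullet> y n = p \<star> (u \<star> y 1 \<boxplus> \<alpha> 1 \<bullet> w)" using sgn[of "y n"] 1 by simp
      also have "\<dots> = p \<star> (u \<star> y 1 \<boxplus> \<rho> n \<bullet> w)" using psgn[of w] \<rho>D[of n] by (simp add: sm_plus)
      finally show "\<exists>w \<in> Hom C W (Dom C (\<rho> n)). \<rho> n \<bullet> y n = p \<star> (u \<star> y 1 \<boxplus> \<rho> n \<bullet> w)"
        by (intro bexI[of _ w]) (simp_all add: in_Hom \<rho>D)
    qed
  next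
    assume m: "monodromy u \<rho>"
    show "monodromy u \<alpha>" unfolding monodromy_def
    proof (intro allI impI, elim conjE)
      fix W x assume x: "\<forall>i \<in> I. x i \<in> Hom C W (Dom C (\<alpha> i))" and px: "\<forall>i \<in> I. i < n \<longrightarrow> \<alpha> i \<bullet> x i = p \<star> x (Suc i)"
      have [simp]: "x i \<in> Ar C" "Dom C (x i) = W" "Cod C (x i) = Dom C (\<alpha> i)" if "i \<in> I" for i
        using x that by (auto simp: in_Hom)
      have [simp]: "W \<in> Ob C" using arr_Ob(1)[of "x 1"] by simp
      obtain v where v: "v \<in> Hom C W (Dom C (\<alpha> 1))" "\<alpha> n \<bullet> x n = p \<star> v" "divisible p (\<alpha> 1 \<bullet> v)"
        by (rule monodromy_step[OF ex, of x W]) (use x px in auto)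
      note [simp] = v(1)[unfolded in_Hom]
      define y where "y i = (if i = n then v else x (Suc i))" for i
      obtain z where z: "z \<in> Hom C W (Dom C (\<rho> n))" "\<rho> n \<bullet> y n = p \<star> (u \<star> y 1 \<boxplus> \<rho> n \<bullet> z)"
      proof (rule monodromyE[OF m])
        show "y i \<in> Hom C W (Dom C (\<rho> i))" if "i \<in> I" for i using that I_less[OF that] by (auto simp: y_def in_Hom \<rho>D)
        show "\<rho> i \<bullet> y i = p \<star> y (Suc i)" if i: "i \<in> I" "i < n" for i
        proof (cases "Suc i = n")
          case True
          then show ?thesis using v(2) i by (simp add: y_def \<rho>)
        next
          case False
          then show ?thesis using px i by (simp add: y_def \<rho>)
        qed
      qed blast
      have [simp]: "z \<in> Ar C" "Dom C z = W" "Cod C z = Dom C (\<alpha> 1)" using z(1) by (auto simp: in_Hom \<rho>D)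
      have y: "y n = v" "y 1 = x 2" using n_ge_3 by (auto simp: y_def numeral_2_eq_2)
      have px1: "p \<star> x 2 = \<alpha> 1 \<bullet> x 1" using px[rule_format, of 1] n_ge_3 by (simp add: numeral_2_eq_2)
      have "\<alpha> 1 \<bullet> v = p \<star> (u \<star> x 2 \<boxplus> \<rho> n \<bullet> z)" using z(2) sgn[OF _ _ v(3)] unfolding y by simp
      also have "\<dots> = u \<star> p \<star> x 2 \<boxplus> p \<star> (\<alpha> 1 \<bullet> z)" using psgn[of z] \<rho>D[of n] by (simp add: sm_plus sm_left_comm[of u p])
      also have "\<dots> = \<alpha> 1 \<bullet> (u \<star> x 1 \<boxplus> p \<star> z)" unfolding px1 by (simp add: linear_simps)
      finally have 1: "\<alpha> 1 \<bullet> v = \<alpha> 1 \<bullet> (u \<star> x 1 \<boxplus> p \<star> z)" .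
      let ?d = "Neg C (u \<star> x 1 \<boxplus> p \<star> z) \<boxplus> v"
      have "\<alpha> 1 \<bullet> ?d = Neg C (\<alpha> 1 \<bullet> (u \<star> x 1 \<boxplus> p \<star> z)) \<boxplus> \<alpha> 1 \<bullet> v" by (subst comp_plus) (simp_all add: neg_comp)
      also have "\<dots> = Null C W (Cod C (\<alpha> 1))" unfolding 1 by simp
      finally have 0: "\<alpha> (nx n) \<bullet> ?d = Null C W (Dom C (\<alpha> (nx (nx n))))" by simp
      have "?d \<in> Hom C W (Dom C (\<alpha> (nx n)))" by (simp add: in_Hom)
      then obtain w where w: "w \<in> Hom C W (Dom C (\<alpha> n))" "?d = \<alpha> n \<bullet> w"
        by (rule exact_kernelE[OF ex I_simps(3) _ 0])
      note [simp] = w(1)[unfolded in_Hom]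
      have "v = (u \<star> x 1 \<boxplus> p \<star> z) \<boxplus> ?d" by (rule neg_plus_cancel(2)[symmetric]) simp_all
      then have "p \<star> v = p \<star> ((u \<star> x 1 \<boxplus> p \<star> z) \<boxplus> \<alpha> n \<bullet> w)" unfolding w(2) by (rule arg_cong)
      also have "\<dots> = p \<star> (u \<star> x 1 \<boxplus> \<alpha> n \<bullet> w)" by (simp add: sm_plus)
      finally have "\<alpha> n \<bullet> x n = p \<star> (u \<star> x 1 \<boxplus> \<alpha> n \<bullet> w)" unfolding v(2) .
      then show "\<exists>y \<in> Hom C W (Dom C (\<alpha> n)). \<alpha> n \<bullet> x n = p \<star> (u \<star> x 1 \<boxplus> \<alpha> n \<bullet> y)" using w(1) by blast
    qed
  qed
  then show ?thesis unfolding \<rho>_def angle_def using exact_rotation[OF s] by blast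
qed

text \<open>The direct sum of \<open>\<alpha>\<close> and \<open>\<beta>\<close> is formed over the given biproducts at positions \<open>1\<close> and \<open>2\<close>.\<close>

lemma first_arrow_sum:
  assumes u: "u \<in> carrier R" and a: "angle u \<alpha>" and b: "angle u \<beta>"
    and bS: "biproduct C (Dom C (\<alpha> 1)) (Dom C (\<beta> 1)) S j1 j2 q1 q2"
    and bT: "biproduct C (Cod C (\<alpha> 1)) (Cod C (\<beta> 1)) T i1 i2 r1 r2"
  shows "\<exists>\<gamma>. angle u \<gamma> \<and> \<gamma> 1 = i1 \<bullet> (\<alpha> 1 \<bullet> q1) \<boxplus> i2 \<bullet> (\<beta> 1 \<bullet> q2)"
proof -
  have s: "\<alpha> \<in> sequences" "\<beta> \<in> sequences" using a b by (auto simp: angle_def exact_iff)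
  note [simp] = seq_arr[OF s(1)] seq_arr[OF s(2)]
  obtain S' j1' j2' q1' q2' where bp: "\<And>i. i \<in> I \<Longrightarrow> biproduct C (Dom C (\<alpha> i)) (Dom C (\<beta> i)) (S' i) (j1' i) (j2' i) (q1' i) (q2' i)"
    by (rule biproduct_family[OF s]) blast
  let ?c = "\<lambda>x y z i. if i = Suc 0 then x else if i = 2 then y else z i"
  have bp': "biproduct C (Dom C (\<alpha> i)) (Dom C (\<beta> i)) (?c S T S' i) (?c j1 i1 j1' i) (?c j2 i2 j2' i) (?c q1 r1 q1' i) (?c q2 r2 q2' i)"
    if "i \<in> I" for i
    using bp[OF that] bS bT by simp
  note ov = direct_sum_over[OF s bp' refl]
  show ?thesis by (rule exI, rule conjI, rule angle_sum[OF u direct_sumI[OF s ov(1,2)] a b]) simp_all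
qed

text \<open>
  By Gaussian elimination the arrow is, up to a change of bases, a diagonal sum of copies of \<open>1\<close>,
  \<open>p\<close> and \<open>0\<close>. Discs begin with \<open>1\<close> or \<open>0\<close>, and the rotation of \<open>F\<^sub>u(p)\<close> begins with \<open>p\<close>.
\<close>

lemma first_arrow:
  assumes u: "u \<in> Units R" and par: "even n \<or> p \<oplus>\<^bsub>R\<^esub> p = \<zero>\<^bsub>R\<^esub>" and f: "f \<in> Ar C"
  shows "\<exists>\<alpha>. angle u \<alpha> \<and> \<alpha> 1 = f"
proof -
  have u' [simp]: "u \<in> carrier R" using u by (rule Units_closed)
  obtain Z where Z: "zero_object C Z" using ex_zero_object by blast
  have [simp]: "Z \<in> Ob C" using zero_objectD(1)[OF Z] .
  have diag: "\<exists>\<gamma>. angle u \<gamma> \<and> \<gamma> 1 = i1 \<bullet> (f \<bullet> q1) \<boxplus> i2 \<bullet> (g \<bullet> q2)"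
    if "\<exists>\<alpha>. angle u \<alpha> \<and> \<alpha> 1 = f" "\<exists>\<alpha>. angle u \<alpha> \<and> \<alpha> 1 = g"
      "biproduct C (Dom C f) (Dom C g) S j1 j2 q1 q2" "biproduct C (Cod C f) (Cod C g) T i1 i2 r1 r2"
    for f g S T j1 j2 q1 q2 i1 i2 r1 r2
    using that first_arrow_sum[OF u'] by blast
  have discs: "angle u (disc i A Z)" if "A \<in> Ob C" "i \<in> I" for i A
    using angle_contractible[OF u'] disc[OF Z that] by blast
  have null: "\<exists>\<alpha>. angle u \<alpha> \<and> \<alpha> 1 = Null C A B" if [simp]: "A \<in> Ob C" "B \<in> Ob C" for A B
  proof -
    have "disc n A Z 1 = Null C A Z" "disc 2 B Z 1 = Null C Z B" using n_ge_3 by (auto simp: disc_def)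
    moreover have "biproduct C A Z A (Ident C A) (Null C Z A) (Ident C A) (Null C A Z)"
      "biproduct C Z B B (Null C Z B) (Ident C B) (Null C B Z) (Ident C B)"
      using zero_object_ident[OF Z] by (simp_all add: biproduct_def in_Hom)
    ultimately show ?thesis
      using first_arrow_sum[OF u' discs[of A n] discs[of B 2], of A "Ident C A" "Null C Z A" "Ident C A" "Null C A Z"
          B "Null C Z B" "Ident C B" "Null C B Z" "Ident C B"] by simp
  qed
  have pU: "\<exists>\<alpha>. angle u \<alpha> \<and> \<alpha> 1 = p \<star> Ident C U"
  proof -
    have t: "u \<star> Ident C U \<in> Hom C U U" by (simp add: in_Hom)
    note tw = twisted[OF t, folded periodic_def]
    have "angle u (left_rotation (periodic u U))"
      using angle_rotation[OF u' par tw(1)] angle_periodic[OF u U_Ob] by simp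
    moreover have "left_rotation (periodic u U) 1 = p \<star> Ident C U"
      using tw(4)[of 2] n_ge_3 by (simp add: left_rotation_nx)
    ultimately show ?thesis by blast
  qed
  have pg: "\<exists>\<alpha>. angle u \<alpha> \<and> \<alpha> 1 = p \<star> g" if "g \<in> Ar C" for g
    using that
  proof (induction rule: arrow_induct)
    case (divisible g)
    then show ?case using null by simp
  next
    case (sum f f' A B S T j1 j2 q1 q2 i1 i2 r1 r2)
    note [simp] = biproduct_arr[OF sum.hyps(3)] biproduct_arr[OF sum.hyps(4)] sum.hyps(1,2)[unfolded in_Hom]
    have "p \<star> f = i1 \<bullet> (p \<star> Ident C U \<bullet> q1) \<boxplus> i2 \<bullet> (p \<star> f' \<bullet> q2)"
      unfolding sum.hyps(5) by (simp add: linear_simps)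
    moreover have "\<exists>\<gamma>. angle u \<gamma> \<and> \<gamma> 1 = i1 \<bullet> (p \<star> Ident C U \<bullet> q1) \<boxplus> i2 \<bullet> (p \<star> f' \<bullet> q2)"
      by (rule diag[OF pU sum.IH]) (use sum.hyps(3,4) in simp_all)
    ultimately show ?case by simp
  qed
  show ?thesis using f
  proof (induction rule: arrow_induct)
    case (divisible g)
    then show ?case by (rule pg)
  next
    case (sum f f' A B S T j1 j2 q1 q2 i1 i2 r1 r2)
    note [simp] = biproduct_arr[OF sum.hyps(3)] biproduct_arr[OF sum.hyps(4)] sum.hyps(1,2)[unfolded in_Hom]
    have "disc 1 U Z 1 = Ident C U" by (simp add: disc_def)
    then have "\<exists>\<alpha>. angle u \<alpha> \<and> \<alpha> 1 = Ident C U" using discs[OF U_Ob I_simps(2)] by blast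
    then have "\<exists>\<gamma>. angle u \<gamma> \<and> \<gamma> 1 = i1 \<bullet> (Ident C U \<bullet> q1) \<boxplus> i2 \<bullet> (f' \<bullet> q2)"
      by (rule diag[OF _ sum.IH]) (use sum.hyps(3,4) in simp_all)
    then show ?case unfolding sum.hyps(5) by simp
  qed
qed

section \<open>Morphisms with exact cones of the right monodromy\<close>

text \<open>The \<open>i\<close>-th arrow of \<open>F\<^sub>u(p)\<close> is multiplication by \<open>p\<close> times this scalar.\<close>

definition weight :: "'r \<Rightarrow> nat \<Rightarrow> 'r" where
  "weight u i = (if i = 1 then u else \<one>\<^bsub>R\<^esub>)"

lemma weight_simps [simp]: "u \<in> carrier R \<Longrightarrow> weight u i \<in> carrier R" "weight u (Suc 0) = u" "i \<noteq> Suc 0 \<Longrightarrow> weight u i = \<one>\<^bsub>R\<^esub>"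
  by (simp_all add: weight_def)

text \<open>
  A strong deformation retraction of \<open>\<alpha>\<close> onto \<open>F\<^sub>u(p)\<close>, with inclusion \<open>s\<close>, retraction \<open>r\<close> and
  homotopy \<open>k\<close>.
\<close>

definition reduction :: "'r \<Rightarrow> (nat \<Rightarrow> 'a) \<Rightarrow> 'o \<Rightarrow> (nat \<Rightarrow> 'a) \<Rightarrow> (nat \<Rightarrow> 'a) \<Rightarrow> (nat \<Rightarrow> 'a) \<Rightarrow> bool" where
  "reduction u \<alpha> F k s r \<longleftrightarrow> F \<in> Ob C \<and> (\<forall>i \<in> I.
     k i \<in> Hom C (Dom C (\<alpha> (nx i))) (Dom C (\<alpha> i)) \<and> s i \<in> Hom C F (Dom C (\<alpha> i)) \<and> r i \<in> Hom C (Dom C (\<alpha> i)) F \<and>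
     r i \<bullet> s i = Ident C F \<and> k i \<bullet> s (nx i) = Null C F (Dom C (\<alpha> i)) \<and> r i \<bullet> k i = Null C (Dom C (\<alpha> (nx i))) F \<and>
     k (nx i) \<bullet> \<alpha> (nx i) \<boxplus> (\<alpha> i \<bullet> k i \<boxplus> s (nx i) \<bullet> r (nx i)) = Ident C (Dom C (\<alpha> (nx i))) \<and>
     \<alpha> i \<bullet> s i = p \<star> weight u i \<star> s (nx i) \<and> r (nx i) \<bullet> \<alpha> i = p \<star> weight u i \<star> r i)"

lemma ex_reduction:
  assumes u: "u \<in> Units R" and a: "angle u \<alpha>"
  shows "\<exists>F k s r. reduction u \<alpha> F k s r"
proof -
  have u' [simp]: "u \<in> carrier R" using u by (rule Units_closed)
  obtain \<gamma> F where g: "contractible \<gamma>" "F \<in> Ob C" "direct_sum_seq \<gamma> (periodic u F) \<alpha>"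
    using a angle_iff[OF u] by blast
  obtain j1 j2 q1 q2 where sq: "\<gamma> \<in> sequences" "periodic u F \<in> sequences" "\<alpha> \<in> sequences"
    and sp: "splitting \<gamma> (periodic u F) \<alpha> j1 j2 q1 q2"
    using g(3) by (rule direct_sumE)
  obtain \<Theta> where \<Theta>: "contraction \<gamma> \<Theta>" using g(1) by (auto simp: contractible_iff)
  have t: "u \<star> Ident C F \<in> Hom C F F" using g(2) by (simp add: in_Hom)
  note tw = twisted[OF t, folded periodic_def]
  have P: "periodic u F i = p \<star> weight u i \<star> Ident C F" if "i \<in> I" for i
    using tw(3) tw(4)[OF that] g(2) by (cases "i = 1") simp_all
  note [simp] = seq_arr[OF sq(1)] seq_arr[OF sq(3)] contraction_arr(1-3)[OF \<Theta>] g(2)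
  note bp = splittingD(1)[OF sp]
  have bps [simp]: "j1 i \<in> Ar C" "j2 i \<in> Ar C" "q1 i \<in> Ar C" "q2 i \<in> Ar C"
    "Dom C (j1 i) = Dom C (\<gamma> i)" "Dom C (j2 i) = F" "Dom C (q1 i) = Dom C (\<alpha> i)" "Dom C (q2 i) = Dom C (\<alpha> i)"
    "Cod C (j1 i) = Dom C (\<alpha> i)" "Cod C (j2 i) = Dom C (\<alpha> i)" "Cod C (q1 i) = Dom C (\<gamma> i)" "Cod C (q2 i) = F"
    if "i \<in> I" for i using biproduct_arr[OF bp[OF that]] tw(2)[OF that] by simp_all
  let ?k = "\<lambda>i. j1 i \<bullet> (\<Theta> i \<bullet> q1 (nx i))"
  have "reduction u \<alpha> F ?k j2 q2" unfolding reduction_def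
  proof (intro conjI ballI)
    fix i assume i [simp]: "i \<in> I"
    note b = bp[OF i] and b' = bp[OF nx_I[OF i]]
    note tw2 = tw(2)[OF i] tw(2)[OF nx_I[OF i]]
    show "?k i \<in> Hom C (Dom C (\<alpha> (nx i))) (Dom C (\<alpha> i))" "j2 i \<in> Hom C F (Dom C (\<alpha> i))" "q2 i \<in> Hom C (Dom C (\<alpha> i)) F"
      by (simp_all add: in_Hom)
    show "q2 i \<bullet> j2 i = Ident C F" using biproduct_arr(14)[OF b] tw2 by simp
    have "q1 (nx i) \<bullet> j2 (nx i) = Null C F (Dom C (\<gamma> (nx i)))" using biproduct_arr(15)[OF b'] tw2 by simp
    then show "?k i \<bullet> j2 (nx i) = Null C F (Dom C (\<alpha> i))" by (simp add: comp_assoc)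
    show "q2 i \<bullet> ?k i = Null C (Dom C (\<alpha> (nx i))) F"
      using biproduct_comp(4)[OF b, of "\<Theta> i \<bullet> q1 (nx i)"] tw2 by simp
    have 1: "?k (nx i) \<bullet> \<alpha> (nx i) = j1 (nx i) \<bullet> (\<Theta> (nx i) \<bullet> (\<gamma> (nx i) \<bullet> q1 (nx i)))"
      by (simp add: comp_assoc splittingD(4)[OF sp])
    have 2: "\<alpha> i \<bullet> ?k i = j1 (nx i) \<bullet> (\<gamma> i \<bullet> (\<Theta> i \<bullet> q1 (nx i)))"
      by (rule splitting_comp(1)[OF sq sp i]) simp_all
    have 3: "?k (nx i) \<bullet> \<alpha> (nx i) \<boxplus> \<alpha> i \<bullet> ?k i = j1 (nx i) \<bullet> q1 (nx i)"
      unfolding 1 2 using contraction_comp(1)[OF sq(1) \<Theta> i, of "q1 (nx i)"]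
        comp_plus[of "\<Theta> (nx i) \<bullet> (\<gamma> (nx i) \<bullet> q1 (nx i))" "\<gamma> i \<bullet> (\<Theta> i \<bullet> q1 (nx i))" "j1 (nx i)"] by simp
    have "?k (nx i) \<bullet> \<alpha> (nx i) \<boxplus> (\<alpha> i \<bullet> ?k i \<boxplus> j2 (nx i) \<bullet> q2 (nx i)) =
        (?k (nx i) \<bullet> \<alpha> (nx i) \<boxplus> \<alpha> i \<bullet> ?k i) \<boxplus> j2 (nx i) \<bullet> q2 (nx i)"
      by (rule plus_assoc[symmetric]) simp_all
    also have "\<dots> = Ident C (Dom C (\<alpha> (nx i)))" unfolding 3 using b' by (simp add: biproduct_def)
    finally show "?k (nx i) \<bullet> \<alpha> (nx i) \<boxplus> (\<alpha> i \<bullet> ?k i \<boxplus> j2 (nx i) \<bullet> q2 (nx i)) = Ident C (Dom C (\<alpha> (nx i)))" .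
    show "\<alpha> i \<bullet> j2 i = p \<star> weight u i \<star> j2 (nx i)"
      unfolding splittingD(3)[OF sp i] P[OF i] by (simp add: sm_comp)
    show "q2 (nx i) \<bullet> \<alpha> i = p \<star> weight u i \<star> q2 i"
      unfolding splittingD(5)[OF sp i] P[OF i] by (simp add: sm_comp)
  qed (rule g(2))
  then show ?thesis by blast
qed

lemma reduction_arr:
  assumes "reduction u \<alpha> F k s r" "i \<in> I"
  shows "k i \<in> Ar C" "Dom C (k i) = Dom C (\<alpha> (nx i))" "Cod C (k i) = Dom C (\<alpha> i)"
    "s i \<in> Ar C" "Dom C (s i) = F" "Cod C (s i) = Dom C (\<alpha> i)"
    "r i \<in> Ar C" "Dom C (r i) = Dom C (\<alpha> i)" "Cod C (r i) = F" "F \<in> Ob C"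
  using assms by (auto simp: reduction_def in_Hom)

lemma reductionD:
  assumes "reduction u \<alpha> F k s r" "i \<in> I"
  shows "r i \<bullet> s i = Ident C F" "k i \<bullet> s (nx i) = Null C F (Dom C (\<alpha> i))" "r i \<bullet> k i = Null C (Dom C (\<alpha> (nx i))) F"
    "k (nx i) \<bullet> \<alpha> (nx i) \<boxplus> (\<alpha> i \<bullet> k i \<boxplus> s (nx i) \<bullet> r (nx i)) = Ident C (Dom C (\<alpha> (nx i)))"
    "\<alpha> i \<bullet> s i = p \<star> weight u i \<star> s (nx i)" "r (nx i) \<bullet> \<alpha> i = p \<star> weight u i \<star> r i"
  using assms by (auto simp: reduction_def)

lemma reduction_comp:
  assumes sq: "\<alpha> \<in> sequences" and u: "u \<in> carrier R" and rd: "reduction u \<alpha> F k s r" and i [simp]: "i \<in> I" and x [simp]: "x \<in> Ar C"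
  shows "Cod C x = Dom C (\<alpha> (nx i)) \<Longrightarrow> k (nx i) \<bullet> (\<alpha> (nx i) \<bullet> x) \<boxplus> (\<alpha> i \<bullet> (k i \<bullet> x) \<boxplus> s (nx i) \<bullet> (r (nx i) \<bullet> x)) = x"
    "Cod C x = F \<Longrightarrow> r i \<bullet> (s i \<bullet> x) = x"
    "Cod C x = F \<Longrightarrow> k i \<bullet> (s (nx i) \<bullet> x) = Null C (Dom C x) (Dom C (\<alpha> i))"
    "Cod C x = Dom C (\<alpha> (nx i)) \<Longrightarrow> r i \<bullet> (k i \<bullet> x) = Null C (Dom C x) F"
    "Cod C x = F \<Longrightarrow> \<alpha> i \<bullet> (s i \<bullet> x) = p \<star> weight u i \<star> (s (nx i) \<bullet> x)"
    "Cod C x = Dom C (\<alpha> i) \<Longrightarrow> r (nx i) \<bullet> (\<alpha> i \<bullet> x) = p \<star> weight u i \<star> (r i \<bullet> x)"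
proof -
  note [simp] = seq_arr[OF sq] reduction_arr(1-9)[OF rd] reduction_arr(10)[OF rd i] u
  show "k (nx i) \<bullet> (\<alpha> (nx i) \<bullet> x) \<boxplus> (\<alpha> i \<bullet> (k i \<bullet> x) \<boxplus> s (nx i) \<bullet> (r (nx i) \<bullet> x)) = x" if [simp]: "Cod C x = Dom C (\<alpha> (nx i))"
  proof -
    have "(k (nx i) \<bullet> \<alpha> (nx i) \<boxplus> (\<alpha> i \<bullet> k i \<boxplus> s (nx i) \<bullet> r (nx i))) \<bullet> x =
      k (nx i) \<bullet> (\<alpha> (nx i) \<bullet> x) \<boxplus> (\<alpha> i \<bullet> (k i \<bullet> x) \<boxplus> s (nx i) \<bullet> (r (nx i) \<bullet> x))"
      by (simp add: arrow_simps)
    then show ?thesis unfolding reductionD(4)[OF rd i] by simp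
  qed
  show "r i \<bullet> (s i \<bullet> x) = x" if [simp]: "Cod C x = F"
    using comp_rewrite[OF reductionD(1)[OF rd i], of x] by simp
  show "k i \<bullet> (s (nx i) \<bullet> x) = Null C (Dom C x) (Dom C (\<alpha> i))" if [simp]: "Cod C x = F"
    using comp_rewrite[OF reductionD(2)[OF rd i], of x] by simp
  show "r i \<bullet> (k i \<bullet> x) = Null C (Dom C x) F" if [simp]: "Cod C x = Dom C (\<alpha> (nx i))"
    using comp_rewrite[OF reductionD(3)[OF rd i], of x] by simp
  show "\<alpha> i \<bullet> (s i \<bullet> x) = p \<star> weight u i \<star> (s (nx i) \<bullet> x)" if [simp]: "Cod C x = F"
    using comp_rewrite[OF reductionD(5)[OF rd i], of x] by (simp add: sm_comp)
  show "r (nx i) \<bullet> (\<alpha> i \<bullet> x) = p \<star> weight u i \<star> (r i \<bullet> x)" if [simp]: "Cod C x = Dom C (\<alpha> i)"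
    using comp_rewrite[OF reductionD(6)[OF rd i], of x] by (simp add: sm_comp)
qed

text \<open>
  The monodromy condition for the mapping cone of \<open>\<phi>\<close>, with generalized elements of the cone
  given by their components \<open>a i\<close> and \<open>b i\<close>.
\<close>

definition cone_monodromy :: "'r \<Rightarrow> (nat \<Rightarrow> 'a) \<Rightarrow> (nat \<Rightarrow> 'a) \<Rightarrow> (nat \<Rightarrow> 'a) \<Rightarrow> bool" where
  "cone_monodromy u \<alpha> \<beta> \<phi> \<longleftrightarrow> (\<forall>W a b.
     (\<forall>i \<in> I. a i \<in> Hom C W (Dom C (\<alpha> (nx i))) \<and> b i \<in> Hom C W (Dom C (\<beta> i))) \<and>
     (\<forall>i \<in> I. i < n \<longrightarrow> Neg C (\<alpha> (nx i) \<bullet> a i) = p \<star> a (Suc i) \<and> \<phi> (nx i) \<bullet> a i \<boxplus> \<beta> i \<bullet> b i = p \<star> b (Suc i)) \<longrightarrow>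
     (\<exists>a' \<in> Hom C W (Dom C (\<alpha> 1)). \<exists>b' \<in> Hom C W (Dom C (\<beta> n)).
        Neg C (\<alpha> 1 \<bullet> a n) = p \<star> (u \<star> a 1 \<boxplus> Neg C (\<alpha> 1 \<bullet> a')) \<and>
        \<phi> 1 \<bullet> a n \<boxplus> \<beta> n \<bullet> b n = p \<star> (u \<star> b 1 \<boxplus> (\<phi> 1 \<bullet> a' \<boxplus> \<beta> n \<bullet> b'))))"

lemma cone_monodromyE:
  assumes "cone_monodromy u \<alpha> \<beta> \<phi>"
    "\<And>i. i \<in> I \<Longrightarrow> a i \<in> Hom C W (Dom C (\<alpha> (nx i)))" "\<And>i. i \<in> I \<Longrightarrow> b i \<in> Hom C W (Dom C (\<beta> i))"
    "\<And>i. i \<in> I \<Longrightarrow> i < n \<Longrightarrow> Neg C (\<alpha> (nx i) \<bullet> a i) = p \<star> a (Suc i)"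
    "\<And>i. i \<in> I \<Longrightarrow> i < n \<Longrightarrow> \<phi> (nx i) \<bullet> a i \<boxplus> \<beta> i \<bullet> b i = p \<star> b (Suc i)"
  obtains a' b' where "a' \<in> Hom C W (Dom C (\<alpha> 1))" "b' \<in> Hom C W (Dom C (\<beta> n))"
    "Neg C (\<alpha> 1 \<bullet> a n) = p \<star> (u \<star> a 1 \<boxplus> Neg C (\<alpha> 1 \<bullet> a'))"
    "\<phi> 1 \<bullet> a n \<boxplus> \<beta> n \<bullet> b n = p \<star> (u \<star> b 1 \<boxplus> (\<phi> 1 \<bullet> a' \<boxplus> \<beta> n \<bullet> b'))"
proof -
  have "\<exists>a' \<in> Hom C W (Dom C (\<alpha> 1)). \<exists>b' \<in> Hom C W (Dom C (\<beta> n)).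
        Neg C (\<alpha> 1 \<bullet> a n) = p \<star> (u \<star> a 1 \<boxplus> Neg C (\<alpha> 1 \<bullet> a')) \<and>
        \<phi> 1 \<bullet> a n \<boxplus> \<beta> n \<bullet> b n = p \<star> (u \<star> b 1 \<boxplus> (\<phi> 1 \<bullet> a' \<boxplus> \<beta> n \<bullet> b'))"
    by (rule assms(1)[unfolded cone_monodromy_def, rule_format]) (use assms(2-) in blast)
  then show ?thesis using that by blast
qed

text \<open>
  Homotopic morphisms have isomorphic cones; on components the isomorphism is
  \<open>(a, b) \<mapsto> (a, b + h a)\<close>.
\<close>

lemma cone_monodromy_homotopy:
  assumes u [simp]: "u \<in> carrier R" and sq: "\<alpha> \<in> sequences" "\<beta> \<in> sequences"
    and cb: "\<And>i. i \<in> I \<Longrightarrow> \<beta> (nx i) \<bullet> \<beta> i = Null C (Dom C (\<beta> i)) (Dom C (\<beta> (nx (nx i))))"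
    and \<phi>: "\<And>i. i \<in> I \<Longrightarrow> \<phi> i \<in> Hom C (Dom C (\<alpha> i)) (Dom C (\<beta> i))"
    and h: "\<And>i. i \<in> I \<Longrightarrow> h i \<in> Hom C (Dom C (\<alpha> (nx i))) (Dom C (\<beta> i))"
    and eq: "\<And>i. i \<in> I \<Longrightarrow> \<phi>' (nx i) = \<phi> (nx i) \<boxplus> (h (nx i) \<bullet> \<alpha> (nx i) \<boxplus> \<beta> i \<bullet> h i)"
    and cone: "cone_monodromy u \<alpha> \<beta> \<phi>"
  shows "cone_monodromy u \<alpha> \<beta> \<phi>'"
  unfolding cone_monodromy_def
proof (intro allI impI, elim conjE)
  fix W a b
  assume ab: "\<forall>i \<in> I. a i \<in> Hom C W (Dom C (\<alpha> (nx i))) \<and> b i \<in> Hom C W (Dom C (\<beta> i))"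
    and st: "\<forall>i \<in> I. i < n \<longrightarrow> Neg C (\<alpha> (nx i) \<bullet> a i) = p \<star> a (Suc i) \<and> \<phi>' (nx i) \<bullet> a i \<boxplus> \<beta> i \<bullet> b i = p \<star> b (Suc i)"
  note [simp] = seq_arr[OF sq(1)] seq_arr[OF sq(2)]
  have [simp]: "a i \<in> Ar C" "Dom C (a i) = W" "Cod C (a i) = Dom C (\<alpha> (nx i))" "b i \<in> Ar C" "Dom C (b i) = W" "Cod C (b i) = Dom C (\<beta> i)"
    if "i \<in> I" for i using ab that by (auto simp: in_Hom)
  have [simp]: "\<phi> i \<in> Ar C" "Dom C (\<phi> i) = Dom C (\<alpha> i)" "Cod C (\<phi> i) = Dom C (\<beta> i)"
    "h i \<in> Ar C" "Dom C (h i) = Dom C (\<alpha> (nx i))" "Cod C (h i) = Dom C (\<beta> i)" if "i \<in> I" for i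
    using \<phi>[OF that] h[OF that] by (auto simp: in_Hom)
  let ?b = "\<lambda>i. b i \<boxplus> h i \<bullet> a i"
  \<comment> \<open>both sides of the step equation change by the same amount\<close>
  have key: "\<phi>' (nx i) \<bullet> a i \<boxplus> \<beta> i \<bullet> b i = (\<phi> (nx i) \<bullet> a i \<boxplus> \<beta> i \<bullet> ?b i) \<boxplus> h (nx i) \<bullet> (\<alpha> (nx i) \<bullet> a i)"
    if [simp]: "i \<in> I" for i
    unfolding eq[OF that] by (simp add: arrow_simps plus_ac)
  obtain a' b' where a': "a' \<in> Hom C W (Dom C (\<alpha> 1))" and b': "b' \<in> Hom C W (Dom C (\<beta> n))"
    and e1: "Neg C (\<alpha> 1 \<bullet> a n) = p \<star> (u \<star> a 1 \<boxplus> Neg C (\<alpha> 1 \<bullet> a'))"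
    and e2: "\<phi> 1 \<bullet> a n \<boxplus> \<beta> n \<bullet> ?b n = p \<star> (u \<star> ?b 1 \<boxplus> (\<phi> 1 \<bullet> a' \<boxplus> \<beta> n \<bullet> b'))"
  proof (rule cone_monodromyE[OF cone, of a W ?b])
    show "\<phi> (nx i) \<bullet> a i \<boxplus> \<beta> i \<bullet> ?b i = p \<star> ?b (Suc i)" if i [simp]: "i \<in> I" "i < n" for i
    proof -
      have 1: "\<alpha> (nx i) \<bullet> a i = Neg C (p \<star> a (Suc i))" using st neg_neg[of "\<alpha> (nx i) \<bullet> a i"] by simp
      have "(\<phi> (nx i) \<bullet> a i \<boxplus> \<beta> i \<bullet> ?b i) \<boxplus> h (nx i) \<bullet> (\<alpha> (nx i) \<bullet> a i) = p \<star> b (Suc i)"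
        unfolding key[OF i(1), symmetric] using st by simp
      then have "p \<star> (h (Suc i) \<bullet> a (Suc i)) \<boxplus> ((\<phi> (nx i) \<bullet> a i \<boxplus> \<beta> i \<bullet> ?b i) \<boxplus> h (nx i) \<bullet> (\<alpha> (nx i) \<bullet> a i)) =
        p \<star> (h (Suc i) \<bullet> a (Suc i)) \<boxplus> p \<star> b (Suc i)" by (rule arg_cong)
      moreover have "h (nx i) \<bullet> (\<alpha> (nx i) \<bullet> a i) = Neg C (p \<star> (h (Suc i) \<bullet> a (Suc i)))"
        unfolding 1 by (simp add: neg_comp sm_comp)
      moreover have "x \<boxplus> (y \<boxplus> Neg C x) = y" if "x \<in> Hom C A B" "y \<in> Hom C A B" for x y A B
        using that by (simp add: in_Hom plus_left_comm[of x y])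
      from this[of "p \<star> (h (Suc i) \<bullet> a (Suc i))" W "Dom C (\<beta> (Suc i))" "\<phi> (nx i) \<bullet> a i \<boxplus> \<beta> i \<bullet> ?b i"]
      have "p \<star> (h (Suc i) \<bullet> a (Suc i)) \<boxplus> ((\<phi> (nx i) \<bullet> a i \<boxplus> \<beta> i \<bullet> ?b i) \<boxplus> Neg C (p \<star> (h (Suc i) \<bullet> a (Suc i)))) = \<phi> (nx i) \<bullet> a i \<boxplus> \<beta> i \<bullet> ?b i"
        by (simp add: in_Hom)
      ultimately have "\<phi> (nx i) \<bullet> a i \<boxplus> \<beta> i \<bullet> ?b i = p \<star> (h (Suc i) \<bullet> a (Suc i)) \<boxplus> p \<star> b (Suc i)"
        by (simp only:)
      also have "\<dots> = p \<star> ?b (Suc i)" by (simp add: sm_plus plus_comm[of "p \<star> b (Suc i)"])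
      finally show ?thesis .
    qed
  qed (use st in \<open>auto simp: in_Hom\<close>)
  have [simp]: "a' \<in> Ar C" "Dom C a' = W" "Cod C a' = Dom C (\<alpha> 1)" "b' \<in> Ar C" "Dom C b' = W" "Cod C b' = Dom C (\<beta> n)"
    using a' b' by (auto simp: in_Hom)
  have \<alpha>an: "\<alpha> 1 \<bullet> a n = Neg C (p \<star> (u \<star> a 1 \<boxplus> Neg C (\<alpha> 1 \<bullet> a')))"
    unfolding e1[symmetric] by simp
  have eq1: "\<phi>' 1 = \<phi> 1 \<boxplus> (h 1 \<bullet> \<alpha> 1 \<boxplus> \<beta> n \<bullet> h n)" using eq[of n] by simp
  have "\<phi>' 1 \<bullet> a n \<boxplus> \<beta> n \<bullet> b n = (\<phi> 1 \<bullet> a n \<boxplus> \<beta> n \<bullet> ?b n) \<boxplus> h 1 \<bullet> (\<alpha> 1 \<bullet> a n)"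
    using key[of n] by simp
  also have "\<dots> = p \<star> (u \<star> b 1 \<boxplus> (\<phi>' 1 \<bullet> a' \<boxplus> \<beta> n \<bullet> (b' \<boxplus> Neg C (h n \<bullet> a'))))"
    unfolding e2 unfolding \<alpha>an eq1 by (simp add: linear_simps plus_ac sm_left_comm[of u])
  finally have "\<phi>' 1 \<bullet> a n \<boxplus> \<beta> n \<bullet> b n = p \<star> (u \<star> b 1 \<boxplus> (\<phi>' 1 \<bullet> a' \<boxplus> \<beta> n \<bullet> (b' \<boxplus> Neg C (h n \<bullet> a'))))" .
  moreover have "b' \<boxplus> Neg C (h n \<bullet> a') \<in> Hom C W (Dom C (\<beta> n))" by (simp add: in_Hom)
  ultimately show "\<exists>a' \<in> Hom C W (Dom C (\<alpha> 1)). \<exists>b' \<in> Hom C W (Dom C (\<beta> n)).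
        Neg C (\<alpha> 1 \<bullet> a n) = p \<star> (u \<star> a 1 \<boxplus> Neg C (\<alpha> 1 \<bullet> a')) \<and>
        \<phi>' 1 \<bullet> a n \<boxplus> \<beta> n \<bullet> b n = p \<star> (u \<star> b 1 \<boxplus> (\<phi>' 1 \<bullet> a' \<boxplus> \<beta> n \<bullet> b'))" using a' e1 by blast
qed

text \<open>
  The monodromy condition for the cone of a morphism \<open>\<psi>\<close> from \<open>F\<^sub>u(p)\<close> to \<open>G\<^sub>u(p)\<close>, simplified by means
  of \<open>p\<^sup>2 = 0\<close> and stripped of the factor \<open>u\<close> in its first component.
\<close>

definition periodic_cone :: "'r \<Rightarrow> 'o \<Rightarrow> 'o \<Rightarrow> (nat \<Rightarrow> 'a) \<Rightarrow> bool" where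
  "periodic_cone u F G \<psi> \<longleftrightarrow> (\<forall>W a b.
     (\<forall>i \<in> I. a i \<in> Hom C W F \<and> b i \<in> Hom C W G) \<and>
     (\<forall>i \<in> I. i < n \<longrightarrow> Neg C (p \<star> a i) = p \<star> a (Suc i) \<and> \<psi> (nx i) \<bullet> a i \<boxplus> p \<star> weight u i \<star> b i = p \<star> b (Suc i)) \<longrightarrow>
     Neg C (p \<star> a n) = p \<star> a 1 \<and> (\<exists>z \<in> Hom C W F. \<psi> 1 \<bullet> a n \<boxplus> p \<star> b n = p \<star> (u \<star> b 1 \<boxplus> \<psi> 1 \<bullet> z)))"

lemma divisible_sm:
  assumes r: "r \<in> carrier R" and d: "divisible p f"
  shows "divisible p (r \<star> f)"
proof -
  obtain g where g: "g \<in> Ar C" "f = p \<star> g" using d by (rule divisibleE)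
  have "r \<star> f = p \<star> r \<star> g" unfolding g(2) using r g(1) by (simp add: sm_left_comm)
  then show ?thesis using divisibleI[of p "r \<star> g"] r g(1) by simp
qed

text \<open>
  Applying the retractions to a chain of the cone of \<open>s' \<psi> r\<close> yields a chain of the cone of \<open>\<psi>\<close>. What the
  retractions forget is, by the homotopies \<open>k\<close> and \<open>k'\<close>, a boundary modulo \<open>p\<close>, and boundaries are
  absorbed by the arrows \<open>a'\<close> and \<open>b'\<close> of the monodromy condition.
\<close>

lemma cone_monodromy_reduced:
  assumes u [simp]: "u \<in> carrier R" and ex: "exact \<alpha>" "exact \<beta>"
    and ra: "reduction u \<alpha> F k s r" and rb: "reduction u \<beta> G k' s' r'"
    and \<psi>: "\<And>i. i \<in> I \<Longrightarrow> \<psi> i \<in> Hom C F G"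
    and mor: "seq_morphism \<alpha> \<beta> (\<lambda>i. s' i \<bullet> (\<psi> i \<bullet> r i))"
    and base: "periodic_cone u F G \<psi>"
  shows "cone_monodromy u \<alpha> \<beta> (\<lambda>i. s' i \<bullet> (\<psi> i \<bullet> r i))"
  unfolding cone_monodromy_def
proof (intro allI impI, elim conjE)
  fix W a b
  assume ab: "\<forall>i \<in> I. a i \<in> Hom C W (Dom C (\<alpha> (nx i))) \<and> b i \<in> Hom C W (Dom C (\<beta> i))"
    and st: "\<forall>i \<in> I. i < n \<longrightarrow> Neg C (\<alpha> (nx i) \<bullet> a i) = p \<star> a (Suc i) \<and> s' (nx i) \<bullet> (\<psi> (nx i) \<bullet> r (nx i)) \<bullet> a i \<boxplus> \<beta> i \<bullet> b i = p \<star> b (Suc i)"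
  note sa = exactD(1)[OF ex(1) I_simps(1)] and sb = exactD(1)[OF ex(2) I_simps(1)]
  note [simp] = seq_arr[OF sa] seq_arr[OF sb] reduction_arr(1-9)[OF ra] reduction_arr(1-9)[OF rb]
    reduction_arr(10)[OF ra I_simps(1)] reduction_arr(10)[OF rb I_simps(1)]
  have [simp]: "a i \<in> Ar C" "Dom C (a i) = W" "Cod C (a i) = Dom C (\<alpha> (nx i))" "b i \<in> Ar C" "Dom C (b i) = W" "Cod C (b i) = Dom C (\<beta> i)"
    "\<psi> i \<in> Ar C" "Dom C (\<psi> i) = F" "Cod C (\<psi> i) = G"
    if "i \<in> I" for i using ab \<psi> that by (auto simp: in_Hom)
  have [simp]: "W \<in> Ob C" using arr_Ob(1)[of "a 1"] by simp
  define \<phi> where "\<phi> i = s' i \<bullet> (\<psi> i \<bullet> r i)" for i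
  have [simp]: "\<phi> i \<in> Ar C" "Dom C (\<phi> i) = Dom C (\<alpha> i)" "Cod C (\<phi> i) = Dom C (\<beta> i)" if "i \<in> I" for i
    using that by (simp_all add: \<phi>_def)
  have \<phi>c: "\<phi> (nx i) \<bullet> (\<alpha> i \<bullet> x) = \<beta> i \<bullet> (\<phi> i \<bullet> x)" if "i \<in> I" "x \<in> Ar C" "Cod C x = Dom C (\<alpha> i)" for i x
  proof -
    have "\<phi> (nx i) \<bullet> \<alpha> i = \<beta> i \<bullet> \<phi> i" using mor that unfolding \<phi>_def by (simp add: seq_morphism_iff)
    from comp_rewrite[OF this, of x] show ?thesis using that by (simp add: comp_assoc)
  qed
  have \<phi>s: "\<phi> i \<bullet> x = s' i \<bullet> (\<psi> i \<bullet> (r i \<bullet> x))" if "i \<in> I" "x \<in> Ar C" "Cod C x = Dom C (\<alpha> i)" for i x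
    using that by (simp add: \<phi>_def comp_assoc)
  have sta: "\<alpha> (nx i) \<bullet> a i = Neg C (p \<star> a (Suc i))" and stb: "\<phi> (nx i) \<bullet> a i \<boxplus> \<beta> i \<bullet> b i = p \<star> b (Suc i)"
    if "i \<in> I" "i < n" for i
  proof -
    show "\<alpha> (nx i) \<bullet> a i = Neg C (p \<star> a (Suc i))" using st that neg_neg[of "\<alpha> (nx i) \<bullet> a i"] by simp
    show "\<phi> (nx i) \<bullet> a i \<boxplus> \<beta> i \<bullet> b i = p \<star> b (Suc i)" using st that by (simp add: \<phi>_def)
  qed
  have \<alpha>\<alpha>: "\<alpha> (nx i) \<bullet> (\<alpha> i \<bullet> x) = Null C (Dom C x) (Dom C (\<alpha> (nx (nx i))))" if "i \<in> I" "x \<in> Ar C" "Cod C x = Dom C (\<alpha> i)" for i x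
    using that comp_rewrite[OF exactD(2)[OF ex(1) that(1)], of x] by simp
  have \<beta>\<beta>: "\<beta> (nx i) \<bullet> (\<beta> i \<bullet> x) = Null C (Dom C x) (Dom C (\<beta> (nx (nx i))))" if "i \<in> I" "x \<in> Ar C" "Cod C x = Dom C (\<beta> i)" for i x
    using that comp_rewrite[OF exactD(2)[OF ex(2) that(1)], of x] by simp
  note rac = reduction_comp[OF sa u ra] and rbc = reduction_comp[OF sb u rb]
  let ?a = "\<lambda>i. r (nx i) \<bullet> a i" and ?b = "\<lambda>i. r' i \<bullet> b i"
  have base': "Neg C (p \<star> ?a n) = p \<star> ?a 1 \<and> (\<exists>z \<in> Hom C W F. \<psi> 1 \<bullet> ?a n \<boxplus> p \<star> ?b n = p \<star> (u \<star> ?b 1 \<boxplus> \<psi> 1 \<bullet> z))"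
  proof (rule base[unfolded periodic_cone_def, rule_format], intro conjI ballI impI)
    fix i assume i [simp]: "i \<in> I"
    show "?a i \<in> Hom C W F" "?b i \<in> Hom C W G" by (simp_all add: in_Hom)
    assume [simp]: "i < n"
    have "r (nx (nx i)) \<bullet> (\<alpha> (nx i) \<bullet> a i) = p \<star> weight u (nx i) \<star> ?a i" by (rule rac(6)) simp_all
    also have "weight u (nx i) = \<one>\<^bsub>R\<^esub>" using \<open>i \<in> I\<close> by (simp add: weight_def I_def)
    finally have "p \<star> ?a i = r (nx (nx i)) \<bullet> (\<alpha> (nx i) \<bullet> a i)" by simp
    also have "\<dots> = Neg C (p \<star> ?a (Suc i))" unfolding sta[OF i \<open>i < n\<close>] by (simp add: neg_comp sm_comp)
    finally show "Neg C (p \<star> ?a i) = p \<star> ?a (Suc i)" by simp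
    have "p \<star> ?b (Suc i) = r' (nx i) \<bullet> p \<star> b (Suc i)" by (simp add: sm_comp)
    also have "\<dots> = r' (nx i) \<bullet> (\<phi> (nx i) \<bullet> a i \<boxplus> \<beta> i \<bullet> b i)" by (simp only: stb[OF i \<open>i < n\<close>])
    also have "\<dots> = r' (nx i) \<bullet> (\<phi> (nx i) \<bullet> a i) \<boxplus> r' (nx i) \<bullet> (\<beta> i \<bullet> b i)" by (rule comp_plus) simp_all
    also have "\<dots> = \<psi> (nx i) \<bullet> ?a i \<boxplus> p \<star> weight u i \<star> ?b i"
      by (simp only: \<phi>s nx_I i rbc(6) \<open>\<And>i. i \<in> I \<Longrightarrow> a i \<in> Ar C\<close> \<open>\<And>i. i \<in> I \<Longrightarrow> Cod C (a i) = Dom C (\<alpha> (nx i))\<close>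
        \<open>\<And>i. i \<in> I \<Longrightarrow> b i \<in> Ar C\<close> \<open>\<And>i. i \<in> I \<Longrightarrow> Cod C (b i) = Dom C (\<beta> i)\<close>) (subst rbc(2), simp_all)
    finally show "\<psi> (nx i) \<bullet> ?a i \<boxplus> p \<star> weight u i \<star> ?b i = p \<star> ?b (Suc i)" by (rule sym)
  qed
  then obtain z where z: "z \<in> Hom C W F" and base1: "Neg C (p \<star> ?a n) = p \<star> ?a 1"
    and base2: "\<psi> 1 \<bullet> ?a n \<boxplus> p \<star> ?b n = p \<star> (u \<star> ?b 1 \<boxplus> \<psi> 1 \<bullet> z)" by blast
  note [simp] = z[unfolded in_Hom]
  \<comment> \<open>the component in \<open>\<alpha>\<close>\<close>
  have n1: "n - 1 \<in> I" "n - 1 < n" "nx (n - 1) = n" "Suc (n - 1) = n" using n_ge_3 by auto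
  have pan: "p \<star> a n = Neg C (\<alpha> n \<bullet> a (n - 1))" using sta[OF n1(1,2)] n1(1) by (simp add: n1(3,4) del: One_nat_def)
  have pbn: "p \<star> b n = \<phi> n \<bullet> a (n - 1) \<boxplus> \<beta> (n - 1) \<bullet> b (n - 1)" using stb[OF n1(1,2)] by (simp add: n1(3,4) del: One_nat_def)
  have can: "Cod C (a (n - 1)) = Dom C (\<alpha> n)" "Cod C (a n) = Dom C (\<alpha> 1)" "a (n - 1) \<in> Ar C" "Dom C (a (n - 1)) = W"
    "b (n - 1) \<in> Ar C" "Dom C (b (n - 1)) = W" "Cod C (b (n - 1)) = Dom C (\<beta> (n - 1))" "\<beta> (n - 1) \<in> Ar C" "Cod C (\<beta> (n - 1)) = Dom C (\<beta> n)"
    using n1 by simp_all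
  have \<alpha>\<alpha>1: "\<alpha> 1 \<bullet> (\<alpha> n \<bullet> x) = Null C (Dom C x) (Dom C (\<alpha> 2))" "\<phi> 1 \<bullet> (\<alpha> n \<bullet> x) = \<beta> n \<bullet> (\<phi> n \<bullet> x)"
    if "x \<in> Ar C" "Cod C x = Dom C (\<alpha> n)" for x
    using \<alpha>\<alpha>[of n x] \<phi>c[of n x] that by simp_all
  have "p \<star> (\<alpha> 1 \<bullet> a n) = \<alpha> 1 \<bullet> p \<star> a n" by (simp add: sm_comp)
  also have "\<dots> = Null C W (Dom C (\<alpha> 2))" unfolding pan using can \<alpha>\<alpha>1(1)[of "a (n - 1)"] by (simp add: neg_comp)
  finally have "p \<star> Neg C (\<alpha> 1 \<bullet> a n) = Null C (Dom C (Neg C (\<alpha> 1 \<bullet> a n))) (Cod C (Neg C (\<alpha> 1 \<bullet> a n)))"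
    by (simp add: sm_neg)
  from p_annihilatorE[OF _ this] obtain v where v: "v \<in> Ar C" "Dom C v = Dom C (Neg C (\<alpha> 1 \<bullet> a n))" "Cod C v = Cod C (Neg C (\<alpha> 1 \<bullet> a n))"
    and pv: "Neg C (\<alpha> 1 \<bullet> a n) = p \<star> v" by auto
  have [simp]: "v \<in> Ar C" "Dom C v = W" "Cod C v = Dom C (\<alpha> 2)" using v by simp_all
  define w where "w = v \<boxplus> Neg C (u \<star> a 1)"
  have [simp]: "w \<in> Ar C" "Dom C w = W" "Cod C w = Dom C (\<alpha> 2)" by (simp_all add: w_def)
  have \<alpha>an: "\<alpha> 1 \<bullet> a n = Neg C (p \<star> v)" unfolding pv[symmetric] by simp
  have "p \<star> (\<alpha> 2 \<bullet> v) = \<alpha> 2 \<bullet> p \<star> v" by (simp add: sm_comp)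
  also have "\<dots> = Null C W (Cod C (\<alpha> 2))" unfolding pv[symmetric] using \<alpha>\<alpha>[of 1 "a n"] by (simp add: neg_comp)
  finally have d1: "divisible p (\<alpha> 2 \<bullet> v)" by (intro p_annihilator) simp_all
  have "\<alpha> 2 \<bullet> a 1 = Neg C (p \<star> a (Suc 1))" using sta[of 1] n_ge_3 by simp
  then have "\<alpha> 2 \<bullet> a 1 = p \<star> Neg C (a (Suc 1))" by (simp add: sm_neg)
  then have d2: "divisible p (\<alpha> 2 \<bullet> a 1)" using divisibleI[of p "Neg C (a (Suc 1))"] by simp
  have \<alpha>w: "\<alpha> 2 \<bullet> w = \<alpha> 2 \<bullet> v \<boxplus> Neg C (u \<star> (\<alpha> 2 \<bullet> a 1))" by (simp add: w_def linear_simps)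
  have d3: "divisible p (\<alpha> 2 \<bullet> w)" unfolding \<alpha>w
    by (rule divisible_plus[OF p_closed d1 divisible_neg[OF p_closed divisible_sm[OF u d2]]]) simp_all
  have kw: "p \<star> (k 2 \<bullet> (\<alpha> 2 \<bullet> w)) = Null C W (Dom C (\<alpha> 2))"
    using p_zero_divisible[OF divisible_comp(1)[OF p_closed d3, of "k 2"]] by simp
  have 1: "r 2 \<bullet> (\<alpha> 1 \<bullet> a n) = p \<star> u \<star> (r 1 \<bullet> a n)" using rac(6)[of 1 "a n"] by simp
  have 2: "p \<star> (r 2 \<bullet> a 1) = Neg C (p \<star> (r 1 \<bullet> a n))" using base1 by simp
  have "p \<star> (r 2 \<bullet> w) = r 2 \<bullet> p \<star> v \<boxplus> Neg C (u \<star> p \<star> (r 2 \<bullet> a 1))"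
    by (simp add: w_def linear_simps sm_left_comm[of p u])
  also have "\<dots> = Null C W F" unfolding 2 pv[symmetric]
    using 1 by (simp add: neg_comp sm_neg sm_left_comm[of u p])
  finally have rw: "p \<star> (r 2 \<bullet> w) = Null C W F" .
  have wi: "k 2 \<bullet> (\<alpha> 2 \<bullet> w) \<boxplus> (\<alpha> 1 \<bullet> (k 1 \<bullet> w) \<boxplus> s 2 \<bullet> (r 2 \<bullet> w)) = w" using rac(1)[of 1 w] by simp
  have "p \<star> w = p \<star> (k 2 \<bullet> (\<alpha> 2 \<bullet> w) \<boxplus> (\<alpha> 1 \<bullet> (k 1 \<bullet> w) \<boxplus> s 2 \<bullet> (r 2 \<bullet> w)))" by (simp only: wi)
  also have "\<dots> = p \<star> (k 2 \<bullet> (\<alpha> 2 \<bullet> w)) \<boxplus> (p \<star> (\<alpha> 1 \<bullet> (k 1 \<bullet> w)) \<boxplus> s 2 \<bullet> (p \<star> (r 2 \<bullet> w)))"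
    by (simp add: linear_simps)
  also have "\<dots> = p \<star> (\<alpha> 1 \<bullet> (k 1 \<bullet> w))" unfolding kw rw by simp
  finally have pw: "p \<star> w = p \<star> (\<alpha> 1 \<bullet> (k 1 \<bullet> w))" .
  define a' where "a' = Neg C (k 1 \<bullet> w) \<boxplus> s 1 \<bullet> z"
  have [simp]: "a' \<in> Ar C" "Dom C a' = W" "Cod C a' = Dom C (\<alpha> 1)" by (simp_all add: a'_def)
  have sz: "\<alpha> 1 \<bullet> (s 1 \<bullet> z) = p \<star> u \<star> (s 2 \<bullet> z)" using rac(5)[of 1 z] by simp
  have "p \<star> (\<alpha> 1 \<bullet> a') = Neg C (p \<star> (\<alpha> 1 \<bullet> (k 1 \<bullet> w))) \<boxplus> p \<star> (\<alpha> 1 \<bullet> (s 1 \<bullet> z))"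
    by (simp add: a'_def linear_simps)
  also have "\<dots> = Neg C (p \<star> w)" unfolding sz pw by simp
  finally have \<alpha>a': "p \<star> (\<alpha> 1 \<bullet> a') = Neg C (p \<star> w)" .
  have e1: "Neg C (\<alpha> 1 \<bullet> a n) = p \<star> (u \<star> a 1 \<boxplus> Neg C (\<alpha> 1 \<bullet> a'))"
  proof -
    have "p \<star> (u \<star> a 1 \<boxplus> Neg C (\<alpha> 1 \<bullet> a')) = p \<star> u \<star> a 1 \<boxplus> Neg C (p \<star> (\<alpha> 1 \<bullet> a'))" by (simp add: sm_plus sm_neg)
    also have "\<dots> = p \<star> v" unfolding \<alpha>a' by (simp add: w_def linear_simps plus_left_comm[of "p \<star> u \<star> a (Suc 0)"])
    finally show ?thesis unfolding pv by (rule sym)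
  qed
  \<comment> \<open>the component in \<open>\<beta>\<close>\<close>
  define V where "V = \<phi> 1 \<bullet> a n \<boxplus> \<beta> n \<bullet> b n"
  have [simp]: "V \<in> Ar C" "Dom C V = W" "Cod C V = Dom C (\<beta> 1)" by (simp_all add: V_def)
  have "p \<star> V = \<phi> 1 \<bullet> p \<star> a n \<boxplus> \<beta> n \<bullet> p \<star> b n" by (simp add: V_def linear_simps)
  also have "\<dots> = Neg C (\<phi> 1 \<bullet> (\<alpha> n \<bullet> a (n - 1))) \<boxplus> (\<beta> n \<bullet> (\<phi> n \<bullet> a (n - 1)) \<boxplus> \<beta> n \<bullet> (\<beta> (n - 1) \<bullet> b (n - 1)))"
    unfolding pan pbn using can by (simp add: neg_comp comp_plus)
  also have "\<beta> n \<bullet> (\<beta> (n - 1) \<bullet> b (n - 1)) = Null C W (Dom C (\<beta> 1))"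
    using \<beta>\<beta>[OF n1(1), of "b (n - 1)"] can unfolding n1(3) by simp
  also have "\<phi> 1 \<bullet> (\<alpha> n \<bullet> a (n - 1)) = \<beta> n \<bullet> (\<phi> n \<bullet> a (n - 1))" using can by (intro \<alpha>\<alpha>1(2)) simp_all
  also have "Neg C (\<beta> n \<bullet> (\<phi> n \<bullet> a (n - 1))) \<boxplus> (\<beta> n \<bullet> (\<phi> n \<bullet> a (n - 1)) \<boxplus> Null C W (Dom C (\<beta> 1))) = Null C (Dom C V) (Cod C V)"
    using can by simp
  finally have 0: "p \<star> V = Null C (Dom C V) (Cod C V)" .
  obtain v' where v': "v' \<in> Ar C" "Dom C v' = Dom C V" "Cod C v' = Cod C V" and pv': "V = p \<star> v'"
    by (rule p_annihilatorE[OF _ 0]) simp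
  have [simp]: "v' \<in> Ar C" "Dom C v' = W" "Cod C v' = Dom C (\<beta> 1)" using v' by simp_all
  define y where "y = v' \<boxplus> Neg C (u \<star> b 1)"
  have [simp]: "y \<in> Ar C" "Dom C y = W" "Cod C y = Dom C (\<beta> 1)" by (simp_all add: y_def)
  have \<phi>\<alpha>: "\<phi> 2 \<bullet> (\<alpha> 1 \<bullet> a n) = \<beta> 1 \<bullet> (\<phi> 1 \<bullet> a n)" using \<phi>c[of 1 "a n"] by simp
  have \<beta>\<beta>1: "\<beta> 1 \<bullet> (\<beta> n \<bullet> b n) = Null C W (Dom C (\<beta> 2))" using \<beta>\<beta>[of n "b n"] by simp
  have "p \<star> (\<beta> 1 \<bullet> v' \<boxplus> \<phi> 2 \<bullet> v) = \<beta> 1 \<bullet> p \<star> v' \<boxplus> \<phi> 2 \<bullet> p \<star> v" by (simp add: linear_simps)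
  also have "\<dots> = (\<beta> 1 \<bullet> (\<phi> 1 \<bullet> a n) \<boxplus> \<beta> 1 \<bullet> (\<beta> n \<bullet> b n)) \<boxplus> Neg C (\<phi> 2 \<bullet> (\<alpha> 1 \<bullet> a n))"
    unfolding pv[symmetric] pv'[symmetric] V_def by (simp add: neg_comp comp_plus)
  also have "\<dots> = Null C W (Dom C (\<beta> 2))" unfolding \<phi>\<alpha> \<beta>\<beta>1 by simp
  finally have d4: "divisible p (\<beta> 1 \<bullet> v' \<boxplus> \<phi> 2 \<bullet> v)" by (intro p_annihilator) simp_all
  have "\<phi> 2 \<bullet> a 1 \<boxplus> \<beta> 1 \<bullet> b 1 = p \<star> b (Suc 1)" using stb[of 1] n_ge_3 by simp
  then have d5: "divisible p (\<phi> 2 \<bullet> a 1 \<boxplus> \<beta> 1 \<bullet> b 1)" using divisibleI[of p "b (Suc 1)"] by simp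
  have "\<beta> 1 \<bullet> y \<boxplus> \<phi> 2 \<bullet> w = (\<beta> 1 \<bullet> v' \<boxplus> \<phi> 2 \<bullet> v) \<boxplus> Neg C (u \<star> (\<phi> 2 \<bullet> a 1 \<boxplus> \<beta> 1 \<bullet> b 1))"
    by (simp add: y_def w_def linear_simps plus_ac)
  also have "divisible p \<dots>"
    by (rule divisible_plus[OF p_closed d4 divisible_neg[OF p_closed divisible_sm[OF u d5]]]) simp_all
  finally have d6: "divisible p (\<beta> 1 \<bullet> y \<boxplus> \<phi> 2 \<bullet> w)" .
  have k\<phi>: "k' 1 \<bullet> (\<phi> 2 \<bullet> w) = Null C W (Dom C (\<beta> 1))"
    using rbc(3)[of 1 "\<psi> 2 \<bullet> (r 2 \<bullet> w)"] by (simp add: \<phi>s)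
  have "k' 1 \<bullet> (\<beta> 1 \<bullet> y) = k' 1 \<bullet> (\<beta> 1 \<bullet> y \<boxplus> \<phi> 2 \<bullet> w)"
    using k\<phi> by (simp add: comp_plus)
  then have "divisible p (k' 1 \<bullet> (\<beta> 1 \<bullet> y))" using divisible_comp(1)[OF p_closed d6, of "k' 1"] by simp
  from p_zero_divisible[OF this] have ky: "p \<star> (k' 1 \<bullet> (\<beta> 1 \<bullet> y)) = Null C W (Dom C (\<beta> 1))" by simp
  have "r' 1 \<bullet> V = r' 1 \<bullet> (\<phi> 1 \<bullet> a n) \<boxplus> r' 1 \<bullet> (\<beta> n \<bullet> b n)" by (simp add: V_def comp_plus)
  also have "r' 1 \<bullet> (\<phi> 1 \<bullet> a n) = \<psi> 1 \<bullet> ?a n" using rbc(2)[of 1 "\<psi> 1 \<bullet> (r 1 \<bullet> a n)"] by (simp add: \<phi>s)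
  also have "r' 1 \<bullet> (\<beta> n \<bullet> b n) = p \<star> ?b n"
  proof -
    have "weight u n = \<one>\<^bsub>R\<^esub>" using n_ge_3 by (simp add: weight_def)
    then show ?thesis using rbc(6)[of n "b n"] by simp
  qed
  also note base2
  finally have rV: "r' 1 \<bullet> V = p \<star> (u \<star> ?b 1 \<boxplus> \<psi> 1 \<bullet> z)" .
  have "p \<star> (r' 1 \<bullet> y) = r' 1 \<bullet> p \<star> v' \<boxplus> Neg C (p \<star> u \<star> ?b 1)" by (simp add: y_def linear_simps)
  also have "\<dots> = p \<star> (\<psi> 1 \<bullet> z)" unfolding pv'[symmetric] rV
    by (simp add: sm_plus plus_comm[of _ "Neg C (p \<star> u \<star> (r' (Suc 0) \<bullet> b (Suc 0)))"])
  finally have ry: "p \<star> (r' 1 \<bullet> y) = p \<star> (\<psi> 1 \<bullet> z)" .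
  have ra': "r 1 \<bullet> a' = z" using rac(4)[of 1 w] rac(2)[of 1 z] by (simp add: a'_def comp_plus neg_comp)
  have "\<phi> 1 \<bullet> a' = s' 1 \<bullet> (\<psi> 1 \<bullet> (r 1 \<bullet> a'))" by (rule \<phi>s) simp_all
  then have \<phi>a': "\<phi> 1 \<bullet> a' = s' 1 \<bullet> (\<psi> 1 \<bullet> z)" unfolding ra' .
  have yi: "k' 1 \<bullet> (\<beta> 1 \<bullet> y) \<boxplus> (\<beta> n \<bullet> (k' n \<bullet> y) \<boxplus> s' 1 \<bullet> (r' 1 \<bullet> y)) = y" using rbc(1)[of n y] by simp
  have "p \<star> y = p \<star> (k' 1 \<bullet> (\<beta> 1 \<bullet> y) \<boxplus> (\<beta> n \<bullet> (k' n \<bullet> y) \<boxplus> s' 1 \<bullet> (r' 1 \<bullet> y)))" by (simp only: yi)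
  also have "\<dots> = p \<star> (k' 1 \<bullet> (\<beta> 1 \<bullet> y)) \<boxplus> (p \<star> (\<beta> n \<bullet> (k' n \<bullet> y)) \<boxplus> s' 1 \<bullet> (p \<star> (r' 1 \<bullet> y)))"
    by (simp add: linear_simps)
  also have "\<dots> = p \<star> (\<phi> 1 \<bullet> a' \<boxplus> \<beta> n \<bullet> (k' n \<bullet> y))" unfolding ky ry \<phi>a'
    by (simp add: linear_simps plus_comm[of "p \<star> (\<beta> n \<bullet> (k' n \<bullet> y))"])
  finally have py: "p \<star> y = p \<star> (\<phi> 1 \<bullet> a' \<boxplus> \<beta> n \<bullet> (k' n \<bullet> y))" .
  have "V = p \<star> u \<star> b 1 \<boxplus> p \<star> y" unfolding pv'
    by (simp add: y_def linear_simps plus_left_comm[of "p \<star> u \<star> b (Suc 0)"])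
  also have "\<dots> = p \<star> (u \<star> b 1 \<boxplus> (\<phi> 1 \<bullet> a' \<boxplus> \<beta> n \<bullet> (k' n \<bullet> y)))" unfolding py by (rule sm_plus[symmetric]) simp_all
  finally have e2: "\<phi> 1 \<bullet> a n \<boxplus> \<beta> n \<bullet> b n = p \<star> (u \<star> b 1 \<boxplus> (\<phi> 1 \<bullet> a' \<boxplus> \<beta> n \<bullet> (k' n \<bullet> y)))" unfolding V_def .
  have "a' \<in> Hom C W (Dom C (\<alpha> 1))" "k' n \<bullet> y \<in> Hom C W (Dom C (\<beta> n))" by (simp_all add: in_Hom)
  then show "\<exists>a' \<in> Hom C W (Dom C (\<alpha> 1)). \<exists>b' \<in> Hom C W (Dom C (\<beta> n)).
        Neg C (\<alpha> 1 \<bullet> a n) = p \<star> (u \<star> a 1 \<boxplus> Neg C (\<alpha> 1 \<bullet> a')) \<and>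
        s' 1 \<bullet> (\<psi> 1 \<bullet> r 1) \<bullet> a n \<boxplus> \<beta> n \<bullet> b n = p \<star> (u \<star> b 1 \<boxplus> (s' 1 \<bullet> (\<psi> 1 \<bullet> r 1) \<bullet> a' \<boxplus> \<beta> n \<bullet> b'))"
    using e1 e2 unfolding \<phi>_def by blast
qed

text \<open>
  In the cone of a morphism of periodic sequences the monodromy acquires an off-diagonal term \<open>c y\<close>,
  which has to be made a multiple \<open>p c z\<close> by adding \<open>p \<theta> a\<close>. The signs along the cone cancel in pairs. For
  even \<open>n\<close> this leaves \<open>p y = 0\<close>, so that \<open>y\<close> is itself a multiple of \<open>p\<close>. For odd \<open>n\<close> it leaves
  \<open>p y = p a\<close>; with a quasi-inverse \<open>c = c g c + p h\<close> and \<open>c a\<close> divisible by \<open>p\<close>, the arrows \<open>c a\<close>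
  and \<open>p h a\<close> differ by an arrow of the form \<open>p c z\<close>, and \<open>\<theta> = -h\<close> compensates.
\<close>

lemma correction:
  assumes par: "even n \<or> p \<oplus>\<^bsub>R\<^esub> p = \<zero>\<^bsub>R\<^esub>" and c: "c \<in> Hom C F G"
  shows "\<exists>\<theta> \<in> Hom C F G. \<forall>W a y. a \<in> Hom C W F \<longrightarrow> y \<in> Hom C W F \<longrightarrow>
     p \<star> y = (if even n then Null C W F else p \<star> a) \<longrightarrow> divisible p (c \<bullet> a) \<longrightarrow>
     (\<exists>z \<in> Hom C W F. c \<bullet> y \<boxplus> p \<star> (\<theta> \<bullet> a) = p \<star> (c \<bullet> z))"
proof -
  note [simp] = c[unfolded in_Hom] Hom_Ob[OF c]
  show ?thesis
  proof (cases "even n")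
    case True
    show ?thesis
    proof (rule bexI[of _ "Null C F G"], intro allI impI)
      show "Null C F G \<in> Hom C F G" by (simp add: in_Hom)
      fix W a y assume a: "a \<in> Hom C W F" and y: "y \<in> Hom C W F"
        and "p \<star> y = (if even n then Null C W F else p \<star> a)"
      then have 0: "p \<star> y = Null C (Dom C y) (Cod C y)" using True by (simp add: in_Hom)
      note [simp] = a[unfolded in_Hom] y[unfolded in_Hom] Hom_Ob[OF a]
      obtain t where t: "t \<in> Ar C" "Dom C t = Dom C y" "Cod C t = Cod C y" "y = p \<star> t"
        by (rule p_annihilatorE[OF _ 0]) simp
      from t(1-3) have [simp]: "t \<in> Ar C" "Dom C t = W" "Cod C t = F" by simp_all
      have "c \<bullet> y \<boxplus> p \<star> (Null C F G \<bullet> a) = p \<star> (c \<bullet> t)" unfolding t(4) by (simp add: sm_comp)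
      then show "\<exists>z \<in> Hom C W F. c \<bullet> y \<boxplus> p \<star> (Null C F G \<bullet> a) = p \<star> (c \<bullet> z)"
        by (intro bexI[of _ t]) (simp_all add: in_Hom)
    qed
  next
    case False
    obtain g h where g: "g \<in> Hom C G F" and h: "h \<in> Hom C F G" and cgh: "c = c \<bullet> (g \<bullet> c) \<boxplus> p \<star> h"
      using quasi_inverse[of c] by auto
    note [simp] = g[unfolded in_Hom] h[unfolded in_Hom]
    show ?thesis
    proof (rule bexI[of _ "Neg C h"], intro allI impI)
      show "Neg C h \<in> Hom C F G" by (simp add: in_Hom)
      fix W a y assume a: "a \<in> Hom C W F" and y: "y \<in> Hom C W F"
        and "p \<star> y = (if even n then Null C W F else p \<star> a)" and d: "divisible p (c \<bullet> a)"
      then have py: "p \<star> y = p \<star> a" using False by simp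
      note [simp] = a[unfolded in_Hom] y[unfolded in_Hom] Hom_Ob[OF a]
      obtain t where t: "t \<in> Ar C" "Dom C t = Dom C y" "Cod C t = Cod C y" "y = a \<boxplus> p \<star> t"
        by (rule p_cancel[OF _ _ _ _ py]) simp_all
      from t(1-3) have [simp]: "t \<in> Ar C" "Dom C t = W" "Cod C t = F" by simp_all
      obtain e where e: "e \<in> Ar C" "Dom C e = Dom C (c \<bullet> a)" "Cod C e = Cod C (c \<bullet> a)" "c \<bullet> a = p \<star> e"
        using d by (rule divisibleE)
      from e(1-3) have [simp]: "e \<in> Ar C" "Dom C e = W" "Cod C e = G" by simp_all
      have "c \<bullet> a = (c \<bullet> (g \<bullet> c) \<boxplus> p \<star> h) \<bullet> a" using cgh by (rule arg_cong)
      also have "\<dots> = c \<bullet> (g \<bullet> (c \<bullet> a)) \<boxplus> p \<star> (h \<bullet> a)" by (simp add: linear_simps)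
      also have "\<dots> = p \<star> (c \<bullet> (g \<bullet> e)) \<boxplus> p \<star> (h \<bullet> a)" unfolding e(4) by (simp add: sm_comp)
      finally have ca: "c \<bullet> a = p \<star> (c \<bullet> (g \<bullet> e)) \<boxplus> p \<star> (h \<bullet> a)" .
      have "c \<bullet> y \<boxplus> p \<star> (Neg C h \<bullet> a) = (c \<bullet> a \<boxplus> p \<star> (c \<bullet> t)) \<boxplus> Neg C (p \<star> (h \<bullet> a))"
        unfolding t(4) by (simp add: linear_simps)
      also have "\<dots> = p \<star> (c \<bullet> (g \<bullet> e \<boxplus> t))"
        unfolding ca by (simp add: linear_simps plus_ac)
      finally show "\<exists>z \<in> Hom C W F. c \<bullet> y \<boxplus> p \<star> (Neg C h \<bullet> a) = p \<star> (c \<bullet> z)"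
        by (intro bexI[of _ "g \<bullet> e \<boxplus> t"]) (simp_all add: in_Hom)
    qed
  qed
qed

text \<open>
  The first two components are prescribed. All others can be \<open>c\<close> except for the last one, which has
  to undo the deviation \<open>p d\<close> of the second and to carry the correction \<open>\<theta>\<close>. At least three
  positions are needed to have a last component that is not prescribed.
\<close>

lemma ex_periodic_cone:
  assumes par: "even n \<or> p \<oplus>\<^bsub>R\<^esub> p = \<zero>\<^bsub>R\<^esub>" and u [simp]: "u \<in> carrier R"
    and c: "c \<in> Hom C F G" and d: "d \<in> Hom C F G"
  shows "\<exists>\<psi>. \<psi> 1 = c \<and> \<psi> 2 = c \<boxplus> p \<star> d \<and> (\<forall>i \<in> I. \<psi> i \<in> Hom C F G \<and> p \<star> \<psi> i = p \<star> c) \<and> periodic_cone u F G \<psi>"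
proof -
  note [simp] = c[unfolded in_Hom] d[unfolded in_Hom] Hom_Ob[OF c]
  obtain \<theta> where \<theta>: "\<theta> \<in> Hom C F G" and corr: "\<And>W a y. \<lbrakk>a \<in> Hom C W F; y \<in> Hom C W F;
     p \<star> y = (if even n then Null C W F else p \<star> a); divisible p (c \<bullet> a)\<rbrakk> \<Longrightarrow>
     \<exists>z \<in> Hom C W F. c \<bullet> y \<boxplus> p \<star> (\<theta> \<bullet> a) = p \<star> (c \<bullet> z)"
    using correction[OF par c] by blast
  note [simp] = \<theta>[unfolded in_Hom]
  define \<psi> where "\<psi> i = (if i = 2 then c \<boxplus> p \<star> d else if i = n then c \<boxplus> p \<star> (\<theta> \<boxplus> Neg C d) else c)" for i
  have n: "n \<noteq> 2" "n \<noteq> Suc 0" "Suc 0 \<noteq> n" using n_ge_3 by auto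
  have "periodic_cone u F G \<psi>" unfolding periodic_cone_def
  proof (intro allI impI, elim conjE)
    fix W a b
    assume ab: "\<forall>i \<in> I. a i \<in> Hom C W F \<and> b i \<in> Hom C W G"
      and st: "\<forall>i \<in> I. i < n \<longrightarrow> Neg C (p \<star> a i) = p \<star> a (Suc i) \<and> \<psi> (nx i) \<bullet> a i \<boxplus> p \<star> weight u i \<star> b i = p \<star> b (Suc i)"
    have [simp]: "a i \<in> Ar C" "Dom C (a i) = W" "Cod C (a i) = F" "b i \<in> Ar C" "Dom C (b i) = W" "Cod C (b i) = G"
      if "i \<in> I" for i using ab that by (auto simp: in_Hom)
    have [simp]: "W \<in> Ob C" using arr_Ob(1)[of "a 1"] by simp
    have pa: "p \<star> a i = (if even i then Neg C (p \<star> a 1) else p \<star> a 1)" if "1 \<le> i" "i \<le> n" for i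
      using that
    proof (induction i rule: dec_induct)
      case (step i)
      then have "i \<in> I" "i < n" by (auto simp: I_def)
      then have "p \<star> a (Suc i) = Neg C (p \<star> a i)" using st by simp
      then show ?case using step \<open>i < n\<close> by simp
    qed simp
    define D where "D = p \<star> u \<star> b 1 \<boxplus> p \<star> (d \<bullet> a 1)"
    have [simp]: "D \<in> Ar C" "Dom C D = W" "Cod C D = G" by (simp_all add: D_def)
    have "\<psi> 2 \<bullet> a 1 \<boxplus> p \<star> u \<star> b 1 = p \<star> b (Suc 1)" using st[rule_format, of 1] n_ge_3 by simp
    then have "(c \<bullet> a 1 \<boxplus> p \<star> (d \<bullet> a 1)) \<boxplus> p \<star> u \<star> b 1 = p \<star> b 2"
      unfolding numeral_2_eq_2 by (simp add: \<psi>_def[of "Suc (Suc 0)"] numeral_2_eq_2 linear_simps)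
    then have b2: "D \<boxplus> c \<bullet> a 1 = p \<star> b 2" by (simp add: D_def plus_ac)
    have dD: "divisible p D" unfolding D_def by (intro divisible_plus divisibleI) simp_all
    have dDc: "divisible p (D \<boxplus> c \<bullet> a 1)" unfolding b2 by (rule divisibleI) simp_all
    have "divisible p (Neg C D \<boxplus> (D \<boxplus> c \<bullet> a 1))"
      by (rule divisible_plus[OF p_closed divisible_neg[OF p_closed dD] dDc]) simp_all
    then have dca: "divisible p (c \<bullet> a 1)" by simp
    \<comment> \<open>the alternating signs cancel the multiples of \<open>c\<close> in pairs\<close>
    have T: "\<exists>y \<in> Hom C W F. p \<star> b i = D \<boxplus> c \<bullet> y \<and> p \<star> y = (if even i then p \<star> a 1 else Null C W F)"
      if "2 \<le> i" "i < n" for i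
      using that
    proof (induction i rule: dec_induct)
      case base
      show ?case using b2 by (intro bexI[of _ "a 1"]) (simp_all add: in_Hom)
    next
      case (step i)
      have [simp]: "i \<in> I" "i < n" using step by (auto simp: I_def)
      obtain y where y: "y \<in> Hom C W F" "p \<star> b i = D \<boxplus> c \<bullet> y" "p \<star> y = (if even i then p \<star> a 1 else Null C W F)"
        using step by auto
      note [simp] = y(1)[unfolded in_Hom]
      have "\<psi> (nx i) = c" "weight u i = \<one>\<^bsub>R\<^esub>" using step by (auto simp: \<psi>_def weight_def)
      then have "p \<star> b (Suc i) = c \<bullet> a i \<boxplus> p \<star> b i" using st[rule_format, of i] by simp
      also have "\<dots> = D \<boxplus> c \<bullet> (y \<boxplus> a i)" unfolding y(2) by (simp add: comp_plus plus_ac)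
      finally have "p \<star> b (Suc i) = D \<boxplus> c \<bullet> (y \<boxplus> a i)" .
      moreover have "p \<star> (y \<boxplus> a i) = (if even (Suc i) then p \<star> a 1 else Null C W F)"
        using y(3) pa[of i] step by (simp add: sm_plus)
      ultimately show ?case by (intro bexI[of _ "y \<boxplus> a i"]) (simp_all add: in_Hom)
    qed
    define m where "m = n - 1"
    have m: "Suc m = n" "m \<in> I" "m < n" "2 \<le> m" "nx m = n" "weight u m = \<one>\<^bsub>R\<^esub>"
      using n_ge_3 by (auto simp: m_def I_def nx_def weight_def)
    obtain y where y: "y \<in> Hom C W F" "p \<star> b m = D \<boxplus> c \<bullet> y" "p \<star> y = (if even m then p \<star> a 1 else Null C W F)"
      using T[OF m(4,3)] by blast
    note [simp] = y(1)[unfolded in_Hom] m(2)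
    have np: "Neg C (p \<star> f) = p \<star> f" if "odd n" "f \<in> Ar C" for f using neg_p[of f] par that by simp
    have pp: "p \<star> a 1 \<boxplus> p \<star> a 1 = Null C W F" if o: "odd n"
    proof -
      have "Neg C (p \<star> a 1) \<boxplus> p \<star> a 1 = Null C W F" by simp
      then show ?thesis by (simp only: np[OF o] \<open>\<And>i. i \<in> I \<Longrightarrow> a i \<in> Ar C\<close> I_simps)
    qed
    have pam: "p \<star> a m = p \<star> a 1"
      using pa[of m] m np[of "a 1"] by (cases "even m") auto
    have "\<psi> n \<bullet> a m \<boxplus> p \<star> b m = p \<star> b n" using st[rule_format, OF m(2,3)] m by simp
    then have "p \<star> b n = \<psi> n \<bullet> a m \<boxplus> (D \<boxplus> c \<bullet> y)" unfolding y(2) by (rule sym)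
    also have "\<psi> n \<bullet> a m = c \<bullet> a m \<boxplus> (\<theta> \<bullet> (p \<star> a m) \<boxplus> Neg C (d \<bullet> (p \<star> a m)))"
      using n by (simp add: \<psi>_def linear_simps)
    also have "\<dots> = c \<bullet> a m \<boxplus> (p \<star> (\<theta> \<bullet> a 1) \<boxplus> Neg C (p \<star> (d \<bullet> a 1)))"
      unfolding pam by (simp add: sm_comp)
    finally have bn: "p \<star> b n = (c \<bullet> a m \<boxplus> (p \<star> (\<theta> \<bullet> a 1) \<boxplus> Neg C (p \<star> (d \<bullet> a 1)))) \<boxplus> (D \<boxplus> c \<bullet> y)" .
    let ?y = "y \<boxplus> (a m \<boxplus> a n)"
    have "p \<star> ?y = (if even n then Null C W F else p \<star> a 1)"
      using y(3) pam pa[of n] pp m n_ge_3 by (auto simp: sm_plus)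
    moreover have "a 1 \<in> Hom C W F" "?y \<in> Hom C W F" by (simp_all add: in_Hom)
    ultimately obtain z where z: "z \<in> Hom C W F" "c \<bullet> ?y \<boxplus> p \<star> (\<theta> \<bullet> a 1) = p \<star> (c \<bullet> z)"
      using corr dca by blast
    note [simp] = z(1)[unfolded in_Hom]
    have "\<psi> 1 = c" using n by (simp add: \<psi>_def)
    then have "\<psi> 1 \<bullet> a n \<boxplus> p \<star> b n = p \<star> u \<star> b 1 \<boxplus> (c \<bullet> ?y \<boxplus> p \<star> (\<theta> \<bullet> a 1))"
      unfolding bn D_def by (simp add: linear_simps plus_ac)
    also have "\<dots> = p \<star> (u \<star> b 1 \<boxplus> \<psi> 1 \<bullet> z)" unfolding z(2) \<open>\<psi> 1 = c\<close> by (simp add: sm_plus)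
    finally have "\<psi> 1 \<bullet> a n \<boxplus> p \<star> b n = p \<star> (u \<star> b 1 \<boxplus> \<psi> 1 \<bullet> z)" .
    moreover have "Neg C (p \<star> a n) = p \<star> a 1" using pa[of n] np[of "a 1"] n_ge_3 by auto
    ultimately show "Neg C (p \<star> a n) = p \<star> a 1 \<and> (\<exists>z \<in> Hom C W F. \<psi> 1 \<bullet> a n \<boxplus> p \<star> b n = p \<star> (u \<star> b 1 \<boxplus> \<psi> 1 \<bullet> z))"
      using z(1) by blast
  qed
  moreover have "\<forall>i \<in> I. \<psi> i \<in> Hom C F G \<and> p \<star> \<psi> i = p \<star> c" by (simp add: \<psi>_def in_Hom sm_plus)
  moreover have "\<psi> 1 = c" "\<psi> 2 = c \<boxplus> p \<star> d" using n by (simp_all add: \<psi>_def)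
  ultimately show ?thesis by blast
qed

definition pv :: "nat \<Rightarrow> nat" where
  "pv i = (if i = 1 then n else i - 1)"

lemma pv: "i \<in> I \<Longrightarrow> pv i \<in> I" "i \<in> I \<Longrightarrow> nx (pv i) = i" "i \<in> I \<Longrightarrow> pv (nx i) = i"
  using n_ge_3 by (auto simp: pv_def nx_def I_def)

text \<open>
  On the periodic parts \<open>f1\<close> and \<open>f2\<close> induce arrows that agree modulo \<open>p\<close>; these are completed to
  a morphism \<open>\<psi>\<close> whose cone has the right monodromy. The morphism \<open>s' \<psi> r\<close> agrees with \<open>f1\<close> and
  \<open>f2\<close> up to a homotopy, which is read off from the identity \<open>1 = k \<alpha> + \<alpha> k + s r\<close> on both sides of
  \<open>f1\<close> and \<open>f2\<close>.
\<close>

lemma fill_cone: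
  assumes u: "u \<in> Units R" and par: "even n \<or> p \<oplus>\<^bsub>R\<^esub> p = \<zero>\<^bsub>R\<^esub>"
    and a: "angle u \<alpha>" and b: "angle u \<beta>"
    and f1: "f1 \<in> Hom C (Dom C (\<alpha> 1)) (Dom C (\<beta> 1))" and f2: "f2 \<in> Hom C (Dom C (\<alpha> 2)) (Dom C (\<beta> 2))"
    and comm: "f2 \<bullet> \<alpha> 1 = \<beta> 1 \<bullet> f1"
  shows "\<exists>\<phi>. \<phi> 1 = f1 \<and> \<phi> 2 = f2 \<and> seq_morphism \<alpha> \<beta> \<phi> \<and> cone_monodromy u \<alpha> \<beta> \<phi>"
proof -
  have u' [simp]: "u \<in> carrier R" "inv\<^bsub>R\<^esub> u \<in> carrier R" using u by (auto simp: Units_closed)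
  have ex: "exact \<alpha>" "exact \<beta>" using a b by (auto simp: angle_def)
  note sa = exactD(1)[OF ex(1) I_simps(1)] and sb = exactD(1)[OF ex(2) I_simps(1)]
  obtain F k s r where ra: "reduction u \<alpha> F k s r" using ex_reduction[OF u a] by blast
  obtain G k' s' r' where rb: "reduction u \<beta> G k' s' r'" using ex_reduction[OF u b] by blast
  note [simp] = seq_arr[OF sa] seq_arr[OF sb] reduction_arr(1-9)[OF ra] reduction_arr(1-9)[OF rb]
    reduction_arr(10)[OF ra I_simps(1)] reduction_arr(10)[OF rb I_simps(1)] f1[unfolded in_Hom] f2[unfolded in_Hom]
  note rac = reduction_comp[OF sa u'(1) ra] and rbc = reduction_comp[OF sb u'(1) rb]
  have \<alpha>\<alpha>: "\<alpha> (nx i) \<bullet> (\<alpha> i \<bullet> x) = Null C (Dom C x) (Dom C (\<alpha> (nx (nx i))))" if "i \<in> I" "x \<in> Ar C" "Cod C x = Dom C (\<alpha> i)" for i x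
    using that comp_rewrite[OF exactD(2)[OF ex(1) that(1)], of x] by simp
  have \<beta>\<beta>: "\<beta> (nx i) \<bullet> (\<beta> i \<bullet> x) = Null C (Dom C x) (Dom C (\<beta> (nx (nx i))))" if "i \<in> I" "x \<in> Ar C" "Cod C x = Dom C (\<beta> i)" for i x
    using that comp_rewrite[OF exactD(2)[OF ex(2) that(1)], of x] by simp
  have commx: "f2 \<bullet> (\<alpha> 1 \<bullet> x) = \<beta> 1 \<bullet> (f1 \<bullet> x)" if "x \<in> Ar C" "Cod C x = Dom C (\<alpha> 1)" for x
    using comp_rewrite[OF comm, of x] that by (simp add: comp_assoc)
  \<comment> \<open>the induced maps on the residual parts agree modulo \<open>p\<close>\<close>
  let ?c = "r' 1 \<bullet> (f1 \<bullet> s 1)"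
  have "p \<star> u \<star> (r' 2 \<bullet> (f2 \<bullet> s 2)) = r' 2 \<bullet> (f2 \<bullet> (\<alpha> 1 \<bullet> s 1))"
    using reductionD(5)[OF ra I_simps(2)] by (simp add: sm_comp)
  also have "\<dots> = r' 2 \<bullet> (\<beta> 1 \<bullet> (f1 \<bullet> s 1))" by (subst commx) simp_all
  also have "\<dots> = p \<star> u \<star> ?c" using rbc(6)[of 1 "f1 \<bullet> s 1"] by simp
  finally have "inv\<^bsub>R\<^esub> u \<star> p \<star> u \<star> (r' 2 \<bullet> (f2 \<bullet> s 2)) = inv\<^bsub>R\<^esub> u \<star> p \<star> u \<star> ?c" by (rule arg_cong)
  then have pc: "p \<star> (r' 2 \<bullet> (f2 \<bullet> s 2)) = p \<star> ?c"
    using u by (simp add: sm_left_comm[of "inv\<^bsub>R\<^esub> u" p] unit_sm_cancel)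
  obtain d where d0: "d \<in> Ar C" "Dom C d = Dom C (r' 2 \<bullet> (f2 \<bullet> s 2))" "Cod C d = Cod C (r' 2 \<bullet> (f2 \<bullet> s 2))" "r' 2 \<bullet> (f2 \<bullet> s 2) = ?c \<boxplus> p \<star> d"
    by (rule p_cancel[OF _ _ _ _ pc]) simp_all
  have c: "?c \<in> Hom C F G" by (simp add: in_Hom)
  have d: "d \<in> Hom C F G" using d0(1-3) by (simp add: in_Hom)
  obtain \<psi> where \<psi>1: "\<psi> 1 = ?c" and \<psi>2: "\<psi> 2 = r' 2 \<bullet> (f2 \<bullet> s 2)"
    and \<psi>: "\<And>i. i \<in> I \<Longrightarrow> \<psi> i \<in> Hom C F G" and p\<psi>: "\<And>i. i \<in> I \<Longrightarrow> p \<star> \<psi> i = p \<star> ?c" and base: "periodic_cone u F G \<psi>"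
    using ex_periodic_cone[OF par u'(1) c d] unfolding d0(4) by blast
  have [simp]: "\<psi> i \<in> Ar C" "Dom C (\<psi> i) = F" "Cod C (\<psi> i) = G" if "i \<in> I" for i using \<psi>[OF that] by (auto simp: in_Hom)
  define \<sigma> where "\<sigma> i = s' i \<bullet> (\<psi> i \<bullet> r i)" for i
  have [simp]: "\<sigma> i \<in> Ar C" "Dom C (\<sigma> i) = Dom C (\<alpha> i)" "Cod C (\<sigma> i) = Dom C (\<beta> i)" if "i \<in> I" for i
    using that by (simp_all add: \<sigma>_def)
  have \<sigma>nat: "\<sigma> (nx i) \<bullet> \<alpha> i = \<beta> i \<bullet> \<sigma> i" if i [simp]: "i \<in> I" for i
  proof -
    have "\<sigma> (nx i) \<bullet> \<alpha> i = s' (nx i) \<bullet> (\<psi> (nx i) \<bullet> (p \<star> weight u i \<star> r i))"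
      by (simp add: \<sigma>_def comp_assoc reductionD(6)[OF ra])
    also have "\<dots> = weight u i \<star> (s' (nx i) \<bullet> (p \<star> \<psi> (nx i) \<bullet> r i))" by (simp add: sm_comp sm_left_comm[of p])
    also have "\<dots> = weight u i \<star> (s' (nx i) \<bullet> (p \<star> \<psi> i \<bullet> r i))" unfolding p\<psi>[OF i] p\<psi>[OF nx_I[OF i]] ..
    also have "\<dots> = \<beta> i \<bullet> \<sigma> i" unfolding \<sigma>_def using rbc(5)[OF i, of "\<psi> i \<bullet> r i"]
      by (simp add: sm_comp sm_left_comm[of p])
    finally show ?thesis .
  qed
  have mor: "seq_morphism \<alpha> \<beta> \<sigma>" by (simp add: seq_morphism_iff in_Hom \<sigma>nat)
  have cone: "cone_monodromy u \<alpha> \<beta> \<sigma>"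
    using cone_monodromy_reduced[OF u'(1) ex ra rb \<psi> mor[unfolded \<sigma>_def] base] unfolding \<sigma>_def .
  \<comment> \<open>factorizations of the parts of \<open>f1\<close> and \<open>f2\<close> that meet the contractible summands\<close>
  have "p \<star> u \<star> (r' 1 \<bullet> (f1 \<bullet> \<alpha> n)) = r' 2 \<bullet> (\<beta> 1 \<bullet> (f1 \<bullet> \<alpha> n))" using rbc(6)[of 1 "f1 \<bullet> \<alpha> n"] by simp
  also have "\<dots> = r' 2 \<bullet> (f2 \<bullet> (\<alpha> 1 \<bullet> \<alpha> n))" using commx[of "\<alpha> n"] by simp
  also have "\<dots> = Null C (Dom C (\<alpha> n)) G" using exactD(2)[OF ex(1) I_simps(3)] by simp
  finally have "inv\<^bsub>R\<^esub> u \<star> p \<star> u \<star> (r' 1 \<bullet> (f1 \<bullet> \<alpha> n)) = inv\<^bsub>R\<^esub> u \<star> Null C (Dom C (\<alpha> n)) G" by (rule arg_cong)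
  then have "divisible p (r' 1 \<bullet> (f1 \<bullet> \<alpha> n))"
    using u by (intro p_annihilator) (simp_all add: sm_left_comm[of "inv\<^bsub>R\<^esub> u" p] unit_sm_cancel)
  then obtain g where g: "g \<in> Ar C" "Dom C g = Dom C (r' 1 \<bullet> (f1 \<bullet> \<alpha> n))" "Cod C g = Cod C (r' 1 \<bullet> (f1 \<bullet> \<alpha> n))" "r' 1 \<bullet> (f1 \<bullet> \<alpha> n) = p \<star> g"
    by (rule divisibleE)
  from g(1-3) have [simp]: "g \<in> Ar C" "Dom C g = Dom C (\<alpha> n)" "Cod C g = G" by simp_all
  have h2: "\<beta> 2 \<bullet> f2 \<in> Hom C (Dom C (\<alpha> (nx 1))) (Dom C (\<beta> 3))" by (simp add: in_Hom)
  have "(\<beta> 2 \<bullet> f2) \<bullet> \<alpha> 1 = \<beta> 2 \<bullet> (\<beta> 1 \<bullet> f1)" using comm by (simp add: comp_assoc)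
  also have "\<dots> = Null C (Dom C (\<alpha> 1)) (Dom C (\<beta> 3))" using \<beta>\<beta>[of 1 f1] by simp
  finally obtain g2 where g2: "g2 \<in> Hom C (Dom C (\<alpha> (nx (nx 1)))) (Dom C (\<beta> 3))" "\<beta> 2 \<bullet> f2 = g2 \<bullet> \<alpha> (nx 1)"
    by (rule exact_cokernelE[OF ex(1) I_simps(2) h2])
  have [simp]: "g2 \<in> Ar C" "Dom C g2 = Dom C (\<alpha> 3)" "Cod C g2 = Dom C (\<beta> 3)" using g2(1) by (auto simp: in_Hom)
  \<comment> \<open>only the three places of the homotopy that touch positions 1 and 2 are nonzero\<close>
  define h where "h i = (if i = 1 then k' 1 \<bullet> f2 \<boxplus> s' 1 \<bullet> (r' 1 \<bullet> (f1 \<bullet> k 1))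
    else if i = 2 then k' 2 \<bullet> g2 \<boxplus> s' 2 \<bullet> (r' 2 \<bullet> (f2 \<bullet> k 2))
    else if i = n then k' n \<bullet> f1 \<boxplus> s' n \<bullet> (g \<bullet> k n)
    else Null C (Dom C (\<alpha> (nx i))) (Dom C (\<beta> i)))" for i
  have h: "h i \<in> Hom C (Dom C (\<alpha> (nx i))) (Dom C (\<beta> i))" if "i \<in> I" for i
    using that by (auto simp: h_def in_Hom)
  have hn: "h 1 = k' 1 \<bullet> f2 \<boxplus> s' 1 \<bullet> (r' 1 \<bullet> (f1 \<bullet> k 1))" "h 2 = k' 2 \<bullet> g2 \<boxplus> s' 2 \<bullet> (r' 2 \<bullet> (f2 \<bullet> k 2))"
    "h n = k' n \<bullet> f1 \<boxplus> s' n \<bullet> (g \<bullet> k n)" using n_ge_3 by (auto simp: h_def)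
  have [simp]: "h i \<in> Ar C" "Dom C (h i) = Dom C (\<alpha> (nx i))" "Cod C (h i) = Dom C (\<beta> i)" if "i \<in> I" for i
    using h[OF that] by (auto simp: in_Hom)
  define \<phi> where "\<phi> i = \<sigma> i \<boxplus> (h i \<bullet> \<alpha> i \<boxplus> \<beta> (pv i) \<bullet> h (pv i))" for i
  have eq: "\<phi> (nx i) = \<sigma> (nx i) \<boxplus> (h (nx i) \<bullet> \<alpha> (nx i) \<boxplus> \<beta> i \<bullet> h i)" if "i \<in> I" for i
    unfolding \<phi>_def pv(3)[OF that] ..
  have \<phi>arr: "\<phi> i \<in> Hom C (Dom C (\<alpha> i)) (Dom C (\<beta> i))" if "i \<in> I" for i
    using that pv[OF that] by (simp add: \<phi>_def in_Hom)
  have "seq_morphism \<alpha> \<beta> \<phi>" unfolding seq_morphism_iff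
  proof (intro ballI conjI \<phi>arr)
    fix i assume i [simp]: "i \<in> I"
    have [simp]: "pv i \<in> I" "nx (pv i) = i" using pv[OF i] by simp_all
    have "\<phi> (nx i) \<bullet> \<alpha> i = \<beta> i \<bullet> \<sigma> i \<boxplus> \<beta> i \<bullet> (h i \<bullet> \<alpha> i)"
      unfolding eq[OF i] by (simp add: arrow_simps \<sigma>nat exactD(2)[OF ex(1)])
    also have "\<dots> = \<beta> i \<bullet> \<phi> i"
      using \<beta>\<beta>[of "pv i" "h (pv i)"] unfolding \<phi>_def by (simp add: arrow_simps)
    finally show "\<phi> (nx i) \<bullet> \<alpha> i = \<beta> i \<bullet> \<phi> i" .
  qed
  moreover have "cone_monodromy u \<alpha> \<beta> \<phi>"
    by (rule cone_monodromy_homotopy[OF u'(1) sa sb exactD(2)[OF ex(2)] _ h eq cone]) (simp_all add: in_Hom)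
  moreover have "\<phi> 1 = f1"
  proof -
    have 1: "k' 1 \<bullet> (\<beta> 1 \<bullet> f1) \<boxplus> (\<beta> n \<bullet> (k' n \<bullet> f1) \<boxplus> s' 1 \<bullet> (r' 1 \<bullet> f1)) = f1" using rbc(1)[of n f1] by simp
    have 2: "k 1 \<bullet> \<alpha> 1 \<boxplus> (\<alpha> n \<bullet> k n \<boxplus> s 1 \<bullet> r 1) = Ident C (Dom C (\<alpha> 1))" using reductionD(4)[OF ra I_simps(3)] by simp
    have "s' 1 \<bullet> (r' 1 \<bullet> f1) = s' 1 \<bullet> (r' 1 \<bullet> (f1 \<bullet> (k 1 \<bullet> \<alpha> 1 \<boxplus> (\<alpha> n \<bullet> k n \<boxplus> s 1 \<bullet> r 1))))" unfolding 2 by simp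
    also have "\<dots> = s' 1 \<bullet> (r' 1 \<bullet> (f1 \<bullet> (k 1 \<bullet> \<alpha> 1))) \<boxplus> (s' 1 \<bullet> ((r' 1 \<bullet> (f1 \<bullet> \<alpha> n)) \<bullet> k n) \<boxplus> \<sigma> 1)"
      unfolding \<sigma>_def \<psi>1 by (simp add: arrow_simps)
    also have "s' 1 \<bullet> ((r' 1 \<bullet> (f1 \<bullet> \<alpha> n)) \<bullet> k n) = \<beta> n \<bullet> (s' n \<bullet> (g \<bullet> k n))"
    proof -
      have "weight u n = \<one>\<^bsub>R\<^esub>" using n_ge_3 by (simp add: weight_def)
      then show ?thesis unfolding g(4) using rbc(5)[of n "g \<bullet> k n"] by (simp add: sm_comp)
    qed
    finally have 3: "s' 1 \<bullet> (r' 1 \<bullet> f1) = s' 1 \<bullet> (r' 1 \<bullet> (f1 \<bullet> (k 1 \<bullet> \<alpha> 1))) \<boxplus> (\<beta> n \<bullet> (s' n \<bullet> (g \<bullet> k n)) \<boxplus> \<sigma> 1)" .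
    have "f1 = k' 1 \<bullet> (f2 \<bullet> \<alpha> 1) \<boxplus> (\<beta> n \<bullet> (k' n \<bullet> f1) \<boxplus> (s' 1 \<bullet> (r' 1 \<bullet> (f1 \<bullet> (k 1 \<bullet> \<alpha> 1))) \<boxplus> (\<beta> n \<bullet> (s' n \<bullet> (g \<bullet> k n)) \<boxplus> \<sigma> 1)))"
      unfolding comm unfolding 3[symmetric] 1 ..
    also have "\<dots> = \<phi> 1" unfolding \<phi>_def by (simp add: pv_def hn[unfolded One_nat_def] arrow_simps plus_ac)
    finally show ?thesis by (rule sym)
  qed
  moreover have "\<phi> 2 = f2"
  proof -
    have 1: "k' 2 \<bullet> (\<beta> 2 \<bullet> f2) \<boxplus> (\<beta> 1 \<bullet> (k' 1 \<bullet> f2) \<boxplus> s' 2 \<bullet> (r' 2 \<bullet> f2)) = f2" using rbc(1)[of 1 f2] by simp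
    have 2: "k 2 \<bullet> \<alpha> 2 \<boxplus> (\<alpha> 1 \<bullet> k 1 \<boxplus> s 2 \<bullet> r 2) = Ident C (Dom C (\<alpha> 2))" using reductionD(4)[OF ra I_simps(2)] by simp
    have "s' 2 \<bullet> (r' 2 \<bullet> f2) = s' 2 \<bullet> (r' 2 \<bullet> (f2 \<bullet> (k 2 \<bullet> \<alpha> 2 \<boxplus> (\<alpha> 1 \<bullet> k 1 \<boxplus> s 2 \<bullet> r 2))))" unfolding 2 by simp
    also have "\<dots> = s' 2 \<bullet> (r' 2 \<bullet> (f2 \<bullet> (k 2 \<bullet> \<alpha> 2))) \<boxplus> (s' 2 \<bullet> (r' 2 \<bullet> (f2 \<bullet> (\<alpha> 1 \<bullet> k 1))) \<boxplus> \<sigma> 2)"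
      unfolding \<sigma>_def \<psi>2 by (simp add: arrow_simps)
    also have "s' 2 \<bullet> (r' 2 \<bullet> (f2 \<bullet> (\<alpha> 1 \<bullet> k 1))) = \<beta> 1 \<bullet> (s' 1 \<bullet> (r' 1 \<bullet> (f1 \<bullet> k 1)))"
    proof -
      have "r' 2 \<bullet> (f2 \<bullet> (\<alpha> 1 \<bullet> k 1)) = r' 2 \<bullet> (\<beta> 1 \<bullet> (f1 \<bullet> k 1))" using commx[of "k 1"] by simp
      also have "\<dots> = p \<star> u \<star> (r' 1 \<bullet> (f1 \<bullet> k 1))" using rbc(6)[of 1 "f1 \<bullet> k 1"] by simp
      finally show ?thesis using rbc(5)[of 1 "r' 1 \<bullet> (f1 \<bullet> k 1)"] by (simp add: sm_comp)
    qed
    finally have 3: "s' 2 \<bullet> (r' 2 \<bullet> f2) = s' 2 \<bullet> (r' 2 \<bullet> (f2 \<bullet> (k 2 \<bullet> \<alpha> 2))) \<boxplus> (\<beta> 1 \<bullet> (s' 1 \<bullet> (r' 1 \<bullet> (f1 \<bullet> k 1))) \<boxplus> \<sigma> 2)" .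
    have g2': "\<beta> 2 \<bullet> f2 = g2 \<bullet> \<alpha> 2" using g2(2) by simp
    have "f2 = k' 2 \<bullet> (g2 \<bullet> \<alpha> 2) \<boxplus> (\<beta> 1 \<bullet> (k' 1 \<bullet> f2) \<boxplus> (s' 2 \<bullet> (r' 2 \<bullet> (f2 \<bullet> (k 2 \<bullet> \<alpha> 2))) \<boxplus> (\<beta> 1 \<bullet> (s' 1 \<bullet> (r' 1 \<bullet> (f1 \<bullet> k 1))) \<boxplus> \<sigma> 2)))"
      unfolding g2'[symmetric] unfolding 3[symmetric] 1 ..
    also have "\<dots> = \<phi> 2" unfolding \<phi>_def by (simp add: pv_def hn[unfolded One_nat_def] arrow_simps plus_ac)
    finally show ?thesis by (rule sym)
  qed
  ultimately show ?thesis by blast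
qed

section \<open>Angles form an angulation\<close>

text \<open>
  Exactness of the cone is a diagram chase that works for every morphism \<open>\<phi>\<close>; only the monodromy
  depends on its choice.
\<close>

lemma cone_angle:
  assumes u [simp]: "u \<in> carrier R" and ex: "exact \<alpha>" "exact \<beta>"
    and \<phi>: "seq_morphism \<alpha> \<beta> \<phi>" and cone: "cone_monodromy u \<alpha> \<beta> \<phi>"
  shows "\<exists>\<gamma>. angle u \<gamma> \<and> mapping_cone \<alpha> \<beta> \<phi> \<gamma>"
proof -
  note sa = exactD(1)[OF ex(1) I_simps(1)] and sb = exactD(1)[OF ex(2) I_simps(1)]
  note [simp] = seq_arr[OF sa] seq_arr[OF sb]
  have [simp]: "\<phi> i \<in> Ar C" "Dom C (\<phi> i) = Dom C (\<alpha> i)" "Cod C (\<phi> i) = Dom C (\<beta> i)" if "i \<in> I" for i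
    using \<phi> that by (auto simp: seq_morphism_iff in_Hom)
  have \<phi>c: "\<phi> (nx i) \<bullet> (\<alpha> i \<bullet> x) = \<beta> i \<bullet> (\<phi> i \<bullet> x)" if "i \<in> I" "x \<in> Ar C" "Cod C x = Dom C (\<alpha> i)" for i x
  proof -
    have "\<phi> (nx i) \<bullet> \<alpha> i = \<beta> i \<bullet> \<phi> i" using \<phi> that by (simp add: seq_morphism_iff)
    from comp_rewrite[OF this, of x] show ?thesis using that by (simp add: comp_assoc)
  qed
  have \<alpha>\<alpha>: "\<alpha> (nx i) \<bullet> (\<alpha> i \<bullet> x) = Null C (Dom C x) (Dom C (\<alpha> (nx (nx i))))" if "i \<in> I" "x \<in> Ar C" "Cod C x = Dom C (\<alpha> i)" for i x
    using that comp_rewrite[OF exactD(2)[OF ex(1) that(1)], of x] by simp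
  have \<beta>\<beta>: "\<beta> (nx i) \<bullet> (\<beta> i \<bullet> x) = Null C (Dom C x) (Dom C (\<beta> (nx (nx i))))" if "i \<in> I" "x \<in> Ar C" "Cod C x = Dom C (\<beta> i)" for i x
    using that comp_rewrite[OF exactD(2)[OF ex(2) that(1)], of x] by simp
  obtain S j1 j2 q1 q2 where bp0: "\<And>i. i \<in> I \<Longrightarrow> biproduct C (Dom C (left_rotation \<alpha> i)) (Dom C (\<beta> i)) (S i) (j1 i) (j2 i) (q1 i) (q2 i)"
    by (rule biproduct_family[OF left_rotation_sequences(1)[OF sa] sb]) blast
  have bp: "biproduct C (Dom C (\<alpha> (nx i))) (Dom C (\<beta> i)) (S i) (j1 i) (j2 i) (q1 i) (q2 i)" if "i \<in> I" for i
    using bp0[OF that] left_rotation_sequences(2)[OF sa that] by simp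
  have bps [simp]: "j1 i \<in> Ar C" "j2 i \<in> Ar C" "q1 i \<in> Ar C" "q2 i \<in> Ar C" "S i \<in> Ob C"
    "Dom C (j1 i) = Dom C (\<alpha> (nx i))" "Dom C (j2 i) = Dom C (\<beta> i)" "Dom C (q1 i) = S i" "Dom C (q2 i) = S i"
    "Cod C (j1 i) = S i" "Cod C (j2 i) = S i" "Cod C (q1 i) = Dom C (\<alpha> (nx i))" "Cod C (q2 i) = Dom C (\<beta> i)"
    if "i \<in> I" for i using biproduct_arr[OF bp[OF that]] biproduct_Ob[OF bp[OF that]] by simp_all
  have qj: "q1 i \<bullet> (j1 i \<bullet> x) = x" "q2 i \<bullet> (j1 i \<bullet> x) = Null C (Dom C x) (Dom C (\<beta> i))"
    if "i \<in> I" "x \<in> Ar C" "Cod C x = Dom C (\<alpha> (nx i))" for i x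
    using that biproduct_comp[OF bp[OF that(1)], of x] by simp_all
  have qj': "q1 i \<bullet> (j2 i \<bullet> x) = Null C (Dom C x) (Dom C (\<alpha> (nx i)))" "q2 i \<bullet> (j2 i \<bullet> x) = x"
    if "i \<in> I" "x \<in> Ar C" "Cod C x = Dom C (\<beta> i)" for i x
    using that biproduct_comp[OF bp[OF that(1)], of x] by simp_all
  define \<gamma> where "\<gamma> = restrict (\<lambda>i. j1 (nx i) \<bullet> Neg C (\<alpha> (nx i)) \<bullet> q1 i \<boxplus> j2 (nx i) \<bullet> \<phi> (nx i) \<bullet> q1 i \<boxplus> j2 (nx i) \<bullet> \<beta> i \<bullet> q2 i) I"
  have \<gamma>: "\<gamma> i = j1 (nx i) \<bullet> Neg C (\<alpha> (nx i)) \<bullet> q1 i \<boxplus> j2 (nx i) \<bullet> \<phi> (nx i) \<bullet> q1 i \<boxplus> j2 (nx i) \<bullet> \<beta> i \<bullet> q2 i" if "i \<in> I" for i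
    using that by (simp add: \<gamma>_def)
  have [simp]: "\<gamma> i \<in> Ar C" "Dom C (\<gamma> i) = S i" "Cod C (\<gamma> i) = S (nx i)" if "i \<in> I" for i
    using that by (simp_all add: \<gamma>)
  have sg: "\<gamma> \<in> sequences" by (simp add: sequences_iff) (simp add: \<gamma>_def)
  have mc: "mapping_cone \<alpha> \<beta> \<phi> \<gamma>"
    unfolding mapping_cone_def I_def[symmetric]
  proof (intro conjI sg exI ballI)
    fix i assume i [simp]: "i \<in> I"
    show "biproduct C (vertex \<alpha> (i + 1)) (vertex \<beta> i) (vertex \<gamma> i) (j1 i) (j2 i) (q1 i) (q2 i)"
      using bp[OF i] by (simp add: vertex_nx vertex_I)
    show "\<gamma> i = prolong j1 (i + 1) \<bullet> Neg C (prolong \<alpha> (i + 1)) \<bullet> q1 i \<boxplus> prolong j2 (i + 1) \<bullet> prolong \<phi> (i + 1) \<bullet> q1 i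
            \<boxplus> prolong j2 (i + 1) \<bullet> \<beta> i \<bullet> q2 i"
      unfolding \<gamma>[OF i] by (simp add: prolong_nx)
  qed
  have Q: "q1 (nx i) \<bullet> (\<gamma> i \<bullet> x) = Neg C (\<alpha> (nx i) \<bullet> (q1 i \<bullet> x))"
    "q2 (nx i) \<bullet> (\<gamma> i \<bullet> x) = \<phi> (nx i) \<bullet> (q1 i \<bullet> x) \<boxplus> \<beta> i \<bullet> (q2 i \<bullet> x)"
    if "i \<in> I" "x \<in> Ar C" "Cod C x = S i" for i x
    using that by (simp_all add: \<gamma> arrow_simps qj qj')
  have J: "\<gamma> i \<bullet> j1 i = j1 (nx i) \<bullet> Neg C (\<alpha> (nx i)) \<boxplus> j2 (nx i) \<bullet> \<phi> (nx i)" "\<gamma> i \<bullet> j2 i = j2 (nx i) \<bullet> \<beta> i"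
    if [simp]: "i \<in> I" for i
    using biproduct_arr[OF bp[OF that]] by (simp_all add: \<gamma> arrow_simps)
  have "exact \<gamma>" unfolding exact_def
  proof (intro conjI ballI allI impI)
    have "\<gamma> (nx i) \<bullet> \<gamma> i = Null C (Dom C (\<gamma> i)) (Dom C (\<gamma> (nx (nx i))))" if i [simp]: "i \<in> I" for i
    proof (rule biproduct_eqI[OF bp[OF nx_I[OF nx_I[OF i]]], of _ "S i"])
      have a: "\<alpha> (nx (nx i)) \<bullet> (\<alpha> (nx i) \<bullet> q1 i) = Null C (S i) (Dom C (\<alpha> (nx (nx (nx i)))))"
        using \<alpha>\<alpha>[of "nx i" "q1 i"] by simp
      have b: "\<beta> (nx i) \<bullet> (\<beta> i \<bullet> q2 i) = Null C (S i) (Dom C (\<beta> (nx (nx i))))" using \<beta>\<beta>[of i "q2 i"] by simp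
      have c: "\<phi> (nx (nx i)) \<bullet> (\<alpha> (nx i) \<bullet> q1 i) = \<beta> (nx i) \<bullet> (\<phi> (nx i) \<bullet> q1 i)" by (rule \<phi>c) simp_all
      have q: "q1 (nx i) \<bullet> \<gamma> i = Neg C (\<alpha> (nx i) \<bullet> q1 i)" "q2 (nx i) \<bullet> \<gamma> i = \<phi> (nx i) \<bullet> q1 i \<boxplus> \<beta> i \<bullet> q2 i"
        using Q[of i "Ident C (S i)"] by simp_all
      show "q1 (nx (nx i)) \<bullet> (\<gamma> (nx i) \<bullet> \<gamma> i) = q1 (nx (nx i)) \<bullet> Null C (Dom C (\<gamma> i)) (Dom C (\<gamma> (nx (nx i))))"
        "q2 (nx (nx i)) \<bullet> (\<gamma> (nx i) \<bullet> \<gamma> i) = q2 (nx (nx i)) \<bullet> Null C (Dom C (\<gamma> i)) (Dom C (\<gamma> (nx (nx i))))"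
        by (simp_all add: Q q arrow_simps a b c)
    qed (simp_all add: in_Hom)
    then show "candidate_angle \<gamma>" using sg by (simp add: candidate_iff)
  next
    fix i W x assume i [simp]: "i \<in> I" and x: "x \<in> Hom C W (Dom C (\<gamma> (nx i)))"
      and 0: "\<gamma> (nx i) \<bullet> x = Null C W (Dom C (\<gamma> (nx (nx i))))"
    have [simp]: "x \<in> Ar C" "Dom C x = W" "Cod C x = S (nx i)" "W \<in> Ob C" using x Hom_Ob[OF x] by (auto simp: in_Hom)
    let ?a = "q1 (nx i) \<bullet> x" and ?b = "q2 (nx i) \<bullet> x"
    have "Neg C (\<alpha> (nx (nx i)) \<bullet> ?a) = Null C W (Dom C (\<alpha> (nx (nx (nx i)))))"
      using Q(1)[of "nx i" x] by (simp add: 0)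
    then have 1: "\<alpha> (nx (nx i)) \<bullet> ?a = Null C W (Dom C (\<alpha> (nx (nx (nx i)))))" by (rule neg_eq_null[rotated -1]) simp_all
    have "?a \<in> Hom C W (Dom C (\<alpha> (nx (nx i))))" by (simp add: in_Hom)
    then obtain a1 where a1: "a1 \<in> Hom C W (Dom C (\<alpha> (nx i)))" "?a = \<alpha> (nx i) \<bullet> a1"
      by (rule exact_kernelE[OF ex(1) nx_I[OF i] _ 1])
    note [simp] = a1(1)[unfolded in_Hom]
    have "\<phi> (nx (nx i)) \<bullet> ?a \<boxplus> \<beta> (nx i) \<bullet> ?b = Null C W (Dom C (\<beta> (nx (nx i))))"
      using Q(2)[of "nx i" x] by (simp add: 0)
    then have 2: "\<beta> (nx i) \<bullet> (\<phi> (nx i) \<bullet> a1 \<boxplus> ?b) = Null C W (Dom C (\<beta> (nx (nx i))))"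
      unfolding a1(2) using \<phi>c[of "nx i" a1] by (simp add: comp_plus)
    have "\<phi> (nx i) \<bullet> a1 \<boxplus> ?b \<in> Hom C W (Dom C (\<beta> (nx i)))" by (simp add: in_Hom)
    then obtain b1 where b1: "b1 \<in> Hom C W (Dom C (\<beta> i))" "\<phi> (nx i) \<bullet> a1 \<boxplus> ?b = \<beta> i \<bullet> b1"
      by (rule exact_kernelE[OF ex(2) i _ 2])
    note [simp] = b1(1)[unfolded in_Hom]
    let ?y = "j1 i \<bullet> Neg C a1 \<boxplus> j2 i \<bullet> b1"
    have q: "q1 i \<bullet> ?y = Neg C a1" "q2 i \<bullet> ?y = b1" by (simp_all add: comp_plus qj qj')
    have "x = \<gamma> i \<bullet> ?y"
    proof (rule biproduct_eqI[OF bp[OF nx_I[OF i]], of _ W])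
      have "q1 (nx i) \<bullet> (\<gamma> i \<bullet> ?y) = Neg C (\<alpha> (nx i) \<bullet> (q1 i \<bullet> ?y))" by (rule Q(1)) simp_all
      then show "?a = q1 (nx i) \<bullet> (\<gamma> i \<bullet> ?y)" unfolding q a1(2) by (simp add: arrow_simps)
      have "q2 (nx i) \<bullet> (\<gamma> i \<bullet> ?y) = \<phi> (nx i) \<bullet> (q1 i \<bullet> ?y) \<boxplus> \<beta> i \<bullet> (q2 i \<bullet> ?y)" by (rule Q(2)) simp_all
      also have "\<dots> = Neg C (\<phi> (nx i) \<bullet> a1) \<boxplus> \<beta> i \<bullet> b1" unfolding q by (simp add: arrow_simps)
      also have "\<dots> = ?b" unfolding b1(2)[symmetric] by simp
      finally show "?b = q2 (nx i) \<bullet> (\<gamma> i \<bullet> ?y)" by (rule sym)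
    qed (simp_all add: in_Hom)
    then show "\<exists>y \<in> Hom C W (Dom C (\<gamma> i)). x = \<gamma> i \<bullet> y" by (intro bexI[of _ ?y]) (simp_all add: in_Hom)
  next
    fix i W x assume i [simp]: "i \<in> I" and x: "x \<in> Hom C (Dom C (\<gamma> (nx i))) W"
      and 0: "x \<bullet> \<gamma> i = Null C (Dom C (\<gamma> i)) W"
    have [simp]: "x \<in> Ar C" "Dom C x = S (nx i)" "Cod C x = W" "W \<in> Ob C" using x Hom_Ob[OF x] by (auto simp: in_Hom)
    let ?s = "x \<bullet> j1 (nx i)" and ?t = "x \<bullet> j2 (nx i)"
    have "?t \<bullet> \<beta> i = (x \<bullet> \<gamma> i) \<bullet> j2 i" by (simp add: comp_assoc J)
    then have 1: "?t \<bullet> \<beta> i = Null C (Dom C (\<beta> i)) W" by (simp add: 0)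
    have "?t \<in> Hom C (Dom C (\<beta> (nx i))) W" by (simp add: in_Hom)
    then obtain t' where t': "t' \<in> Hom C (Dom C (\<beta> (nx (nx i)))) W" "?t = t' \<bullet> \<beta> (nx i)"
      by (rule exact_cokernelE[OF ex(2) i _ 1])
    note [simp] = t'(1)[unfolded in_Hom]
    have "(x \<bullet> \<gamma> i) \<bullet> j1 i = Neg C (?s \<bullet> \<alpha> (nx i)) \<boxplus> ?t \<bullet> \<phi> (nx i)" by (simp add: arrow_simps J)
    then have "Neg C (?s \<bullet> \<alpha> (nx i)) \<boxplus> ?t \<bullet> \<phi> (nx i) = Null C (Dom C (\<alpha> (nx i))) W" by (simp add: 0)
    moreover have "?t \<bullet> \<phi> (nx i) = (t' \<bullet> \<phi> (nx (nx i))) \<bullet> \<alpha> (nx i)"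
      unfolding t'(2) using \<phi> by (simp add: comp_assoc seq_morphism_iff)
    ultimately have 2: "(Neg C ?s \<boxplus> t' \<bullet> \<phi> (nx (nx i))) \<bullet> \<alpha> (nx i) = Null C (Dom C (\<alpha> (nx i))) W"
      by (simp add: plus_comp neg_comp)
    have "Neg C ?s \<boxplus> t' \<bullet> \<phi> (nx (nx i)) \<in> Hom C (Dom C (\<alpha> (nx (nx i)))) W" by (simp add: in_Hom)
    then obtain s' where s': "s' \<in> Hom C (Dom C (\<alpha> (nx (nx (nx i))))) W" "Neg C ?s \<boxplus> t' \<bullet> \<phi> (nx (nx i)) = s' \<bullet> \<alpha> (nx (nx i))"
      by (rule exact_cokernelE[OF ex(1) nx_I[OF i] _ 2])
    note [simp] = s'(1)[unfolded in_Hom]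
    let ?y = "s' \<bullet> q1 (nx (nx i)) \<boxplus> t' \<bullet> q2 (nx (nx i))"
    note bn = biproduct_arr[OF bp[OF nx_I[OF nx_I[OF i]]]]
    have "x = ?y \<bullet> \<gamma> (nx i)"
    proof (rule biproduct_eqI'[OF bp[OF nx_I[OF i]], of _ W])
      have "(?y \<bullet> \<gamma> (nx i)) \<bullet> j1 (nx i) = Neg C (s' \<bullet> \<alpha> (nx (nx i))) \<boxplus> t' \<bullet> \<phi> (nx (nx i))"
        by (simp add: arrow_simps J qj qj')
      also have "\<dots> = ?s" unfolding s'(2)[symmetric] by (simp add: neg_sum plus_assoc)
      finally show "?s = (?y \<bullet> \<gamma> (nx i)) \<bullet> j1 (nx i)" by (rule sym)
      show "?t = (?y \<bullet> \<gamma> (nx i)) \<bullet> j2 (nx i)" unfolding t'(2) by (simp add: arrow_simps J qj')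
    qed (simp_all add: in_Hom)
    then show "\<exists>y \<in> Hom C (Dom C (\<gamma> (nx (nx i)))) W. x = y \<bullet> \<gamma> (nx i)" by (intro bexI[of _ ?y]) (simp_all add: in_Hom)
  qed
  moreover have "monodromy u \<gamma>" unfolding monodromy_def
  proof (intro allI impI, elim conjE)
    fix W x assume x: "\<forall>i \<in> I. x i \<in> Hom C W (Dom C (\<gamma> i))" and px: "\<forall>i \<in> I. i < n \<longrightarrow> \<gamma> i \<bullet> x i = p \<star> x (Suc i)"
    have [simp]: "x i \<in> Ar C" "Dom C (x i) = W" "Cod C (x i) = S i" if "i \<in> I" for i
      using x that by (auto simp: in_Hom)
    obtain a' b' where a': "a' \<in> Hom C W (Dom C (\<alpha> 1))" and b': "b' \<in> Hom C W (Dom C (\<beta> n))"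
      and e1: "Neg C (\<alpha> 1 \<bullet> (q1 n \<bullet> x n)) = p \<star> (u \<star> (q1 1 \<bullet> x 1) \<boxplus> Neg C (\<alpha> 1 \<bullet> a'))"
      and e2: "\<phi> 1 \<bullet> (q1 n \<bullet> x n) \<boxplus> \<beta> n \<bullet> (q2 n \<bullet> x n) = p \<star> (u \<star> (q2 1 \<bullet> x 1) \<boxplus> (\<phi> 1 \<bullet> a' \<boxplus> \<beta> n \<bullet> b'))"
    proof (rule cone_monodromyE[OF cone, of "\<lambda>i. q1 i \<bullet> x i" W "\<lambda>i. q2 i \<bullet> x i"])
      fix i assume i [simp]: "i \<in> I"
      show "q1 i \<bullet> x i \<in> Hom C W (Dom C (\<alpha> (nx i)))" "q2 i \<bullet> x i \<in> Hom C W (Dom C (\<beta> i))" by (simp_all add: in_Hom)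
      assume [simp]: "i < n"
      have *: "\<gamma> i \<bullet> x i = p \<star> x (Suc i)" using px by simp
      show "Neg C (\<alpha> (nx i) \<bullet> (q1 i \<bullet> x i)) = p \<star> (q1 (Suc i) \<bullet> x (Suc i))"
        "\<phi> (nx i) \<bullet> (q1 i \<bullet> x i) \<boxplus> \<beta> i \<bullet> (q2 i \<bullet> x i) = p \<star> (q2 (Suc i) \<bullet> x (Suc i))"
        using Q[of i "x i"] unfolding * by (simp_all add: sm_comp)
    qed
    have [simp]: "a' \<in> Ar C" "Dom C a' = W" "Cod C a' = Dom C (\<alpha> 1)" "b' \<in> Ar C" "Dom C b' = W" "Cod C b' = Dom C (\<beta> n)"
      using a' b' by (auto simp: in_Hom)
    let ?y = "j1 n \<bullet> a' \<boxplus> j2 n \<bullet> b'"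
    have q: "q1 n \<bullet> ?y = a'" "q2 n \<bullet> ?y = b'" by (simp_all add: comp_plus qj qj')
    have y: "?y \<in> Ar C" "Dom C ?y = W" "Cod C ?y = S n" by simp_all
    have Qn: "q1 1 \<bullet> (\<gamma> n \<bullet> z) = Neg C (\<alpha> 1 \<bullet> (q1 n \<bullet> z))" "q2 1 \<bullet> (\<gamma> n \<bullet> z) = \<phi> 1 \<bullet> (q1 n \<bullet> z) \<boxplus> \<beta> n \<bullet> (q2 n \<bullet> z)"
      if "z \<in> Ar C" "Cod C z = S n" for z using Q[of n z] that by simp_all
    have l: "q1 1 \<bullet> p \<star> (u \<star> x 1 \<boxplus> z) = p \<star> (u \<star> (q1 1 \<bullet> x 1) \<boxplus> q1 1 \<bullet> z)"
      "q2 1 \<bullet> p \<star> (u \<star> x 1 \<boxplus> z) = p \<star> (u \<star> (q2 1 \<bullet> x 1) \<boxplus> q2 1 \<bullet> z)"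
      if "z \<in> Ar C" "Dom C z = W" "Cod C z = S 1" for z using that by (simp_all add: linear_simps)
    have "\<gamma> n \<bullet> x n = p \<star> (u \<star> x 1 \<boxplus> \<gamma> n \<bullet> ?y)"
    proof (rule biproduct_eqI[OF bp[OF I_simps(2)], of _ W])
      have "q1 1 \<bullet> (\<gamma> n \<bullet> x n) = p \<star> (u \<star> (q1 1 \<bullet> x 1) \<boxplus> Neg C (\<alpha> 1 \<bullet> a'))" using e1 by (subst Qn) simp_all
      also have "\<dots> = q1 1 \<bullet> p \<star> (u \<star> x 1 \<boxplus> \<gamma> n \<bullet> ?y)"
        by (subst l) (simp_all only: Qn[OF y(1,3)] q, simp_all)
      finally show "q1 1 \<bullet> (\<gamma> n \<bullet> x n) = q1 1 \<bullet> p \<star> (u \<star> x 1 \<boxplus> \<gamma> n \<bullet> ?y)" .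
      have "q2 1 \<bullet> (\<gamma> n \<bullet> x n) = p \<star> (u \<star> (q2 1 \<bullet> x 1) \<boxplus> (\<phi> 1 \<bullet> a' \<boxplus> \<beta> n \<bullet> b'))" using e2 by (subst Qn) simp_all
      also have "\<dots> = q2 1 \<bullet> p \<star> (u \<star> x 1 \<boxplus> \<gamma> n \<bullet> ?y)"
        by (subst l) (simp_all only: Qn[OF y(1,3)] q, simp_all)
      finally show "q2 1 \<bullet> (\<gamma> n \<bullet> x n) = q2 1 \<bullet> p \<star> (u \<star> x 1 \<boxplus> \<gamma> n \<bullet> ?y)" .
    qed (simp_all add: in_Hom)
    then show "\<exists>y \<in> Hom C W (Dom C (\<gamma> n)). \<gamma> n \<bullet> x n = p \<star> (u \<star> x 1 \<boxplus> \<gamma> n \<bullet> y)"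
      by (intro bexI[of _ ?y]) (simp_all add: in_Hom)
  qed
  ultimately show ?thesis using mc by (auto simp: angle_def)
qed

theorem angles_angulation:
  assumes u: "u \<in> Units R" and par: "even n \<or> p \<oplus>\<^bsub>R\<^esub> p = \<zero>\<^bsub>R\<^esub>"
  shows "n_angulation C identity_functor n {\<alpha>. angle u \<alpha>}"
proof -
  have u' [simp]: "u \<in> carrier R" using u by (rule Units_closed)
  have seq: "\<alpha> \<in> sequences" if "angle u \<alpha>" for \<alpha> using that by (simp add: angle_def exact_iff)
  have v: "vertex \<alpha> 1 = Dom C (\<alpha> 1)" "vertex \<alpha> 2 = Dom C (\<alpha> 2)" for \<alpha> by (simp_all add: vertex_I)
  have fill: "\<exists>\<phi>. \<phi> 1 = f1 \<and> \<phi> 2 = f2 \<and> seq_morphism \<alpha> \<beta> \<phi> \<and> (\<exists>\<gamma> \<in> {\<alpha>. angle u \<alpha>}. mapping_cone \<alpha> \<beta> \<phi> \<gamma>)"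
    if N: "\<alpha> \<in> {\<alpha>. angle u \<alpha>}" "\<beta> \<in> {\<alpha>. angle u \<alpha>}" and f: "f1 \<in> Hom C (vertex \<alpha> 1) (vertex \<beta> 1)"
      "f2 \<in> Hom C (vertex \<alpha> 2) (vertex \<beta> 2)" "f2 \<bullet> \<alpha> 1 = \<beta> 1 \<bullet> f1" for \<alpha> \<beta> f1 f2
  proof -
    have ab: "angle u \<alpha>" "angle u \<beta>" using N by simp_all
    obtain \<phi> where \<phi>: "\<phi> 1 = f1" "\<phi> 2 = f2" "seq_morphism \<alpha> \<beta> \<phi>" "cone_monodromy u \<alpha> \<beta> \<phi>"
      using fill_cone[OF u par ab f[unfolded v]] by blast
    moreover obtain \<gamma> where "angle u \<gamma>" "mapping_cone \<alpha> \<beta> \<phi> \<gamma>"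
      using cone_angle[OF u' _ _ \<phi>(3,4)] ab by (auto simp: angle_def)
    ultimately show ?thesis by blast
  qed
  show ?thesis
  proof (unfold n_angulation_def, intro conjI allI impI)
    show "{\<alpha>. angle u \<alpha>} \<subseteq> sequences" using seq by blast
  next
    fix \<alpha> \<beta> \<gamma> assume "\<alpha> \<in> {\<alpha>. angle u \<alpha>}" "\<beta> \<in> {\<alpha>. angle u \<alpha>}" "direct_sum_seq \<alpha> \<beta> \<gamma>"
    then show "\<gamma> \<in> {\<alpha>. angle u \<alpha>}" using angle_sum[OF u'] by blast
  next
    fix \<alpha> \<beta> \<gamma> assume "\<gamma> \<in> {\<alpha>. angle u \<alpha>}" "direct_sum_seq \<alpha> \<beta> \<gamma>"
    then show "\<alpha> \<in> {\<alpha>. angle u \<alpha>}" using angle_summand[OF u'] by blast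
  next
    fix \<alpha> \<beta> assume "\<alpha> \<in> {\<alpha>. angle u \<alpha>}" "\<beta> \<in> sequences" "isomorphic_seqs \<alpha> \<beta>"
    then show "\<beta> \<in> {\<alpha>. angle u \<alpha>}" using angle_iso[OF u'] by blast
  next
    fix A Z assume "A \<in> Ob C" "zero_object C Z"
    then show "trivial_seq A Z \<in> {\<alpha>. angle u \<alpha>}"
      using angle_contractible[OF u'] disc(2,3)[of Z A 1] by (simp add: trivial_seq_disc)
  next
    fix f assume "f \<in> Ar C"
    then show "\<exists>\<alpha> \<in> {\<alpha>. angle u \<alpha>}. \<alpha> 1 = f" using first_arrow[OF u par] by blast
  next
    fix \<alpha> assume "\<alpha> \<in> sequences"
    then show "\<alpha> \<in> {\<alpha>. angle u \<alpha>} \<longleftrightarrow> left_rotation \<alpha> \<in> {\<alpha>. angle u \<alpha>}"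
      using angle_rotation[OF u' par] by simp
  next
    fix \<alpha> \<beta> f1 f2
    assume "\<alpha> \<in> {\<alpha>. angle u \<alpha>}" "\<beta> \<in> {\<alpha>. angle u \<alpha>}" "f1 \<in> Hom C (vertex \<alpha> 1) (vertex \<beta> 1)"
      "f2 \<in> Hom C (vertex \<alpha> 2) (vertex \<beta> 2)" "f2 \<bullet> \<alpha> 1 = \<beta> 1 \<bullet> f1"
    from fill[OF this] show "\<exists>\<phi>. \<phi> 1 = f1 \<and> \<phi> 2 = f2 \<and> seq_morphism \<alpha> \<beta> \<phi>" by blast
  next
    fix \<alpha> \<beta> f1 f2
    assume "\<alpha> \<in> {\<alpha>. angle u \<alpha>}" "\<beta> \<in> {\<alpha>. angle u \<alpha>}" "f1 \<in> Hom C (vertex \<alpha> 1) (vertex \<beta> 1)"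
      "f2 \<in> Hom C (vertex \<alpha> 2) (vertex \<beta> 2)" "f2 \<bullet> \<alpha> 1 = \<beta> 1 \<bullet> f1"
    from fill[OF this] show "\<exists>\<phi>. \<phi> 1 = f1 \<and> \<phi> 2 = f2 \<and> seq_morphism \<alpha> \<beta> \<phi> \<and> (\<exists>\<gamma> \<in> {\<alpha>. angle u \<alpha>}. mapping_cone \<alpha> \<beta> \<phi> \<gamma>)" .
  qed
qed

section \<open>Every angulation arises from a unit\<close>

text \<open>The arrow that changes its sign is zero.\<close>

lemma left_rotation_disc:
  assumes Z: "zero_object C Z" and A: "A \<in> Ob C" and i: "i \<in> I" "i < n"
  shows "left_rotation (disc (Suc i) A Z) = disc i A Z"
proof (rule sequences_eqI)
  note s = disc(1)[OF Z A Suc_I[OF i]]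
  show "left_rotation (disc (Suc i) A Z) \<in> sequences" by (rule left_rotation_sequences(1)[OF s])
  show "disc i A Z \<in> sequences" by (rule disc(1)[OF Z A i(1)])
  fix k assume k: "k \<in> I"
  have e: "disc (Suc i) A Z (nx k) = disc i A Z k"
    using k i nx_inj[of k i] nx_inj[of "nx k" i] nx_inj[of k "nx i"] nx_inj[of "nx k" "nx i"] by (simp add: disc_def)
  have [simp]: "Z \<in> Ob C" using Z zero_objectD by blast
  show "left_rotation (disc (Suc i) A Z) k = disc i A Z k"
  proof (cases "k < n")
    case True then show ?thesis using k e by (simp add: left_rotation_nx)
  next
    case False
    then have "k = n" using k I_less by blast
    then show ?thesis using k e i A by (simp add: left_rotation_nx) (simp add: disc_def)
  qed
qed

lemma direct_sum_periodic:
  assumes r: "r \<in> carrier R" and b: "biproduct C A B S j1 j2 q1 q2"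
  shows "direct_sum_seq (periodic r A) (periodic r B) (periodic r S)"
proof -
  note [simp] = r biproduct_arr[OF b] biproduct_Ob[OF b]
  have sq: "periodic r W \<in> sequences" "i \<in> I \<Longrightarrow> Dom C (periodic r W i) = W"
    "i \<in> I \<Longrightarrow> periodic r W i = p \<star> (if i = 1 then r else \<one>\<^bsub>R\<^esub>) \<star> Ident C W" if [simp]: "W \<in> Ob C" for W i
  proof -
    have "r \<star> Ident C W \<in> Hom C W W" by (simp add: in_Hom)
    note t = twisted[OF this]
    show "periodic r W \<in> sequences" "i \<in> I \<Longrightarrow> Dom C (periodic r W i) = W" using t by (simp_all add: periodic_def)
    show "i \<in> I \<Longrightarrow> periodic r W i = p \<star> (if i = 1 then r else \<one>\<^bsub>R\<^esub>) \<star> Ident C W"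
      using t(3,4) by (simp add: periodic_def)
  qed
  have "splitting (periodic r A) (periodic r B) (periodic r S) (\<lambda>_. j1) (\<lambda>_. j2) (\<lambda>_. q1) (\<lambda>_. q2)"
    using b by (simp add: splitting_def sq linear_simps)
  then show ?thesis by (intro direct_sumI sq) simp_all
qed

lemma isomorphic_twisted:
  assumes j: "j \<in> Hom C M L" and q: "q \<in> Hom C L M" and jq: "j \<bullet> q = Ident C L" and qj: "q \<bullet> j = Ident C M"
    and t: "t \<in> Hom C M M"
  shows "isomorphic_seqs (twisted t) (twisted (j \<bullet> (t \<bullet> q)))"
proof -
  note [simp] = j[unfolded in_Hom] q[unfolded in_Hom] t[unfolded in_Hom] Hom_Ob[OF j]
  have t': "j \<bullet> (t \<bullet> q) \<in> Hom C L L" by (simp add: in_Hom)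
  have "seq_morphism (twisted t) (twisted (j \<bullet> (t \<bullet> q))) (\<lambda>_. j)" unfolding seq_morphism_iff
  proof
    fix i assume i: "i \<in> I"
    show "j \<in> Hom C (Dom C (twisted t i)) (Dom C (twisted (j \<bullet> (t \<bullet> q)) i)) \<and> j \<bullet> twisted t i = twisted (j \<bullet> (t \<bullet> q)) i \<bullet> j"
      using twisted(3)[OF t] twisted(3)[OF t'] twisted(4)[OF t i] twisted(4)[OF t' i] j
      by (cases "i = 1") (simp_all add: twisted(2)[OF t i] twisted(2)[OF t' i] linear_simps qj del: One_nat_def)
  qed
  moreover have "iso_arrow C j" by (rule iso_arrowI[OF j q q jq qj])
  ultimately show ?thesis unfolding isomorphic_seqs_def by blast
qed

lemma periodic_cong:
  assumes "u \<in> carrier R" "v \<in> carrier R" "p \<otimes>\<^bsub>R\<^esub> u = p \<otimes>\<^bsub>R\<^esub> v" "F \<in> Ob C"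
  shows "periodic u F = periodic v F"
  unfolding periodic_def by (rule twisted_cong) (use assms in \<open>simp_all add: mult_sm\<close>)

text \<open>
  If both sets agree then the monodromy of \<open>U\<^sub>u(p)\<close> is \<open>v\<close>, hence \<open>u p = v p\<close>. Conversely \<open>F\<^sub>u(p)\<close> depends
  only on \<open>u p\<close>.
\<close>

theorem angle_eq_iff:
  assumes u: "u \<in> Units R" and v: "v \<in> Units R"
  shows "{\<alpha>. angle u \<alpha>} = {\<alpha>. angle v \<alpha>} \<longleftrightarrow> u \<otimes>\<^bsub>R\<^esub> p = v \<otimes>\<^bsub>R\<^esub> p"
proof
  have [simp]: "u \<in> carrier R" "v \<in> carrier R" using u v by (simp_all add: Units_closed)
  have tU: "u \<star> Ident C U \<in> Hom C U U" by (simp add: in_Hom)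
  assume "{\<alpha>. angle u \<alpha>} = {\<alpha>. angle v \<alpha>}"
  then have "angle v (periodic u U)" using angle_periodic[OF u U_Ob] by blast
  then have "p \<star> u \<star> Ident C U = p \<star> v \<star> Ident C U"
    using monodromy_twisted(1)[OF _ tU, of v] by (simp add: angle_def periodic_def)
  then have eq: "(p \<otimes>\<^bsub>R\<^esub> u) \<star> Ident C U = (p \<otimes>\<^bsub>R\<^esub> v) \<star> Ident C U" by (simp add: mult_sm)
  have "(p \<otimes>\<^bsub>R\<^esub> u \<ominus>\<^bsub>R\<^esub> p \<otimes>\<^bsub>R\<^esub> v) \<star> Ident C U = (p \<otimes>\<^bsub>R\<^esub> u) \<star> Ident C U \<boxplus> (\<ominus>\<^bsub>R\<^esub> (p \<otimes>\<^bsub>R\<^esub> v)) \<star> Ident C U"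
    by (simp add: a_minus_def add_sm)
  also have "\<dots> = (p \<otimes>\<^bsub>R\<^esub> v \<oplus>\<^bsub>R\<^esub> \<ominus>\<^bsub>R\<^esub> (p \<otimes>\<^bsub>R\<^esub> v)) \<star> Ident C U" unfolding eq by (simp add: add_sm)
  also have "\<dots> = Null C U U" by (simp add: r_neg)
  finally have "p \<otimes>\<^bsub>R\<^esub> u \<ominus>\<^bsub>R\<^esub> p \<otimes>\<^bsub>R\<^esub> v = \<zero>\<^bsub>R\<^esub>" by (rule End_U_faithful[rotated]) simp
  then show "u \<otimes>\<^bsub>R\<^esub> p = v \<otimes>\<^bsub>R\<^esub> p" by (simp add: m_comm)
next
  have [simp]: "u \<in> carrier R" "v \<in> carrier R" using u v by (simp_all add: Units_closed)
  assume "u \<otimes>\<^bsub>R\<^esub> p = v \<otimes>\<^bsub>R\<^esub> p"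
  then have "F \<in> Ob C \<Longrightarrow> periodic u F = periodic v F" for F by (intro periodic_cong) (simp_all add: m_comm)
  then show "{\<alpha>. angle u \<alpha>} = {\<alpha>. angle v \<alpha>}" unfolding angle_iff[OF u] angle_iff[OF v] by (intro Collect_cong) (metis (no_types))
qed

end

locale angulation = cyclic_sequences C R sm U p n + n_angulation C identity_functor n N
  for C :: "('o, 'a) precategory" (structure) and R :: "('r, 'x) ring_scheme"
    and sm :: "'r \<Rightarrow> 'a \<Rightarrow> 'a" (infixr \<open>\<star>\<close> 75) and U :: 'o and p :: 'r and n :: nat and N :: "(nat \<Rightarrow> 'a) set"
begin

lemma N_seq: "\<alpha> \<in> N \<Longrightarrow> \<alpha> \<in> sequences" using N_sequences by blast

lemma N_rotation: "\<alpha> \<in> N \<Longrightarrow> left_rotation \<alpha> \<in> N" using N2 N_seq by blast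

lemma fill_in:
  assumes "\<alpha> \<in> N" "\<beta> \<in> N" "f1 \<in> Hom C (Dom C (\<alpha> 1)) (Dom C (\<beta> 1))" "f2 \<in> Hom C (Dom C (\<alpha> 2)) (Dom C (\<beta> 2))"
    "f2 \<bullet> \<alpha> 1 = \<beta> 1 \<bullet> f1"
  obtains \<phi> where "\<phi> 1 = f1" "\<phi> 2 = f2" "\<And>i. i \<in> I \<Longrightarrow> \<phi> i \<in> Hom C (Dom C (\<alpha> i)) (Dom C (\<beta> i))"
    "\<And>i. i \<in> I \<Longrightarrow> \<phi> (nx i) \<bullet> \<alpha> i = \<beta> i \<bullet> \<phi> i"
proof -
  have v: "vertex \<alpha> 1 = Dom C (\<alpha> 1)" "vertex \<alpha> 2 = Dom C (\<alpha> 2)" for \<alpha> by (simp_all add: vertex_I)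
  show ?thesis using N3[OF assms(1,2), unfolded v, OF assms(3-5)] that by (auto simp: seq_morphism_iff)
qed

text \<open>The disc at \<open>1\<close> is the trivial sequence, and the disc at \<open>i + 1\<close> rotates to the disc at \<open>i\<close>.\<close>

lemma disc_N:
  assumes Z: "zero_object C Z" and A: "A \<in> Ob C" and "i \<in> I"
  shows "disc i A Z \<in> N"
proof -
  have "i \<in> I \<longrightarrow> disc i A Z \<in> N" if "1 \<le> i" for i using that
  proof (induction i rule: dec_induct)
    case base
    then show ?case using N1b[OF A Z] by (simp add: trivial_seq_disc)
  next
    case (step k)
    show ?case
    proof
      assume "Suc k \<in> I"
      then have k: "k \<in> I" "k < n" using step(1) by (auto simp: I_def)
      then show "disc (Suc k) A Z \<in> N"
        using step(3) N2[OF disc(1)[OF Z A Suc_I[OF k]]] left_rotation_disc[OF Z A k] by simp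
    qed
  qed
  then show ?thesis using assms(3) by (auto simp: I_def)
qed

text \<open>
  Arrows \<open>x\<close> with \<open>\<alpha>\<^sub>2 x = 0\<close> are squares from a disc to the rotation of \<open>\<alpha>\<close>, arrows \<open>y\<close> with \<open>y \<alpha>\<^sub>1 = 0\<close>
  are squares from \<open>\<alpha>\<close> to a disc, and the trivial square on \<open>\<alpha>\<^sub>1\<close> starts at the disc of its domain. In
  each case the extension to a morphism has one more component, which is the required factorization
  or shows that \<open>\<alpha>\<^sub>2 \<alpha>\<^sub>1\<close> factors through zero.
\<close>

lemma first_exact_pair:
  assumes a: "\<alpha> \<in> N"
  shows "exact_pair (\<alpha> 1) (\<alpha> 2)"
proof -
  note [simp] = seq_arr[OF N_seq[OF a]]
  obtain Z where Z: "zero_object C Z" using ex_zero_object by blast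
  then have [simp]: "Z \<in> Ob C" by (rule zero_objectD)
  have ne: "(3::nat) \<noteq> Suc 0" "(2::nat) \<noteq> Suc 0" "(3::nat) \<noteq> 2" "nx 3 \<noteq> 3" using nx_neq[of 3] by auto
  have D: "Dom C (disc i A Z k) = (if k = i \<or> k = nx i then A else Z)" if "A \<in> Ob C" "k \<in> I" for i A k
    by (rule disc_Dom[OF Z that])
  show ?thesis unfolding exact_pair_def
  proof (intro conjI allI ballI impI)
    show "\<alpha> 2 \<bullet> \<alpha> 1 = Null C (Dom C (\<alpha> 1)) (Cod C (\<alpha> 2))"
    proof -
      let ?A = "Dom C (\<alpha> 1)"
      have d: "disc 1 ?A Z \<in> N" using Z by (rule disc_N) simp_all
      obtain \<phi> where \<phi>: "\<phi> 2 = \<alpha> 1" "\<And>i. i \<in> I \<Longrightarrow> \<phi> i \<in> Hom C (Dom C (disc 1 ?A Z i)) (Dom C (\<alpha> i))"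
        "\<And>i. i \<in> I \<Longrightarrow> \<phi> (nx i) \<bullet> disc 1 ?A Z i = \<alpha> i \<bullet> \<phi> i"
        by (rule fill_in[OF d a, of "Ident C ?A" "\<alpha> 1"]) (simp_all add: D in_Hom, simp add: disc_def)
      have "\<phi> 3 \<in> Hom C Z (Dom C (\<alpha> 3))" using \<phi>(2)[of 3] ne by (simp add: D)
      then have "\<phi> 3 = Null C Z (Dom C (\<alpha> 3))" by (rule zero_object_Hom(2)[OF Z])
      then show ?thesis using \<phi>(3)[of 2] \<phi>(1) by (simp add: disc_def)
    qed
  next
    have n: "n \<noteq> 1" "n \<noteq> 2" using n_ge_3 by auto
    fix W x assume x: "x \<in> Hom C W (Dom C (\<alpha> 2))" and 0: "\<alpha> 2 \<bullet> x = Null C W (Cod C (\<alpha> 2))"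
    note [simp] = x[unfolded in_Hom] Hom_Ob(1)[OF x]
    have d: "disc n W Z \<in> N" using Z by (rule disc_N) simp_all
    note l = left_rotation_sequences(2)[OF N_seq[OF a]] left_rotation_nx[of _ \<alpha>]
    obtain \<phi> where \<phi>: "\<phi> 1 = x" "\<And>i. i \<in> I \<Longrightarrow> \<phi> i \<in> Hom C (Dom C (disc n W Z i)) (Dom C (left_rotation \<alpha> i))"
        "\<And>i. i \<in> I \<Longrightarrow> \<phi> (nx i) \<bullet> disc n W Z i = left_rotation \<alpha> i \<bullet> \<phi> i"
    proof (rule fill_in[OF d N_rotation[OF a], of x "Null C Z (Dom C (\<alpha> 3))"])
      have l1: "left_rotation \<alpha> 1 = \<alpha> 2" using n_ge_3 by (simp add: left_rotation_nx)
      show "x \<in> Hom C (Dom C (disc n W Z 1)) (Dom C (left_rotation \<alpha> 1))" unfolding l1 using x by (simp add: D)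
      show "Null C Z (Dom C (\<alpha> 3)) \<in> Hom C (Dom C (disc n W Z 2)) (Dom C (left_rotation \<alpha> 2))" using n by (simp add: D l(1) in_Hom)
      have "disc n W Z 1 = Null C W Z" using n by (simp add: disc_def)
      then show "Null C Z (Dom C (\<alpha> 3)) \<bullet> disc n W Z 1 = left_rotation \<alpha> 1 \<bullet> x" unfolding l1 using 0 by simp
    qed (rule that)
    have \<phi>n: "\<phi> n \<in> Hom C W (Dom C (\<alpha> 1))" using \<phi>(2)[of n] by (simp add: D l(1))
    note [simp] = \<phi>n[unfolded in_Hom]
    have "x = left_rotation \<alpha> n \<bullet> \<phi> n" using \<phi>(3)[of n] \<phi>(1) by (simp add: disc_def)
    then have "x = (if even n then \<alpha> 1 \<bullet> \<phi> n else \<alpha> 1 \<bullet> Neg C (\<phi> n))" by (simp add: l(2) neg_comp split: if_splits)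
    then show "\<exists>y \<in> Hom C W (Dom C (\<alpha> 1)). x = \<alpha> 1 \<bullet> y"
      using \<phi>n Neg_Hom[OF \<phi>n] by (auto split: if_splits)
  next
    fix W y assume y: "y \<in> Hom C (Dom C (\<alpha> 2)) W" and 0: "y \<bullet> \<alpha> 1 = Null C (Dom C (\<alpha> 1)) W"
    note [simp] = y[unfolded in_Hom] Hom_Ob(2)[OF y]
    have d: "disc 2 W Z \<in> N" using Z by (rule disc_N) simp_all
    obtain \<phi> where \<phi>: "\<phi> 2 = y" "\<And>i. i \<in> I \<Longrightarrow> \<phi> i \<in> Hom C (Dom C (\<alpha> i)) (Dom C (disc 2 W Z i))"
        "\<And>i. i \<in> I \<Longrightarrow> \<phi> (nx i) \<bullet> \<alpha> i = disc 2 W Z i \<bullet> \<phi> i"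
    proof (rule fill_in[OF a d, of "Null C (Dom C (\<alpha> 1)) Z" y])
      show "Null C (Dom C (\<alpha> 1)) Z \<in> Hom C (Dom C (\<alpha> 1)) (Dom C (disc 2 W Z 1))" by (simp add: D in_Hom)
      show "y \<in> Hom C (Dom C (\<alpha> 2)) (Dom C (disc 2 W Z 2))" using y by (simp add: D)
      have "disc 2 W Z 1 = Null C Z W" by (simp add: disc_def)
      then show "y \<bullet> \<alpha> 1 = disc 2 W Z 1 \<bullet> Null C (Dom C (\<alpha> 1)) Z" using 0 by simp
    qed (rule that)
    have "\<phi> 3 \<in> Hom C (Dom C (\<alpha> 3)) W" "\<phi> 3 \<bullet> \<alpha> 2 = y" using \<phi>(2)[of 3] \<phi>(3)[of 2] \<phi>(1) by (simp_all add: D) (simp add: disc_def)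
    then show "\<exists>z \<in> Hom C (Cod C (\<alpha> 2)) W. y = z \<bullet> \<alpha> 2" by (intro bexI[of _ "\<phi> 3"]) simp_all
  qed
qed

text \<open>Rotating moves every position to the first one; the signs do not affect exactness.\<close>

lemma exact_N:
  assumes "\<alpha> \<in> N"
  shows "exact \<alpha>"
proof -
  have "\<forall>\<alpha> \<in> N. i \<in> I \<longrightarrow> exact_pair (\<alpha> i) (\<alpha> (nx i))" if "1 \<le> i" for i using that
  proof (induction i rule: dec_induct)
    case base
    then show ?case using first_exact_pair by simp
  next
    case (step k)
    show ?case
    proof (intro ballI impI)
      fix \<alpha> assume a: "\<alpha> \<in> N" and "Suc k \<in> I"
      then have k [simp]: "k \<in> I" "k < n" using step(1) by (auto simp: I_def)
      note [simp] = seq_arr[OF N_seq[OF a]] Suc_I[OF k]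
      have 1: "exact_pair (\<alpha> (Suc k)) (left_rotation \<alpha> (Suc k))"
        using step(3) N_rotation[OF a] by (auto simp: left_rotation_nx[of k])
      show "exact_pair (\<alpha> (Suc k)) (\<alpha> (nx (Suc k)))"
      proof (cases "Suc k < n \<or> even n")
        case True
        then show ?thesis using 1 left_rotation_nx[of "Suc k" \<alpha>] by simp
      next
        case False
        then have "exact_pair (\<alpha> (Suc k)) (Neg C (Neg C (\<alpha> (nx (Suc k)))))"
          using 1 left_rotation_nx[of "Suc k" \<alpha>] by - (rule exact_pair_neg(2), simp_all)
        then show ?thesis by simp
      qed
    qed
  qed
  then show ?thesis using assms N_seq by (auto simp: exact_iff I_def)
qed

lemma zero_seq_N:
  assumes Z: "zero_object C Z"
  shows "zero_seq Z \<in> N"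
proof -
  have "disc 1 Z Z = zero_seq Z" unfolding disc_def zero_seq_def by (rule restrict_ext) (simp add: zero_object_ident[OF Z])
  then show ?thesis using disc_N[OF Z zero_objectD(1)[OF Z], of 1] by simp
qed

text \<open>Splitting off discs, which belong to \<open>N\<close>, from a contractible sequence leaves zero objects only.\<close>

lemma contractible_N:
  assumes cand: "candidate_angle \<alpha>" and c: "contractible \<alpha>"
  shows "\<alpha> \<in> N"
proof -
  obtain \<gamma> \<mu> where g: "\<gamma> \<in> N" and s: "direct_sum_seq \<gamma> \<mu> \<alpha>" and d: "\<forall>i \<in> I. divisible p (\<mu> i)"
    using decomposition[OF cand, of "\<lambda>\<gamma>. \<gamma> \<in> N"] zero_seq_N disc_N[OF _ U_Ob] N1a_sum by blast
  have sm: "\<mu> \<in> sequences" using s by (auto elim: direct_sumE)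
  note [simp] = seq_arr[OF sm]
  obtain Z where Z: "zero_object C Z" using ex_zero_object by blast
  then have ZO [simp]: "Z \<in> Ob C" by (rule zero_objectD)
  have z: "zero_object C (Dom C (\<mu> i))" if "i \<in> I" for i
    using contractible_minimal_summand[OF s c _ that] d by blast
  have "seq_morphism (zero_seq Z) \<mu> (\<lambda>i. Null C Z (Dom C (\<mu> i)))"
    by (simp add: seq_morphism_iff zero_seq(4)[OF Z] in_Hom) (simp add: zero_seq_def)
  moreover have "iso_arrow C (Null C Z (Dom C (\<mu> i)))" if i [simp]: "i \<in> I" for i
    by (rule iso_arrowI[of _ Z "Dom C (\<mu> i)" "Null C (Dom C (\<mu> i)) Z" "Null C (Dom C (\<mu> i)) Z"])
      (simp_all add: in_Hom zero_object_ident[OF Z] zero_object_ident[OF z[OF i]])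
  ultimately have "isomorphic_seqs (zero_seq Z) \<mu>" unfolding isomorphic_seqs_def I_def[symmetric] by blast
  then have "\<mu> \<in> N" by (rule N1a_iso[OF zero_seq_N[OF Z] sm])
  then show ?thesis by (rule N1a_sum[OF g _ s])
qed

lemma N_decomposition:
  assumes a: "\<alpha> \<in> N"
  obtains \<gamma> M t where "candidate_angle \<gamma>" "contractible \<gamma>" "t \<in> Hom C M M" "iso_arrow C t"
    "direct_sum_seq \<gamma> (twisted t) \<alpha>" "twisted t \<in> N"
  using exact_decomposition[OF exact_N[OF a]] N1a_summand[OF a] direct_sum_swap by metis

lemma twisted_zero:
  assumes Z: "zero_object C M" and t: "t \<in> Hom C M M"
  shows "twisted t = zero_seq M"
proof (rule sequences_eqI[OF twisted(1)[OF t] zero_seq(1)[OF Z]])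
  fix i assume i: "i \<in> I"
  have "twisted t i \<in> Hom C M M"
    using seq_arr[OF twisted(1)[OF t] i] twisted(2)[OF t] i by (simp add: in_Hom)
  then have "twisted t i = Null C M M" by (rule zero_object_Hom(1)[OF Z])
  then show "twisted t i = zero_seq M i" using i by (simp add: zero_seq_def)
qed

lemma p_U_nonzero: "p \<star> Ident C U \<noteq> Null C U U"
  using End_U_faithful[OF p_closed] p_nonzero by blast

text \<open>
  In a member of \<open>N\<close> with first arrow \<open>p 1\<^sub>U\<close> the first object of the minimal part is a summand \<open>M\<close> of
  \<open>U\<close>. As \<open>U\<close> has only trivial idempotents, \<open>M = U\<close> unless \<open>M = 0\<close>. In the latter case the sequence
  would be contractible, by \<open>\<Theta>\<close> say, and \<open>p = p \<Theta>\<^sub>1 p = 0\<close>.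
\<close>

lemma ex_periodic_U: "\<exists>r \<in> Units R. periodic r U \<in> N"
proof -
  have "p \<star> Ident C U \<in> Ar C" by simp
  then obtain \<alpha> where a: "\<alpha> \<in> N" and a1: "\<alpha> 1 = p \<star> Ident C U" using N1c by blast
  note ex = exact_N[OF a] and [simp] = seq_arr[OF N_seq[OF a]]
  obtain \<gamma> M t where g: "candidate_angle \<gamma>" "contractible \<gamma>" and t: "t \<in> Hom C M M" and it: "iso_arrow C t"
    and s: "direct_sum_seq \<gamma> (twisted t) \<alpha>" and tN: "twisted t \<in> N"
    by (rule N_decomposition[OF a])
  obtain j1 j2 q1 q2 where sp: "splitting \<gamma> (twisted t) \<alpha> j1 j2 q1 q2"
    using s by (rule direct_sumE)
  have "biproduct C (Dom C (\<gamma> 1)) M U (j1 1) (j2 1) (q1 1) (q2 1)"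
    using splittingD(1)[OF sp, of 1] twisted(2)[OF t] by (simp add: a1[simplified])
  then obtain j q where j: "j \<in> Hom C M U" and q: "q \<in> Hom C U M" and qj: "q \<bullet> j = Ident C M"
    by (auto simp: biproduct_def)
  note [simp] = j[unfolded in_Hom] q[unfolded in_Hom] Hom_Ob[OF j] t[unfolded in_Hom]
  have qjx: "q \<bullet> (j \<bullet> x) = x" if "x \<in> Ar C" "Cod C x = M" for x using comp_rewrite[OF qj, of x] that by simp
  have M: "\<not> zero_object C M"
  proof
    assume Z: "zero_object C M"
    have "contractible \<alpha>"
      using contractible_sum[OF s g(2)] zero_seq(3)[OF Z] by (simp add: twisted_zero[OF Z t])
    then obtain \<Theta> where \<Theta>: "contraction \<alpha> \<Theta>" by (auto simp: contractible_iff)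
    note c = contraction_arr[OF \<Theta>]
    have c': "\<Theta> n \<in> Ar C" "Dom C (\<Theta> n) = U" "Cod C (\<Theta> n) = Dom C (\<alpha> n)" "\<Theta> 1 \<in> Ar C" "Dom C (\<Theta> 1) = U" "Cod C (\<Theta> 1) = U"
      using c(1-3)[of n] c(1-3)[of 1] seq_arr(2)[OF N_seq[OF a], of 1] by (simp_all add: a1[simplified])
    have z: "\<alpha> 1 \<bullet> (\<alpha> n \<bullet> \<Theta> n) = Null C U U"
      using comp_rewrite[OF exactD(2)[OF ex, of n], of "\<Theta> n"] c' seq_arr(2)[OF N_seq[OF a], of 1]
      by (simp add: a1[simplified])
    have "\<alpha> 1 = \<alpha> 1 \<bullet> (\<Theta> 1 \<bullet> \<alpha> 1 \<boxplus> \<alpha> n \<bullet> \<Theta> n)" using c(4)[of n] by simp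
    also have "\<dots> = \<alpha> 1 \<bullet> (\<Theta> 1 \<bullet> \<alpha> 1) \<boxplus> \<alpha> 1 \<bullet> (\<alpha> n \<bullet> \<Theta> n)"
      using c' seq_arr(2)[OF N_seq[OF a], of n] by (simp add: comp_plus a1[simplified])
    also have "\<dots> = Null C U U" unfolding z unfolding a1 using c' by (simp add: linear_simps)
    finally show False using p_U_nonzero unfolding a1 by blast
  qed
  have "j \<bullet> q \<in> Hom C U U" by (simp add: in_Hom)
  then consider "divisible p (j \<bullet> q)" | r where "r \<in> Units R" "j \<bullet> q = r \<star> Ident C U"
    using U_unit_or_divisible by blast
  then have jq: "j \<bullet> q = Ident C U"
  proof cases
    case 1
    then have "divisible p ((q \<bullet> (j \<bullet> q)) \<bullet> j)"
      using divisible_comp[of p "j \<bullet> q" q] divisible_comp[of p "q \<bullet> (j \<bullet> q)" j] by simp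
    then have "divisible p (Ident C M)" by (simp add: comp_assoc qj qjx)
    then have "zero_object C M" by (rule divisible_ident_zero[rotated]) simp
    then show ?thesis using M by blast
  next
    case 2
    then have [simp]: "r \<in> carrier R" "inv\<^bsub>R\<^esub> r \<in> carrier R" by (auto intro: Units_closed)
    have "(j \<bullet> q) \<bullet> (j \<bullet> q) = j \<bullet> q" by (simp add: comp_assoc qjx)
    then have "r \<star> r \<star> Ident C U = r \<star> Ident C U" unfolding 2(2) by (simp add: linear_simps)
    then have "inv\<^bsub>R\<^esub> r \<star> r \<star> r \<star> Ident C U = inv\<^bsub>R\<^esub> r \<star> r \<star> Ident C U" by simp
    then show ?thesis using 2 unit_sm_cancel(1)[OF 2(1)] by simp
  qed
  let ?t = "j \<bullet> (t \<bullet> q)"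
  have t': "?t \<in> Hom C U U" by (simp add: in_Hom)
  have N': "twisted ?t \<in> N"
    by (rule N1a_iso[OF tN twisted(1)[OF t'] isomorphic_twisted[OF j q jq qj t]])
  from U_unit_or_divisible[OF t'] show ?thesis
  proof (elim disjE bexE)
    assume "divisible p ?t"
    then have "divisible p ((q \<bullet> ?t) \<bullet> j)"
      using divisible_comp[of p ?t q] divisible_comp[of p "q \<bullet> ?t" j] by simp
    then have d: "divisible p t" by (simp add: comp_assoc qj qjx)
    obtain t1 where t1: "t1 \<in> Ar C" "Dom C t1 = M" "t1 \<bullet> t = Ident C M" using it t by (auto simp: iso_arrow_def in_Hom)
    have "divisible p (t1 \<bullet> t)" using d t1 divisible_comp(1)[of p t t1] by simp
    then have "zero_object C M" unfolding t1(3) by (rule divisible_ident_zero[rotated]) simp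
    then show ?thesis using M by blast
  next
    fix r assume "r \<in> Units R" "?t = r \<star> Ident C U"
    then show ?thesis using N' by (auto simp: periodic_def)
  qed
qed

lemma periodic_N:
  assumes r: "r \<in> carrier R" and U: "periodic r U \<in> N" and F: "F \<in> Ob C"
  shows "periodic r F \<in> N"
  using F
proof (induction rule: object_induct)
  case (zero Z)
  have "Z \<in> Ob C" using zero by (rule zero_objectD)
  then have "periodic r Z = zero_seq Z" unfolding periodic_def
    using r by (intro twisted_zero[OF zero]) (simp add: in_Hom)
  then show ?case using zero_seq_N[OF zero] by simp
next
  case (add A S j1 j2 q1 q2)
  then show ?case using N1a_sum[OF U _ direct_sum_periodic[OF r]] by blast
qed

text \<open>
  All arrows but the first of both sequences are multiplication by \<open>p\<close>, so the components of a morphism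
  between them agree modulo \<open>p\<close>, except possibly between positions \<open>1\<close> and \<open>2\<close>; going around the cycle
  the other way they agree there as well. The morphism that starts with \<open>1\<close> and \<open>r\<^sup>-\<^sup>1 t\<close> therefore
  shows \<open>p t = p r\<close>.
\<close>

lemma twisted_N:
  assumes r: "r \<in> Units R" and N: "periodic r M \<in> N" and t: "t \<in> Hom C M M" and tN: "twisted t \<in> N"
  shows "twisted t = periodic r M"
proof -
  have rc [simp]: "r \<in> carrier R" "inv\<^bsub>R\<^esub> r \<in> carrier R" using r by (auto intro: Units_closed)
  note [simp] = t[unfolded in_Hom] Hom_Ob[OF t]
  have rt: "r \<star> Ident C M \<in> Hom C M M" by (simp add: in_Hom)
  note T = twisted[OF t] and P = twisted[OF rt, folded periodic_def]
  obtain \<phi> where \<phi>: "\<phi> 1 = Ident C M" "\<phi> 2 = inv\<^bsub>R\<^esub> r \<star> t" "\<And>i. i \<in> I \<Longrightarrow> \<phi> i \<in> Hom C M M"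
      "\<And>i. i \<in> I \<Longrightarrow> \<phi> (nx i) \<bullet> periodic r M i = twisted t i \<bullet> \<phi> i"
  proof (rule fill_in[OF N tN, of "Ident C M" "inv\<^bsub>R\<^esub> r \<star> t"])
    show "Ident C M \<in> Hom C (Dom C (periodic r M 1)) (Dom C (twisted t 1))"
      "inv\<^bsub>R\<^esub> r \<star> t \<in> Hom C (Dom C (periodic r M 2)) (Dom C (twisted t 2))"
      using T(2) P(2) by (simp_all add: in_Hom)
    show "inv\<^bsub>R\<^esub> r \<star> t \<bullet> periodic r M 1 = twisted t 1 \<bullet> Ident C M"
      unfolding T(3) P(3) using unit_sm_cancel(2)[OF r, of t]
      by (simp add: linear_simps sm_left_comm[of r p t] sm_left_comm[of "inv\<^bsub>R\<^esub> r" p])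
    fix \<phi> assume "\<phi> 1 = Ident C M" "\<phi> 2 = inv\<^bsub>R\<^esub> r \<star> t"
      "\<And>i. i \<in> I \<Longrightarrow> \<phi> i \<in> Hom C (Dom C (periodic r M i)) (Dom C (twisted t i))"
      "\<And>i. i \<in> I \<Longrightarrow> \<phi> (nx i) \<bullet> periodic r M i = twisted t i \<bullet> \<phi> i"
    then show ?thesis using T(2) P(2) by (intro that[of \<phi>]) simp_all
  qed
  have p\<phi>: "p \<star> \<phi> (nx i) = p \<star> \<phi> i" if i: "i \<in> I" "i \<noteq> 1" for i
    using \<phi>(4)[OF i(1)] \<phi>(3)[OF i(1)] \<phi>(3)[OF nx_I[OF i(1)]] unfolding T(4)[OF i] P(4)[OF i]
    by (simp add: in_Hom linear_simps)
  have all: "k \<in> I \<longrightarrow> p \<star> \<phi> k = p \<star> \<phi> 2" if "2 \<le> k" for k using that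
  proof (induction k rule: dec_induct)
    case (step k)
    show ?case
    proof
      assume "Suc k \<in> I"
      then have k: "k \<in> I" "k \<noteq> 1" "nx k = Suc k" using step(1) by (auto simp: I_def)
      have "p \<star> \<phi> (Suc k) = p \<star> \<phi> k" using p\<phi>[OF k(1,2)] unfolding k(3) .
      then show "p \<star> \<phi> (Suc k) = p \<star> \<phi> 2" using step(3) k(1) by (simp only:)
    qed
  qed simp
  have n: "2 \<le> n" "n \<noteq> 1" using n_ge_3 by auto
  have "p \<star> inv\<^bsub>R\<^esub> r \<star> t = p \<star> \<phi> n" using all[OF n(1)] \<phi>(2) by (simp only: I_simps)
  also have "\<dots> = p \<star> Ident C M" using p\<phi>[OF _ n(2)] unfolding I_simps(6) \<phi>(1) by (simp only: I_simps)
  finally have e: "p \<star> inv\<^bsub>R\<^esub> r \<star> t = p \<star> Ident C M" .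
  have "p \<star> t = r \<star> p \<star> inv\<^bsub>R\<^esub> r \<star> t"
    using sm_left_comm[of r p "inv\<^bsub>R\<^esub> r \<star> t"] unit_sm_cancel(2)[OF r, of t] by simp
  also have "\<dots> = p \<star> r \<star> Ident C M" unfolding e using sm_left_comm[of r p "Ident C M"] by simp
  finally show ?thesis unfolding periodic_def by (rule twisted_cong) simp
qed

theorem N_eq_angles: "\<exists>r \<in> Units R. N = {\<alpha>. angle r \<alpha>}"
proof -
  obtain r where r: "r \<in> Units R" and rU: "periodic r U \<in> N" using ex_periodic_U by blast
  have rc: "r \<in> carrier R" using r by (rule Units_closed)
  note rN = periodic_N[OF rc rU]
  have "\<alpha> \<in> N" if "angle r \<alpha>" for \<alpha>
    using that rN contractible_N N1a_sum unfolding angle_iff[OF r] by blast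
  moreover have "angle r \<alpha>" if a: "\<alpha> \<in> N" for \<alpha>
  proof -
    obtain \<gamma> M t where g: "candidate_angle \<gamma>" "contractible \<gamma>" and t: "t \<in> Hom C M M"
      and s: "direct_sum_seq \<gamma> (twisted t) \<alpha>" and tN: "twisted t \<in> N"
      by (rule N_decomposition[OF a])
    have "twisted t = periodic r M" by (rule twisted_N[OF r rN[OF Hom_Ob(1)[OF t]] t tN])
    then show ?thesis using g s Hom_Ob(1)[OF t] unfolding angle_iff[OF r] by auto
  qed
  ultimately show ?thesis using r by blast
qed

end

section \<open>Modules with a finite basis\<close>

context cring
begin

abbreviation lin :: "('a, 'm, 'c) module_scheme \<Rightarrow> ('a, 'k, 'd) module_scheme \<Rightarrow> ('m \<Rightarrow> 'k) set" where
  "lin M L \<equiv> LinearCombinations.module_hom R M L"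

lemma linI:
  "\<lbrakk>\<And>x. x \<in> carrier M \<Longrightarrow> f x \<in> carrier L;
    \<And>x y. \<lbrakk>x \<in> carrier M; y \<in> carrier M\<rbrakk> \<Longrightarrow> f (x \<oplus>\<^bsub>M\<^esub> y) = f x \<oplus>\<^bsub>L\<^esub> f y;
    \<And>r x. \<lbrakk>r \<in> carrier R; x \<in> carrier M\<rbrakk> \<Longrightarrow> f (r \<odot>\<^bsub>M\<^esub> x) = r \<odot>\<^bsub>L\<^esub> f x\<rbrakk> \<Longrightarrow> f \<in> lin M L"
  by (auto simp: LinearCombinations.module_hom_def)

lemma linD:
  assumes "f \<in> lin M L"
  shows "x \<in> carrier M \<Longrightarrow> f x \<in> carrier L"
    "\<lbrakk>x \<in> carrier M; y \<in> carrier M\<rbrakk> \<Longrightarrow> f (x \<oplus>\<^bsub>M\<^esub> y) = f x \<oplus>\<^bsub>L\<^esub> f y"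
    "\<lbrakk>r \<in> carrier R; x \<in> carrier M\<rbrakk> \<Longrightarrow> f (r \<odot>\<^bsub>M\<^esub> x) = r \<odot>\<^bsub>L\<^esub> f x"
  using assms by (auto simp: LinearCombinations.module_hom_def)

lemma lin_mod_hom: "\<lbrakk>Module.module R M; Module.module R L; f \<in> lin M L\<rbrakk> \<Longrightarrow> mod_hom R M L f"
  by (simp add: mod_hom_def mod_hom_axioms_def)

lemma lin_zero: "\<lbrakk>Module.module R M; Module.module R L; f \<in> lin M L\<rbrakk> \<Longrightarrow> f \<zero>\<^bsub>M\<^esub> = \<zero>\<^bsub>L\<^esub>"
  by (rule mod_hom.f0_is_0[OF lin_mod_hom])

definition free_basis :: "('a, 'm) module \<Rightarrow> 'm set \<Rightarrow> bool" where
  "free_basis M B \<longleftrightarrow> finite B \<and> B \<subseteq> carrier M \<and> \<not> module.lin_dep R M B \<and> module.span R M B = carrier M"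

lemma fg_free_module_iff: "fg_free_module R M \<longleftrightarrow> Module.module R M \<and> (\<exists>B. free_basis M B)"
  unfolding fg_free_module_def free_basis_def by blast

lemma free_basisI:
  assumes M: "Module.module R M" and B: "finite B" "B \<subseteq> carrier M"
    and indep: "\<And>a v. \<lbrakk>a \<in> B \<rightarrow> carrier R; module.lincomb M a B = \<zero>\<^bsub>M\<^esub>; v \<in> B\<rbrakk> \<Longrightarrow> a v = \<zero>"
    and gen: "\<And>x. x \<in> carrier M \<Longrightarrow> \<exists>a \<in> B \<rightarrow> carrier R. x = module.lincomb M a B"
  shows "free_basis M B"
proof -
  interpret M: Module.module R M by (rule M)
  have "M.lin_indpt B" by (rule M.finite_lin_indpt2[OF B]) (use indep in blast)
  moreover have "M.span B = carrier M" using M.span_is_subset2[OF B(2)] gen M.finite_span[OF B] by blast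
  ultimately show ?thesis using B by (simp add: free_basis_def)
qed

lemma free_basisD:
  assumes M: "Module.module R M" and b: "free_basis M B"
  shows "finite B" "B \<subseteq> carrier M"
    "\<lbrakk>a \<in> B \<rightarrow> carrier R; module.lincomb M a B = \<zero>\<^bsub>M\<^esub>; v \<in> B\<rbrakk> \<Longrightarrow> a v = \<zero>"
    "x \<in> carrier M \<Longrightarrow> \<exists>a \<in> B \<rightarrow> carrier R. x = module.lincomb M a B"
proof -
  interpret M: Module.module R M by (rule M)
  show B: "finite B" "B \<subseteq> carrier M" using b by (auto simp: free_basis_def)
  have b': "M.lin_indpt B" "M.span B = carrier M" using b by (auto simp: free_basis_def)
  show "a v = \<zero>" if "a \<in> B \<rightarrow> carrier R" "M.lincomb a B = \<zero>\<^bsub>M\<^esub>" "v \<in> B"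
    using M.lin_dep_crit[OF B(1) subset_refl that(1,3) _ that(2)] b'(1) by blast
  show "\<exists>a \<in> B \<rightarrow> carrier R. x = M.lincomb a B" if "x \<in> carrier M"
    using M.finite_in_span[OF B, of x] that b'(2) by blast
qed

lemma lincomb_image:
  assumes M: "Module.module R M" "Module.module R L" and f: "f \<in> lin M L" and B: "finite B" "B \<subseteq> carrier M" "inj_on f B"
    and a: "a \<in> f ` B \<rightarrow> carrier R"
  shows "module.lincomb L a (f ` B) = f (module.lincomb M (\<lambda>v. a (f v)) B)"
proof -
  interpret f: mod_hom R M L f by (rule lin_mod_hom[OF M f])
  have aB [simp]: "a (f v) \<in> carrier R" "v \<in> carrier M" if "v \<in> B" for v using that a B(2) by auto
  have "f.N.lincomb a (f ` B) = (\<Oplus>\<^bsub>L\<^esub> v \<in> B. a (f v) \<odot>\<^bsub>L\<^esub> f v)" unfolding f.N.lincomb_def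
    using B a by (intro f.N.M.finsum_reindex) auto
  also have "\<dots> = (\<Oplus>\<^bsub>L\<^esub> v \<in> B. f (a (f v) \<odot>\<^bsub>M\<^esub> v))" by (intro f.N.M.finsum_cong') (auto simp del: f.f_smult simp: linD(3)[OF f] linD(1)[OF f])
  also have "\<dots> = f (\<Oplus>\<^bsub>M\<^esub> v \<in> B. a (f v) \<odot>\<^bsub>M\<^esub> v)" by (intro f.hom_sum[symmetric]) auto
  finally show ?thesis unfolding f.M.lincomb_def .
qed

text \<open>Disjointness of the two images needs \<open>1 \<noteq> 0\<close>: otherwise both bases could contain zero.\<close>

lemma free_basis_sum:
  assumes nontriv: "\<one> \<noteq> \<zero>" and M: "Module.module R A" "Module.module R B" "Module.module R S"
    and b: "free_basis A E" "free_basis B F"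
    and lin: "j1 \<in> lin A S" "j2 \<in> lin B S" "q1 \<in> lin S A" "q2 \<in> lin S B"
    and qj: "\<And>x. x \<in> carrier A \<Longrightarrow> q1 (j1 x) = x" "\<And>x. x \<in> carrier A \<Longrightarrow> q2 (j1 x) = \<zero>\<^bsub>B\<^esub>"
      "\<And>x. x \<in> carrier B \<Longrightarrow> q1 (j2 x) = \<zero>\<^bsub>A\<^esub>" "\<And>x. x \<in> carrier B \<Longrightarrow> q2 (j2 x) = x"
    and jq: "\<And>x. x \<in> carrier S \<Longrightarrow> j1 (q1 x) \<oplus>\<^bsub>S\<^esub> j2 (q2 x) = x"
  shows "free_basis S (j1 ` E \<union> j2 ` F)"
proof -
  interpret A: Module.module R A by (rule M)
  interpret B: Module.module R B by (rule M)
  interpret S: Module.module R S by (rule M)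
  note E = free_basisD[OF M(1) b(1)] and F = free_basisD[OF M(2) b(2)]
  have inj: "inj_on j1 E" "inj_on j2 F" using qj E(2) F(2) by (metis inj_onI subsetD)+
  have "carrier R \<noteq> {\<zero>}" using nontriv by auto
  then have "\<zero>\<^bsub>A\<^esub> \<notin> E" using A.zero_nin_lin_indpt[of E] b(1) by (auto simp: free_basis_def)
  have disj: "j1 ` E \<inter> j2 ` F = {}"
  proof (rule ccontr)
    assume "j1 ` E \<inter> j2 ` F \<noteq> {}"
    then obtain x y where xy: "x \<in> E" "y \<in> F" "j1 x = j2 y" by blast
    then have "x = \<zero>\<^bsub>A\<^esub>" using qj(1)[of x] qj(3)[of y] E(2) F(2) by auto
    then show False using xy \<open>\<zero>\<^bsub>A\<^esub> \<notin> E\<close> by simp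
  qed
  have fin: "finite (j1 ` E \<union> j2 ` F)" and sub: "j1 ` E \<union> j2 ` F \<subseteq> carrier S"
    using E(1,2) F(1,2) linD(1)[OF lin(1)] linD(1)[OF lin(2)] by auto
  have lc: "S.lincomb a (j1 ` E \<union> j2 ` F) = j1 (A.lincomb (\<lambda>v. a (j1 v)) E) \<oplus>\<^bsub>S\<^esub> j2 (B.lincomb (\<lambda>v. a (j2 v)) F)"
    if "a \<in> j1 ` E \<union> j2 ` F \<rightarrow> carrier R" for a
    using S.lincomb_union[OF fin sub disj that] lincomb_image[OF M(1,3) lin(1) E(1,2) inj(1), of a]
      lincomb_image[OF M(2,3) lin(2) F(1,2) inj(2), of a] that by auto
  have cl: "A.lincomb a E \<in> carrier A" if "a \<in> E \<rightarrow> carrier R" for a by (rule A.lincomb_closed[OF E(2) that])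
  have cl': "B.lincomb a F \<in> carrier B" if "a \<in> F \<rightarrow> carrier R" for a by (rule B.lincomb_closed[OF F(2) that])
  note L [simp] = linD(1)[OF lin(1)] linD(1)[OF lin(2)] linD(1)[OF lin(3)] linD(1)[OF lin(4)]
  show ?thesis
  proof (rule free_basisI[OF M(3) fin sub])
    fix a v assume a: "a \<in> j1 ` E \<union> j2 ` F \<rightarrow> carrier R" and 0: "S.lincomb a (j1 ` E \<union> j2 ` F) = \<zero>\<^bsub>S\<^esub>" and v: "v \<in> j1 ` E \<union> j2 ` F"
    let ?x = "A.lincomb (\<lambda>v. a (j1 v)) E" and ?y = "B.lincomb (\<lambda>v. a (j2 v)) F"
    have aE: "(\<lambda>v. a (j1 v)) \<in> E \<rightarrow> carrier R" and aF: "(\<lambda>v. a (j2 v)) \<in> F \<rightarrow> carrier R" using a by auto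
    note x = cl[OF aE] and y = cl'[OF aF]
    have z: "j1 ?x \<oplus>\<^bsub>S\<^esub> j2 ?y = \<zero>\<^bsub>S\<^esub>" using 0 unfolding lc[OF a] .
    have "q1 (j1 ?x \<oplus>\<^bsub>S\<^esub> j2 ?y) = ?x" "q2 (j1 ?x \<oplus>\<^bsub>S\<^esub> j2 ?y) = ?y"
      using x y by (simp_all add: linD(2)[OF lin(3)] linD(2)[OF lin(4)] qj)
    then have "?x = \<zero>\<^bsub>A\<^esub>" "?y = \<zero>\<^bsub>B\<^esub>" unfolding z by (simp_all add: lin_zero[OF M(3,1) lin(3)] lin_zero[OF M(3,2) lin(4)])
    then show "a v = \<zero>" using E(3)[OF aE] F(3)[OF aF] v by blast
  next
    fix x assume x: "x \<in> carrier S"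
    obtain c where c: "c \<in> E \<rightarrow> carrier R" "q1 x = A.lincomb c E" using E(4)[of "q1 x"] x by auto
    obtain d where d: "d \<in> F \<rightarrow> carrier R" "q2 x = B.lincomb d F" using F(4)[of "q2 x"] x by auto
    let ?a = "\<lambda>v. if v \<in> j1 ` E then c (inv_into E j1 v) else d (inv_into F j2 v)"
    have 1: "?a (j1 v) = c v" if "v \<in> E" for v using that inj(1) by simp
    have 2: "?a (j2 v) = d v" if "v \<in> F" for v
    proof -
      have "j2 v \<notin> j1 ` E" using that disj by blast
      then show ?thesis using that inj(2) by simp
    qed
    have a: "?a \<in> j1 ` E \<union> j2 ` F \<rightarrow> carrier R"
    proof (rule Pi_I)
      fix v assume "v \<in> j1 ` E \<union> j2 ` F"
      then show "?a v \<in> carrier R"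
      proof (elim UnE imageE)
        show "?a v \<in> carrier R" if "v = j1 w" "w \<in> E" for w
          using 1[OF that(2)] c(1) that by (auto simp only: that(1))
        show "?a v \<in> carrier R" if "v = j2 w" "w \<in> F" for w
          using 2[OF that(2)] d(1) that by (auto simp only: that(1))
      qed
    qed
    have "A.lincomb (\<lambda>v. ?a (j1 v)) E = q1 x" unfolding c(2) by (rule A.lincomb_cong[OF refl E(2) 1 c(1)])
    moreover have "B.lincomb (\<lambda>v. ?a (j2 v)) F = q2 x" unfolding d(2) by (rule B.lincomb_cong[OF refl F(2) 2 d(1)])
    ultimately show "\<exists>a \<in> j1 ` E \<union> j2 ` F \<rightarrow> carrier R. x = S.lincomb a (j1 ` E \<union> j2 ` F)"
      using lc[OF a] jq[OF x] by (intro bexI[OF _ a]) (simp only:)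
  qed
qed

definition transport :: "('k \<Rightarrow> 'm) \<Rightarrow> ('a, 'k) module \<Rightarrow> ('a, 'm) module" where
  "transport h M = \<lparr>carrier = h ` carrier M, monoid.mult = (\<lambda>x y. h \<zero>\<^bsub>M\<^esub>), one = h \<zero>\<^bsub>M\<^esub>, ring.zero = h \<zero>\<^bsub>M\<^esub>,
     ring.add = (\<lambda>x y. h (inv_into (carrier M) h x \<oplus>\<^bsub>M\<^esub> inv_into (carrier M) h y)),
     smult = (\<lambda>r x. h (r \<odot>\<^bsub>M\<^esub> inv_into (carrier M) h x))\<rparr>"

lemma transport:
  assumes M: "Module.module R M" and h: "inj_on h (carrier M)"
  shows "Module.module R (transport h M)" "h \<in> lin M (transport h M)" "inv_into (carrier M) h \<in> lin (transport h M) M"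
proof -
  interpret M: Module.module R M by (rule M)
  note [simp] = h
  show "Module.module R (transport h M)"
  proof (rule module_criteria)
    show "\<forall>v \<in> carrier (transport h M). \<exists>w \<in> carrier (transport h M). v \<oplus>\<^bsub>transport h M\<^esub> w = \<zero>\<^bsub>transport h M\<^esub>"
    proof
      fix v assume "v \<in> carrier (transport h M)"
      then obtain x where x: "x \<in> carrier M" "v = h x" by (auto simp: transport_def)
      then show "\<exists>w \<in> carrier (transport h M). v \<oplus>\<^bsub>transport h M\<^esub> w = \<zero>\<^bsub>transport h M\<^esub>"
        by (intro bexI[of _ "h (\<ominus>\<^bsub>M\<^esub> x)"]) (auto simp: transport_def M.r_neg)
    qed
  qed (auto simp: transport_def M.smult_l_distr M.smult_r_distr M.smult_assoc1 M.a_ac is_cring)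
  show "h \<in> lin M (transport h M)" "inv_into (carrier M) h \<in> lin (transport h M) M"
    by (auto intro!: linI simp: transport_def)
qed

text \<open>
  Coefficient lists of a fixed length encode the elements of a free module; this is how carriers of
  direct sums are found inside the universe.
\<close>

lemma coefficient_lists:
  assumes M: "Module.module R M" and b: "free_basis M B"
  obtains k e where "inj_on e (carrier M)" "\<And>x. x \<in> carrier M \<Longrightarrow> e x \<in> lists (carrier R) \<and> length (e x) = k"
proof -
  interpret M: Module.module R M by (rule M)
  note B = free_basisD[OF M b]
  obtain bs where bs: "set bs = B" using finite_list[OF B(1)] by blast
  have "\<forall>x \<in> carrier M. \<exists>a. a \<in> B \<rightarrow> carrier R \<and> x = M.lincomb a B" using B(4) by blast
  then obtain c where c: "\<And>x. x \<in> carrier M \<Longrightarrow> c x \<in> B \<rightarrow> carrier R \<and> x = M.lincomb (c x) B" by metis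
  show ?thesis
  proof (rule that)
    show "inj_on (\<lambda>x. map (c x) bs) (carrier M)"
    proof (rule inj_onI)
      fix x y assume xy: "x \<in> carrier M" "y \<in> carrier M" "map (c x) bs = map (c y) bs"
      then have "v \<in> B \<Longrightarrow> c x v = c y v" for v using bs by (auto simp: map_eq_conv)
      then have "M.lincomb (c x) B = M.lincomb (c y) B" using c[OF xy(2)] by (intro M.lincomb_cong[OF refl B(2)]) auto
      then show "x = y" using c[OF xy(1)] c[OF xy(2)] by simp
    qed
    show "map (c x) bs \<in> lists (carrier R) \<and> length (map (c x) bs) = length bs" if "x \<in> carrier M" for x
      using c[OF that] bs by auto
  qed
qed

end

section \<open>The category of finitely generated free modules\<close>

locale free_module_category = cring R
  for R :: "('r, 'x) ring_scheme" (structure) +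
  fixes \<iota> :: "'r list \<Rightarrow> 'm"
  assumes inj_\<iota>: "inj_on \<iota> (lists (carrier R))"
    and nontrivial: "\<one> \<noteq> \<zero>"
begin

abbreviation C :: "(('r, 'm) module, ('r, 'm) linear_arrow) precategory" where
  "C \<equiv> fg_free_modules R"

definition arr :: "('r, 'm) module \<Rightarrow> ('m \<Rightarrow> 'm) \<Rightarrow> ('r, 'm) module \<Rightarrow> ('r, 'm) linear_arrow" where
  "arr M f L = (M, restrict f (carrier M), L)"

definition sm :: "'r \<Rightarrow> ('r, 'm) linear_arrow \<Rightarrow> ('r, 'm) linear_arrow" where
  "sm r = (\<lambda>(M, f, L). (M, \<lambda>x \<in> carrier M. r \<odot>\<^bsub>L\<^esub> f x, L))"

lemma Ob_iff: "M \<in> Ob C \<longleftrightarrow> fg_free_module R M"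
  by (simp add: fg_free_modules_def)

lemma fg_module: "fg_free_module R M \<Longrightarrow> Module.module R M"
  by (simp add: fg_free_module_def)

lemma arr_eq_iff: "arr M f L = arr M g L \<longleftrightarrow> (\<forall>x \<in> carrier M. f x = g x)"
  by (auto simp: arr_def restrict_def fun_eq_iff)

lemma arr_cong: "(\<And>x. x \<in> carrier M \<Longrightarrow> f x = g x) \<Longrightarrow> arr M f L = arr M g L"
  by (simp add: arr_eq_iff)

lemma lin_restrict:
  assumes M: "Module.module R M" and f: "f \<in> lin M L"
  shows "restrict f (carrier M) \<in> lin M L"
proof -
  interpret M: Module.module R M by (rule M)
  show ?thesis by (rule linI) (auto simp: linD[OF f])
qed

lemma arr_Hom:
  assumes "fg_free_module R M" "fg_free_module R L" "f \<in> lin M L"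
  shows "arr M f L \<in> Hom C M L"
  using assms lin_restrict[OF fg_module] by (simp add: arr_def Hom_def fg_free_modules_def)

lemma HomE:
  assumes "t \<in> Hom C M L"
  obtains f where "t = arr M f L" "f \<in> lin M L" "fg_free_module R M" "fg_free_module R L"
proof -
  obtain f where "t = (M, f, L)" "f \<in> lin M L" "f \<in> extensional (carrier M)" "fg_free_module R M" "fg_free_module R L"
    using assms by (auto simp: Hom_def fg_free_modules_def)
  then show ?thesis using that[of f] by (simp add: arr_def extensional_restrict)
qed

lemma arr_Comp: "f \<in> lin M L \<Longrightarrow> arr L g K \<bullet>\<^bsub>C\<^esub> arr M f L = arr M (\<lambda>x. g (f x)) K"
  using linD(1) by (fastforce simp: arr_def fg_free_modules_def compose_def restrict_def fun_eq_iff)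

lemma arr_simps:
  "arr M f L \<boxplus>\<^bsub>C\<^esub> arr M g L = arr M (\<lambda>x. f x \<oplus>\<^bsub>L\<^esub> g x) L"
  "Null C M L = arr M (\<lambda>x. \<zero>\<^bsub>L\<^esub>) L"
  "Ident C M = arr M (\<lambda>x. x) M"
  "sm r (arr M f L) = arr M (\<lambda>x. r \<odot>\<^bsub>L\<^esub> f x) L"
  by (auto simp: arr_def fg_free_modules_def sm_def fun_eq_iff)

lemma lin_ops:
  assumes M: "Module.module R M" "Module.module R L" and f: "f \<in> lin M L"
  shows "g \<in> lin M L \<Longrightarrow> (\<lambda>x. f x \<oplus>\<^bsub>L\<^esub> g x) \<in> lin M L"
    "(\<lambda>x. \<ominus>\<^bsub>L\<^esub> f x) \<in> lin M L"
    "r \<in> carrier R \<Longrightarrow> (\<lambda>x. r \<odot>\<^bsub>L\<^esub> f x) \<in> lin M L"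
proof -
  interpret L: Module.module R L by (rule M)
  note f' = linD[OF f]
  show "(\<lambda>x. f x \<oplus>\<^bsub>L\<^esub> g x) \<in> lin M L" if g: "g \<in> lin M L"
    by (rule linI) (auto simp: f' linD[OF g] L.smult_r_distr L.a_ac)
  show "(\<lambda>x. \<ominus>\<^bsub>L\<^esub> f x) \<in> lin M L"
    by (rule linI) (auto simp: f' L.minus_add L.smult_r_minus)
  show "(\<lambda>x. r \<odot>\<^bsub>L\<^esub> f x) \<in> lin M L" if "r \<in> carrier R"
    by (rule linI) (use that in \<open>auto simp: f' L.smult_r_distr L.smult_assoc1[symmetric] m_comm\<close>)
qed

lemma lin_trivial:
  assumes "Module.module R M" "Module.module R L"
  shows "(\<lambda>x. \<zero>\<^bsub>L\<^esub>) \<in> lin M L" "(\<lambda>x. x) \<in> lin M M"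
proof -
  interpret L: Module.module R L by (rule assms)
  show "(\<lambda>x. \<zero>\<^bsub>L\<^esub>) \<in> lin M L" by (rule linI) auto
  show "(\<lambda>x. x) \<in> lin M M" by (rule linI) auto
qed

lemma lin_comp: "f \<in> lin M L \<Longrightarrow> g \<in> lin L K \<Longrightarrow> (\<lambda>x. g (f x)) \<in> lin M K"
  by (rule linI) (auto simp: linD)

lemma biproduct_arr_iff:
  assumes M: "fg_free_module R A" "fg_free_module R B" "fg_free_module R S"
    and lin: "j1 \<in> lin A S" "j2 \<in> lin B S" "q1 \<in> lin S A" "q2 \<in> lin S B"
    and qj: "\<And>x. x \<in> carrier A \<Longrightarrow> q1 (j1 x) = x" "\<And>x. x \<in> carrier A \<Longrightarrow> q2 (j1 x) = \<zero>\<^bsub>B\<^esub>"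
      "\<And>x. x \<in> carrier B \<Longrightarrow> q1 (j2 x) = \<zero>\<^bsub>A\<^esub>" "\<And>x. x \<in> carrier B \<Longrightarrow> q2 (j2 x) = x"
    and jq: "\<And>x. x \<in> carrier S \<Longrightarrow> j1 (q1 x) \<oplus>\<^bsub>S\<^esub> j2 (q2 x) = x"
  shows "biproduct C A B S (arr A j1 S) (arr B j2 S) (arr S q1 A) (arr S q2 B)"
  unfolding biproduct_def
  by (simp add: arr_Hom M lin arr_simps arr_Comp[OF lin(1)] arr_Comp[OF lin(2)] arr_Comp[OF lin(3)] arr_Comp[OF lin(4)]
    arr_eq_iff qj jq)

text \<open>The module \<open>R\<close>, with its elements encoded in the universe.\<close>

definition U :: "('r, 'm) module" where
  "U = transport (\<lambda>r. \<iota> [r]) \<lparr>carrier = carrier R, monoid.mult = (\<otimes>), one = \<one>, ring.zero = \<zero>, ring.add = (\<oplus>), smult = (\<otimes>)\<rparr>"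

lemma inj_\<iota>1: "inj_on (\<lambda>r. \<iota> [r]) (carrier R)"
  by (rule inj_onI) (use inj_onD[OF inj_\<iota>] in \<open>metis list.inject lists.simps\<close>)

lemma inj_\<iota>2:
  assumes "inj_on e A" "\<And>x. x \<in> A \<Longrightarrow> e x \<in> lists (carrier R) \<and> length (e x) = k"
    and "inj_on e' B" "\<And>x. x \<in> B \<Longrightarrow> e' x \<in> lists (carrier R)"
  shows "inj_on (\<lambda>(x, y). \<iota> (e x @ e' y)) (A \<times> B)"
proof (rule inj_onI, clarify)
  fix x y x' y' assume xy: "x \<in> A" "y \<in> B" "x' \<in> A" "y' \<in> B" "\<iota> (e x @ e' y) = \<iota> (e x' @ e' y')"
  have "e x @ e' y = e x' @ e' y'"
    by (rule inj_onD[OF inj_\<iota> xy(5)]) (use assms(2)[OF xy(1)] assms(2)[OF xy(3)] assms(4)[OF xy(2)] assms(4)[OF xy(4)] in auto)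
  then have "e x = e x'" "e' y = e' y'" using assms(2)[OF xy(1)] assms(2)[OF xy(3)] by auto
  then show "x = x' \<and> y = y'" using inj_onD[OF assms(1)] inj_onD[OF assms(3)] xy by blast
qed

lemma U_simps:
  "carrier U = (\<lambda>r. \<iota> [r]) ` carrier R" "\<zero>\<^bsub>U\<^esub> = \<iota> [\<zero>]"
  "\<lbrakk>r \<in> carrier R; s \<in> carrier R\<rbrakk> \<Longrightarrow> \<iota> [r] \<oplus>\<^bsub>U\<^esub> \<iota> [s] = \<iota> [r \<oplus> s]"
  "\<lbrakk>r \<in> carrier R; s \<in> carrier R\<rbrakk> \<Longrightarrow> r \<odot>\<^bsub>U\<^esub> \<iota> [s] = \<iota> [r \<otimes> s]"
  using inv_into_f_f[OF inj_\<iota>1] by (simp_all add: U_def transport_def)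

lemma U_module: "Module.module R U"
  unfolding U_def
  by (rule transport(1)) (auto intro!: module_criteria simp: is_cring a_ac m_ac l_distr r_distr inj_\<iota>1 intro: bexI[of _ "\<ominus> _"] r_neg)

lemma U_fg: "fg_free_module R U"
proof -
  interpret U: Module.module R U by (rule U_module)
  have c: "\<iota> [\<one>] \<in> carrier U" by (simp add: U_simps)
  have l: "U.lincomb a {\<iota> [\<one>]} = a (\<iota> [\<one>]) \<odot>\<^bsub>U\<^esub> \<iota> [\<one>]" if "a \<in> {\<iota> [\<one>]} \<rightarrow> carrier R" for a
    unfolding U.lincomb_def using that c by simp
  have "free_basis U {\<iota> [\<one>]}"
  proof (rule free_basisI[OF U_module])
    show "a v = \<zero>" if "a \<in> {\<iota> [\<one>]} \<rightarrow> carrier R" "U.lincomb a {\<iota> [\<one>]} = \<zero>\<^bsub>U\<^esub>" "v \<in> {\<iota> [\<one>]}" for a v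
      using that l[OF that(1)] inj_onD[OF inj_\<iota>1, of "a v" \<zero>] by (simp add: U_simps)
    show "\<exists>a \<in> {\<iota> [\<one>]} \<rightarrow> carrier R. x = U.lincomb a {\<iota> [\<one>]}" if "x \<in> carrier U" for x
    proof -
      obtain r where r: "r \<in> carrier R" "x = \<iota> [r]" using \<open>x \<in> carrier U\<close> by (auto simp: U_simps)
      have a: "(\<lambda>_. r) \<in> {\<iota> [\<one>]} \<rightarrow> carrier R" using r by simp
      show ?thesis using l[OF a] r by (intro bexI[OF _ a]) (simp add: U_simps)
    qed
  qed (use c in auto)
  then show ?thesis using U_module by (auto simp: fg_free_module_iff)
qed

lemma empty_basis_iff:
  assumes M: "Module.module R M"
  shows "free_basis M {} \<longleftrightarrow> carrier M = {\<zero>\<^bsub>M\<^esub>}"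
proof -
  interpret M: Module.module R M by (rule M)
  have e: "M.lincomb a {} = \<zero>\<^bsub>M\<^esub>" for a by (simp add: M.lincomb_def)
  show ?thesis
  proof
    assume b: "free_basis M {}"
    show "carrier M = {\<zero>\<^bsub>M\<^esub>}" using free_basisD(4)[OF M b] e by auto
  next
    assume "carrier M = {\<zero>\<^bsub>M\<^esub>}"
    then show "free_basis M {}" by (intro free_basisI[OF M]) (auto simp: e)
  qed
qed

lemma zero_object_carrier:
  assumes M: "fg_free_module R M" and 0: "carrier M = {\<zero>\<^bsub>M\<^esub>}"
  shows "zero_object C M"
  unfolding zero_object_def
proof (intro conjI ballI)
  show "M \<in> Ob C" using M by (simp add: Ob_iff)
  fix A assume "A \<in> Ob C"
  then have A: "fg_free_module R A" by (simp add: Ob_iff)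
  note m = fg_module[OF M] fg_module[OF A]
  show "\<exists>!f. f \<in> Hom C A M"
  proof (rule ex1I)
    show "arr A (\<lambda>x. \<zero>\<^bsub>M\<^esub>) M \<in> Hom C A M" by (rule arr_Hom[OF A M lin_trivial(1)[OF m(2,1)]])
    fix t assume "t \<in> Hom C A M"
    then obtain f where f: "t = arr A f M" "f \<in> lin A M" by (rule HomE)
    show "t = arr A (\<lambda>x. \<zero>\<^bsub>M\<^esub>) M" unfolding f(1) by (rule arr_cong) (use linD(1)[OF f(2)] 0 in auto)
  qed
  show "\<exists>!f. f \<in> Hom C M A"
  proof (rule ex1I)
    show "arr M (\<lambda>x. \<zero>\<^bsub>A\<^esub>) A \<in> Hom C M A" by (rule arr_Hom[OF M A lin_trivial(1)[OF m(1,2)]])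
    fix t assume "t \<in> Hom C M A"
    then obtain f where f: "t = arr M f A" "f \<in> lin M A" by (rule HomE)
    show "t = arr M (\<lambda>x. \<zero>\<^bsub>A\<^esub>) A" unfolding f(1) by (rule arr_cong) (use lin_zero[OF m f(2)] 0 in auto)
  qed
qed

lemma ex_zero_object: "\<exists>Z. zero_object C Z"
proof -
  interpret U: Module.module R U by (rule U_module)
  let ?Z = "U\<lparr>carrier := {\<zero>\<^bsub>U\<^esub>}\<rparr>"
  have Z: "Module.module R ?Z" by (rule U.submodule_is_module) (simp add: submodule_def U_module)
  then have "fg_free_module R ?Z" using empty_basis_iff[OF Z] by (auto simp: fg_free_module_iff)
  then show ?thesis using zero_object_carrier[of ?Z] by auto
qed

lemma ex_biproduct:
  assumes A: "fg_free_module R A" and B: "fg_free_module R B"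
  shows "\<exists>S j1 j2 q1 q2. biproduct C A B S j1 j2 q1 q2"
proof -
  note m = fg_module[OF A] fg_module[OF B]
  interpret A: Module.module R A by (rule m)
  interpret B: Module.module R B by (rule m)
  obtain E F where EF: "free_basis A E" "free_basis B F" using A B by (auto simp: fg_free_module_iff)
  \<comment> \<open>concatenation of coefficient lists of fixed lengths is injective\<close>
  obtain k e where e: "inj_on e (carrier A)" "\<And>x. x \<in> carrier A \<Longrightarrow> e x \<in> lists (carrier R) \<and> length (e x) = k"
    by (rule coefficient_lists[OF m(1) EF(1)]) blast
  obtain k' e' where e': "inj_on e' (carrier B)" "\<And>x. x \<in> carrier B \<Longrightarrow> e' x \<in> lists (carrier R) \<and> length (e' x) = k'"
    by (rule coefficient_lists[OF m(2) EF(2)]) blast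
  let ?D = "direct_sum A B" and ?h = "\<lambda>(x, y). \<iota> (e x @ e' y)"
  have D: "Module.module R ?D" by (rule direct_sum_is_module[OF m])
  have h: "inj_on ?h (carrier ?D)" using inj_\<iota>2[OF e e'(1)] e'(2) by (simp add: direct_sum_def)
  define S g where "S = transport ?h ?D" and "g = inv_into (carrier ?D) ?h"
  note S = transport[OF D h, folded S_def g_def]
  have gh: "g (?h z) = z" if "z \<in> carrier ?D" for z unfolding g_def by (rule inv_into_f_f[OF h that])
  have hg: "?h (g x) = x" if "x \<in> carrier S" for x unfolding g_def using that
    by (intro f_inv_into_f) (simp add: S_def transport_def)
  have l: "(\<lambda>x. (x, \<zero>\<^bsub>B\<^esub>)) \<in> lin A ?D" "(\<lambda>y. (\<zero>\<^bsub>A\<^esub>, y)) \<in> lin B ?D" "fst \<in> lin ?D A" "snd \<in> lin ?D B"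
    by (rule linI; auto simp: direct_sum_def)+
  note l' = lin_comp[OF l(1) S(2)] lin_comp[OF l(2) S(2)] lin_comp[OF S(3) l(3)] lin_comp[OF S(3) l(4)]
  have qj: "x \<in> carrier A \<Longrightarrow> g (?h (x, \<zero>\<^bsub>B\<^esub>)) = (x, \<zero>\<^bsub>B\<^esub>)" "y \<in> carrier B \<Longrightarrow> g (?h (\<zero>\<^bsub>A\<^esub>, y)) = (\<zero>\<^bsub>A\<^esub>, y)" for x y
    by (rule gh; simp add: direct_sum_def)+
  have jq: "?h (fst (g x), \<zero>\<^bsub>B\<^esub>) \<oplus>\<^bsub>S\<^esub> ?h (\<zero>\<^bsub>A\<^esub>, snd (g x)) = x" if x: "x \<in> carrier S" for x
  proof -
    have gx: "fst (g x) \<in> carrier A" "snd (g x) \<in> carrier B" using linD(1)[OF S(3) x] by (auto simp: direct_sum_def)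
    have "?h (fst (g x), \<zero>\<^bsub>B\<^esub>) \<oplus>\<^bsub>S\<^esub> ?h (\<zero>\<^bsub>A\<^esub>, snd (g x)) = ?h ((fst (g x), \<zero>\<^bsub>B\<^esub>) \<oplus>\<^bsub>?D\<^esub> (\<zero>\<^bsub>A\<^esub>, snd (g x)))"
      using gx by (intro linD(2)[OF S(2), symmetric]) (simp_all add: direct_sum_def)
    also have "(fst (g x), \<zero>\<^bsub>B\<^esub>) \<oplus>\<^bsub>?D\<^esub> (\<zero>\<^bsub>A\<^esub>, snd (g x)) = g x" using gx by (simp add: direct_sum_def)
    finally show ?thesis using hg[OF x] by simp
  qed
  have "free_basis S ((\<lambda>x. ?h (x, \<zero>\<^bsub>B\<^esub>)) ` E \<union> (\<lambda>y. ?h (\<zero>\<^bsub>A\<^esub>, y)) ` F)"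
    by (rule free_basis_sum[OF nontrivial m S(1) EF l']) (simp_all only: qj jq fst_conv snd_conv)
  then have S': "fg_free_module R S" using S(1) by (auto simp: fg_free_module_iff)
  have "biproduct C A B S (arr A (\<lambda>x. ?h (x, \<zero>\<^bsub>B\<^esub>)) S) (arr B (\<lambda>y. ?h (\<zero>\<^bsub>A\<^esub>, y)) S) (arr S (\<lambda>x. fst (g x)) A) (arr S (\<lambda>x. snd (g x)) B)"
    by (rule biproduct_arr_iff[OF A B S' l']) (simp_all only: qj jq fst_conv snd_conv)
  then show ?thesis by blast
qed

lemma hom_comm_group:
  assumes M: "fg_free_module R M" and L: "fg_free_module R L"
  shows "comm_group (hom_group C M L)"
proof -
  note m = fg_module[OF M] fg_module[OF L]
  interpret L: Module.module R L by (rule m)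
  have hg: "carrier (hom_group C M L) = Hom C M L" "x \<otimes>\<^bsub>hom_group C M L\<^esub> y = x \<boxplus>\<^bsub>C\<^esub> y" "\<one>\<^bsub>hom_group C M L\<^esub> = Null C M L" for x y
    by (simp_all add: hom_group_def)
  note H = arr_Hom[OF M L]
  show ?thesis
  proof (rule comm_groupI, unfold hg)
    show "x \<boxplus>\<^bsub>C\<^esub> y \<in> Hom C M L" if "x \<in> Hom C M L" "y \<in> Hom C M L" for x y
      using that by (auto elim!: HomE simp: arr_simps intro!: H lin_ops(1)[OF m])
    show "Null C M L \<in> Hom C M L" by (simp add: arr_simps H lin_trivial(1)[OF m])
    show "x \<boxplus>\<^bsub>C\<^esub> y \<boxplus>\<^bsub>C\<^esub> z = x \<boxplus>\<^bsub>C\<^esub> (y \<boxplus>\<^bsub>C\<^esub> z)" if "x \<in> Hom C M L" "y \<in> Hom C M L" "z \<in> Hom C M L" for x y z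
      using that by (auto elim!: HomE simp: arr_simps arr_eq_iff linD(1) L.a_assoc)
    show "x \<boxplus>\<^bsub>C\<^esub> y = y \<boxplus>\<^bsub>C\<^esub> x" if "x \<in> Hom C M L" "y \<in> Hom C M L" for x y
      using that by (auto elim!: HomE simp: arr_simps arr_eq_iff linD(1) L.a_comm)
    show "Null C M L \<boxplus>\<^bsub>C\<^esub> x = x" if "x \<in> Hom C M L" for x
      using that by (auto elim!: HomE simp: arr_simps arr_eq_iff linD(1))
    show "\<exists>y \<in> Hom C M L. y \<boxplus>\<^bsub>C\<^esub> x = Null C M L" if x: "x \<in> Hom C M L" for x
    proof -
      obtain f where f: "x = arr M f L" "f \<in> lin M L" using x by (rule HomE)
      show ?thesis
        by (rule bexI[OF _ H[OF lin_ops(2)[OF m f(2)]]]) (simp add: f(1) arr_simps arr_eq_iff linD(1)[OF f(2)] L.l_neg)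
    qed
  qed
qed

lemma additive: "additive_category C"
proof (rule additive_category.intro)
  show "f \<in> Ar C \<Longrightarrow> Dom C f \<in> Ob C" "f \<in> Ar C \<Longrightarrow> Cod C f \<in> Ob C" for f by (auto simp: fg_free_modules_def)
  show "A \<in> Ob C \<Longrightarrow> Ident C A \<in> Hom C A A" for A
    unfolding Ob_iff arr_simps using arr_Hom lin_trivial(2)[OF fg_module fg_module] by blast
  show "\<exists>Z. zero_object C Z" by (rule ex_zero_object)
  show "A \<in> Ob C \<Longrightarrow> B \<in> Ob C \<Longrightarrow> \<exists>S j1 j2 q1 q2. biproduct C A B S j1 j2 q1 q2" for A B
    unfolding Ob_iff by (rule ex_biproduct)
  show "A \<in> Ob C \<Longrightarrow> B \<in> Ob C \<Longrightarrow> comm_group (hom_group C A B)" for A B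
    unfolding Ob_iff by (rule hom_comm_group)
  fix f A B assume "f \<in> Hom C A B"
  then obtain f' where f: "f = arr A f' B" "f' \<in> lin A B" "fg_free_module R A" "fg_free_module R B" by (rule HomE)
  note m = fg_module[OF f(3)] fg_module[OF f(4)]
  show "f \<bullet>\<^bsub>C\<^esub> Ident C A = f" unfolding f(1) arr_simps using arr_Comp[OF lin_trivial(2)[OF m(1) m(1)]] by simp
  show "Ident C B \<bullet>\<^bsub>C\<^esub> f = f" unfolding f(1) arr_simps using arr_Comp[OF f(2)] by simp
  fix g D
  show "g \<bullet>\<^bsub>C\<^esub> f \<in> Hom C A D" if g0: "g \<in> Hom C B D"
  proof -
    obtain g' where g: "g = arr B g' D" "g' \<in> lin B D" "fg_free_module R B" "fg_free_module R D" using g0 by (rule HomE)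
    show ?thesis unfolding f(1) g(1) arr_Comp[OF f(2)] by (rule arr_Hom[OF f(3) g(4) lin_comp[OF f(2) g(2)]])
  qed
  show "(h \<bullet>\<^bsub>C\<^esub> g) \<bullet>\<^bsub>C\<^esub> f = h \<bullet>\<^bsub>C\<^esub> (g \<bullet>\<^bsub>C\<^esub> f)" if g0: "g \<in> Hom C B D" and h0: "h \<in> Hom C D E" for h E
  proof -
    obtain g' where g: "g = arr B g' D" "g' \<in> lin B D" using g0 by (rule HomE)
    obtain h' where h: "h = arr D h' E" using h0 by (rule HomE)
    show ?thesis unfolding f(1) g(1) h arr_Comp[OF f(2)] arr_Comp[OF g(2)] arr_Comp[OF lin_comp[OF f(2) g(2)]] ..
  qed
  show "g \<bullet>\<^bsub>C\<^esub> (f \<boxplus>\<^bsub>C\<^esub> k) = g \<bullet>\<^bsub>C\<^esub> f \<boxplus>\<^bsub>C\<^esub> g \<bullet>\<^bsub>C\<^esub> k" if k0: "k \<in> Hom C A B" and g0: "g \<in> Hom C B D" for k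
  proof -
    obtain g' where g: "g = arr B g' D" "g' \<in> lin B D" using g0 by (rule HomE)
    obtain k' where k: "k = arr A k' B" "k' \<in> lin A B" using k0 by (rule HomE)
    show ?thesis unfolding f(1) g(1) k(1) arr_simps arr_Comp[OF f(2)] arr_Comp[OF k(2)] arr_Comp[OF lin_ops(1)[OF m f(2) k(2)]]
      by (rule arr_cong) (simp add: linD(1)[OF f(2)] linD(1)[OF k(2)] linD(2)[OF g(2)])
  qed
  show "(g \<boxplus>\<^bsub>C\<^esub> k) \<bullet>\<^bsub>C\<^esub> f = g \<bullet>\<^bsub>C\<^esub> f \<boxplus>\<^bsub>C\<^esub> k \<bullet>\<^bsub>C\<^esub> f" if g0: "g \<in> Hom C B D" and k0: "k \<in> Hom C B D" for k
  proof -
    obtain g' where g: "g = arr B g' D" using g0 by (rule HomE)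
    obtain k' where k: "k = arr B k' D" using k0 by (rule HomE)
    show ?thesis unfolding f(1) g(1) k(1) arr_simps arr_Comp[OF f(2)] ..
  qed
qed

lemma linear: "linear_category C R sm"
proof (intro linear_category.intro additive is_cring linear_category_axioms.intro)
  show "sm \<one> f = f" if f0: "f \<in> Hom C A B" for f A B
  proof -
    obtain f' where f: "f = arr A f' B" "f' \<in> lin A B" "fg_free_module R A" "fg_free_module R B" using f0 by (rule HomE)
    interpret B: Module.module R B by (rule fg_module[OF f(4)])
    show ?thesis unfolding f(1) arr_simps by (rule arr_cong) (simp add: linD(1)[OF f(2)])
  qed
next
  fix r f A B assume r: "r \<in> carrier R" and "f \<in> Hom C A B"
  then obtain f' where f: "f = arr A f' B" "f' \<in> lin A B" "fg_free_module R A" "fg_free_module R B" by - (rule HomE)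
  note m = fg_module[OF f(3)] fg_module[OF f(4)]
  interpret B: Module.module R B by (rule m)
  show "sm r f \<in> Hom C A B" unfolding f(1) arr_simps by (rule arr_Hom[OF f(3,4) lin_ops(3)[OF m f(2) r]])
  show "sm (r \<oplus> s) f = sm r f \<boxplus>\<^bsub>C\<^esub> sm s f" "sm (r \<otimes> s) f = sm r (sm s f)" if "s \<in> carrier R" for s
    unfolding f(1) arr_simps by (rule arr_cong; use r that in \<open>simp add: linD(1)[OF f(2)] B.smult_l_distr B.smult_assoc1\<close>)+
  fix g D assume "g \<in> Hom C B D"
  then obtain g' where g: "g = arr B g' D" "g' \<in> lin B D" by (rule HomE)
  show "sm r g \<bullet>\<^bsub>C\<^esub> f = sm r (g \<bullet>\<^bsub>C\<^esub> f)" unfolding f(1) g(1) arr_simps arr_Comp[OF f(2)] ..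
  show "g \<bullet>\<^bsub>C\<^esub> sm r f = sm r (g \<bullet>\<^bsub>C\<^esub> f)" unfolding f(1) g(1) arr_simps arr_Comp[OF f(2)] arr_Comp[OF lin_ops(3)[OF m f(2) r]]
    by (rule arr_cong) (simp add: linD(1)[OF f(2)] linD(3)[OF g(2)] r)
qed

end

context free_module_category
begin

text \<open>
  A basis vector \<open>b\<close> is split off: each \<open>x\<close> is \<open>c(x) b + d(x)\<close> with a unique \<open>d(x)\<close> in the span of
  the remaining basis, and uniqueness makes \<open>c\<close> and \<open>d\<close> linear.
\<close>

lemma free_of_rank_basis:
  assumes "Module.module R M" "free_basis M B"
  shows "free_of_rank C U (card B) M"
  using assms
proof (induction "card B" arbitrary: B M)
  case 0
  then have "B = {}" using free_basisD(1)[OF 0(2,3)] by simp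
  then have "carrier M = {\<zero>\<^bsub>M\<^esub>}" using 0(3) empty_basis_iff[OF 0(2)] by simp
  then have "zero_object C M" using 0(2,3) by (intro zero_object_carrier) (auto simp: fg_free_module_iff)
  then have "free_of_rank C U 0 M" by (rule free_of_rank.zero)
  then show ?case using 0(1) by simp
next
  case (Suc k)
  interpret M: Module.module R M by (rule Suc(3))
  note B = free_basisD[OF Suc(3,4)]
  obtain b E where b: "B = insert b E" "b \<notin> E" "card E = k" using Suc(2) by (metis card_Suc_eq)
  have E: "finite E" "E \<subseteq> carrier M" and bM [simp]: "b \<in> carrier M" using B(1,2) b(1) by auto
  let ?N = "M.span E"
  let ?M = "M\<lparr>carrier := ?N\<rparr>"
  note sub = M.span_is_submodule[OF E(2)]
  interpret N: submodule R ?N M by (rule sub)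
  have [simp]: "x \<in> ?N \<Longrightarrow> x \<in> carrier M" for x using N.subset by blast
  have mod: "Module.module R ?M" by (rule M.submodule_is_module[OF sub])
  have "M.lin_indpt E" using Suc(4) b(1) M.subset_li_is_li[of B E] by (auto simp: free_basis_def)
  then have basis: "free_basis ?M E"
    using M.span_li_not_depend[OF M.in_own_span[OF E(2)] sub] E M.in_own_span[OF E(2)] by (simp add: free_basis_def)
  have lc: "M.lincomb a B = a b \<odot>\<^bsub>M\<^esub> b \<oplus>\<^bsub>M\<^esub> M.lincomb a E" if "a \<in> B \<rightarrow> carrier R" for a
    using M.lincomb_insert[OF E(1,2), of a b] that b by simp
  have "\<exists>r y. r \<in> carrier R \<and> y \<in> ?N \<and> x = r \<odot>\<^bsub>M\<^esub> b \<oplus>\<^bsub>M\<^esub> y" if x: "x \<in> carrier M" for x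
  proof -
    obtain a where a: "a \<in> B \<rightarrow> carrier R" "x = M.lincomb a B" using B(4)[OF x] by blast
    moreover have "M.lincomb a E \<in> ?N" using M.finite_span[OF E] a(1) b(1) by auto
    ultimately show ?thesis using lc[OF a(1)] b(1) by auto
  qed
  then obtain c d where cd: "\<And>x. x \<in> carrier M \<Longrightarrow> c x \<in> carrier R \<and> d x \<in> ?N \<and> x = c x \<odot>\<^bsub>M\<^esub> b \<oplus>\<^bsub>M\<^esub> d x" by metis
  have zero: "r = \<zero>" if r: "r \<in> carrier R" "r \<odot>\<^bsub>M\<^esub> b \<in> ?N" for r
  proof -
    obtain a where a: "a \<in> E \<rightarrow> carrier R" "M.lincomb a E = r \<odot>\<^bsub>M\<^esub> b" using M.finite_in_span[OF E r(2)] by blast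
    let ?a = "a(b := \<ominus> r)"
    have a': "?a \<in> B \<rightarrow> carrier R" using a(1) r(1) b(1) by auto
    have "M.lincomb ?a E = M.lincomb a E" by (rule M.lincomb_cong[OF refl E(2) _ a(1)]) (use b(2) in auto)
    then have "M.lincomb ?a B = (\<ominus> r) \<odot>\<^bsub>M\<^esub> b \<oplus>\<^bsub>M\<^esub> r \<odot>\<^bsub>M\<^esub> b" unfolding lc[OF a'] a(2) by simp
    also have "\<dots> = \<zero>\<^bsub>M\<^esub>" using r(1) by (simp add: M.smult_l_minus M.l_neg)
    finally have "\<ominus> r = \<zero>" using B(3)[OF a', of b] b(1) by simp
    then show ?thesis using r(1) by (metis minus_minus minus_zero)
  qed
  have uniq: "c x = r \<and> d x = y" if x: "x = r \<odot>\<^bsub>M\<^esub> b \<oplus>\<^bsub>M\<^esub> y" and r: "r \<in> carrier R" "y \<in> ?N" for x r y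
  proof -
    have xM: "x \<in> carrier M" using r by (simp add: x)
    have c: "c x \<in> carrier R" "d x \<in> ?N" "d x \<in> carrier M" using cd[OF xM] by auto
    have eq: "c x \<odot>\<^bsub>M\<^esub> b \<oplus>\<^bsub>M\<^esub> d x = r \<odot>\<^bsub>M\<^esub> b \<oplus>\<^bsub>M\<^esub> y" using cd[OF xM] x by metis
    have "(c x \<ominus> r) \<odot>\<^bsub>M\<^esub> b = c x \<odot>\<^bsub>M\<^esub> b \<oplus>\<^bsub>M\<^esub> \<ominus>\<^bsub>M\<^esub> (r \<odot>\<^bsub>M\<^esub> b)"
      using c r by (simp add: a_minus_def M.smult_l_distr M.smult_l_minus)
    also have "\<dots> = (c x \<odot>\<^bsub>M\<^esub> b \<oplus>\<^bsub>M\<^esub> d x) \<oplus>\<^bsub>M\<^esub> (\<ominus>\<^bsub>M\<^esub> d x \<oplus>\<^bsub>M\<^esub> \<ominus>\<^bsub>M\<^esub> (r \<odot>\<^bsub>M\<^esub> b))"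
      using c r by (simp add: M.a_assoc M.r_neg2)
    also have "\<dots> = (y \<oplus>\<^bsub>M\<^esub> r \<odot>\<^bsub>M\<^esub> b) \<oplus>\<^bsub>M\<^esub> (\<ominus>\<^bsub>M\<^esub> (r \<odot>\<^bsub>M\<^esub> b) \<oplus>\<^bsub>M\<^esub> \<ominus>\<^bsub>M\<^esub> d x)"
      unfolding eq using c r by (simp add: M.a_comm)
    also have "\<dots> = y \<oplus>\<^bsub>M\<^esub> \<ominus>\<^bsub>M\<^esub> d x" using c r by (simp add: M.a_assoc M.r_neg2)
    also have "\<ominus>\<^bsub>M\<^esub> d x = (\<ominus> \<one>) \<odot>\<^bsub>M\<^esub> d x" using c by (simp add: M.smult_l_minus)
    finally have "(c x \<ominus> r) \<odot>\<^bsub>M\<^esub> b = y \<oplus>\<^bsub>M\<^esub> (\<ominus> \<one>) \<odot>\<^bsub>M\<^esub> d x" .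
    then have "(c x \<ominus> r) \<odot>\<^bsub>M\<^esub> b \<in> ?N" using c r by simp
    then have "c x \<ominus> r = \<zero>" by (intro zero) (use c r in auto)
    then have cr: "c x = r" using c r by simp
    then have "d x = y" using eq c r by simp
    then show ?thesis using cr by simp
  qed
  define i where "i = inv_into (carrier R) (\<lambda>r. \<iota> [r])"
  have i: "i (\<iota> [r]) = r" if "r \<in> carrier R" for r unfolding i_def using inv_into_f_f[OF inj_\<iota>1 that] .
  have U: "\<exists>r \<in> carrier R. x = \<iota> [r]" if "x \<in> carrier U" for x using that by (auto simp: U_simps)
  have c [simp]: "x \<in> carrier M \<Longrightarrow> c x \<in> carrier R" "x \<in> carrier M \<Longrightarrow> d x \<in> ?N" for x using cd by auto
  have add: "c (x \<oplus>\<^bsub>M\<^esub> y) = c x \<oplus> c y \<and> d (x \<oplus>\<^bsub>M\<^esub> y) = d x \<oplus>\<^bsub>M\<^esub> d y" if xy: "x \<in> carrier M" "y \<in> carrier M" for x y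
  proof (rule uniq)
    have "x \<oplus>\<^bsub>M\<^esub> y = (c x \<odot>\<^bsub>M\<^esub> b \<oplus>\<^bsub>M\<^esub> d x) \<oplus>\<^bsub>M\<^esub> (c y \<odot>\<^bsub>M\<^esub> b \<oplus>\<^bsub>M\<^esub> d y)" using cd[OF xy(1)] cd[OF xy(2)] by metis
    also have "\<dots> = (c x \<oplus> c y) \<odot>\<^bsub>M\<^esub> b \<oplus>\<^bsub>M\<^esub> (d x \<oplus>\<^bsub>M\<^esub> d y)" using xy by (simp add: M.smult_l_distr M.a_ac)
    finally show "x \<oplus>\<^bsub>M\<^esub> y = (c x \<oplus> c y) \<odot>\<^bsub>M\<^esub> b \<oplus>\<^bsub>M\<^esub> (d x \<oplus>\<^bsub>M\<^esub> d y)" .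
  qed (use xy in auto)
  have smult: "c (r \<odot>\<^bsub>M\<^esub> x) = r \<otimes> c x \<and> d (r \<odot>\<^bsub>M\<^esub> x) = r \<odot>\<^bsub>M\<^esub> d x" if r: "r \<in> carrier R" "x \<in> carrier M" for r x
  proof (rule uniq)
    have "r \<odot>\<^bsub>M\<^esub> x = r \<odot>\<^bsub>M\<^esub> (c x \<odot>\<^bsub>M\<^esub> b \<oplus>\<^bsub>M\<^esub> d x)" using cd[OF r(2)] by metis
    also have "\<dots> = (r \<otimes> c x) \<odot>\<^bsub>M\<^esub> b \<oplus>\<^bsub>M\<^esub> r \<odot>\<^bsub>M\<^esub> d x" using r by (simp add: M.smult_r_distr M.smult_assoc1)
    finally show "r \<odot>\<^bsub>M\<^esub> x = (r \<otimes> c x) \<odot>\<^bsub>M\<^esub> b \<oplus>\<^bsub>M\<^esub> r \<odot>\<^bsub>M\<^esub> d x" .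
  qed (use r in auto)
  have j1: "(\<lambda>x. i x \<odot>\<^bsub>M\<^esub> b) \<in> lin U M"
    by (rule linI) (auto dest!: U simp: i U_simps M.smult_l_distr M.smult_assoc1)
  have j2: "(\<lambda>x. x) \<in> lin ?M M" by (rule linI) auto
  have q1: "(\<lambda>x. \<iota> [c x]) \<in> lin M U" by (rule linI) (auto simp: U_simps add smult)
  have q2: "d \<in> lin M ?M" by (rule linI) (auto simp: add smult)
  have u1: "c (r \<odot>\<^bsub>M\<^esub> b) = r \<and> d (r \<odot>\<^bsub>M\<^esub> b) = \<zero>\<^bsub>M\<^esub>" if "r \<in> carrier R" for r
    by (rule uniq) (use that in auto)
  have u2: "c x = \<zero> \<and> d x = x" if "x \<in> ?N" for x by (rule uniq) (use that in auto)
  have fg: "fg_free_module R ?M" "fg_free_module R M" using mod basis Suc(3,4) by (auto simp: fg_free_module_iff)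
  have "biproduct C U ?M M (arr U (\<lambda>x. i x \<odot>\<^bsub>M\<^esub> b) M) (arr ?M (\<lambda>x. x) M) (arr M (\<lambda>x. \<iota> [c x]) U) (arr M d ?M)"
  proof (rule biproduct_arr_iff[OF U_fg fg j1 j2 q1 q2])
    show "i (\<iota> [c x]) \<odot>\<^bsub>M\<^esub> b \<oplus>\<^bsub>M\<^esub> d x = x" if "x \<in> carrier M" for x using cd[OF that] by (simp add: i)
  qed (auto dest!: U simp: i u1 u2 U_simps)
  moreover have "free_of_rank C U (card E) ?M" using Suc(1)[OF _ mod basis] b(3) by simp
  ultimately have "free_of_rank C U (Suc (card E)) M" by (intro free_of_rank.add)
  then show ?case using Suc(2) b(3) by simp
qed

lemma homothety_sm: "homothety F r = sm r (Ident C F)"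
  unfolding arr_simps(3,4) by (simp add: homothety_def arr_def)

lemma End_U:
  assumes "f \<in> Hom C U U"
  shows "\<exists>r \<in> carrier R. f = sm r (Ident C U)"
proof -
  obtain g where g: "f = arr U g U" "g \<in> lin U U" using assms by (rule HomE)
  have one: "\<iota> [\<one>] \<in> carrier U" by (simp add: U_simps)
  obtain s where s: "s \<in> carrier R" "g (\<iota> [\<one>]) = \<iota> [s]" using linD(1)[OF g(2) one] by (auto simp: U_simps)
  have "g x = s \<odot>\<^bsub>U\<^esub> x" if x: "x \<in> carrier U" for x
  proof -
    obtain r where r: "r \<in> carrier R" "x = \<iota> [r]" using x by (auto simp: U_simps)
    have "g x = g (r \<odot>\<^bsub>U\<^esub> \<iota> [\<one>])" using r by (simp add: U_simps)
    also have "\<dots> = r \<odot>\<^bsub>U\<^esub> \<iota> [s]" using linD(3)[OF g(2) r(1) one] s(2) by simp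
    finally show ?thesis using r s by (simp add: U_simps m_comm)
  qed
  then have "f = sm s (Ident C U)" unfolding g(1) arr_simps by (rule arr_cong)
  then show ?thesis using s(1) by blast
qed

lemma End_U_faithful:
  assumes r: "r \<in> carrier R" and 0: "sm r (Ident C U) = Null C U U"
  shows "r = \<zero>"
proof -
  have one: "\<iota> [\<one>] \<in> carrier U" by (simp add: U_simps)
  have "r \<odot>\<^bsub>U\<^esub> \<iota> [\<one>] = \<zero>\<^bsub>U\<^esub>" using 0 one unfolding arr_simps arr_eq_iff by blast
  then have "\<iota> [r] = \<iota> [\<zero>]" using r by (simp add: U_simps)
  then show ?thesis using inj_onD[OF inj_\<iota>1, of r \<zero>] r by simp
qed

lemma cyclic_sequences_fg_free_modules:
  assumes p: "p \<in> carrier R" "p \<otimes> p = \<zero>" "p \<noteq> \<zero>"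
    and up: "\<And>r. r \<in> carrier R \<Longrightarrow> r \<in> Units R \<or> (\<exists>s \<in> carrier R. r = p \<otimes> s)" and n: "n \<ge> 3"
  shows "cyclic_sequences C R sm U p n"
proof (intro cyclic_sequences.intro length_two_category.intro linear length_two_category_axioms.intro cyclic_sequences_axioms.intro p n)
  show "U \<in> Ob C" by (simp add: Ob_iff U_fg)
  show "\<exists>k. free_of_rank C U k A" if "A \<in> Ob C" for A
    using that free_of_rank_basis by (auto simp: Ob_iff fg_free_module_iff)
qed (use End_U End_U_faithful up in auto)

lemma unit_angulation_eq:
  assumes "cyclic_sequences C R sm U p n" and u: "u \<in> Units R"
  shows "(unit_angulation R n p u :: (nat \<Rightarrow> ('r, 'm) linear_arrow) set) = {\<alpha>. cyclic_sequences.angle C sm p n u \<alpha>}"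
proof -
  interpret cyclic_sequences C R sm U p n by (rule assms)
  have p: "p \<in> carrier R" "u \<in> carrier R" using u by auto
  have "periodic_seq R n p u F = periodic u F" if F: "F \<in> Ob C" for F :: "('r, 'm) module"
    unfolding periodic_seq_def periodic_def twisted_def I_def
    using p F by (intro restrict_ext) (simp add: homothety_sm mult_sm m_comm)
  then show ?thesis unfolding unit_angulation_def angle_iff_isomorphic[OF u] Ob_iff[symmetric]
    by (intro Collect_cong conj_cong refl ex_cong1) (metis (no_types, lifting))
qed

end

section \<open>The angulations of the category of free modules\<close>

text \<open>If \<open>r \<notin> \<mm>\<close> then \<open>1 = q + t r\<close> with \<open>q \<in> \<mm>\<close>, and \<open>(1 + q) t\<close> is inverse to \<open>r\<close> because \<open>q\<^sup>2 = 0\<close>.\<close>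

lemma (in cring) unit_or_multiple:
  assumes m: "maximalideal \<mm> R" and p: "p \<in> carrier R" "\<mm> = PIdl p" and sq: "p \<otimes> p = \<zero>" and r: "r \<in> carrier R"
  shows "r \<in> Units R \<or> (\<exists>s \<in> carrier R. r = p \<otimes> s)"
proof (cases "r \<in> \<mm>")
  case True
  then show ?thesis using p by (auto simp: cgenideal_def m_comm)
next
  case False
  interpret maximalideal \<mm> R by (rule m)
  have J: "ideal (\<mm> <+> PIdl r) R" by (rule add_ideals[OF is_ideal cgenideal_ideal[OF r]])
  have sum: "\<mm> <+> PIdl r = {a \<oplus> b | a b. a \<in> \<mm> \<and> b \<in> PIdl r}" by (auto simp: set_add_def')
  have "\<mm> \<subseteq> \<mm> <+> PIdl r"
  proof
    fix a assume a: "a \<in> \<mm>"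
    have "\<zero> \<in> PIdl r" by (rule additive_subgroup.zero_closed[OF ideal.axioms(1)[OF cgenideal_ideal[OF r]]])
    then have "a \<oplus> \<zero> \<in> \<mm> <+> PIdl r" unfolding sum using a by blast
    then show "a \<in> \<mm> <+> PIdl r" using a by simp
  qed
  moreover have "\<mm> <+> PIdl r \<noteq> \<mm>"
  proof
    assume eq: "\<mm> <+> PIdl r = \<mm>"
    have "\<zero> \<oplus> r \<in> \<mm> <+> PIdl r" unfolding sum using cgenideal_self[OF r] zero_closed by blast
    then show False using False r unfolding eq by simp
  qed
  moreover have "\<mm> <+> PIdl r \<subseteq> carrier R" using J by (rule ideal.axioms(1)[THEN additive_subgroup.a_subset])
  ultimately have "\<mm> <+> PIdl r = carrier R" using I_maximal[OF J] by blast
  then have "\<one> \<in> \<mm> <+> PIdl r" by simp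
  then obtain a b where "a \<in> PIdl p" "b \<in> PIdl r" "\<one> = a \<oplus> b" unfolding sum unfolding p(2) by blast
  then obtain s t where st: "s \<in> carrier R" "t \<in> carrier R" "\<one> = s \<otimes> p \<oplus> t \<otimes> r"
    by (auto simp: cgenideal_def)
  let ?q = "s \<otimes> p"
  have qc: "?q \<in> carrier R" "t \<otimes> r \<in> carrier R" using st p r by auto
  have "?q \<otimes> ?q = (s \<otimes> s) \<otimes> (p \<otimes> p)" using st p by (simp add: m_ac)
  then have q2: "?q \<otimes> ?q = \<zero>" using st sq by simp
  have "(\<one> \<oplus> ?q) \<otimes> (t \<otimes> r) = (\<one> \<oplus> ?q) \<otimes> (t \<otimes> r) \<oplus> ?q \<otimes> ?q" using qc q2 by simp
  also have "\<dots> = t \<otimes> r \<oplus> ?q \<otimes> (?q \<oplus> t \<otimes> r)" using qc by (simp add: l_distr r_distr a_ac)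
  also have "\<dots> = t \<otimes> r \<oplus> ?q" unfolding st(3)[symmetric] using qc by simp
  also have "\<dots> = \<one>" using a_comm[OF qc(2,1)] st(3)[symmetric] by (simp only:)
  finally have "((\<one> \<oplus> ?q) \<otimes> t) \<otimes> r = \<one>" using st p r by (simp add: m_assoc)
  then have "r \<in> Units R" using st p r unfolding Units_def by (auto intro!: bexI[of _ "(\<one> \<oplus> ?q) \<otimes> t"] simp: m_comm)
  then show ?thesis ..
qed

theorem theorem4p1:
  fixes R :: "('r, 'x) ring_scheme" (structure)
    and \<mm> :: "'r set"
    and p :: 'r
    and n :: nat
    and \<C> :: "(('r, 'm) module, ('r, 'm) linear_arrow) precategory"
    and \<Sigma> :: "(('r, 'm) module, ('r, 'm) linear_arrow) endofunctor"
  assumes "local_ring R"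
    and "maximalideal \<mm> R"
    and "p \<in> carrier R" and "\<mm> = PIdl p" and "\<mm> \<noteq> {\<zero>}"
    and "ideal_prod R \<mm> \<mm> = {\<zero>}"
    and universe: "\<exists>\<iota> :: 'r list \<Rightarrow> 'm. inj_on \<iota> (lists (carrier R))"
    and "\<C> = fg_free_modules R"
    and "n \<ge> 3"
    and "\<Sigma> = identity_functor"
  shows "(\<forall>u \<in> Units R. even n \<or> (odd n \<and> p \<oplus> p = \<zero>) \<longrightarrow>
            n_angulated_category \<C> \<Sigma> n (unit_angulation R n p u)) \<and>
         (\<forall>N. n_angulation \<C> \<Sigma> n N \<longrightarrow> (\<exists>u \<in> Units R. N = unit_angulation R n p u)) \<and>
         (\<forall>u \<in> Units R. \<forall>v \<in> Units R.
            (unit_angulation R n p u :: (nat \<Rightarrow> ('r, 'm) linear_arrow) set) = unit_angulation R n p v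
              \<longleftrightarrow> u \<otimes> p = v \<otimes> p)"
proof -
  interpret R: cring R using assms(1) by (simp add: local_ring_def)
  note p [simp] = assms(3)
  have pm: "p \<in> \<mm>" unfolding assms(4) by (rule R.cgenideal_self[OF p])
  have sq: "p \<otimes> p = \<zero>" using ideal_prod.prod[of p \<mm> p \<mm> R] pm unfolding assms(6) by simp
  have p0: "p \<noteq> \<zero>"
  proof
    assume "p = \<zero>"
    then have "\<mm> = {\<zero>}" unfolding assms(4) by (auto simp: cgenideal_def intro!: exI[of _ \<zero>])
    then show False using assms(5) by blast
  qed
  have "\<one> \<noteq> \<zero>"
  proof
    assume "\<one> = \<zero>"
    then have "\<one> \<otimes> p = \<zero> \<otimes> p" by simp
    then show False using p0 by simp
  qed
  moreover obtain \<iota> :: "'r list \<Rightarrow> 'm" where "inj_on \<iota> (lists (carrier R))" using universe by blast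
  ultimately interpret F: free_module_category R \<iota> by unfold_locales
  have cyc: "cyclic_sequences \<C> R F.sm F.U p n" unfolding assms(8)
    by (rule F.cyclic_sequences_fg_free_modules[OF p sq p0 R.unit_or_multiple[OF assms(2-4) sq] assms(9)])
  interpret cyclic_sequences \<C> R F.sm F.U p n by (rule cyc)
  have N: "unit_angulation R n p u = {\<alpha>. angle u \<alpha>}" if "u \<in> Units R" for u
    using F.unit_angulation_eq[OF cyc[unfolded assms(8)] that] unfolding assms(8) .
  have "category_automorphism \<C> \<Sigma>"
    unfolding assms(10) by (simp add: category_automorphism_def bij_betw_def inj_on_def)
  then have "n_angulated_category \<C> \<Sigma> n (unit_angulation R n p u)" if "u \<in> Units R" "even n \<or> odd n \<and> p \<oplus> p = \<zero>" for u
    using angles_angulation[OF that(1)] that(2) assms(9) additive_category_axioms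
    unfolding n_angulated_category_def N[OF that(1)] assms(10) by blast
  moreover have "\<exists>u \<in> Units R. N = unit_angulation R n p u" if "n_angulation \<C> \<Sigma> n N" for N
  proof -
    interpret angulation \<C> R F.sm F.U p n N
      using that unfolding assms(10) by (intro angulation.intro cyc)
    show ?thesis using N_eq_angles N by blast
  qed
  ultimately show ?thesis using angle_eq_iff N by simp
qed

end
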